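(* Let $(\mathbf{R},\mathfrak{m})$ be a Cohen--Macaulay local ring of dimension $d$ and let $I$ be an $\mathfrak{m}$-primary almost complete intersection such that the symmetric algebra $\operatorname{Sym}(I)$ is reduced. Then the Rees algebra $\mathbf{R}[It]$ is almost Cohen--Macaulay, that is, $\operatorname{depth}\mathbf{R}[It]\ge d$.
   Context: An $\mathfrak{m}$-primary almost complete intersection is an $\mathfrak{m}$-primary ideal $I=(a_1,\dots,a_d,a_{d+1})$ where $J=(a_1,\dots,a_d)$ is a complete intersection (generated by a regular sequence) and $a_{d+1}\notin J$. $\mathbf{R}[It]=\bigoplus_{j\ge0}I^jt^j$ is the Rees algebra; depth is taken with respect to its maximal homogeneous ideal $(\mathfrak{m},It)$. The Rees algebra is called almost Cohen--Macaulay if its depth is at least $d=\dim\mathbf{R}$. *)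

theory Defs
  imports "HOL-Algebra.Algebra" "HOL-Algebra.UnivPoly" "HOL-Library.Extended_Nat"
begin

section \<open>Noetherian local rings, dimension and depth\<close>

text \<open>As usual for Cohen-Macaulay rings, local rings are commutative and Noetherian.\<close>

definition noetherian_local_ring :: "('a, 'b) ring_scheme \<Rightarrow> 'a set \<Rightarrow> bool" where
  "noetherian_local_ring R m \<longleftrightarrow>
     cring R \<and> noetherian_ring R \<and> maximalideal m R \<and> (\<forall>n. maximalideal n R \<longrightarrow> n = m)"

definition krull_dim :: "('a, 'b) ring_scheme \<Rightarrow> enat" where
  "krull_dim R =
     (SUP n \<in> {n. \<exists>P. (\<forall>i\<le>n. primeideal (P i) R) \<and> (\<forall>i<n. P i \<subset> P (Suc i))}. enat n)"

definition regular_sequence :: "('a, 'b) ring_scheme \<Rightarrow> 'a list \<Rightarrow> bool" where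
  "regular_sequence R xs \<longleftrightarrow>
     set xs \<subseteq> carrier R \<and>
     (\<forall>i<length xs. \<forall>y\<in>carrier R.
        xs ! i \<otimes>\<^bsub>R\<^esub> y \<in> Idl\<^bsub>R\<^esub> (set (take i xs)) \<longrightarrow> y \<in> Idl\<^bsub>R\<^esub> (set (take i xs))) \<and>
     Idl\<^bsub>R\<^esub> (set xs) \<noteq> carrier R"

definition depth :: "('a, 'b) ring_scheme \<Rightarrow> 'a set \<Rightarrow> enat" where
  "depth R Q = (SUP xs \<in> {xs. regular_sequence R xs \<and> set xs \<subseteq> Q}. enat (length xs))"

definition cohen_macaulay_local_ring :: "('a, 'b) ring_scheme \<Rightarrow> 'a set \<Rightarrow> bool" where
  "cohen_macaulay_local_ring R m \<longleftrightarrow> noetherian_local_ring R m \<and> depth R m = krull_dim R"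

definition reduced_ring :: "('a, 'b) ring_scheme \<Rightarrow> bool" where
  "reduced_ring R \<longleftrightarrow> (\<forall>x\<in>carrier R. \<forall>n::nat. x [^]\<^bsub>R\<^esub> n = \<zero>\<^bsub>R\<^esub> \<longrightarrow> x = \<zero>\<^bsub>R\<^esub>)"


section \<open>Primary ideals and almost complete intersections\<close>

definition radical :: "('a, 'b) ring_scheme \<Rightarrow> 'a set \<Rightarrow> 'a set" where
  "radical R Q = {x \<in> carrier R. \<exists>n::nat. x [^]\<^bsub>R\<^esub> n \<in> Q}"

definition primary_ideal :: "('a, 'b) ring_scheme \<Rightarrow> 'a set \<Rightarrow> bool" where
  "primary_ideal R Q \<longleftrightarrow>
     ideal Q R \<and> Q \<noteq> carrier R \<and>
     (\<forall>a\<in>carrier R. \<forall>b\<in>carrier R.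
        a \<otimes>\<^bsub>R\<^esub> b \<in> Q \<longrightarrow> a \<in> Q \<or> (\<exists>n::nat. b [^]\<^bsub>R\<^esub> n \<in> Q))"

definition primary_almost_complete_intersection ::
  "('a, 'b) ring_scheme \<Rightarrow> 'a set \<Rightarrow> nat \<Rightarrow> 'a set \<Rightarrow> bool" where
  "primary_almost_complete_intersection R m d I \<longleftrightarrow>
     primary_ideal R I \<and> radical R I = m \<and>
     (\<exists>as b. length as = d \<and> regular_sequence R as \<and>
        b \<in> carrier R \<and> b \<notin> Idl\<^bsub>R\<^esub> (set as) \<and> I = Idl\<^bsub>R\<^esub> (insert b (set as)))"


section \<open>Symmetric algebras\<close>

text \<open>
  The polynomial ring over \<^term>\<open>R\<close> in variables indexed by \<^term>\<open>V\<close>, with monomials as multisets;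
  carrier, constants, variables and addition are those of the theory \<open>Indexed_Polynomials\<close>.
\<close>

definition indexed_poly_ring :: "('a, 'b) ring_scheme \<Rightarrow> 'c set \<Rightarrow> ('c multiset \<Rightarrow> 'a) ring" where
  "indexed_poly_ring R V =
     \<lparr> carrier = ring.indexed_pset R V (carrier R),
       monoid.mult = (\<lambda>P Q u. finsum R (\<lambda>(v, w). P v \<otimes>\<^bsub>R\<^esub> Q w) {(v, w). v + w = u}),
       monoid.one = ring.indexed_const R \<one>\<^bsub>R\<^esub>,
       ring.zero = ring.indexed_const R \<zero>\<^bsub>R\<^esub>,
       ring.add = ring.indexed_padd R \<rparr>"

text \<open>
  \<open>Sym\<^sub>R(M)\<close> is the commutative \<open>R\<close>-algebra generated by symbols \<open>\<xi>\<^sub>x\<close>, one for each element \<open>x\<close> of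
  \<open>M\<close>, subject to the relations making \<open>x \<mapsto> \<xi>\<^sub>x\<close> an \<open>R\<close>-linear map. No choice of
  generators of \<open>M\<close> is involved.
\<close>

definition symmetric_relations ::
  "('a, 'b) ring_scheme \<Rightarrow> ('a, 'c, 'd) module_scheme \<Rightarrow> ('c multiset \<Rightarrow> 'a) set" where
  "symmetric_relations R M =
     (let S = indexed_poly_ring R (carrier M); \<xi> = ring.indexed_var R in
       {\<xi> (x \<oplus>\<^bsub>M\<^esub> y) \<ominus>\<^bsub>S\<^esub> (\<xi> x \<oplus>\<^bsub>S\<^esub> \<xi> y) | x y. x \<in> carrier M \<and> y \<in> carrier M} \<union>
       {\<xi> (a \<odot>\<^bsub>M\<^esub> x) \<ominus>\<^bsub>S\<^esub> (ring.indexed_const R a \<otimes>\<^bsub>S\<^esub> \<xi> x) | a x. a \<in> carrier R \<and> x \<in> carrier M})"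

definition symmetric_algebra ::
  "('a, 'b) ring_scheme \<Rightarrow> ('a, 'c, 'd) module_scheme \<Rightarrow> ('c multiset \<Rightarrow> 'a) set ring" where
  "symmetric_algebra R M =
     (let S = indexed_poly_ring R (carrier M) in S Quot (Idl\<^bsub>S\<^esub> (symmetric_relations R M)))"

text \<open>
  The fields \<^const>\<open>monoid.mult\<close> and \<^const>\<open>monoid.one\<close> of a module record carry no meaning.
\<close>

definition ideal_module :: "('a, 'b) ring_scheme \<Rightarrow> 'a set \<Rightarrow> ('a, 'a) module" where
  "ideal_module R I =
     \<lparr> carrier = I, monoid.mult = monoid.mult R, monoid.one = \<one>\<^bsub>R\<^esub>,
       ring.zero = \<zero>\<^bsub>R\<^esub>, ring.add = ring.add R, smult = monoid.mult R \<rparr>"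


section \<open>Rees algebras\<close>

text \<open>\<open>R[It]\<close> as a subring of \<open>R[t]\<close>; powers of \<open>I\<close> are taken in the semiring of ideals of \<open>R\<close>.\<close>

definition rees_algebra :: "('a, 'b) ring_scheme \<Rightarrow> 'a set \<Rightarrow> ('a, nat \<Rightarrow> 'a) up_ring" where
  "rees_algebra R I =
     (UP R) \<lparr> carrier := {p \<in> carrier (UP R). \<forall>j. up_ring.coeff (UP R) p j \<in> I [^]\<^bsub>ideals_set R\<^esub> j} \<rparr>"

text \<open>The maximal homogeneous ideal \<open>(m, It)\<close> of \<open>R[It]\<close>.\<close>

definition rees_homogeneous_ideal ::
  "('a, 'b) ring_scheme \<Rightarrow> 'a set \<Rightarrow> 'a set \<Rightarrow> (nat \<Rightarrow> 'a) set" where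
  "rees_homogeneous_ideal R m I =
     Idl\<^bsub>rees_algebra R I\<^esub> ((\<lambda>a. up_ring.monom (UP R) a 0) ` m \<union> (\<lambda>a. up_ring.monom (UP R) a 1) ` I)"

end

theory Submission
  imports Defs
begin

text \<open>
  Let \<open>c\<^sub>0, \<dots>, c\<^bsub>d-1\<^esub>\<close> be the regular sequence, \<open>c\<^sub>d\<close> the additional generator,
  \<open>J\<^sub>j = (c\<^sub>0, \<dots>, c\<^bsub>j-1\<^esub>)\<close>, \<open>P = R[T\<^sub>0, \<dots>, T\<^sub>d]\<close> and \<open>Q = (m, T\<^sub>0, \<dots>, T\<^sub>d)\<close>. Let \<open>L\<^sub>j\<close> be generated by
  the linear forms in \<open>T\<^sub>0, \<dots>, T\<^bsub>j-1\<^esub>\<close> that vanish at \<open>T\<^sub>i = c\<^sub>i\<close>, so that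
  \<open>Sym(I) = P/L\<^bsub>d+1\<^esub>\<close>; write \<open>L\<close> for \<open>L\<^bsub>d+1\<^esub>\<close>. Multiplication by \<open>c\<^sub>0\<close> on one side and by \<open>c\<^sub>0T\<^sub>j - c\<^sub>jT\<^sub>0\<close> on
  the other identifies \<open>L\<^bsub>j+1\<^esub>/L\<^sub>j\<close> with \<open>(J\<^sub>j : c\<^sub>j)P/L\<^sub>j\<close>, and induction on \<open>j\<close> shows that every
  ideal containing \<open>mP\<close> has on \<open>P/L\<close> at least the grade that it has on \<open>P/mP\<close>.
  In particular \<open>Q\<close> has grade \<open>d + 1\<close> on \<open>P/L\<close>.

  Let \<open>A\<close> be the kernel of \<open>P \<rightarrow> R[It]\<close>. As \<open>A/L\<close> is \<open>m\<close>-power torsion and \<open>L\<close> is a radical ideal,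
  \<open>mA \<subseteq> L\<close> and \<open>A \<inter> mP \<subseteq> L\<close>. If \<open>A \<noteq> L\<close>, factoriality of \<open>P/mP\<close> gives
  \<open>A + mP = fA' + mP\<close> with \<open>A'\<close> of grade at least 2 on \<open>P/mP\<close>, hence on \<open>P/L\<close>. Therefore \<open>f\<close>
  lifts to some \<open>h\<close> with \<open>A = hP + L\<close>, so that \<open>A/L\<close> is isomorphic to \<open>P/mP\<close>. Then \<open>Q\<close> has grade \<open>d + 1\<close> on \<open>P/L\<close>
  and on \<open>A/L\<close>, and at least \<open>d\<close> on \<open>P/A\<close>.
\<close>

section \<open>Grade of subquotients\<close>

text \<open>Identifying \<open>L (Suc j)/L j\<close> with \<open>(J j : c j)P/L j\<close> means
  dividing by \<open>c 0\<close>, so the obstacle is the regularity of \<open>c 0\<close> on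
  \<open>P/L j\<close>. It is carried along by induction for j up to d, using
  \<open>(J i : c i) = J i\<close> for \<open>i < d\<close>. At \<open>Suc d\<close> it fails
  exactly when \<open>A\<close> differs from \<open>L\<close>, since then \<open>c 0\<close> kills
  \<open>A/L\<close>. The count is this: an ideal containing \<open>mP\<close> and of grade n on
  \<open>P/mP\<close> has grade at least n + d on \<open>P\<close>, the elements \<open>c i\<close>
  contributing d, and each of the d steps from \<open>L 1 = 0\<close> to \<open>L (Suc d)\<close>
  costs one. The bound is proved for all ideals containing \<open>mP\<close>, because the lift of
  \<open>f\<close> needs it for \<open>A'\<close> and the conclusion for \<open>Q\<close>.
  Reducedness acts through (ap)^(n+1) = (ap^n)(a^n p): torsion of any exponent becomes torsion of
  exponent one. Modules occur only as \<open>U/Y\<close> for ideals of one ring and isomorphisms as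
  congruences modulo an ideal, so the depth lemma is proved by elements, without Ext.\<close>

context cring
begin

section \<open>Membership calculus for ideals\<close>

lemma ideal_intro:
  assumes "S \<subseteq> carrier R" "\<zero> \<in> S" "\<And>a b. \<lbrakk>a \<in> S; b \<in> S\<rbrakk> \<Longrightarrow> a \<oplus> b \<in> S"
    and mult: "\<And>a x. \<lbrakk>a \<in> S; x \<in> carrier R\<rbrakk> \<Longrightarrow> x \<otimes> a \<in> S"
  shows "ideal S R"
proof (rule idealI[OF ring_axioms])
  show "subgroup S (add_monoid R)"
  proof (rule add.subgroupI)
    show "S \<subseteq> carrier R" "S \<noteq> {}" using assms by auto
    fix a b assume "a \<in> S" "b \<in> S"
    then show "a \<oplus> b \<in> S" using assms by blast
    have "\<ominus> \<one> \<otimes> a \<in> S" using mult[OF \<open>a \<in> S\<close>, of "\<ominus> \<one>"] by simp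
    moreover have "\<ominus> \<one> \<otimes> a = \<ominus> a" using \<open>a \<in> S\<close> assms(1) by (auto simp: l_minus)
    ultimately show "\<ominus> a \<in> S" by simp
  qed
qed (use assms m_comm in \<open>auto simp: subset_iff\<close>)

lemma ideal_sub: "ideal I R \<Longrightarrow> I \<subseteq> carrier R"
  by (rule subsetI) (rule ideal.Icarr)

lemma ideal_carrier: "\<lbrakk>ideal I R; a \<in> I\<rbrakk> \<Longrightarrow> a \<in> carrier R"
  by (rule ideal.Icarr)

lemma ideal_zero: "ideal I R \<Longrightarrow> \<zero> \<in> I"
  by (simp add: additive_subgroup.zero_closed ideal.axioms(1))

lemma ideal_add: "\<lbrakk>ideal I R; a \<in> I; b \<in> I\<rbrakk> \<Longrightarrow> a \<oplus> b \<in> I"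
  by (simp add: additive_subgroup.a_closed ideal.axioms(1))

lemma ideal_neg: "\<lbrakk>ideal I R; a \<in> I\<rbrakk> \<Longrightarrow> \<ominus> a \<in> I"
  by (simp add: additive_subgroup.a_inv_closed ideal.axioms(1))

lemma ideal_diff: "\<lbrakk>ideal I R; a \<in> I; b \<in> I\<rbrakk> \<Longrightarrow> a \<ominus> b \<in> I"
  by (simp add: a_minus_def ideal_add ideal_neg)

lemma ideal_mult: "\<lbrakk>ideal I R; a \<in> I; x \<in> carrier R\<rbrakk> \<Longrightarrow> x \<otimes> a \<in> I"
  by (simp add: ideal.I_l_closed)

lemma ideal_mult_right: "\<lbrakk>ideal I R; a \<in> I; x \<in> carrier R\<rbrakk> \<Longrightarrow> a \<otimes> x \<in> I"
  by (simp add: ideal.I_r_closed)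

lemma ideal_add_cancel: "\<lbrakk>ideal I R; a \<oplus> b \<in> I; b \<in> I; a \<in> carrier R\<rbrakk> \<Longrightarrow> a \<in> I"
proof -
  assume I: "ideal I R" and *: "a \<oplus> b \<in> I" "b \<in> I" "a \<in> carrier R"
  have "(a \<oplus> b) \<ominus> b \<in> I" using ideal_diff[OF I *(1,2)] .
  moreover have "(a \<oplus> b) \<ominus> b = a"
    using ideal_carrier[OF I *(2)] *(3) by algebra
  ultimately show ?thesis by simp
qed

lemma ideal_diff_cancel: "\<lbrakk>ideal I R; a \<ominus> b \<in> I; b \<in> I; a \<in> carrier R\<rbrakk> \<Longrightarrow> a \<in> I"
  using ideal_add_cancel[of I a "\<ominus> b"] ideal_neg by (simp add: a_minus_def)

lemma ideal_diff_cancel2: "\<lbrakk>ideal I R; a \<ominus> b \<in> I; a \<in> I; b \<in> carrier R\<rbrakk> \<Longrightarrow> b \<in> I"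
proof -
  assume I: "ideal I R" and *: "a \<ominus> b \<in> I" "a \<in> I" "b \<in> carrier R"
  have "a \<ominus> (a \<ominus> b) \<in> I" using ideal_diff[OF I *(2,1)] .
  moreover have "a \<ominus> (a \<ominus> b) = b"
    using ideal_carrier[OF I *(2)] *(3) by algebra
  ultimately show ?thesis by metis
qed

subsection \<open>Associated primes and prime avoidance\<close>

text \<open>In a Noetherian ring a nonempty chain of ideals contains its union, so Zorn's lemma
  applies without any closure condition on the family.\<close>

lemma noetherian_maximal:
  assumes "noetherian_ring R" "SS \<noteq> {}" "\<And>I. I \<in> SS \<Longrightarrow> ideal I R"
  obtains M where "M \<in> SS" "\<And>N. \<lbrakk>N \<in> SS; M \<subseteq> N\<rbrakk> \<Longrightarrow> N = M"
proof -
  have "\<exists>M\<in>SS. \<forall>U\<in>SS. M \<subseteq> U \<longrightarrow> U = M"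
  proof (rule subset_Zorn)
    fix C assume C: "subset.chain SS C"
    show "\<exists>B\<in>SS. \<forall>A\<in>C. A \<subseteq> B"
    proof (cases "C = {}")
      case True then show ?thesis using assms(2) by auto
    next
      case False
      have "subset.chain {I. ideal I R} C"
        using C assms(3) unfolding pred_on.chain_def by auto
      then have "\<Union>C \<in> C" using noetherian_ring.ideal_chain_is_trivial[OF assms(1) False] by blast
      moreover have "C \<subseteq> SS" using C unfolding pred_on.chain_def by auto
      ultimately show ?thesis by (intro bexI[of _ "\<Union>C"]) auto
    qed
  qed
  then show ?thesis using that by blast
qed

text \<open>The finite set is found inside \<open>S\<close>, by maximality among the ideals with
  finitely many generators from \<open>S\<close>. In \<open>finite_associated_primes\<close> the
  generators must themselves be elements with maximal annihilator.\<close>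

lemma noetherian_finite_subset:
  assumes "noetherian_ring R" "S \<subseteq> carrier R"
  obtains S' where "finite S'" "S' \<subseteq> S" "Idl S' = Idl S"
proof -
  define SS where "SS = {Idl S' | S'. finite S' \<and> S' \<subseteq> S}"
  have "SS \<noteq> {}" unfolding SS_def by blast
  moreover have "\<And>I. I \<in> SS \<Longrightarrow> ideal I R"
    using assms(2) by (auto simp: SS_def intro!: genideal_ideal)
  ultimately obtain M where M: "M \<in> SS" "\<And>N. \<lbrakk>N \<in> SS; M \<subseteq> N\<rbrakk> \<Longrightarrow> N = M"
    using noetherian_maximal[OF assms(1)] by metis
  then obtain S' where S': "M = Idl S'" "finite S'" "S' \<subseteq> S" unfolding SS_def by blast
  have "s \<in> M" if "s \<in> S" for s
  proof -
    have sub: "insert s S' \<subseteq> carrier R" using that S' assms(2) by auto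
    have "Idl S' \<subseteq> Idl (insert s S')"
      using genideal_minimal[OF genideal_ideal[OF sub]] genideal_self[OF sub] by auto
    then have "Idl (insert s S') = M"
      using M(2)[of "Idl (insert s S')"] S' that unfolding SS_def by blast
    then show ?thesis using genideal_self[OF sub] by auto
  qed
  moreover have "ideal M R" using S' assms(2) genideal_ideal by auto
  ultimately have "Idl S \<subseteq> M" by (intro genideal_minimal) auto
  moreover have "M \<subseteq> Idl S"
    using S' assms(2) genideal_minimal[OF genideal_ideal[OF assms(2)], of S'] genideal_self[OF assms(2)] by auto
  ultimately show ?thesis using that S' by auto
qed

text \<open>The annihilator of the class of \<open>p\<close> in the module R/Y.\<close>

definition colon :: "'a set \<Rightarrow> 'a \<Rightarrow> 'a set" where
  "colon Y p = {r \<in> carrier R. r \<otimes> p \<in> Y}"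

lemma colon_ideal: "\<lbrakk>ideal Y R; p \<in> carrier R\<rbrakk> \<Longrightarrow> ideal (colon Y p) R"
  by (rule ideal_intro)
    (auto simp: colon_def l_distr m_assoc ideal_add ideal_mult ideal_zero)

text \<open>For \<open>Y\<close> inside \<open>U\<close> this is regularity of \<open>z\<close> on
  the module U/Y, which may be zero. A pair of ideals stands for a module throughout.\<close>

definition nzd_on :: "'a \<Rightarrow> 'a set \<Rightarrow> 'a set \<Rightarrow> bool" where
  "nzd_on z U Y \<longleftrightarrow> (\<forall>p\<in>U. z \<otimes> p \<in> Y \<longrightarrow> p \<in> Y)"

lemma nzd_onD: "\<lbrakk>nzd_on z U Y; p \<in> U; z \<otimes> p \<in> Y\<rbrakk> \<Longrightarrow> p \<in> Y"
  by (simp add: nzd_on_def)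

text \<open>A maximal annihilator is prime: for b outside (Y : p) the class of bp is nonzero and its
  annihilator contains (Y : p), hence equals it; so ab in (Y : p) puts a into (Y : bp) = (Y :
  p).\<close>

lemma colon_prime:
  assumes "ideal U R" "ideal Y R" "p \<in> U" "p \<notin> Y"
    and max: "\<And>q. \<lbrakk>q \<in> U; q \<notin> Y; colon Y p \<subseteq> colon Y q\<rbrakk> \<Longrightarrow> colon Y q = colon Y p"
  shows "primeideal (colon Y p) R"
proof (rule primeidealI)
  have p: "p \<in> carrier R" using assms(1,3) ideal_sub by auto
  show "ideal (colon Y p) R" using colon_ideal assms p by auto
  show "cring R" using is_cring .
  have "\<one> \<notin> colon Y p" using assms(4) p by (simp add: colon_def)
  then show "carrier R \<noteq> colon Y p" by blast
  fix a b assume ab: "a \<in> carrier R" "b \<in> carrier R" "a \<otimes> b \<in> colon Y p"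
  show "a \<in> colon Y p \<or> b \<in> colon Y p"
  proof (rule disjCI)
    assume "b \<notin> colon Y p"
    then have "b \<otimes> p \<notin> Y" using ab by (auto simp: colon_def)
    moreover have "colon Y p \<subseteq> colon Y (b \<otimes> p)"
    proof
      fix x assume x: "x \<in> colon Y p"
      then have "x \<otimes> (b \<otimes> p) = b \<otimes> (x \<otimes> p)" using ab p by (simp add: colon_def m_lcomm)
      then show "x \<in> colon Y (b \<otimes> p)" using x ab p assms(2) ideal_mult by (simp add: colon_def)
    qed
    moreover have "b \<otimes> p \<in> U" using assms ab ideal_mult by auto
    ultimately have "colon Y (b \<otimes> p) = colon Y p" using max by blast
    moreover have "a \<in> colon Y (b \<otimes> p)" using ab p by (auto simp: colon_def m_assoc)
    ultimately show "a \<in> colon Y p" by simp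
  qed
qed

text \<open>Supplies an associated prime above a given annihilator. Maximality is kept in the
  conclusion because \<open>finite_associated_primes\<close> collects only maximal
  annihilators.\<close>

lemma exists_prime_colon:
  assumes "noetherian_ring R" "ideal U R" "ideal Y R" "p \<in> U" "p \<notin> Y"
  obtains q where "q \<in> U" "q \<notin> Y" "colon Y p \<subseteq> colon Y q" "primeideal (colon Y q) R"
    "\<And>q'. \<lbrakk>q' \<in> U; q' \<notin> Y; colon Y q \<subseteq> colon Y q'\<rbrakk> \<Longrightarrow> colon Y q' = colon Y q"
proof -
  define SS where "SS = {colon Y q | q. q \<in> U \<and> q \<notin> Y \<and> colon Y p \<subseteq> colon Y q}"
  have "SS \<noteq> {}" using assms(4,5) unfolding SS_def by blast
  moreover have "\<And>I. I \<in> SS \<Longrightarrow> ideal I R"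
    unfolding SS_def using assms colon_ideal ideal_sub by blast
  ultimately obtain M where M: "M \<in> SS" "\<And>N. \<lbrakk>N \<in> SS; M \<subseteq> N\<rbrakk> \<Longrightarrow> N = M"
    using noetherian_maximal[OF assms(1)] by metis
  then obtain q where q: "M = colon Y q" "q \<in> U" "q \<notin> Y" "colon Y p \<subseteq> colon Y q"
    unfolding SS_def by blast
  have *: "\<And>q'. \<lbrakk>q' \<in> U; q' \<notin> Y; colon Y q \<subseteq> colon Y q'\<rbrakk> \<Longrightarrow> colon Y q' = colon Y q"
    using M(2) q unfolding SS_def by blast
  show ?thesis using that[OF q(2-4) colon_prime[OF assms(2,3) q(2,3) *] *] by auto
qed

text \<open>The witness is a product with one factor from each ideal, all outside the prime.\<close>

lemma prime_not_contain_inter: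
  assumes "primeideal \<pp> R" "finite F" "\<And>I. I \<in> F \<Longrightarrow> ideal I R \<and> \<not> I \<subseteq> \<pp>"
  obtains r where "r \<in> carrier R" "r \<notin> \<pp>" "\<forall>I\<in>F. r \<in> I"
proof -
  from assms(2,3) have "\<exists>r\<in>carrier R. r \<notin> \<pp> \<and> (\<forall>I\<in>F. r \<in> I)"
  proof (induction F rule: finite_induct)
    case empty
    have "\<one> \<notin> \<pp>" using primeideal.I_notcarr[OF assms(1)] ideal.one_imp_carrier primeideal.axioms(1) assms(1) by blast
    then show ?case by auto
  next
    case (insert I F)
    then obtain r where r: "r \<in> carrier R" "r \<notin> \<pp>" "\<forall>I\<in>F. r \<in> I" by auto
    obtain s where s: "s \<in> I" "s \<notin> \<pp>" using insert by blast
    have sc: "s \<in> carrier R" using insert.prems[of I] s(1) ideal_sub by auto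
    have "r \<otimes> s \<notin> \<pp>" using primeideal.I_prime[OF assms(1)] r s sc by blast
    moreover have "r \<otimes> s \<in> I" using s insert.prems[of I] r ideal_mult by auto
    moreover have "\<forall>I\<in>F. r \<otimes> s \<in> I" using insert.prems r sc ideal_mult_right by auto
    ultimately show ?case using r sc by auto
  qed
  then show ?thesis using that by auto
qed

text \<open>Only the maximal annihilators are collected; they suffice, since the annihilator of
  every nonzero class lies in one of them. Finiteness comes from finitely many generators of the
  ideal spanned by their witnesses.\<close>

lemma finite_associated_primes:
  assumes "noetherian_ring R" "ideal U R" "ideal Y R"
  obtains F where "finite F" "\<forall>\<pp>\<in>F. primeideal \<pp> R \<and> (\<exists>p\<in>U. p \<notin> Y \<and> \<pp> = colon Y p)"
    "\<forall>z\<in>carrier R. (\<forall>\<pp>\<in>F. z \<notin> \<pp>) \<longrightarrow> nzd_on z U Y"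
proof -
  define Mx where "Mx = {p \<in> U. p \<notin> Y \<and> (\<forall>q\<in>U. q \<notin> Y \<longrightarrow> colon Y p \<subseteq> colon Y q \<longrightarrow> colon Y q = colon Y p)}"
  have MxX: "Mx \<subseteq> U" unfolding Mx_def by auto
  then have Mxc: "Mx \<subseteq> carrier R" using assms(2) ideal_sub by blast
  obtain S where S: "finite S" "S \<subseteq> Mx" "Idl S = Idl Mx"
    using noetherian_finite_subset[OF assms(1) Mxc] by auto
  have prime: "primeideal (colon Y p) R" if "p \<in> Mx" for p
    using colon_prime[OF assms(2,3), of p] that unfolding Mx_def by blast
  \<comment> \<open>If (Y : p) differed from (Y : q) for all q in \<open>S\<close>, maximality would
    forbid (Y : q) to lie in (Y : p). An r outside (Y : p) and inside all the (Y : q) would then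
    kill \<open>S\<close> modulo \<open>Y\<close>, and p with it.\<close>
  have in_S: "\<exists>q\<in>S. colon Y q = colon Y p" if p: "p \<in> Mx" for p
  proof (rule ccontr)
    assume no: "\<not> ?thesis"
    have "\<not> colon Y q \<subseteq> colon Y p" if "q \<in> S" for q
      using no that S(2) p unfolding Mx_def by blast
    then have *: "ideal I R \<and> \<not> I \<subseteq> colon Y p" if "I \<in> colon Y ` S" for I
      using that colon_ideal[OF assms(3)] S(2) Mxc by auto
    obtain r where r: "r \<in> carrier R" "r \<notin> colon Y p" "\<forall>I\<in>colon Y ` S. r \<in> I"
      by (rule prime_not_contain_inter[OF prime[OF p] finite_imageI[OF S(1), of "colon Y"] *])
    have "ideal {x \<in> carrier R. r \<otimes> x \<in> Y} R"
      by (rule ideal_intro)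
       (use r assms(3) in \<open>auto simp: r_distr m_lcomm ideal_add ideal_mult ideal_zero\<close>)
    moreover have "S \<subseteq> {x \<in> carrier R. r \<otimes> x \<in> Y}"
      using r(3) S(2) Mxc by (auto simp: colon_def)
    ultimately have "Idl S \<subseteq> {x \<in> carrier R. r \<otimes> x \<in> Y}" by (rule genideal_minimal)
    then have "r \<otimes> p \<in> Y" using S(3) genideal_self[OF Mxc] p by auto
    then show False using r(1,2) by (auto simp: colon_def)
  qed
  show ?thesis
  proof (rule that[of "colon Y ` S"])
    show "finite (colon Y ` S)" using S by auto
    show "\<forall>\<pp>\<in>colon Y ` S. primeideal \<pp> R \<and> (\<exists>p\<in>U. p \<notin> Y \<and> \<pp> = colon Y p)"
      using prime S(2) unfolding Mx_def by auto
    show "\<forall>z\<in>carrier R. (\<forall>\<pp>\<in>colon Y ` S. z \<notin> \<pp>) \<longrightarrow> nzd_on z U Y"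
    proof (intro ballI impI)
    fix z assume z: "z \<in> carrier R" "\<forall>\<pp>\<in>colon Y ` S. z \<notin> \<pp>"
    show "nzd_on z U Y"
      unfolding nzd_on_def
    proof (intro ballI impI, rule ccontr)
      fix p assume p: "p \<in> U" "z \<otimes> p \<in> Y" "p \<notin> Y"
      obtain q where q: "q \<in> U" "q \<notin> Y" "colon Y p \<subseteq> colon Y q"
        "\<And>q'. \<lbrakk>q' \<in> U; q' \<notin> Y; colon Y q \<subseteq> colon Y q'\<rbrakk> \<Longrightarrow> colon Y q' = colon Y q"
        using exists_prime_colon[OF assms p(1,3)] by metis
      then have "q \<in> Mx" unfolding Mx_def by blast
      then obtain q' where "q' \<in> S" "colon Y q' = colon Y q" using in_S by blast
      moreover have "z \<in> colon Y p" using p z by (auto simp: colon_def)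
      ultimately show False using z(2) q(3) by blast
    qed
    qed
  qed
qed

lemma prime_avoidance:
  assumes "finite F" "ideal Q R" "\<And>\<pp>. \<pp> \<in> F \<Longrightarrow> primeideal \<pp> R \<and> \<not> Q \<subseteq> \<pp>"
  obtains z where "z \<in> Q" "\<And>\<pp>. \<pp> \<in> F \<Longrightarrow> z \<notin> \<pp>"
proof -
  from assms(1,3) have "\<exists>z\<in>Q. \<forall>\<pp>\<in>F. z \<notin> \<pp>"
  proof (induction F rule: finite_psubset_induct)
    case (psubset F)
    consider "F = {}" | \<pp> \<qq> where "\<pp> \<in> F" "\<qq> \<in> F" "\<pp> \<noteq> \<qq>" "\<qq> \<subseteq> \<pp>"
      | \<pp> where "\<pp> \<in> F" "\<And>\<qq>. \<lbrakk>\<qq> \<in> F; \<qq> \<noteq> \<pp>\<rbrakk> \<Longrightarrow> \<not> \<qq> \<subseteq> \<pp>" by blast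
    then show ?case
    proof cases
      case 1 then show ?thesis using assms(2) ideal_zero by blast
    next
      case (2 \<pp> \<qq>)
      then have "F - {\<qq>} \<subset> F" by blast
      then obtain z where "z \<in> Q" "\<forall>\<pp>\<in>F - {\<qq>}. z \<notin> \<pp>"
        using psubset.IH[of "F - {\<qq>}"] psubset.prems by (metis DiffD1)
      then show ?thesis using 2 by blast
    next
      case (3 \<pp>)
      then have "F - {\<pp>} \<subset> F" by blast
      then obtain z where z: "z \<in> Q" "\<forall>\<pp>'\<in>F - {\<pp>}. z \<notin> \<pp>'"
        using psubset.IH[of "F - {\<pp>}"] psubset.prems by (metis DiffD1)
      have pp: "primeideal \<pp> R" using 3 psubset.prems by blast
      have id: "ideal I R" if "I \<in> F" for I using psubset.prems[OF that] primeideal.axioms(1) by blast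
      show ?thesis
      proof (cases "z \<in> \<pp>")
        case False then show ?thesis using z by blast
      next
        case True
        have "ideal I R \<and> \<not> I \<subseteq> \<pp>" if "I \<in> insert Q (F - {\<pp>})" for I
          using that 3 id assms(2) psubset.prems by blast
        then obtain w where w: "w \<in> carrier R" "w \<notin> \<pp>" "\<And>I. I \<in> insert Q (F - {\<pp>}) \<Longrightarrow> w \<in> I"
          using prime_not_contain_inter[OF pp, of "insert Q (F - {\<pp>})"] psubset.hyps by (metis finite.insertI finite_Diff)
        have zc: "z \<in> carrier R" using z assms(2) ideal_sub by blast
        have "w \<oplus> z \<in> Q" using z w assms(2) ideal_add by auto
        moreover have "w \<oplus> z \<notin> \<pp>" using ideal_add_cancel[OF id[OF 3(1)]] True w by blast
        moreover have "w \<oplus> z \<notin> \<pp>'" if "\<pp>' \<in> F - {\<pp>}" for \<pp>'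
        proof
          assume "w \<oplus> z \<in> \<pp>'"
          then have "z \<oplus> w \<in> \<pp>'" using w zc a_comm by simp
          then have "z \<in> \<pp>'" using ideal_add_cancel[OF id, of \<pp>' z w] that w(3) zc by blast
          then show False using z that by blast
        qed
        ultimately show ?thesis by (metis DiffI empty_iff insertE)
      qed
    qed
  qed
  then show ?thesis using that by auto
qed

text \<open>For \<open>Y\<close> inside \<open>U\<close> this is Hom(R/Q, U/Y) = 0. Over a
  Noetherian ring it amounts to an element of \<open>Q\<close> regular on U/Y, but it is easier to
  transport between quotients.\<close>

definition no_socle :: "'a set \<Rightarrow> 'a set \<Rightarrow> 'a set \<Rightarrow> bool" where
  "no_socle Q U Y \<longleftrightarrow> (\<forall>p\<in>U. (\<forall>q\<in>Q. q \<otimes> p \<in> Y) \<longrightarrow> p \<in> Y)"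

lemma nzd_no_socle: "\<lbrakk>z \<in> Q; nzd_on z U Y\<rbrakk> \<Longrightarrow> no_socle Q U Y"
  by (auto simp: no_socle_def nzd_on_def)

text \<open>An associated prime containing \<open>Q\<close> would be the annihilator of a nonzero
  class killed by \<open>Q\<close>. So \<open>Q\<close> is contained in none of the finitely many
  primes of all the pairs, and one element serves for every pair; this simultaneous choice drives
  the inductions on grade.\<close>

lemma common_nzd:
  assumes noeth: "noetherian_ring R" and "ideal Q R" "finite M"
    and "\<And>U Y. (U, Y) \<in> M \<Longrightarrow> ideal U R \<and> ideal Y R \<and> no_socle Q U Y"
  obtains z where "z \<in> Q" "\<And>U Y. (U, Y) \<in> M \<Longrightarrow> nzd_on z U Y"
proof -
  have "\<exists>F. finite F \<and> (\<forall>\<pp>\<in>F. primeideal \<pp> R \<and> \<not> Q \<subseteq> \<pp>) \<and>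
      (\<forall>z\<in>carrier R. (\<forall>\<pp>\<in>F. z \<notin> \<pp>) \<longrightarrow> nzd_on z (fst m) (snd m))" if "m \<in> M" for m
  proof -
    obtain U Y where m: "m = (U, Y)" by force
    have UY: "ideal U R" "ideal Y R" "no_socle Q U Y" using assms(4) that m by auto
    obtain F where F: "finite F" "\<forall>\<pp>\<in>F. primeideal \<pp> R \<and> (\<exists>p\<in>U. p \<notin> Y \<and> \<pp> = colon Y p)"
      "\<forall>z\<in>carrier R. (\<forall>\<pp>\<in>F. z \<notin> \<pp>) \<longrightarrow> nzd_on z U Y"
      by (rule finite_associated_primes[OF noeth UY(1,2)])
    have "\<not> Q \<subseteq> \<pp>" if "\<pp> \<in> F" for \<pp>
    proof
      assume "Q \<subseteq> \<pp>"
      moreover obtain p where "p \<in> U" "p \<notin> Y" "\<pp> = colon Y p" using F(2) \<open>\<pp> \<in> F\<close> by metis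
      ultimately show False using UY(3) unfolding no_socle_def colon_def by blast
    qed
    then have "\<forall>\<pp>\<in>F. primeideal \<pp> R \<and> \<not> Q \<subseteq> \<pp>" using F(2) by simp
    then show ?thesis unfolding m using F(1,3) by (intro exI[of _ F]) simp
  qed
  then obtain F where F: "\<And>m. m \<in> M \<Longrightarrow> finite (F m) \<and> (\<forall>\<pp>\<in>F m. primeideal \<pp> R \<and> \<not> Q \<subseteq> \<pp>) \<and>
      (\<forall>z\<in>carrier R. (\<forall>\<pp>\<in>F m. z \<notin> \<pp>) \<longrightarrow> nzd_on z (fst m) (snd m))"
    by metis
  obtain z where z: "z \<in> Q" "\<And>\<pp>. \<pp> \<in> (\<Union>m\<in>M. F m) \<Longrightarrow> z \<notin> \<pp>"
  proof (rule prime_avoidance[of "\<Union>m\<in>M. F m" Q])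
    show "finite (\<Union>m\<in>M. F m)" using F assms(3) by blast
    show "primeideal \<pp> R \<and> \<not> Q \<subseteq> \<pp>" if "\<pp> \<in> (\<Union>m\<in>M. F m)" for \<pp>
      using F that by blast
  qed (use assms(2) in auto)
  have zc: "z \<in> carrier R" using z assms(2) ideal_sub by blast
  have "nzd_on z U Y" if "(U, Y) \<in> M" for U Y
    using F[OF that] z(2) that zc by fastforce
  then show ?thesis using that z by blast
qed

lemma common_nzd2:
  assumes "noetherian_ring R" "ideal Q R" "ideal U R" "ideal Y R" "ideal U' R" "ideal Y' R"
    "no_socle Q U Y" "no_socle Q U' Y'"
  obtains z where "z \<in> Q" "nzd_on z U Y" "nzd_on z U' Y'"
  using common_nzd[OF assms(1,2), of "{(U, Y), (U', Y')}"] assms(3-8)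
  by (smt (verit) Pair_inject empty_iff finite.emptyI finite.insertI insertE insertI1 insertI2)

lemma common_nzd3:
  assumes "noetherian_ring R" "ideal Q R" "ideal U R" "ideal Y R" "ideal U' R" "ideal Y' R"
    "ideal U'' R" "ideal Y'' R" "no_socle Q U Y" "no_socle Q U' Y'" "no_socle Q U'' Y''"
  obtains z where "z \<in> Q" "nzd_on z U Y" "nzd_on z U' Y'" "nzd_on z U'' Y''"
  using common_nzd[OF assms(1,2), of "{(U, Y), (U', Y'), (U'', Y'')}"] assms(3-11)
  by (smt (verit) Pair_inject empty_iff finite.emptyI finite.insertI insertE insertI1 insertI2)

subsection \<open>Regular sequences on subquotients\<close>

text \<open>The ideal Y + zU, which turns U/Y into its quotient by z.\<close>

definition extend :: "'a set \<Rightarrow> 'a set \<Rightarrow> 'a \<Rightarrow> 'a set" where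
  "extend U Y z = {y \<oplus> z \<otimes> x | y x. y \<in> Y \<and> x \<in> U}"

lemma extend_ideal:
  assumes "ideal U R" "ideal Y R" "z \<in> carrier R"
  shows "ideal (extend U Y z) R"
proof (rule ideal_intro)
  have c: "\<And>x. x \<in> U \<Longrightarrow> x \<in> carrier R" "\<And>y. y \<in> Y \<Longrightarrow> y \<in> carrier R"
    using assms ideal_sub by auto
  show "extend U Y z \<subseteq> carrier R" using c assms(3) by (auto simp: extend_def)
  have "\<zero> = \<zero> \<oplus> z \<otimes> \<zero>" using assms by simp
  then show "\<zero> \<in> extend U Y z"
    unfolding extend_def using assms ideal_zero by blast
  fix a b assume "a \<in> extend U Y z" "b \<in> extend U Y z"
  then obtain y x y' x' where *: "a = y \<oplus> z \<otimes> x" "b = y' \<oplus> z \<otimes> x'" "y \<in> Y" "y' \<in> Y" "x \<in> U" "x' \<in> U"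
    by (auto simp: extend_def)
  have "a \<oplus> b = (y \<oplus> y') \<oplus> z \<otimes> (x \<oplus> x')"
    unfolding *(1,2) using c(1)[OF *(5)] c(1)[OF *(6)] c(2)[OF *(3)] c(2)[OF *(4)] assms(3) by algebra
  then show "a \<oplus> b \<in> extend U Y z"
    unfolding extend_def using * assms ideal_add by blast
next
  have c: "\<And>x. x \<in> U \<Longrightarrow> x \<in> carrier R" "\<And>y. y \<in> Y \<Longrightarrow> y \<in> carrier R"
    using assms ideal_sub by auto
  fix a r assume "a \<in> extend U Y z" and r: "r \<in> carrier R"
  then obtain y x where *: "a = y \<oplus> z \<otimes> x" "y \<in> Y" "x \<in> U" by (auto simp: extend_def)
  have "r \<otimes> a = r \<otimes> y \<oplus> z \<otimes> (r \<otimes> x)"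
    unfolding *(1) using c(1)[OF *(3)] c(2)[OF *(2)] r assms(3) by algebra
  then show "r \<otimes> a \<in> extend U Y z"
    unfolding extend_def using * r assms ideal_mult by blast
qed

lemma extend_upper1: "\<lbrakk>ideal U R; ideal Y R; z \<in> carrier R\<rbrakk> \<Longrightarrow> Y \<subseteq> extend U Y z"
proof
  fix y assume *: "ideal U R" "ideal Y R" "z \<in> carrier R" "y \<in> Y"
  then have "y = y \<oplus> z \<otimes> \<zero>" using ideal_carrier[of Y y] by simp
  then show "y \<in> extend U Y z" unfolding extend_def using * ideal_zero by blast
qed

lemma extend_upper2: "\<lbrakk>ideal U R; ideal Y R; z \<in> carrier R; x \<in> U\<rbrakk> \<Longrightarrow> z \<otimes> x \<in> extend U Y z"
proof -
  assume *: "ideal U R" "ideal Y R" "z \<in> carrier R" "x \<in> U"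
  then have "z \<otimes> x = \<zero> \<oplus> z \<otimes> x" using ideal_carrier[of U x] by simp
  then show ?thesis unfolding extend_def using * ideal_zero by blast
qed

lemma extend_least: "\<lbrakk>ideal I R; Y \<subseteq> I; \<And>x. x \<in> U \<Longrightarrow> z \<otimes> x \<in> I\<rbrakk> \<Longrightarrow> extend U Y z \<subseteq> I"
  by (auto simp: extend_def intro!: ideal_add)

lemma extend_extend_subset:
  assumes "ideal U R" "ideal Y R" "z \<in> carrier R" "w \<in> carrier R"
  shows "extend U (extend U Y z) w \<subseteq> extend U (extend U Y w) z"
proof -
  have 1: "ideal (extend U Y w) R" "ideal (extend U (extend U Y w) z) R"
    using assms extend_ideal by auto
  then show ?thesis
    using assms extend_upper1[OF assms(1,2)] extend_upper1[OF assms(1) 1(1) assms(3)]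
    by (intro extend_least) (auto intro!: extend_upper2 dest: extend_upper2[OF assms(1,2,4)])
qed

lemma extend_commute:
  assumes "ideal U R" "ideal Y R" "z \<in> carrier R" "w \<in> carrier R"
  shows "extend U (extend U Y z) w = extend U (extend U Y w) z"
  using assms extend_extend_subset by (meson equalityI)

text \<open>Swaps the regular sequence z, w: from zp = y + wx, regularity of w modulo Y + zU gives x
  = y' + zx', and then z(p - wx') lies in Y.\<close>

lemma nzd_exchange:
  assumes "ideal U R" "ideal Y R" "Y \<subseteq> U" "z \<in> carrier R" "w \<in> carrier R"
    and z: "nzd_on z U Y" and w: "nzd_on w U (extend U Y z)" "nzd_on w U Y"
  shows "nzd_on z U (extend U Y w)"
  unfolding nzd_on_def
proof (intro ballI impI)
  fix p assume p: "p \<in> U" "z \<otimes> p \<in> extend U Y w"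
  have c: "\<And>x. x \<in> U \<Longrightarrow> x \<in> carrier R" "\<And>y. y \<in> Y \<Longrightarrow> y \<in> carrier R"
    using assms ideal_sub by auto
  obtain y x where yx: "z \<otimes> p = y \<oplus> w \<otimes> x" "y \<in> Y" "x \<in> U" using p by (auto simp: extend_def)
  have "w \<otimes> x = \<ominus> y \<oplus> z \<otimes> p" unfolding yx(1) using c yx assms by (simp add: r_neg1)
  moreover have "\<ominus> y \<in> Y" using yx assms ideal_neg by auto
  ultimately have "w \<otimes> x \<in> extend U Y z" unfolding extend_def using p by blast
  then have "x \<in> extend U Y z" using w yx nzd_onD by blast
  then obtain y' x' where yx': "x = y' \<oplus> z \<otimes> x'" "y' \<in> Y" "x' \<in> U" by (auto simp: extend_def)
  have cc: "p \<in> carrier R" "y \<in> carrier R" "y' \<in> carrier R" "x' \<in> carrier R"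
    using c p yx yx' by auto
  have "z \<otimes> (p \<ominus> w \<otimes> x') = z \<otimes> p \<ominus> w \<otimes> (z \<otimes> x')" using cc assms by algebra
  also have "\<dots> = y \<oplus> w \<otimes> y'" unfolding yx(1) yx'(1) using cc assms by algebra
  finally have "z \<otimes> (p \<ominus> w \<otimes> x') \<in> Y" using yx yx' assms ideal_add ideal_mult by auto
  moreover have "p \<ominus> w \<otimes> x' \<in> U" using p yx' assms ideal_diff ideal_mult by auto
  ultimately have "p \<ominus> w \<otimes> x' \<in> Y" using z nzd_onD by blast
  moreover have "p = (p \<ominus> w \<otimes> x') \<oplus> w \<otimes> x'" using cc assms by algebra
  ultimately show "p \<in> extend U Y w" unfolding extend_def using yx' by blast
qed

text \<open>An elementary form of Hom(R/Q, M/zM) = Ext^1(R/Q, M) = Hom(R/Q, M/wM) for M = U/Y: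
  writing zp = y + wx sends a socle class p modulo w to a socle class x modulo z. As x vanishes
  there, so does p.\<close>

lemma no_socle_exchange:
  assumes "ideal U R" "ideal Y R" "Y \<subseteq> U" "ideal Q R" "z \<in> Q" "w \<in> Q"
    and z: "nzd_on z U Y" and w: "nzd_on w U Y" and ns: "no_socle Q U (extend U Y z)"
  shows "no_socle Q U (extend U Y w)"
  unfolding no_socle_def
proof (intro ballI impI)
  fix p assume p: "p \<in> U" and Qp: "\<forall>q\<in>Q. q \<otimes> p \<in> extend U Y w"
  have c: "\<And>x. x \<in> U \<Longrightarrow> x \<in> carrier R" "\<And>y. y \<in> Y \<Longrightarrow> y \<in> carrier R" "\<And>y. y \<in> Q \<Longrightarrow> y \<in> carrier R"
    using assms(1,2,4) ideal_sub by auto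
  have zw: "z \<in> carrier R" "w \<in> carrier R" using assms c by auto
  obtain y x where yx: "z \<otimes> p = y \<oplus> w \<otimes> x" "y \<in> Y" "x \<in> U"
    using Qp assms(5) by (auto simp: extend_def)
  have "q \<otimes> x \<in> extend U Y z" if q: "q \<in> Q" for q
  proof -
    obtain y' x' where yx': "q \<otimes> p = y' \<oplus> w \<otimes> x'" "y' \<in> Y" "x' \<in> U"
      using Qp q by (auto simp: extend_def)
    have cc: "p \<in> carrier R" "y \<in> carrier R" "y' \<in> carrier R" "x' \<in> carrier R" "x \<in> carrier R" "q \<in> carrier R"
      using c p yx yx' q by auto
    have "w \<otimes> (q \<otimes> x \<ominus> z \<otimes> x') = (q \<otimes> (y \<oplus> w \<otimes> x) \<ominus> z \<otimes> (y' \<oplus> w \<otimes> x')) \<oplus> (z \<otimes> y' \<ominus> q \<otimes> y)"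
      using cc zw by algebra
    also have "\<dots> = (q \<otimes> (z \<otimes> p) \<ominus> z \<otimes> (q \<otimes> p)) \<oplus> (z \<otimes> y' \<ominus> q \<otimes> y)" using yx yx' by simp
    also have "\<dots> = z \<otimes> y' \<ominus> q \<otimes> y" using cc zw by algebra
    finally have "w \<otimes> (q \<otimes> x \<ominus> z \<otimes> x') \<in> Y"
      using yx yx' assms(2) cc zw ideal_mult ideal_diff by auto
    moreover have "q \<otimes> x \<ominus> z \<otimes> x' \<in> U" using yx yx' cc zw assms(1) ideal_mult ideal_diff by auto
    ultimately have "q \<otimes> x \<ominus> z \<otimes> x' \<in> Y" using w nzd_onD by blast
    moreover have "q \<otimes> x = (q \<otimes> x \<ominus> z \<otimes> x') \<oplus> z \<otimes> x'" using cc zw by algebra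
    ultimately show ?thesis unfolding extend_def using yx' by blast
  qed
  then have "x \<in> extend U Y z" using ns yx unfolding no_socle_def by blast
  then obtain y' x' where yx': "x = y' \<oplus> z \<otimes> x'" "y' \<in> Y" "x' \<in> U" by (auto simp: extend_def)
  have cc: "p \<in> carrier R" "y \<in> carrier R" "y' \<in> carrier R" "x' \<in> carrier R"
    using c p yx yx' by auto
  have "z \<otimes> (p \<ominus> w \<otimes> x') = z \<otimes> p \<ominus> w \<otimes> (z \<otimes> x')" using cc zw by algebra
  also have "\<dots> = y \<oplus> w \<otimes> y'" unfolding yx(1) yx'(1) using cc zw by algebra
  finally have "z \<otimes> (p \<ominus> w \<otimes> x') \<in> Y" using yx yx' zw assms(2) ideal_add ideal_mult by auto
  moreover have "p \<ominus> w \<otimes> x' \<in> U" using p yx' zw assms(1) ideal_diff ideal_mult by auto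
  ultimately have "p \<ominus> w \<otimes> x' \<in> Y" using z nzd_onD by blast
  moreover have "p = (p \<ominus> w \<otimes> x') \<oplus> w \<otimes> x'" using cc zw by algebra
  ultimately show "p \<in> extend U Y w" unfolding extend_def using yx' by blast
qed

text \<open>
  A sequence of length \<open>n\<close> in \<open>Q\<close> is regular on \<open>U/Y\<close>; the quotient of \<open>U/Y\<close> by the sequence is allowed to be zero.
\<close>

primrec grade_ge :: "'a set \<Rightarrow> nat \<Rightarrow> 'a set \<Rightarrow> 'a set \<Rightarrow> bool" where
  "grade_ge Q 0 U Y = True"
| "grade_ge Q (Suc n) U Y = (\<exists>z\<in>Q. nzd_on z U Y \<and> grade_ge Q n U (extend U Y z))"

lemma grade_ge_mono: "\<lbrakk>grade_ge Q n U Y; k \<le> n\<rbrakk> \<Longrightarrow> grade_ge Q k U Y"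
proof (induction n arbitrary: Y k)
  case (Suc n)
  then show ?case by (cases k) auto
qed simp

lemma grade_ge_no_socle: "grade_ge Q (Suc n) U Y \<Longrightarrow> no_socle Q U Y"
  using nzd_no_socle by auto

text \<open>Every regular element of \<open>Q\<close> can begin a regular sequence of full length.
  If x is the first element of the given sequence, choose w regular modulo Y, Y + xU and Y + zU;
  replacing x by w and then w by z involves only shorter sequences, over Y + xU and Y + wU.\<close>

lemma grade_ge_exchange:
  assumes noeth: "noetherian_ring R" and Q: "ideal Q R" and U: "ideal U R"
  shows "\<lbrakk>ideal Y R; Y \<subseteq> U; grade_ge Q (Suc n) U Y; z \<in> Q; nzd_on z U Y\<rbrakk> \<Longrightarrow> grade_ge Q n U (extend U Y z)"
proof (induction n arbitrary: Y z)
  case (Suc n)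
  obtain x where x: "x \<in> Q" "nzd_on x U Y" "grade_ge Q (Suc n) U (extend U Y x)"
    using Suc.prems(3) by (metis grade_ge.simps(2))
  have xz: "x \<in> carrier R" "z \<in> carrier R" using x Suc.prems Q ideal_sub by auto
  note Y = Suc.prems(1,2)
  have id: "ideal (extend U Y x) R" "ideal (extend U Y z) R" using xz U Y extend_ideal by auto
  have sub: "extend U Y w \<subseteq> U" if "w \<in> carrier R" for w
    using that extend_least[OF U Y(2)] U ideal_mult by blast
  have ns: "no_socle Q U (extend U Y x)" using x grade_ge_no_socle by blast
  have "no_socle Q U (extend U Y z)" using no_socle_exchange[OF U Y Q x(1) Suc.prems(4) x(2) Suc.prems(5) ns] .
  moreover have "no_socle Q U Y" using x nzd_no_socle by blast
  ultimately obtain w where w: "w \<in> Q" "nzd_on w U Y" "nzd_on w U (extend U Y x)" "nzd_on w U (extend U Y z)"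
    using common_nzd3[OF noeth Q U Y(1) U id(1) U id(2)] ns by blast
  have wc: "w \<in> carrier R" using w Q ideal_sub by auto
  have idw: "ideal (extend U Y w) R" using wc U Y extend_ideal by auto
  have "grade_ge Q n U (extend U (extend U Y x) w)"
    using Suc.IH[OF id(1) sub[OF xz(1)] x(3) w(1,3)] .
  then have "grade_ge Q n U (extend U (extend U Y w) x)" using extend_commute[OF U Y(1)] xz wc by simp
  moreover have "nzd_on x U (extend U Y w)" using nzd_exchange[OF U Y xz(1) wc x(2) w(3,2)] .
  ultimately have "grade_ge Q (Suc n) U (extend U Y w)" using x(1) by auto
  moreover have "nzd_on z U (extend U Y w)" using nzd_exchange[OF U Y xz(2) wc Suc.prems(5) w(4,2)] .
  ultimately have "grade_ge Q n U (extend U (extend U Y w) z)"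
    using Suc.IH[OF idw sub[OF wc]] Suc.prems(4) by blast
  then have "grade_ge Q n U (extend U (extend U Y z) w)" using extend_commute[OF U Y(1)] xz wc by simp
  then show ?case using w by auto
qed simp

text \<open>The congruence \<alpha> p = \<beta> q modulo \<open>Z\<close> plays the graph of an
  isomorphism from U/Y to U'/Y': multiply by \<alpha>, divide by \<beta>. No map has to be chosen;
  totality, surjectivity and the matching of \<open>Y\<close> with \<open>Y'\<close> are all that
  regular sequences see.\<close>

lemma grade_ge_iso:
  assumes "\<alpha> \<in> carrier R" "\<beta> \<in> carrier R" "ideal Z R" "ideal U R" "ideal U' R"
    and Q: "Q \<subseteq> carrier R"
    and "\<And>p. p \<in> U \<Longrightarrow> \<exists>q\<in>U'. \<alpha> \<otimes> p \<ominus> \<beta> \<otimes> q \<in> Z"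
    and surj: "\<And>q. q \<in> U' \<Longrightarrow> \<exists>p\<in>U. \<alpha> \<otimes> p \<ominus> \<beta> \<otimes> q \<in> Z"
  shows "\<lbrakk>ideal Y R; ideal Y' R; \<And>p q. \<lbrakk>p \<in> U; q \<in> U'; \<alpha> \<otimes> p \<ominus> \<beta> \<otimes> q \<in> Z\<rbrakk> \<Longrightarrow> p \<in> Y \<longleftrightarrow> q \<in> Y';
     grade_ge Q n U Y\<rbrakk> \<Longrightarrow> grade_ge Q n U' Y'"
proof (induction n arbitrary: Y Y')
  case (Suc n)
  obtain z where z: "z \<in> Q" "nzd_on z U Y" "grade_ge Q n U (extend U Y z)" using Suc.prems by auto
  have zc: "z \<in> carrier R" using z Q by auto
  have c: "\<And>p. p \<in> U \<Longrightarrow> p \<in> carrier R" "\<And>q. q \<in> U' \<Longrightarrow> q \<in> carrier R" using assms(4,5) ideal_sub by auto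
  have rel_mult: "\<alpha> \<otimes> (z \<otimes> p) \<ominus> \<beta> \<otimes> (z \<otimes> q) \<in> Z" if "p \<in> U" "q \<in> U'" "\<alpha> \<otimes> p \<ominus> \<beta> \<otimes> q \<in> Z" for p q
  proof -
    have "\<alpha> \<otimes> (z \<otimes> p) \<ominus> \<beta> \<otimes> (z \<otimes> q) = z \<otimes> (\<alpha> \<otimes> p \<ominus> \<beta> \<otimes> q)"
      using c(1)[OF that(1)] c(2)[OF that(2)] assms(1,2) zc by algebra
    then show ?thesis using ideal_mult[OF assms(3) that(3) zc] by simp
  qed
  have rel_diff: "\<alpha> \<otimes> (p \<ominus> p') \<ominus> \<beta> \<otimes> (q \<ominus> q') \<in> Z"
    if "p \<in> U" "q \<in> U'" "\<alpha> \<otimes> p \<ominus> \<beta> \<otimes> q \<in> Z" "p' \<in> U" "q' \<in> U'" "\<alpha> \<otimes> p' \<ominus> \<beta> \<otimes> q' \<in> Z" for p q p' q'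
  proof -
    have "\<alpha> \<otimes> (p \<ominus> p') \<ominus> \<beta> \<otimes> (q \<ominus> q') = (\<alpha> \<otimes> p \<ominus> \<beta> \<otimes> q) \<ominus> (\<alpha> \<otimes> p' \<ominus> \<beta> \<otimes> q')"
      using c(1)[OF that(1)] c(2)[OF that(2)] c(1)[OF that(4)] c(2)[OF that(5)] assms(1,2) by algebra
    then show ?thesis using ideal_diff[OF assms(3) that(3,6)] by simp
  qed
  have "nzd_on z U' Y'"
    unfolding nzd_on_def
  proof (intro ballI impI)
    fix q assume q: "q \<in> U'" "z \<otimes> q \<in> Y'"
    obtain p where p: "p \<in> U" "\<alpha> \<otimes> p \<ominus> \<beta> \<otimes> q \<in> Z" using surj q by blast
    have "z \<otimes> p \<in> Y"
      using Suc.prems(3)[OF _ _ rel_mult[OF p(1) q(1) p(2)]] q p zc assms(4,5) ideal_mult by blast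
    then have "p \<in> Y" using z(2) p nzd_onD by blast
    then show "q \<in> Y'" using Suc.prems(3) p q by blast
  qed
  moreover have "p \<in> extend U Y z \<longleftrightarrow> q \<in> extend U' Y' z"
    if pq: "p \<in> U" "q \<in> U'" "\<alpha> \<otimes> p \<ominus> \<beta> \<otimes> q \<in> Z" for p q
  proof
    assume "p \<in> extend U Y z"
    then obtain y x where yx: "p = y \<oplus> z \<otimes> x" "y \<in> Y" "x \<in> U" by (auto simp: extend_def)
    obtain x' where x': "x' \<in> U'" "\<alpha> \<otimes> x \<ominus> \<beta> \<otimes> x' \<in> Z" using assms(7) yx by blast
    have zx: "z \<otimes> x \<in> U" "z \<otimes> x' \<in> U'" using yx x' assms(4,5) zc ideal_mult by auto
    have "\<alpha> \<otimes> (p \<ominus> z \<otimes> x) \<ominus> \<beta> \<otimes> (q \<ominus> z \<otimes> x') \<in> Z"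
      using rel_diff[OF pq zx rel_mult[OF yx(3) x']] .
    moreover have "p \<ominus> z \<otimes> x = y"
      unfolding yx(1) using yx(2) ideal_sub[OF Suc.prems(1)] c yx zc by (auto simp: a_minus_def a_assoc r_neg subsetD)
    ultimately have "q \<ominus> z \<otimes> x' \<in> Y'"
      using Suc.prems(3) yx(2) pq zx ideal_diff assms(4,5) by metis
    moreover have "q = (q \<ominus> z \<otimes> x') \<oplus> z \<otimes> x'" using c(2)[OF pq(2)] c(2)[OF x'(1)] zc by algebra
    ultimately show "q \<in> extend U' Y' z" unfolding extend_def using x' by blast
  next
    assume "q \<in> extend U' Y' z"
    then obtain y x' where yx: "q = y \<oplus> z \<otimes> x'" "y \<in> Y'" "x' \<in> U'" by (auto simp: extend_def)
    obtain x where x': "x \<in> U" "\<alpha> \<otimes> x \<ominus> \<beta> \<otimes> x' \<in> Z" using surj yx by blast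
    have zx: "z \<otimes> x \<in> U" "z \<otimes> x' \<in> U'" using yx x' assms(4,5) zc ideal_mult by auto
    have "\<alpha> \<otimes> (p \<ominus> z \<otimes> x) \<ominus> \<beta> \<otimes> (q \<ominus> z \<otimes> x') \<in> Z"
      using rel_diff[OF pq zx rel_mult[OF x'(1) yx(3) x'(2)]] .
    moreover have "q \<ominus> z \<otimes> x' = y"
      unfolding yx(1) using yx(2) ideal_sub[OF Suc.prems(2)] c yx zc by (auto simp: a_minus_def a_assoc r_neg subsetD)
    ultimately have "p \<ominus> z \<otimes> x \<in> Y"
      using Suc.prems(3) yx(2) pq zx ideal_diff assms(4,5) by metis
    moreover have "p = (p \<ominus> z \<otimes> x) \<oplus> z \<otimes> x" using c(1)[OF pq(1)] c(1)[OF x'(1)] zc by algebra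
    ultimately show "p \<in> extend U Y z" unfolding extend_def using x' by blast
  qed
  ultimately show ?case
    using Suc.IH[OF _ _ _ z(3), of "extend U' Y' z"] extend_ideal assms(4,5) Suc.prems(1,2) zc z(1) by auto
qed simp

section \<open>Grade along short exact sequences\<close>

lemma nzd_on_sub: "\<lbrakk>nzd_on z U Y; U' \<subseteq> U\<rbrakk> \<Longrightarrow> nzd_on z U' Y"
  by (auto simp: nzd_on_def)

text \<open>For \<open>z\<close> regular on \<open>U/U'\<close> the image of \<open>U'\<close> in \<open>U/(Y + zU)\<close> is \<open>U'/(Y + zU')\<close>.\<close>

lemma grade_ge_restrict:
  assumes U: "ideal U R" "ideal U' R" "ideal Y R" "Y \<subseteq> U'" "U' \<subseteq> U" "ideal Q R" "z \<in> carrier R"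
    and reg: "nzd_on z U U'"
  shows "grade_ge Q n U' (extend U' Y z) \<longleftrightarrow> grade_ge Q n (extend U U' z) (extend U Y z)"
proof -
  note id = extend_ideal[OF U(2,3,7)] extend_ideal[OF U(1,2,7)] extend_ideal[OF U(1,3,7)]
  have c: "\<And>p. p \<in> U \<Longrightarrow> p \<in> carrier R" using U ideal_sub by blast
  have int: "p \<in> extend U' Y z" if p: "p \<in> U'" "p \<in> extend U Y z" for p
  proof -
    obtain y x where yx: "p = y \<oplus> z \<otimes> x" "y \<in> Y" "x \<in> U" using p by (auto simp: extend_def)
    have cc: "y \<in> carrier R" "z \<otimes> x \<in> carrier R" using yx c U by auto
    then have "z \<otimes> x \<oplus> y \<in> U'" using yx(1) p(1) a_comm by simp
    then have "z \<otimes> x \<in> U'" using ideal_add_cancel[OF U(2)] yx(2) U(4) cc by blast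
    then have "x \<in> U'" using reg yx nzd_onD by blast
    then show ?thesis using yx by (auto simp: extend_def)
  qed
  have sub: "extend U' Y z \<subseteq> extend U Y z" using U(5) by (auto simp: extend_def)
  have rel: "p \<in> extend U' Y z \<longleftrightarrow> q \<in> extend U Y z"
    if "p \<in> U'" "q \<in> extend U U' z" "\<one> \<otimes> p \<ominus> \<one> \<otimes> q \<in> extend U Y z" for p q
  proof -
    have cc: "p \<in> carrier R" "q \<in> carrier R" using that c U ideal_sub[OF id(2)] by auto
    have pq: "p \<ominus> q \<in> extend U Y z" using that cc by simp
    have "p \<in> extend U Y z \<longleftrightarrow> q \<in> extend U Y z"
      using ideal_diff_cancel[OF id(3) pq] ideal_diff_cancel2[OF id(3) pq] cc by blast
    then show ?thesis using int that sub by blast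
  qed
  have tot: "\<exists>q\<in>extend U U' z. \<one> \<otimes> p \<ominus> \<one> \<otimes> q \<in> extend U Y z" if "p \<in> U'" for p
  proof (rule bexI[of _ p])
    show "p \<in> extend U U' z" using extend_upper1[OF U(1,2,7)] that by blast
    show "\<one> \<otimes> p \<ominus> \<one> \<otimes> p \<in> extend U Y z" using c that U(5) ideal_zero[OF id(3)] by (simp add: r_neg a_minus_def subsetD)
  qed
  have surj: "\<exists>p\<in>U'. \<one> \<otimes> p \<ominus> \<one> \<otimes> q \<in> extend U Y z" if q: "q \<in> extend U U' z" for q
  proof -
    obtain p x where px: "q = p \<oplus> z \<otimes> x" "p \<in> U'" "x \<in> U" using q by (auto simp: extend_def)
    have cc: "p \<in> carrier R" "x \<in> carrier R" using px c U by auto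
    have "\<one> \<otimes> p \<ominus> \<one> \<otimes> q = z \<otimes> (\<ominus> x)" unfolding px(1) using cc U(7) by algebra
    moreover have "z \<otimes> (\<ominus> x) \<in> extend U Y z" using extend_upper2[OF U(1,3,7)] px U(1) ideal_neg by blast
    ultimately show ?thesis using px(2) by metis
  qed
  have Qc: "Q \<subseteq> carrier R" using U ideal_sub by blast
  show ?thesis
  proof
    assume "grade_ge Q n U' (extend U' Y z)"
    then show "grade_ge Q n (extend U U' z) (extend U Y z)"
      using grade_ge_iso[OF one_closed one_closed id(3) U(2) id(2) Qc tot surj id(1,3) rel] by blast
  next
    assume g: "grade_ge Q n (extend U U' z) (extend U Y z)"
    have flip: "\<one> \<otimes> q \<ominus> \<one> \<otimes> p \<in> extend U Y z \<longleftrightarrow> \<one> \<otimes> p \<ominus> \<one> \<otimes> q \<in> extend U Y z"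
      if "p \<in> U'" "q \<in> extend U U' z" for p q
    proof -
      have cc: "p \<in> carrier R" "q \<in> carrier R" using that c U ideal_sub[OF id(2)] by auto
      have "\<one> \<otimes> q \<ominus> \<one> \<otimes> p = \<ominus> (\<one> \<otimes> p \<ominus> \<one> \<otimes> q)" "\<one> \<otimes> p \<ominus> \<one> \<otimes> q = \<ominus> (\<one> \<otimes> q \<ominus> \<one> \<otimes> p)"
        using cc by algebra+
      then show ?thesis using ideal_neg[OF id(3)] by metis
    qed
    show "grade_ge Q n U' (extend U' Y z)"
      using grade_ge_iso[OF one_closed one_closed id(3) id(2) U(2) Qc _ _ id(3,1) _ g]
        tot surj rel flip by metis
  qed
qed

text \<open>Depth lemma for 0 -> U'/Y -> U/Y -> U/U' -> 0, bounding the third term. Instead of a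
  long exact sequence, one z regular on all three modules is divided out.\<close>

lemma grade_ge_quotient:
  assumes noeth: "noetherian_ring R" and Q: "ideal Q R"
  shows "\<lbrakk>ideal U R; ideal U' R; ideal Y R; Y \<subseteq> U'; U' \<subseteq> U; grade_ge Q (Suc n) U' Y; grade_ge Q n U Y\<rbrakk>
    \<Longrightarrow> grade_ge Q n U U'"
proof (induction n arbitrary: U U' Y)
  case (Suc n)
  note id = Suc.prems(1-3) and sub = Suc.prems(4,5)
  have ns: "no_socle Q U' Y" "no_socle Q U Y" using Suc.prems grade_ge_no_socle by blast+
  obtain z where z: "z \<in> Q" "nzd_on z U' Y" "nzd_on z U Y"
    using common_nzd2[OF noeth Q id(2,3,1,3)] ns by blast
  have zc: "z \<in> carrier R" using z Q ideal_sub by blast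
  have g: "grade_ge Q (Suc n) U' (extend U' Y z)"
    using grade_ge_exchange[OF noeth Q id(2,3) sub(1) Suc.prems(6) z(1,2)] .
  \<comment> \<open>Needed for a z that is regular on U/U' too. For a socle class p of U/U' the
    multiple zp is a socle class of U'/(Y + zU'), which has none because U'/Y has grade at least 2.
    Hence zp lies in Y + zU', and p in U'.\<close>
  have "no_socle Q U U'"
    unfolding no_socle_def
  proof (intro ballI impI)
    fix p assume p: "p \<in> U" "\<forall>q\<in>Q. q \<otimes> p \<in> U'"
    have pc: "p \<in> carrier R" using p id ideal_sub by blast
    have "q \<otimes> (z \<otimes> p) \<in> extend U' Y z" if q: "q \<in> Q" for q
    proof -
      have qc: "q \<in> carrier R" using q Q ideal_sub by blast
      have "q \<otimes> (z \<otimes> p) = z \<otimes> (q \<otimes> p)" using qc pc zc by (simp add: m_lcomm)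
      then show ?thesis using p q extend_upper2[OF id(2,3) zc] by simp
    qed
    moreover have "z \<otimes> p \<in> U'" using p z by blast
    ultimately have "z \<otimes> p \<in> extend U' Y z"
      using grade_ge_no_socle[OF g] unfolding no_socle_def by blast
    then obtain y x where yx: "z \<otimes> p = y \<oplus> z \<otimes> x" "y \<in> Y" "x \<in> U'" by (auto simp: extend_def)
    have cc: "y \<in> carrier R" "x \<in> carrier R" using yx id ideal_sub by blast+
    have "z \<otimes> (p \<ominus> x) = z \<otimes> p \<ominus> z \<otimes> x" using pc cc zc by algebra
    also have "\<dots> = y" unfolding yx(1) using pc cc zc by algebra
    finally have "p \<ominus> x \<in> Y" using nzd_onD[OF z(3)] yx p sub id ideal_diff by (metis subsetD)
    then show "p \<in> U'" using ideal_diff_cancel[OF id(2)] yx sub pc by blast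
  qed
  then obtain z where z: "z \<in> Q" "nzd_on z U' Y" "nzd_on z U Y" "nzd_on z U U'"
    using common_nzd3[OF noeth Q id(2,3,1,3,1,2)] ns by blast
  have zc: "z \<in> carrier R" using z Q ideal_sub by blast
  have "grade_ge Q (Suc n) U' (extend U' Y z)"
    by (rule grade_ge_exchange[OF noeth Q id(2,3) sub(1) Suc.prems(6) z(1,2)])
  then have "grade_ge Q (Suc n) (extend U U' z) (extend U Y z)"
    using grade_ge_restrict[OF id sub Q zc z(4)] by blast
  moreover have "grade_ge Q n U (extend U Y z)"
    using grade_ge_exchange[OF noeth Q id(1,3) _ Suc.prems(7) z(1,3)] sub by blast
  moreover have "extend U U' z \<subseteq> U"
    using extend_least[OF id(1) sub(2)] ideal_mult[OF id(1) _ zc] by blast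
  moreover have "extend U Y z \<subseteq> extend U U' z" using sub by (auto simp: extend_def)
  ultimately have "grade_ge Q n U (extend U U' z)"
    using Suc.IH extend_ideal id zc by blast
  then show ?case using z by auto
qed simp

text \<open>Depth lemma, bounding the first term. In the base case an element regular on U/Y is
  regular on the submodule U'/Y.\<close>

lemma grade_ge_sub:
  assumes noeth: "noetherian_ring R" and Q: "ideal Q R"
  shows "\<lbrakk>ideal U R; ideal U' R; ideal Y R; Y \<subseteq> U'; U' \<subseteq> U; grade_ge Q (Suc n) U Y; grade_ge Q n U U'\<rbrakk>
    \<Longrightarrow> grade_ge Q (Suc n) U' Y"
proof (induction n arbitrary: U U' Y)
  case 0
  then obtain z where "z \<in> Q" "nzd_on z U Y" by auto
  then show ?case using nzd_on_sub[of z U Y U'] 0(5) by auto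
next
  case (Suc n)
  note id = Suc.prems(1-3) and sub = Suc.prems(4,5)
  have ns: "no_socle Q U U'" "no_socle Q U Y" using Suc.prems grade_ge_no_socle by blast+
  obtain z where z: "z \<in> Q" "nzd_on z U Y" "nzd_on z U U'"
    using common_nzd2[OF noeth Q id(1,3,1,2)] ns by blast
  have zc: "z \<in> carrier R" using z Q ideal_sub by blast
  have "grade_ge Q (Suc n) U (extend U Y z)"
    using grade_ge_exchange[OF noeth Q id(1,3) _ Suc.prems(6) z(1,2)] sub by blast
  moreover have "grade_ge Q n U (extend U U' z)"
    using grade_ge_exchange[OF noeth Q id(1,2) _ Suc.prems(7) z(1,3)] sub by blast
  moreover have "extend U U' z \<subseteq> U"
    using extend_least[OF id(1) sub(2)] ideal_mult[OF id(1) _ zc] by blast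
  moreover have "extend U Y z \<subseteq> extend U U' z" using sub by (auto simp: extend_def)
  ultimately have "grade_ge Q (Suc n) (extend U U' z) (extend U Y z)"
    using Suc.IH extend_ideal id zc by blast
  then have "grade_ge Q (Suc n) U' (extend U' Y z)"
    using grade_ge_restrict[OF id sub Q zc z(3)] by blast
  then show ?case using z nzd_on_sub[OF z(2) sub(2)] by auto
qed

text \<open>Depth lemma, bounding the middle term: an element regular on U'/Y and on U/U' is regular
  on U/Y.\<close>

lemma grade_ge_extension:
  assumes noeth: "noetherian_ring R" and Q: "ideal Q R"
  shows "\<lbrakk>ideal U R; ideal U' R; ideal Y R; Y \<subseteq> U'; U' \<subseteq> U; grade_ge Q n U' Y; grade_ge Q n U U'\<rbrakk>
    \<Longrightarrow> grade_ge Q n U Y"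
proof (induction n arbitrary: U U' Y)
  case (Suc n)
  note id = Suc.prems(1-3) and sub = Suc.prems(4,5)
  have ns: "no_socle Q U U'" "no_socle Q U' Y" using Suc.prems grade_ge_no_socle by blast+
  obtain z where z: "z \<in> Q" "nzd_on z U' Y" "nzd_on z U U'"
    using common_nzd2[OF noeth Q id(2,3,1,2)] ns by blast
  have zc: "z \<in> carrier R" using z Q ideal_sub by blast
  have "nzd_on z U Y" using z sub unfolding nzd_on_def by blast
  moreover have "grade_ge Q n U' (extend U' Y z)"
    using grade_ge_exchange[OF noeth Q id(2,3) sub(1) Suc.prems(6) z(1,2)] .
  then have "grade_ge Q n (extend U U' z) (extend U Y z)"
    using grade_ge_restrict[OF id sub Q zc z(3)] by blast
  moreover have "grade_ge Q n U (extend U U' z)"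
    using grade_ge_exchange[OF noeth Q id(1,2) _ Suc.prems(7) z(1,3)] sub by blast
  moreover have "extend U U' z \<subseteq> U"
    using extend_least[OF id(1) sub(2)] ideal_mult[OF id(1) _ zc] by blast
  moreover have "extend U Y z \<subseteq> extend U U' z" using sub by (auto simp: extend_def)
  ultimately have "nzd_on z U Y" "grade_ge Q n U (extend U Y z)"
    using Suc.IH extend_ideal id zc by blast+
  then show ?case using z by auto
qed simp

end

section \<open>Indexed polynomial rings and their evaluation\<close>

lemma finite_submultisets: "finite {v. v \<subseteq># u}"
proof (induction u)
  case (add x u)
  have "{v. v \<subseteq># add_mset x u} \<subseteq> {v. v \<subseteq># u} \<union> add_mset x ` {v. v \<subseteq># u}"
  proof
    fix v assume "v \<in> {v. v \<subseteq># add_mset x u}"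
    then have v: "v \<subseteq># add_mset x u" by simp
    show "v \<in> {v. v \<subseteq># u} \<union> add_mset x ` {v. v \<subseteq># u}"
    proof (cases "x \<in># v")
      case True
      then obtain w where "v = add_mset x w" by (metis multi_member_split)
      then show ?thesis using v by auto
    next
      case False
      then have "v \<subseteq># u" using v by (metis diff_single_trivial subset_eq_diff_conv add_mset_add_single)
      then show ?thesis by simp
    qed
  qed
  then show ?case using add by (meson finite_Un finite_imageI finite_subset)
qed simp

text \<open>Makes the \<open>finsum\<close> in the product of \<open>indexed_poly_ring\<close> a
  genuine finite sum.\<close>

lemma finite_splittings: "finite {(v, w). v + w = (u :: 'c multiset)}"
proof (rule finite_subset)
  show "{(v, w). v + w = u} \<subseteq> (\<lambda>v. (v, u - v)) ` {v. v \<subseteq># u}" by auto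
qed (simp add: finite_submultisets)

context cring
begin

section \<open>Polynomials as finitely supported coefficient functions\<close>

definition mon :: "'a \<Rightarrow> 'c multiset \<Rightarrow> ('c multiset \<Rightarrow> 'a)" where
  "mon r u = (\<lambda>v. if v = u then r else \<zero>)"

text \<open>Pointwise form of the inductive set \<open>indexed_pset\<close>; closure under products
  is read off from it.\<close>

definition poly_set :: "'c set \<Rightarrow> ('c multiset \<Rightarrow> 'a) set" where
  "poly_set V = {P. (\<forall>u. P u \<in> carrier R) \<and> finite {u. P u \<noteq> \<zero>} \<and> (\<forall>u. P u \<noteq> \<zero> \<longrightarrow> set_mset u \<subseteq> V)}"

lemma mon_empty: "mon r {#} = indexed_const r"
  by (auto simp: mon_def indexed_const_def)

lemma mon_pmult: "indexed_pmult (mon r u) x = mon r (add_mset x u)"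
  unfolding mon_def indexed_pmult_def by (rule ext) (metis insert_DiffM add_mset_remove_trivial union_single_eq_member)

lemma var_mon: "indexed_var x = mon \<one> {#x#}"
  unfolding indexed_var_def mon_empty[symmetric] mon_pmult by simp

lemma mon_in_pset: "\<lbrakk>r \<in> carrier R; set_mset u \<subseteq> V\<rbrakk> \<Longrightarrow> mon r u \<in> indexed_pset V (carrier R)"
proof (induction u)
  case empty then show ?case by (simp add: mon_empty indexed_pset.indexed_const)
next
  case (add x u) then show ?case by (simp add: mon_pmult[symmetric] indexed_pset.indexed_pmult)
qed

lemma finite_supp_split:
  assumes "P \<in> poly_set V" "P u \<noteq> \<zero>"
  shows "P(u := \<zero>) \<in> poly_set V" "P = indexed_padd (mon (P u) u) (P(u := \<zero>))"
    "{v. (P(u := \<zero>)) v \<noteq> \<zero>} = {v. P v \<noteq> \<zero>} - {u}"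
proof -
  show 1: "{v. (P(u := \<zero>)) v \<noteq> \<zero>} = {v. P v \<noteq> \<zero>} - {u}" by auto
  show "P(u := \<zero>) \<in> poly_set V" unfolding poly_set_def using assms(1) 1 by (auto simp: poly_set_def)
  show "P = indexed_padd (mon (P u) u) (P(u := \<zero>))"
    using assms by (auto simp: poly_set_def indexed_padd_def mon_def fun_eq_iff)
qed

lemma indexed_pset_eq: "indexed_pset V (carrier R) = poly_set V"
proof
  show "indexed_pset V (carrier R) \<subseteq> poly_set V"
  proof
    fix P assume "P \<in> indexed_pset V (carrier R)"
    then show "P \<in> poly_set V"
    proof induction
      case (indexed_const k)
      have "{u. indexed_const k u \<noteq> \<zero>} \<subseteq> {{#}}" by (auto simp: indexed_const_def)
      then have "finite {u. indexed_const k u \<noteq> \<zero>}" by (rule finite_subset) simp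
      then show ?case using indexed_const by (auto simp: poly_set_def indexed_const_def)
    next
      case (indexed_padd P Q)
      have "{u. indexed_padd P Q u \<noteq> \<zero>} \<subseteq> {u. P u \<noteq> \<zero>} \<union> {u. Q u \<noteq> \<zero>}"
        by (auto simp: indexed_padd_def)
      then have "finite {u. indexed_padd P Q u \<noteq> \<zero>}"
        using indexed_padd by (auto simp: poly_set_def intro: finite_subset)
      moreover have "set_mset u \<subseteq> V" if "indexed_padd P Q u \<noteq> \<zero>" for u
      proof -
        have "P u \<noteq> \<zero> \<or> Q u \<noteq> \<zero>" using that by (auto simp: indexed_padd_def)
        then show ?thesis using indexed_padd unfolding poly_set_def by blast
      qed
      ultimately show ?case using indexed_padd by (auto simp: poly_set_def) (simp add: indexed_padd_def)
    next
      case (indexed_pmult P i)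
      have "{u. indexed_pmult P i u \<noteq> \<zero>} \<subseteq> add_mset i ` {u. P u \<noteq> \<zero>}"
        by (auto simp: indexed_pmult_def image_iff split: if_splits) (metis insert_DiffM)
      then have "finite {u. indexed_pmult P i u \<noteq> \<zero>}"
        using indexed_pmult by (auto simp: poly_set_def intro: finite_subset)
      moreover have "set_mset u \<subseteq> V" if "indexed_pmult P i u \<noteq> \<zero>" for u
      proof -
        have "i \<in># u" "P (u - {#i#}) \<noteq> \<zero>" using that by (auto simp: indexed_pmult_def split: if_splits)
        then have "set_mset (u - {#i#}) \<subseteq> V" using indexed_pmult unfolding poly_set_def by blast
        then show ?thesis using \<open>i \<in># u\<close> indexed_pmult(2)
          by (metis insert_DiffM insert_subset set_mset_add_mset_insert)
      qed
      ultimately show ?case using indexed_pmult by (auto simp: poly_set_def) (simp add: indexed_pmult_def)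
    qed
  qed
  show "poly_set V \<subseteq> indexed_pset V (carrier R)"
  proof
    fix P assume "P \<in> poly_set V"
    moreover have "finite F \<Longrightarrow> P \<in> poly_set V \<Longrightarrow> {u. P u \<noteq> \<zero>} = F \<Longrightarrow> P \<in> indexed_pset V (carrier R)" for F
    proof (induction F arbitrary: P rule: finite_induct)
      case empty
      then have "P = indexed_const \<zero>" by (auto simp: indexed_const_def)
      then show ?case by (simp add: indexed_pset.indexed_const)
    next
      case (insert u F)
      then have u: "P u \<noteq> \<zero>" by auto
      note split = finite_supp_split[OF insert.prems(1) u]
      have "P(u := \<zero>) \<in> indexed_pset V (carrier R)"
      proof (rule insert.IH[OF split(1)])
        show "{v. (P(u := \<zero>)) v \<noteq> \<zero>} = F" unfolding split(3) using insert.prems(2) insert.hyps(2) by auto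
      qed
      moreover have "mon (P u) u \<in> indexed_pset V (carrier R)"
        using insert.prems(1) u by (intro mon_in_pset) (auto simp: poly_set_def)
      ultimately show ?case using split(2) indexed_pset.indexed_padd by metis
    qed
    ultimately show "P \<in> indexed_pset V (carrier R)" unfolding poly_set_def by blast
  qed
qed

abbreviation "PR V \<equiv> indexed_poly_ring R V"

lemma PR_simps:
  "carrier (PR V) = poly_set V"
  "P \<otimes>\<^bsub>PR V\<^esub> Q = (\<lambda>u. finsum R (\<lambda>(v, w). P v \<otimes> Q w) {(v, w). v + w = u})"
  "\<one>\<^bsub>PR V\<^esub> = indexed_const \<one>" "\<zero>\<^bsub>PR V\<^esub> = indexed_const \<zero>"
  "P \<oplus>\<^bsub>PR V\<^esub> Q = indexed_padd P Q"
  by (auto simp: indexed_poly_ring_def indexed_pset_eq)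

lemma PR_add_apply: "(P \<oplus>\<^bsub>PR V\<^esub> Q) u = P u \<oplus> Q u"
  by (simp add: PR_simps indexed_padd_def)

lemma PR_zero_apply: "\<zero>\<^bsub>PR V\<^esub> u = \<zero>"
  by (simp add: PR_simps indexed_const_def)

lemma PR_apply: "P \<in> carrier (PR V) \<Longrightarrow> P u \<in> carrier R"
  by (simp add: PR_simps poly_set_def)

lemma PR_mono: "V \<subseteq> W \<Longrightarrow> carrier (PR V) \<subseteq> carrier (PR W)"
  unfolding PR_simps poly_set_def by blast

text \<open>No operation of \<open>indexed_poly_ring\<close> mentions the variable set, so fewer
  variables give a literal subring. This lets \<open>simple_ext\<close> treat the coefficient ring
  as a subset of the carrier.\<close>

lemma PR_restrict: "PR V = (PR W)\<lparr>carrier := carrier (PR V)\<rparr>"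
  by (simp add: indexed_poly_ring_def)

lemma mon_closed: "\<lbrakk>r \<in> carrier R; set_mset u \<subseteq> V\<rbrakk> \<Longrightarrow> mon r u \<in> carrier (PR V)"
  by (simp add: PR_simps indexed_pset_eq[symmetric] mon_in_pset)

lemma PR_induct [consumes 1, case_names mon add]:
  assumes "P \<in> carrier (PR V)"
    and "\<And>r u. \<lbrakk>r \<in> carrier R; set_mset u \<subseteq> V\<rbrakk> \<Longrightarrow> \<Phi> (mon r u)"
    and "\<And>P Q. \<lbrakk>P \<in> carrier (PR V); Q \<in> carrier (PR V); \<Phi> P; \<Phi> Q\<rbrakk> \<Longrightarrow> \<Phi> (P \<oplus>\<^bsub>PR V\<^esub> Q)"
  shows "\<Phi> P"
proof -
  have "finite F \<Longrightarrow> P \<in> poly_set V \<Longrightarrow> {u. P u \<noteq> \<zero>} = F \<Longrightarrow> \<Phi> P" for F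
  proof (induction F arbitrary: P rule: finite_induct)
    case empty
    then have "P = mon \<zero> {#}" by (auto simp: mon_def)
    then show ?case using assms(2)[of \<zero> "{#}"] by simp
  next
    case (insert u F)
    then have u: "P u \<noteq> \<zero>" by auto
    have uV: "P u \<in> carrier R" "set_mset u \<subseteq> V" using insert.prems(1) u by (auto simp: poly_set_def)
    note split = finite_supp_split[OF insert.prems(1) u]
    have "\<Phi> (P(u := \<zero>))"
    proof (rule insert.IH[OF split(1)])
      show "{v. (P(u := \<zero>)) v \<noteq> \<zero>} = F" unfolding split(3) using insert.prems(2) insert.hyps(2) by auto
    qed
    then have "\<Phi> (mon (P u) u \<oplus>\<^bsub>PR V\<^esub> P(u := \<zero>))"
      using assms(3)[OF mon_closed[OF uV]] split(1) assms(2)[OF uV] by (simp add: PR_simps)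
    then show ?case using split(2) by (simp add: PR_simps)
  qed
  then show ?thesis using assms(1) unfolding PR_simps by (auto simp: poly_set_def)
qed

text \<open>The convolution collapses to a single splitting. Together with \<open>PR_induct\<close>
  this reduces the ring laws to monomials.\<close>

lemma mon_mult:
  assumes "r \<in> carrier R" "\<And>u. P u \<in> carrier R"
  shows "(mon r u \<otimes>\<^bsub>PR V\<^esub> P) v = (if u \<subseteq># v then r \<otimes> P (v - u) else \<zero>)"
proof -
  have "(mon r u \<otimes>\<^bsub>PR V\<^esub> P) v = finsum R (\<lambda>(a, b). mon r u a \<otimes> P b) {(a, b). a + b = v}"
    by (simp add: PR_simps)
  also have "\<dots> = finsum R (\<lambda>(a, b). r \<otimes> P b) ({(a, b). a + b = v} \<inter> {(u, v - u)})"
    by (rule add.finprod_mono_neutral_cong_right)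
      (use assms in \<open>auto simp: finite_splittings mon_def split: if_splits\<close>)
  also have "{(a, b). a + b = v} \<inter> {(u, v - u)} = (if u \<subseteq># v then {(u, v - u)} else {})"
    by auto (metis mset_subset_eq_add_left)
  also have "finsum R (\<lambda>(a, b). r \<otimes> P b) \<dots> = (if u \<subseteq># v then r \<otimes> P (v - u) else \<zero>)"
    using assms by auto
  finally show ?thesis .
qed

lemma mon_mult_mon:
  assumes "r \<in> carrier R" "s \<in> carrier R"
  shows "mon r u \<otimes>\<^bsub>PR V\<^esub> mon s v = mon (r \<otimes> s) (u + v)"
proof
  fix w
  have "\<And>u. mon s v u \<in> carrier R" using assms by (simp add: mon_def)
  then show "(mon r u \<otimes>\<^bsub>PR V\<^esub> mon s v) w = mon (r \<otimes> s) (u + v) w"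
    using assms by (subst mon_mult) (auto simp: mon_def)
qed

lemma PR_mult_closed_mon:
  assumes "r \<in> carrier R" "set_mset u \<subseteq> V" "P \<in> carrier (PR V)"
  shows "mon r u \<otimes>\<^bsub>PR V\<^esub> P \<in> carrier (PR V)"
proof -
  have P: "\<And>u. P u \<in> carrier R" using assms(3) PR_apply by blast
  note * = mon_mult[OF assms(1), of P, OF P]
  have "{v. (mon r u \<otimes>\<^bsub>PR V\<^esub> P) v \<noteq> \<zero>} \<subseteq> (\<lambda>w. u + w) ` {w. P w \<noteq> \<zero>}"
  proof
    fix v assume "v \<in> {v. (mon r u \<otimes>\<^bsub>PR V\<^esub> P) v \<noteq> \<zero>}"
    then have "u \<subseteq># v" "P (v - u) \<noteq> \<zero>" using assms(1) by (auto simp: * split: if_splits)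
    then show "v \<in> (\<lambda>w. u + w) ` {w. P w \<noteq> \<zero>}" by (auto intro!: image_eqI[of _ _ "v - u"])
  qed
  moreover have "finite {w. P w \<noteq> \<zero>}" using assms(3) by (simp add: PR_simps poly_set_def)
  ultimately have "finite {v. (mon r u \<otimes>\<^bsub>PR V\<^esub> P) v \<noteq> \<zero>}" by (meson finite_imageI finite_subset)
  moreover have "set_mset v \<subseteq> V" if "(mon r u \<otimes>\<^bsub>PR V\<^esub> P) v \<noteq> \<zero>" for v
  proof -
    have uv: "u \<subseteq># v" "P (v - u) \<noteq> \<zero>" using that assms(1) by (auto simp: * split: if_splits)
    then have "set_mset (v - u) \<subseteq> V" using assms(3) by (simp add: PR_simps poly_set_def)
    moreover have "set_mset v = set_mset u \<union> set_mset (v - u)"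
      using uv(1) by (metis set_mset_union subset_mset.add_diff_inverse)
    ultimately show ?thesis using assms(2) by auto
  qed
  moreover have "(mon r u \<otimes>\<^bsub>PR V\<^esub> P) v \<in> carrier R" for v using assms(1) P by (simp add: *)
  ultimately show ?thesis by (simp add: PR_simps(1) poly_set_def)
qed

lemma PR_add_closed: "\<lbrakk>P \<in> carrier (PR V); Q \<in> carrier (PR V)\<rbrakk> \<Longrightarrow> P \<oplus>\<^bsub>PR V\<^esub> Q \<in> carrier (PR V)"
  unfolding PR_simps indexed_pset_eq[symmetric] by (rule indexed_pset.indexed_padd)

lemma PR_l_distr:
  assumes "P \<in> carrier (PR V)" "P' \<in> carrier (PR V)" "Q \<in> carrier (PR V)"
  shows "(P \<oplus>\<^bsub>PR V\<^esub> P') \<otimes>\<^bsub>PR V\<^esub> Q = P \<otimes>\<^bsub>PR V\<^esub> Q \<oplus>\<^bsub>PR V\<^esub> P' \<otimes>\<^bsub>PR V\<^esub> Q"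
proof
  fix u
  note c = PR_apply[OF assms(1)] PR_apply[OF assms(2)] PR_apply[OF assms(3)]
  have "((P \<oplus>\<^bsub>PR V\<^esub> P') \<otimes>\<^bsub>PR V\<^esub> Q) u = (\<Oplus>x\<in>{(v, w). v + w = u}. P (fst x) \<otimes> Q (snd x) \<oplus> P' (fst x) \<otimes> Q (snd x))"
    unfolding PR_simps by (intro add.finprod_cong') (use c in \<open>auto simp: indexed_padd_def l_distr\<close>)
  also have "\<dots> = (\<Oplus>x\<in>{(v, w). v + w = u}. P (fst x) \<otimes> Q (snd x)) \<oplus> (\<Oplus>x\<in>{(v, w). v + w = u}. P' (fst x) \<otimes> Q (snd x))"
    by (rule finsum_addf) (use c in auto)
  finally show "((P \<oplus>\<^bsub>PR V\<^esub> P') \<otimes>\<^bsub>PR V\<^esub> Q) u = (P \<otimes>\<^bsub>PR V\<^esub> Q \<oplus>\<^bsub>PR V\<^esub> P' \<otimes>\<^bsub>PR V\<^esub> Q) u"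
    by (simp add: PR_simps indexed_padd_def split_def)
qed

lemma PR_r_distr:
  assumes "P \<in> carrier (PR V)" "P' \<in> carrier (PR V)" "Q \<in> carrier (PR V)"
  shows "Q \<otimes>\<^bsub>PR V\<^esub> (P \<oplus>\<^bsub>PR V\<^esub> P') = Q \<otimes>\<^bsub>PR V\<^esub> P \<oplus>\<^bsub>PR V\<^esub> Q \<otimes>\<^bsub>PR V\<^esub> P'"
proof
  fix u
  note c = PR_apply[OF assms(1)] PR_apply[OF assms(2)] PR_apply[OF assms(3)]
  have "(Q \<otimes>\<^bsub>PR V\<^esub> (P \<oplus>\<^bsub>PR V\<^esub> P')) u = (\<Oplus>x\<in>{(v, w). v + w = u}. Q (fst x) \<otimes> P (snd x) \<oplus> Q (fst x) \<otimes> P' (snd x))"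
    unfolding PR_simps by (intro add.finprod_cong') (use c in \<open>auto simp: indexed_padd_def r_distr\<close>)
  also have "\<dots> = (\<Oplus>x\<in>{(v, w). v + w = u}. Q (fst x) \<otimes> P (snd x)) \<oplus> (\<Oplus>x\<in>{(v, w). v + w = u}. Q (fst x) \<otimes> P' (snd x))"
    by (rule finsum_addf) (use c in auto)
  finally show "(Q \<otimes>\<^bsub>PR V\<^esub> (P \<oplus>\<^bsub>PR V\<^esub> P')) u = (Q \<otimes>\<^bsub>PR V\<^esub> P \<oplus>\<^bsub>PR V\<^esub> Q \<otimes>\<^bsub>PR V\<^esub> P') u"
    by (simp add: PR_simps indexed_padd_def split_def)
qed

lemma PR_mult_closed:
  "\<lbrakk>P \<in> carrier (PR V); Q \<in> carrier (PR V)\<rbrakk> \<Longrightarrow> P \<otimes>\<^bsub>PR V\<^esub> Q \<in> carrier (PR V)"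
  by (induction P rule: PR_induct) (simp_all add: PR_mult_closed_mon PR_l_distr PR_add_closed)

lemma PR_mult_comm:
  assumes "P \<in> carrier (PR V)" "Q \<in> carrier (PR V)"
  shows "P \<otimes>\<^bsub>PR V\<^esub> Q = Q \<otimes>\<^bsub>PR V\<^esub> P"
  using assms
proof (induction P rule: PR_induct)
  case (mon r u)
  from mon(3) show ?case
  proof (induction Q rule: PR_induct)
    case (mon s v)
    then show ?case using \<open>r \<in> carrier R\<close> by (simp add: mon_mult_mon m_comm add.commute)
  next
    case (add P Q)
    then show ?case using mon_closed[OF mon(1,2)] by (simp add: PR_l_distr PR_r_distr)
  qed
qed (simp add: PR_l_distr PR_r_distr)

lemma PR_mon_assoc:
  assumes "r \<in> carrier R" "s \<in> carrier R" "P \<in> carrier (PR V)" "set_mset v \<subseteq> V"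
  shows "mon r u \<otimes>\<^bsub>PR V\<^esub> (mon s v \<otimes>\<^bsub>PR V\<^esub> P) = mon (r \<otimes> s) (u + v) \<otimes>\<^bsub>PR V\<^esub> P"
proof
  fix w
  have P: "P u \<in> carrier R" for u using assms PR_apply by blast
  have sP: "(mon s v \<otimes>\<^bsub>PR V\<^esub> P) u \<in> carrier R" for u using assms P by (subst mon_mult) auto
  have rs: "r \<otimes> s \<in> carrier R" using assms by simp
  have "u + v \<subseteq># w \<longleftrightarrow> u \<subseteq># w \<and> v \<subseteq># w - u"
    by (metis add.commute mset_subset_eq_add_left subset_eq_diff_conv subset_mset.dual_order.trans
        subset_mset.le_diff_conv2)
  then show "(mon r u \<otimes>\<^bsub>PR V\<^esub> (mon s v \<otimes>\<^bsub>PR V\<^esub> P)) w = (mon (r \<otimes> s) (u + v) \<otimes>\<^bsub>PR V\<^esub> P) w"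
    unfolding mon_mult[OF assms(1) sP] mon_mult[OF rs P] mon_mult[OF assms(2) P]
    using assms P by (simp add: m_assoc)
qed

lemma PR_mult_assoc:
  assumes "P \<in> carrier (PR V)" "Q \<in> carrier (PR V)" "S \<in> carrier (PR V)"
  shows "(P \<otimes>\<^bsub>PR V\<^esub> Q) \<otimes>\<^bsub>PR V\<^esub> S = P \<otimes>\<^bsub>PR V\<^esub> (Q \<otimes>\<^bsub>PR V\<^esub> S)"
  using assms
proof (induction P rule: PR_induct)
  case (mon r u)
  from mon(3) show ?case
  proof (induction Q rule: PR_induct)
    case (mon s v)
    then show ?case using \<open>r \<in> carrier R\<close> \<open>S \<in> carrier (PR V)\<close> by (simp add: mon_mult_mon PR_mon_assoc)
  next
    case (add P Q)
    then show ?case using mon_closed[OF mon(1,2)] \<open>S \<in> carrier (PR V)\<close>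
      by (simp add: PR_l_distr PR_r_distr PR_mult_closed)
  qed
qed (simp add: PR_l_distr PR_mult_closed)

lemma PR_cring: "cring (PR V)"
proof (rule cringI)
  show "abelian_group (PR V)"
  proof (rule abelian_groupI)
    show "\<zero>\<^bsub>PR V\<^esub> \<in> carrier (PR V)" using mon_closed[of \<zero> "{#}" V] by (simp add: PR_simps mon_empty)
    fix P assume P: "P \<in> carrier (PR V)"
    show "\<zero>\<^bsub>PR V\<^esub> \<oplus>\<^bsub>PR V\<^esub> P = P"
      using PR_apply[OF P] by (auto simp: PR_add_apply PR_zero_apply)
    have "(\<lambda>u. \<ominus> P u) \<in> carrier (PR V)" using P by (auto simp: PR_simps poly_set_def)
    moreover have "(\<lambda>u. \<ominus> P u) \<oplus>\<^bsub>PR V\<^esub> P = \<zero>\<^bsub>PR V\<^esub>"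
      using PR_apply[OF P] by (auto simp: PR_add_apply PR_zero_apply l_neg)
    ultimately show "\<exists>Q\<in>carrier (PR V). Q \<oplus>\<^bsub>PR V\<^esub> P = \<zero>\<^bsub>PR V\<^esub>" by blast
  next
    fix P Q S assume c: "P \<in> carrier (PR V)" "Q \<in> carrier (PR V)" "S \<in> carrier (PR V)"
    then show "P \<oplus>\<^bsub>PR V\<^esub> Q \<oplus>\<^bsub>PR V\<^esub> S = P \<oplus>\<^bsub>PR V\<^esub> (Q \<oplus>\<^bsub>PR V\<^esub> S)"
      using PR_apply[OF c(1)] PR_apply[OF c(2)] PR_apply[OF c(3)] by (auto simp: PR_add_apply a_assoc)
  next
    fix P Q assume c: "P \<in> carrier (PR V)" "Q \<in> carrier (PR V)"
    show "P \<oplus>\<^bsub>PR V\<^esub> Q = Q \<oplus>\<^bsub>PR V\<^esub> P"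
      using PR_apply[OF c(1)] PR_apply[OF c(2)] by (auto simp: PR_add_apply a_comm)
  qed (rule PR_add_closed)
  show "comm_monoid (PR V)"
  proof (rule comm_monoidI)
    show "\<one>\<^bsub>PR V\<^esub> \<in> carrier (PR V)" using mon_closed[of \<one> "{#}" V] by (simp add: PR_simps mon_empty)
    fix P assume P: "P \<in> carrier (PR V)"
    have "(mon \<one> {#} \<otimes>\<^bsub>PR V\<^esub> P) u = P u" for u using PR_apply[OF P] by (subst mon_mult) auto
    then show "\<one>\<^bsub>PR V\<^esub> \<otimes>\<^bsub>PR V\<^esub> P = P" unfolding PR_simps(3) mon_empty[symmetric] by (rule ext)
    show "P \<otimes>\<^bsub>PR V\<^esub> Q \<in> carrier (PR V)" if "Q \<in> carrier (PR V)" for Q using PR_mult_closed P that .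
    show "P \<otimes>\<^bsub>PR V\<^esub> Q = Q \<otimes>\<^bsub>PR V\<^esub> P" if "Q \<in> carrier (PR V)" for Q using PR_mult_comm P that .
    show "P \<otimes>\<^bsub>PR V\<^esub> Q \<otimes>\<^bsub>PR V\<^esub> S = P \<otimes>\<^bsub>PR V\<^esub> (Q \<otimes>\<^bsub>PR V\<^esub> S)"
      if "Q \<in> carrier (PR V)" "S \<in> carrier (PR V)" for Q S using PR_mult_assoc P that .
  qed
qed (rule PR_l_distr)

lemma const_closed: "r \<in> carrier R \<Longrightarrow> indexed_const r \<in> carrier (PR V)"
  using mon_closed[of r "{#}"] by (simp add: mon_empty)

lemma var_closed: "x \<in> V \<Longrightarrow> indexed_var x \<in> carrier (PR V)"
  unfolding var_mon by (rule mon_closed) auto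

lemma const_mult_apply:
  assumes "r \<in> carrier R" "P \<in> carrier (PR V)"
  shows "(indexed_const r \<otimes>\<^bsub>PR V\<^esub> P) u = r \<otimes> P u"
  unfolding mon_empty[symmetric] using mon_mult[where r = r and P = P and u = "{#}" and V = V and v = u, OF assms(1)] PR_apply[OF assms(2)] by simp

lemma var_mult_apply:
  assumes "P \<in> carrier (PR V)"
  shows "(indexed_var x \<otimes>\<^bsub>PR V\<^esub> P) u = (if x \<in># u then P (u - {#x#}) else \<zero>)"
  unfolding var_mon using mon_mult[where r = \<one> and P = P and u = "{#x#}" and V = V and v = u] PR_apply[OF assms] by simp

lemma var_mult_add_mset: "P \<in> carrier (PR V) \<Longrightarrow> (indexed_var x \<otimes>\<^bsub>PR V\<^esub> P) (add_mset x u) = P u"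
  by (simp add: var_mult_apply)

lemma const_hom: "ring_hom_cring R (PR V) indexed_const"
proof (rule ring_hom_cringI[OF is_cring PR_cring ring_hom_memI])
  show "indexed_const (r \<otimes> s) = indexed_const r \<otimes>\<^bsub>PR V\<^esub> indexed_const s"
    if "r \<in> carrier R" "s \<in> carrier R" for r s
    using mon_mult_mon[where r = r and s = s and u = "{#}" and V = V and v = "{#}"] that by (simp add: mon_empty)
qed (simp_all add: const_closed PR_simps(3,5) indexed_padd_const)

lemma mon_eq_const_mult: "r \<in> carrier R \<Longrightarrow> mon r (add_mset x u) = indexed_var x \<otimes>\<^bsub>PR V\<^esub> mon r u"
  unfolding var_mon by (simp add: mon_mult_mon)

lemma PR_induct_gen [consumes 1, case_names const var add]:
  assumes "P \<in> carrier (PR V)"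
    and "\<And>r. r \<in> carrier R \<Longrightarrow> \<Phi> (indexed_const r)"
    and "\<And>x P. \<lbrakk>x \<in> V; P \<in> carrier (PR V); \<Phi> P\<rbrakk> \<Longrightarrow> \<Phi> (indexed_var x \<otimes>\<^bsub>PR V\<^esub> P)"
    and "\<And>P Q. \<lbrakk>P \<in> carrier (PR V); Q \<in> carrier (PR V); \<Phi> P; \<Phi> Q\<rbrakk> \<Longrightarrow> \<Phi> (P \<oplus>\<^bsub>PR V\<^esub> Q)"
  shows "\<Phi> P"
  using assms(1)
proof (induction P rule: PR_induct)
  case (mon r u)
  then show ?case
  proof (induction u)
    case empty then show ?case by (simp add: mon_empty assms(2))
  next
    case (add x u)
    then show ?case using assms(3)[of x "mon r u"] mon_closed[of r u V] mon_eq_const_mult[where r = r and x = x and u = u and V = V] by simp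
  qed
qed (rule assms(4))

end

text \<open>The guards make the folded function commute on the whole type, as
  \<open>fold_mset\<close> requires; for values \<open>e x\<close> in the carrier they always
  hold.\<close>

definition meval :: "('b, 'm) ring_scheme \<Rightarrow> ('c \<Rightarrow> 'b) \<Rightarrow> 'c multiset \<Rightarrow> 'b" where
  "meval E e u = fold_mset (\<lambda>x a. if a \<in> carrier E \<and> e x \<in> carrier E then e x \<otimes>\<^bsub>E\<^esub> a else a) \<one>\<^bsub>E\<^esub> u"

definition peval :: "('a, 'n) ring_scheme \<Rightarrow> ('b, 'm) ring_scheme \<Rightarrow> ('a \<Rightarrow> 'b) \<Rightarrow> ('c \<Rightarrow> 'b) \<Rightarrow> ('c multiset \<Rightarrow> 'a) \<Rightarrow> 'b" where
  "peval R E \<phi> e P = finsum E (\<lambda>u. \<phi> (P u) \<otimes>\<^bsub>E\<^esub> meval E e u) {u. P u \<noteq> \<zero>\<^bsub>R\<^esub>}"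

context cring
begin

lemma comp_fun_commute_meval:
  "comp_fun_commute (\<lambda>x a. if a \<in> carrier R \<and> e x \<in> carrier R then e x \<otimes> a else a)"
  by standard (auto simp: fun_eq_iff m_lcomm)

lemma meval_empty: "meval R e {#} = \<one>"
  by (simp add: meval_def)

lemma meval_add: "meval R e (add_mset x u) =
    (if meval R e u \<in> carrier R \<and> e x \<in> carrier R then e x \<otimes> meval R e u else meval R e u)"
  unfolding meval_def by (simp add: comp_fun_commute.fold_mset_add_mset[OF comp_fun_commute_meval])

lemma meval_closed: "meval R e u \<in> carrier R"
  by (induction u) (auto simp: meval_empty meval_add)

lemma meval_add_mset: "e x \<in> carrier R \<Longrightarrow> meval R e (add_mset x u) = e x \<otimes> meval R e u"
  by (simp add: meval_add meval_closed)

lemma meval_union: "\<forall>x\<in>set_mset u. e x \<in> carrier R \<Longrightarrow> meval R e (u + v) = meval R e u \<otimes> meval R e v"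
  by (induction u) (auto simp: meval_empty meval_add_mset meval_closed m_assoc)

end

locale poly_eval = R: cring R + E: cring E for R (structure) and E (structure) and \<phi> e V +
  assumes hom: "\<phi> \<in> ring_hom R E" and e: "\<And>x. x \<in> V \<Longrightarrow> e x \<in> carrier E"
begin

lemma phi_closed: "r \<in> carrier R \<Longrightarrow> \<phi> r \<in> carrier E"
  and phi_add: "\<lbrakk>r \<in> carrier R; s \<in> carrier R\<rbrakk> \<Longrightarrow> \<phi> (r \<oplus> s) = \<phi> r \<oplus>\<^bsub>E\<^esub> \<phi> s"
  and phi_mult: "\<lbrakk>r \<in> carrier R; s \<in> carrier R\<rbrakk> \<Longrightarrow> \<phi> (r \<otimes> s) = \<phi> r \<otimes>\<^bsub>E\<^esub> \<phi> s"
  and phi_one: "\<phi> \<one> = \<one>\<^bsub>E\<^esub>"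
  using hom by (auto simp: ring_hom_def)

lemma phi_zero: "\<phi> \<zero> = \<zero>\<^bsub>E\<^esub>"
  using ring_hom_zero[OF hom R.ring_axioms E.ring_axioms] .

text \<open>Allows two polynomials with different supports to be summed over one common finite set,
  as in \<open>peval_add\<close>.\<close>

lemma peval_superset:
  assumes "P \<in> carrier (R.PR V)" "finite F" "{u. P u \<noteq> \<zero>} \<subseteq> F"
  shows "peval R E \<phi> e P = finsum E (\<lambda>u. \<phi> (P u) \<otimes>\<^bsub>E\<^esub> meval E e u) F"
  unfolding peval_def
  by (rule E.add.finprod_mono_neutral_cong_left)
    (use assms in \<open>auto simp: phi_zero E.meval_closed phi_closed R.PR_apply\<close>)

lemma peval_closed: "P \<in> carrier (R.PR V) \<Longrightarrow> peval R E \<phi> e P \<in> carrier E"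
  unfolding peval_def by (rule E.finsum_closed) (auto simp: E.meval_closed phi_closed R.PR_apply)

lemma supp_finite: "P \<in> carrier (R.PR V) \<Longrightarrow> finite {u. P u \<noteq> \<zero>}"
  by (simp add: R.PR_simps R.poly_set_def)

lemma peval_add:
  assumes "P \<in> carrier (R.PR V)" "Q \<in> carrier (R.PR V)"
  shows "peval R E \<phi> e (P \<oplus>\<^bsub>R.PR V\<^esub> Q) = peval R E \<phi> e P \<oplus>\<^bsub>E\<^esub> peval R E \<phi> e Q"
proof -
  define F where "F = {u. P u \<noteq> \<zero>} \<union> {u. Q u \<noteq> \<zero>}"
  have F: "finite F" using assms supp_finite F_def by auto
  note c = R.PR_apply[OF assms(1)] R.PR_apply[OF assms(2)]
  have "peval R E \<phi> e (P \<oplus>\<^bsub>R.PR V\<^esub> Q) = finsum E (\<lambda>u. \<phi> ((P \<oplus>\<^bsub>R.PR V\<^esub> Q) u) \<otimes>\<^bsub>E\<^esub> meval E e u) F"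
    by (rule peval_superset[OF R.PR_add_closed[OF assms] F]) (auto simp: F_def R.PR_add_apply)
  also have "\<dots> = finsum E (\<lambda>u. \<phi> (P u) \<otimes>\<^bsub>E\<^esub> meval E e u \<oplus>\<^bsub>E\<^esub> \<phi> (Q u) \<otimes>\<^bsub>E\<^esub> meval E e u) F"
    by (rule E.add.finprod_cong')
      (use c in \<open>auto simp: R.PR_add_apply phi_add E.l_distr phi_closed E.meval_closed\<close>)
  also have "\<dots> = finsum E (\<lambda>u. \<phi> (P u) \<otimes>\<^bsub>E\<^esub> meval E e u) F \<oplus>\<^bsub>E\<^esub> finsum E (\<lambda>u. \<phi> (Q u) \<otimes>\<^bsub>E\<^esub> meval E e u) F"
    by (rule E.finsum_addf) (use c in \<open>auto simp: phi_closed E.meval_closed\<close>)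
  also have "\<dots> = peval R E \<phi> e P \<oplus>\<^bsub>E\<^esub> peval R E \<phi> e Q"
    using peval_superset[OF assms(1) F] peval_superset[OF assms(2) F] F_def by auto
  finally show ?thesis .
qed

lemma peval_mon:
  assumes "r \<in> carrier R" "set_mset u \<subseteq> V"
  shows "peval R E \<phi> e (R.mon r u) = \<phi> r \<otimes>\<^bsub>E\<^esub> meval E e u"
proof -
  have "peval R E \<phi> e (R.mon r u) = finsum E (\<lambda>v. \<phi> (R.mon r u v) \<otimes>\<^bsub>E\<^esub> meval E e v) {u}"
    by (rule peval_superset[OF R.mon_closed[OF assms]]) (auto simp: R.mon_def)
  also have "\<dots> = \<phi> r \<otimes>\<^bsub>E\<^esub> meval E e u"
    using assms by (simp add: R.mon_def phi_closed E.meval_closed)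
  finally show ?thesis .
qed

lemma peval_mult:
  assumes "P \<in> carrier (R.PR V)" "Q \<in> carrier (R.PR V)"
  shows "peval R E \<phi> e (P \<otimes>\<^bsub>R.PR V\<^esub> Q) = peval R E \<phi> e P \<otimes>\<^bsub>E\<^esub> peval R E \<phi> e Q"
  using assms
proof (induction P rule: R.PR_induct)
  case (mon r u)
  from mon(3) show ?case
  proof (induction Q rule: R.PR_induct)
    case (mon s v)
    have "peval R E \<phi> e (R.mon r u \<otimes>\<^bsub>R.PR V\<^esub> R.mon s v) = \<phi> (r \<otimes> s) \<otimes>\<^bsub>E\<^esub> meval E e (u + v)"
      using mon \<open>r \<in> carrier R\<close> \<open>set_mset u \<subseteq> V\<close> by (simp add: R.mon_mult_mon peval_mon)
    also have "\<dots> = (\<phi> r \<otimes>\<^bsub>E\<^esub> \<phi> s) \<otimes>\<^bsub>E\<^esub> (meval E e u \<otimes>\<^bsub>E\<^esub> meval E e v)"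
      using mon \<open>r \<in> carrier R\<close> \<open>set_mset u \<subseteq> V\<close> e by (auto simp: phi_mult E.meval_union subset_iff)
    also have "\<dots> = (\<phi> r \<otimes>\<^bsub>E\<^esub> meval E e u) \<otimes>\<^bsub>E\<^esub> (\<phi> s \<otimes>\<^bsub>E\<^esub> meval E e v)"
      using phi_closed[OF \<open>r \<in> carrier R\<close>] phi_closed[OF mon(1)]
      by (simp add: E.meval_closed E.m_assoc E.m_comm E.m_lcomm)
    finally show ?case using mon \<open>r \<in> carrier R\<close> \<open>set_mset u \<subseteq> V\<close> by (simp add: peval_mon)
  next
    case (add P Q)
    then show ?case using R.mon_closed[OF mon(1,2)]
      by (simp add: R.PR_r_distr peval_add R.PR_mult_closed E.r_distr peval_closed)
  qed
qed (simp add: R.PR_l_distr peval_add R.PR_mult_closed E.l_distr peval_closed)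

lemma peval_const: "r \<in> carrier R \<Longrightarrow> peval R E \<phi> e (ring.indexed_const R r) = \<phi> r"
  using peval_mon[of r "{#}"] by (simp add: R.mon_empty E.meval_empty phi_closed)

lemma peval_var: "x \<in> V \<Longrightarrow> peval R E \<phi> e (ring.indexed_var R x) = e x"
  using peval_mon[of \<one> "{#x#}"] by (simp add: R.var_mon E.meval_add_mset E.meval_empty phi_one e)

lemma peval_hom: "ring_hom_cring (R.PR V) E (peval R E \<phi> e)"
proof (rule ring_hom_cringI[OF R.PR_cring E.is_cring ring_hom_memI])
  show "peval R E \<phi> e \<one>\<^bsub>R.PR V\<^esub> = \<one>\<^bsub>E\<^esub>"
    by (simp add: R.PR_simps(3) peval_const phi_one)
qed (simp_all add: peval_closed peval_add peval_mult)

end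

context cring
begin

lemma PR_hom_eq:
  assumes "f \<in> ring_hom (PR V) E" "g \<in> ring_hom (PR V) E" "P \<in> carrier (PR V)"
    and "\<And>r. r \<in> carrier R \<Longrightarrow> f (indexed_const r) = g (indexed_const r)"
    and "\<And>x. x \<in> V \<Longrightarrow> f (indexed_var x) = g (indexed_var x)"
  shows "f P = g P"
  using assms(3)
  by (induction P rule: PR_induct_gen)
    (simp_all add: assms(4,5) ring_hom_mult[OF assms(1)] ring_hom_mult[OF assms(2)]
      ring_hom_add[OF assms(1)] ring_hom_add[OF assms(2)] var_closed)

end

section \<open>Change of coefficients\<close>

lemma coefficient_map_hom:
  assumes hom: "ring_hom_cring R k \<phi>"
  shows "ring_hom_cring (indexed_poly_ring R V) (indexed_poly_ring k V) (\<lambda>P. \<phi> \<circ> P)"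
proof -
  interpret R: cring R by (rule ring_hom_cring.axioms(1)[OF hom])
  interpret k: cring k by (rule ring_hom_cring.axioms(2)[OF hom])
  interpret hom: ring_hom_cring R k \<phi> by (rule hom)
  show ?thesis
  proof (rule ring_hom_cringI[OF R.PR_cring k.PR_cring ring_hom_memI])
    fix P assume P: "P \<in> carrier (R.PR V)"
    have "{u. (\<phi> \<circ> P) u \<noteq> \<zero>\<^bsub>k\<^esub>} \<subseteq> {u. P u \<noteq> \<zero>\<^bsub>R\<^esub>}" by auto
    moreover have "finite {u. P u \<noteq> \<zero>\<^bsub>R\<^esub>}" using P by (simp add: R.PR_simps R.poly_set_def)
    ultimately have "finite {u. (\<phi> \<circ> P) u \<noteq> \<zero>\<^bsub>k\<^esub>}" by (rule finite_subset)
    moreover have "set_mset u \<subseteq> V" if "(\<phi> \<circ> P) u \<noteq> \<zero>\<^bsub>k\<^esub>" for u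
    proof -
      have "P u \<noteq> \<zero>\<^bsub>R\<^esub>" using that by auto
      then show ?thesis using P by (simp add: R.PR_simps R.poly_set_def)
    qed
    ultimately show "\<phi> \<circ> P \<in> carrier (k.PR V)"
      using R.PR_apply[OF P] by (simp add: k.PR_simps(1) k.poly_set_def)
    fix Q assume Q: "Q \<in> carrier (R.PR V)"
    show "\<phi> \<circ> (P \<oplus>\<^bsub>R.PR V\<^esub> Q) = (\<phi> \<circ> P) \<oplus>\<^bsub>k.PR V\<^esub> (\<phi> \<circ> Q)"
      using R.PR_apply[OF P] R.PR_apply[OF Q] by (auto simp: R.PR_add_apply k.PR_add_apply)
    show "\<phi> \<circ> (P \<otimes>\<^bsub>R.PR V\<^esub> Q) = (\<phi> \<circ> P) \<otimes>\<^bsub>k.PR V\<^esub> (\<phi> \<circ> Q)"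
    proof
      fix u
      have "(\<phi> \<circ> (P \<otimes>\<^bsub>R.PR V\<^esub> Q)) u = finsum k (\<phi> \<circ> (\<lambda>(v, w). P v \<otimes>\<^bsub>R\<^esub> Q w)) {(v, w). v + w = u}"
        using R.PR_apply[OF P] R.PR_apply[OF Q] by (simp add: R.PR_simps(2)) (subst hom.hom_finsum, auto)
      also have "\<dots> = finsum k (\<lambda>(v, w). (\<phi> \<circ> P) v \<otimes>\<^bsub>k\<^esub> (\<phi> \<circ> Q) w) {(v, w). v + w = u}"
        by (rule k.add.finprod_cong') (use R.PR_apply[OF P] R.PR_apply[OF Q] in auto)
      finally show "(\<phi> \<circ> (P \<otimes>\<^bsub>R.PR V\<^esub> Q)) u = ((\<phi> \<circ> P) \<otimes>\<^bsub>k.PR V\<^esub> (\<phi> \<circ> Q)) u"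
        by (simp add: k.PR_simps(2))
    qed
  next
    show "\<phi> \<circ> \<one>\<^bsub>R.PR V\<^esub> = \<one>\<^bsub>k.PR V\<^esub>"
      by (auto simp: R.PR_simps k.PR_simps R.indexed_const_def k.indexed_const_def)
  qed
qed

lemma coefficient_map_surj:
  assumes hom: "ring_hom_cring R k \<phi>" and surj: "\<phi> ` carrier R = carrier k"
    and "Q \<in> carrier (indexed_poly_ring k V)"
  obtains P where "P \<in> carrier (indexed_poly_ring R V)" "\<phi> \<circ> P = Q"
proof -
  interpret R: cring R by (rule ring_hom_cring.axioms(1)[OF hom])
  interpret k: cring k by (rule ring_hom_cring.axioms(2)[OF hom])
  interpret hom: ring_hom_cring R k \<phi> by (rule hom)
  interpret c: ring_hom_cring "R.PR V" "k.PR V" "\<lambda>P. \<phi> \<circ> P" by (rule coefficient_map_hom[OF hom])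
  have "\<exists>P\<in>carrier (R.PR V). \<phi> \<circ> P = Q"
    using assms(3)
  proof (induction Q rule: k.PR_induct)
    case (mon r u)
    then obtain r' where "r' \<in> carrier R" "\<phi> r' = r" using surj by (metis imageE)
    then show ?case using R.mon_closed[of r' u V] mon
      by (intro bexI[of _ "R.mon r' u"]) (auto simp: R.mon_def k.mon_def)
  next
    case (add P Q)
    then show ?case by (metis R.PR_add_closed c.hom_add)
  qed
  then show ?thesis using that by blast
qed

section \<open>Adjoining one variable\<close>

text \<open>\<open>R\<close> is the polynomial ring \<open>C[x]\<close>, and \<open>coef p k\<close> is the coefficient of \<open>x\<^sup>k\<close> in \<open>p\<close>.\<close>

locale simple_ext = cring R for R (structure) +
  fixes C :: "'a set" and x :: 'a and coef :: "'a \<Rightarrow> nat \<Rightarrow> 'a"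
  assumes C: "subring C R" and x: "x \<in> carrier R"
    and coef_C: "p \<in> carrier R \<Longrightarrow> coef p k \<in> C"
    and coef_add: "\<lbrakk>p \<in> carrier R; q \<in> carrier R\<rbrakk> \<Longrightarrow> coef (p \<oplus> q) k = coef p k \<oplus> coef q k"
    and coef_scale: "\<lbrakk>c \<in> C; p \<in> carrier R\<rbrakk> \<Longrightarrow> coef (c \<otimes> p) k = c \<otimes> coef p k"
    and coef_x0: "p \<in> carrier R \<Longrightarrow> coef (x \<otimes> p) 0 = \<zero>"
    and coef_xS: "p \<in> carrier R \<Longrightarrow> coef (x \<otimes> p) (Suc k) = coef p k"
    and coef_const: "c \<in> C \<Longrightarrow> coef c k = (if k = 0 then c else \<zero>)"
    and coef_finite: "p \<in> carrier R \<Longrightarrow> \<exists>n. \<forall>k\<ge>n. coef p k = \<zero>"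
    and coef_ext: "\<lbrakk>p \<in> carrier R; \<forall>k. coef p k = \<zero>\<rbrakk> \<Longrightarrow> p = \<zero>"
begin

lemmas C_sub = subringE(1)[OF C] and C_zero = subringE(2)[OF C] and C_one = subringE(3)[OF C]
  and C_neg = subringE(5)[OF C] and C_mult = subringE(6)[OF C] and C_add = subringE(7)[OF C]

lemma C_carrier: "c \<in> C \<Longrightarrow> c \<in> carrier R"
  using C_sub by blast

lemma coef_carrier: "p \<in> carrier R \<Longrightarrow> coef p k \<in> carrier R"
  using coef_C C_carrier by blast

lemma coef_zero: "coef \<zero> k = \<zero>"
  using coef_const[OF C_zero] by simp

lemma coef_neg: "p \<in> carrier R \<Longrightarrow> coef (\<ominus> p) k = \<ominus> coef p k"
  using coef_scale[OF C_neg[OF C_one], of p k] coef_carrier[of p k] by (simp add: l_minus)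

lemma coef_diff: "\<lbrakk>p \<in> carrier R; q \<in> carrier R\<rbrakk> \<Longrightarrow> coef (p \<ominus> q) k = coef p k \<ominus> coef q k"
  by (simp add: a_minus_def coef_add coef_neg)

section \<open>Degrees and leading coefficients\<close>

lemma coef_x_pow: "p \<in> carrier R \<Longrightarrow> coef (x [^] i \<otimes> p) k = (if k < i then \<zero> else coef p (k - i))"
proof (induction i arbitrary: k)
  case (Suc i)
  have "x [^] Suc i \<otimes> p = x \<otimes> (x [^] i \<otimes> p)"
    using Suc.prems x by (simp add: m_assoc[symmetric] m_comm)
  then show ?case using Suc x by (cases k) (simp_all add: coef_x0 coef_xS)
qed simp

lemma coef_monom: "c \<in> C \<Longrightarrow> coef (c \<otimes> x [^] n) k = (if k = n then c else \<zero>)"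
  using coef_x_pow[of c n k] x C_carrier[of c] coef_const[of c] by (auto simp: m_comm)

lemma coef_monom_mult:
  "\<lbrakk>c \<in> C; p \<in> carrier R\<rbrakk> \<Longrightarrow> coef ((c \<otimes> x [^] n) \<otimes> p) k = (if k < n then \<zero> else c \<otimes> coef p (k - n))"
  using coef_scale[of c "x [^] n \<otimes> p" k] coef_x_pow[of p n k] x C_carrier[of c] by (simp add: m_assoc)

text \<open>A strict bound: \<open>deg_less p 0\<close> singles out zero, so inductions on the
  degree start there and the zero polynomial needs no degree of its own.\<close>

definition deg_less :: "'a \<Rightarrow> nat \<Rightarrow> bool" where
  "deg_less p n \<longleftrightarrow> p \<in> carrier R \<and> (\<forall>k\<ge>n. coef p k = \<zero>)"

lemma deg_less_carrier: "deg_less p n \<Longrightarrow> p \<in> carrier R"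
  by (simp add: deg_less_def)

lemma deg_less_ex: "p \<in> carrier R \<Longrightarrow> \<exists>n. deg_less p n"
  using coef_finite by (auto simp: deg_less_def)

lemma deg_less_mono: "\<lbrakk>deg_less p n; n \<le> m\<rbrakk> \<Longrightarrow> deg_less p m"
  by (simp add: deg_less_def)

lemma deg_less_0: "deg_less p 0 \<Longrightarrow> p = \<zero>"
  using coef_ext by (simp add: deg_less_def)

lemma deg_less_zero: "deg_less \<zero> n"
  by (simp add: deg_less_def coef_zero)

lemma deg_less_add: "\<lbrakk>deg_less p n; deg_less q n\<rbrakk> \<Longrightarrow> deg_less (p \<oplus> q) n"
  by (simp add: deg_less_def coef_add)

lemma deg_less_scale: "\<lbrakk>c \<in> C; deg_less p n\<rbrakk> \<Longrightarrow> deg_less (c \<otimes> p) n"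
  using C_carrier by (auto simp: deg_less_def coef_scale)

lemma deg_less_x_pow: "deg_less p n \<Longrightarrow> deg_less (x [^] i \<otimes> p) (n + i)"
  using x by (auto simp: deg_less_def coef_x_pow)

lemma deg_less_reduce: "deg_less p (Suc n) \<Longrightarrow> deg_less (p \<ominus> coef p n \<otimes> x [^] n) n"
proof -
  assume p: "deg_less p (Suc n)"
  then have c: "p \<in> carrier R" "coef p n \<otimes> x [^] n \<in> carrier R" using x coef_carrier by (auto simp: deg_less_def)
  then have "coef (p \<ominus> coef p n \<otimes> x [^] n) k = \<zero>" if "k \<ge> n" for k
    unfolding coef_diff[OF c] coef_monom[OF coef_C[OF c(1)]]
    using p that coef_carrier[of p n] c(1) by (cases "k = n") (auto simp: deg_less_def a_minus_def r_neg)
  then show ?thesis using c by (simp add: deg_less_def)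
qed

lemma split_top:
  "deg_less p (Suc n) \<Longrightarrow> p = coef p n \<otimes> x [^] n \<oplus> (p \<ominus> coef p n \<otimes> x [^] n)"
proof -
  assume "deg_less p (Suc n)"
  then have "p \<in> carrier R" "coef p n \<otimes> x [^] n \<in> carrier R" using x coef_carrier by (auto simp: deg_less_def)
  then show ?thesis by algebra
qed

lemma deg_less_1: "deg_less p (Suc 0) \<Longrightarrow> p \<in> C"
  using split_top[of p 0] deg_less_0[OF deg_less_reduce, of p] coef_C[of p 0] coef_carrier[of p 0]
  by (simp add: deg_less_def)

lemma ext_induct [consumes 1, case_names zero add]:
  assumes "p \<in> carrier R" "\<Phi> \<zero>"
    and "\<And>c n q. \<lbrakk>c \<in> C; deg_less q n; \<Phi> q\<rbrakk> \<Longrightarrow> \<Phi> (c \<otimes> x [^] n \<oplus> q)"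
  shows "\<Phi> p"
proof -
  have "deg_less p n \<Longrightarrow> \<Phi> p" for n
  proof (induction n arbitrary: p)
    case 0 then show ?case using deg_less_0 assms(2) by blast
  next
    case (Suc n)
    then show ?case
      using split_top[OF Suc.prems] assms(3)[OF _ deg_less_reduce[OF Suc.prems]]
        Suc.IH[OF deg_less_reduce[OF Suc.prems]] coef_C deg_less_carrier by metis
  qed
  then show ?thesis using deg_less_ex assms(1) by blast
qed

text \<open>These are the ideals extended from \<open>C\<close>. For them R/Y is a polynomial ring
  over C/(Y \<inter> C), so arguments with leading coefficients work modulo
  \<open>Y\<close>.\<close>

definition stable :: "'a set \<Rightarrow> bool" where
  "stable Y \<longleftrightarrow> ideal Y R \<and> (\<forall>p\<in>Y. \<forall>k. coef p k \<in> Y)"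

lemma stable_ideal: "stable Y \<Longrightarrow> ideal Y R"
  by (simp add: stable_def)

lemma stable_coef: "\<lbrakk>stable Y; p \<in> Y\<rbrakk> \<Longrightarrow> coef p k \<in> Y"
  by (simp add: stable_def)

text \<open>The elements all of whose coefficients lie in \<open>Idl Z\<close> form an ideal, and it
  contains \<open>Z\<close>.\<close>

lemma genideal_stable:
  assumes "Z \<subseteq> C"
  shows "stable (Idl Z)"
proof -
  have Zc: "Z \<subseteq> carrier R" using assms C_sub by blast
  note Y = genideal_ideal[OF Zc]
  have "ideal {p \<in> carrier R. \<forall>k. coef p k \<in> Idl Z} R"
  proof (rule ideal_intro)
    fix p r assume p: "p \<in> {p \<in> carrier R. \<forall>k. coef p k \<in> Idl Z}" and r: "r \<in> carrier R"
    from r have "\<forall>k. coef (r \<otimes> p) k \<in> Idl Z"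
    proof (induction r rule: ext_induct)
      case zero then show ?case using p ideal_zero[OF Y] by (simp add: coef_zero)
    next
      case (add c n q)
      have cc: "c \<otimes> x [^] n \<in> carrier R" "q \<in> carrier R" using add C_carrier x deg_less_carrier by auto
      then have "(c \<otimes> x [^] n \<oplus> q) \<otimes> p = (c \<otimes> x [^] n) \<otimes> p \<oplus> q \<otimes> p" using p by (simp add: l_distr)
      moreover have "coef ((c \<otimes> x [^] n) \<otimes> p) k \<in> Idl Z" for k
        using p add(1) ideal_mult[OF Y] ideal_zero[OF Y] C_carrier by (auto simp: coef_monom_mult)
      ultimately show ?case using add.IH p cc ideal_add[OF Y] by (simp add: coef_add)
    qed
    then show "r \<otimes> p \<in> {p \<in> carrier R. \<forall>k. coef p k \<in> Idl Z}" using p r by simp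
  qed (use ideal_zero[OF Y] ideal_add[OF Y] in \<open>auto simp: coef_zero coef_add\<close>)
  moreover have "Z \<subseteq> {p \<in> carrier R. \<forall>k. coef p k \<in> Idl Z}"
    using subsetD[OF assms] subsetD[OF Zc] subsetD[OF genideal_self[OF Zc]] ideal_zero[OF Y] by (auto simp: coef_const)
  ultimately have "Idl Z \<subseteq> {p \<in> carrier R. \<forall>k. coef p k \<in> Idl Z}" by (rule genideal_minimal)
  then show ?thesis using Y by (auto simp: stable_def)
qed

lemma deg_less_mult: "\<lbrakk>deg_less p n; deg_less q (Suc m)\<rbrakk> \<Longrightarrow> deg_less (p \<otimes> q) (n + m)"
proof (induction n arbitrary: p)
  case 0
  then show ?case using deg_less_0[OF 0(1)] deg_less_carrier[OF 0(2)] deg_less_zero by simp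
next
  case (Suc n)
  let ?t = "coef p n \<otimes> x [^] n" and ?r = "p \<ominus> coef p n \<otimes> x [^] n"
  have c: "p \<in> carrier R" "?t \<in> carrier R" "q \<in> carrier R" "?r \<in> carrier R" "coef p n \<in> carrier R"
    using Suc.prems x coef_carrier deg_less_carrier by auto
  have "p \<otimes> q = ?t \<otimes> q \<oplus> ?r \<otimes> q"
    using split_top[OF Suc.prems(1)] c by (metis l_distr)
  moreover have "deg_less (?t \<otimes> q) (Suc n + m)"
    using deg_less_scale[OF coef_C[OF c(1)] deg_less_x_pow[OF Suc.prems(2), of n]] c x by (simp add: m_assoc add.commute)
  moreover have "deg_less (?r \<otimes> q) (Suc n + m)"
    using Suc.IH[OF deg_less_reduce[OF Suc.prems(1)] Suc.prems(2)] deg_less_mono by fastforce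
  ultimately show ?case using deg_less_add by simp
qed

lemma coef_mult_top:
  assumes "deg_less p (Suc n)" "deg_less q (Suc m)"
  shows "coef (p \<otimes> q) (n + m) = coef p n \<otimes> coef q m"
proof -
  let ?t = "coef p n \<otimes> x [^] n" and ?r = "p \<ominus> coef p n \<otimes> x [^] n"
  have c: "p \<in> carrier R" "?t \<in> carrier R" "q \<in> carrier R" "?r \<in> carrier R"
    using assms x coef_carrier deg_less_carrier by auto
  have "p \<otimes> q = ?t \<otimes> q \<oplus> ?r \<otimes> q"
    using split_top[OF assms(1)] c by (metis l_distr)
  moreover have "coef (?r \<otimes> q) (n + m) = \<zero>"
    using deg_less_mult[OF deg_less_reduce[OF assms(1)] assms(2)] by (simp add: deg_less_def)
  ultimately show ?thesis
    using c coef_carrier by (simp add: coef_add coef_monom_mult coef_C)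
qed

text \<open>Top terms with coefficient in \<open>Y\<close> are dropped until a coefficient outside
  \<open>Y\<close> is reached; it serves as a leading coefficient modulo \<open>Y\<close>.\<close>

lemma lead_mod_ideal:
  assumes "ideal Y R" "p \<in> carrier R" "p \<notin> Y"
  obtains q n where "deg_less q (Suc n)" "p \<ominus> q \<in> Y" "coef q n \<notin> Y"
proof -
  have "deg_less p n \<Longrightarrow> p \<notin> Y \<Longrightarrow> \<exists>q n. deg_less q (Suc n) \<and> p \<ominus> q \<in> Y \<and> coef q n \<notin> Y" for n
  proof (induction n arbitrary: p)
    case 0 then show ?case using deg_less_0 ideal_zero[OF assms(1)] by blast
  next
    case (Suc n)
    let ?t = "coef p n \<otimes> x [^] n"
    have c: "p \<in> carrier R" "?t \<in> carrier R" using Suc.prems x coef_carrier deg_less_carrier by auto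
    show ?case
    proof (cases "coef p n \<in> Y")
      case True
      then have t: "?t \<in> Y" using x ideal_mult_right[OF assms(1)] by auto
      then have "p \<ominus> ?t \<notin> Y" using ideal_diff_cancel[OF assms(1)] Suc.prems c by blast
      then obtain q m where q: "deg_less q (Suc m)" "(p \<ominus> ?t) \<ominus> q \<in> Y" "coef q m \<notin> Y"
        using Suc.IH[OF deg_less_reduce[OF Suc.prems(1)]] by blast
      have "p \<ominus> q = ((p \<ominus> ?t) \<ominus> q) \<oplus> ?t" using c deg_less_carrier[OF q(1)] by algebra
      then show ?thesis using q t ideal_add[OF assms(1)] by metis
    next
      case False
      then show ?thesis using Suc.prems c ideal_zero[OF assms(1)] by (auto simp: a_minus_def r_neg intro!: exI[of _ p])
    qed
  qed
  then show ?thesis using deg_less_ex assms that by blast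
qed

text \<open>Leading coefficients modulo \<open>Y\<close> multiply to the top coefficient of the
  product, so primality is assumed only for elements of \<open>C\<close>. For the zero ideal this
  makes polynomial rings domains; for a principal ideal it keeps primes of \<open>C\<close>
  prime.\<close>

lemma stable_prime:
  assumes Y: "stable Y" and prime: "\<And>a b. \<lbrakk>a \<in> C; b \<in> C; a \<otimes> b \<in> Y\<rbrakk> \<Longrightarrow> a \<in> Y \<or> b \<in> Y"
    and ab: "a \<in> carrier R" "b \<in> carrier R" "a \<otimes> b \<in> Y"
  shows "a \<in> Y \<or> b \<in> Y"
proof (rule ccontr)
  note id = stable_ideal[OF Y]
  assume "\<not> ?thesis"
  then have no: "a \<notin> Y" "b \<notin> Y" by auto
  obtain a' n where a': "deg_less a' (Suc n)" "a \<ominus> a' \<in> Y" "coef a' n \<notin> Y"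
    using lead_mod_ideal[OF id ab(1) no(1)] .
  obtain b' m where b': "deg_less b' (Suc m)" "b \<ominus> b' \<in> Y" "coef b' m \<notin> Y"
    using lead_mod_ideal[OF id ab(2) no(2)] .
  note c = deg_less_carrier[OF a'(1)] deg_less_carrier[OF b'(1)]
  have "a' \<otimes> b' = a \<otimes> b \<ominus> (b \<otimes> (a \<ominus> a') \<oplus> a' \<otimes> (b \<ominus> b'))" using c ab by algebra
  then have "a' \<otimes> b' \<in> Y" using ab a'(2) b'(2) c ideal_diff[OF id] ideal_add[OF id] ideal_mult[OF id] by metis
  then have "coef a' n \<otimes> coef b' m \<in> Y" using stable_coef[OF Y] coef_mult_top[OF a'(1) b'(1)] by metis
  then show False using prime coef_C c a'(3) b'(3) by blast
qed

subsection \<open>The basis theorem\<close>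

abbreviation "S \<equiv> R\<lparr>carrier := C\<rparr>"

lemma S_cring: "cring S"
  using subcring.axioms subcring_iff[OF C_sub] C m_comm C_sub by (meson is_cring subcringI' subsetD)

text \<open>Hilbert's ideals of leading coefficients, one for each degree; elements of smaller
  degree contribute only zero.\<close>

definition leads :: "'a set \<Rightarrow> nat \<Rightarrow> 'a set" where
  "leads B n = {coef p n | p. p \<in> B \<and> deg_less p (Suc n)}"

lemma mem_leads: "\<lbrakk>p \<in> B; deg_less p (Suc n); coef p n = c\<rbrakk> \<Longrightarrow> c \<in> leads B n"
  by (auto simp: leads_def)

lemma leads_ideal:
  assumes "ideal B R"
  shows "ideal (leads B n) S"
proof (rule cring.ideal_intro[OF S_cring])
  show "leads B n \<subseteq> carrier S" using coef_C deg_less_carrier by (auto simp: leads_def)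
  show "\<zero>\<^bsub>S\<^esub> \<in> leads B n"
    using mem_leads[OF ideal_zero[OF assms] deg_less_zero coef_zero] by simp
  show "a \<oplus>\<^bsub>S\<^esub> b \<in> leads B n" if ab: "a \<in> leads B n" "b \<in> leads B n" for a b
  proof -
    obtain p q where pq: "p \<in> B" "q \<in> B" "deg_less p (Suc n)" "deg_less q (Suc n)" "a = coef p n" "b = coef q n"
      using ab unfolding leads_def by blast
    have "a \<oplus> b \<in> leads B n"
      by (rule mem_leads[of "p \<oplus> q"])
        (simp_all add: pq ideal_add[OF assms] deg_less_add coef_add deg_less_carrier[OF pq(3)] deg_less_carrier[OF pq(4)])
    then show ?thesis by simp
  qed
  show "c \<otimes>\<^bsub>S\<^esub> a \<in> leads B n" if ac: "a \<in> leads B n" "c \<in> carrier S" for a c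
  proof -
    obtain p where p: "p \<in> B" "deg_less p (Suc n)" "a = coef p n"
      using ac(1) unfolding leads_def by blast
    have c: "c \<in> C" using ac(2) by simp
    have "c \<otimes> a \<in> leads B n"
      by (rule mem_leads[of "c \<otimes> p"])
        (simp_all add: p c C_carrier ideal_mult[OF assms] deg_less_scale coef_scale deg_less_carrier[OF p(2)])
    then show ?thesis by simp
  qed
qed

lemma leads_mono: "ideal B R \<Longrightarrow> n \<le> m \<Longrightarrow> leads B n \<subseteq> leads B m"
proof
  fix c assume B: "ideal B R" and nm: "n \<le> m" and "c \<in> leads B n"
  then obtain p where p: "p \<in> B" "deg_less p (Suc n)" "c = coef p n" by (auto simp: leads_def)
  have "x [^] (m - n) \<otimes> p \<in> B" using ideal_mult[OF B p(1)] x by simp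
  moreover have "deg_less (x [^] (m - n) \<otimes> p) (Suc m)" using deg_less_x_pow[OF p(2), of "m - n"] nm by simp
  moreover have "\<not> m < m - n" by arith
  then have "coef (x [^] (m - n) \<otimes> p) m = c" using coef_x_pow[of p "m - n" m] p deg_less_carrier nm by simp
  ultimately show "c \<in> leads B m" unfolding leads_def by blast
qed

text \<open>Subtracting an element of \<open>A\<close> with the same leading coefficient lowers the
  degree and stays in \<open>B\<close>.\<close>

lemma subset_by_leads:
  assumes "ideal A R" "ideal B R" "A \<subseteq> B" "\<And>n. leads B n \<subseteq> leads A n"
  shows "B \<subseteq> A"
proof
  fix p assume p: "p \<in> B"
  have "deg_less p n \<Longrightarrow> p \<in> B \<Longrightarrow> p \<in> A" for n
  proof (induction n arbitrary: p)
    case 0 then show ?case using deg_less_0 ideal_zero[OF assms(1)] by blast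
  next
    case (Suc n)
    have "coef p n \<in> leads A n" using Suc.prems assms(4) by (auto simp: leads_def)
    then obtain q where q: "q \<in> A" "deg_less q (Suc n)" "coef q n = coef p n" by (auto simp: leads_def)
    note c = deg_less_carrier[OF q(2)] deg_less_carrier[OF Suc.prems(1)]
    have "coef (p \<ominus> q) k = \<zero>" if "k \<ge> n" for k
      unfolding coef_diff[OF c(2,1)]
      using that q(2,3) Suc.prems(1) coef_carrier[OF c(2), of n]
      by (cases "k = n") (auto simp: deg_less_def a_minus_def r_neg)
    then have "deg_less (p \<ominus> q) n" using c by (simp add: deg_less_def)
    then have "p \<ominus> q \<in> A" using Suc.IH Suc.prems(2) q(1) assms(2,3) ideal_diff by (metis subsetD)
    then show ?case using ideal_diff_cancel[OF assms(1) _ q(1)] c by blast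
  qed
  then show "p \<in> A" using p deg_less_ex ideal_carrier[OF assms(2)] by blast
qed

text \<open>Hilbert's argument. The leading coefficients of all degrees generate an ideal with
  finitely many generators, all of which occur in degree \<open>N\<close>; from there on these
  account for every \<open>leads B n\<close>, and the finitely many ideals below \<open>N\<close>
  are treated one by one.\<close>

lemma noetherian_ext:
  assumes noeth: "noetherian_ring S"
  shows "noetherian_ring R"
proof (rule noetherian_ringI)
  fix B assume B: "ideal B R"
  interpret S: cring S by (rule S_cring)
  have fin: "\<exists>T. finite T \<and> T \<subseteq> L \<and> Idl\<^bsub>S\<^esub> T = Idl\<^bsub>S\<^esub> L" if "L \<subseteq> C" for L
  proof -
    have "L \<subseteq> carrier S" using that by simp
    then show ?thesis using S.noetherian_finite_subset[OF noeth] by metis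
  qed
  define L where "L = (\<Union>n. leads B n)"
  have LC: "leads B n \<subseteq> C" for n using coef_C deg_less_carrier by (auto simp: leads_def)
  then have "L \<subseteq> C" by (auto simp: L_def)
  then obtain T where T: "finite T" "T \<subseteq> L" "Idl\<^bsub>S\<^esub> T = Idl\<^bsub>S\<^esub> L" using fin by metis
  have "\<forall>t\<in>T. \<exists>n. t \<in> leads B n" using T L_def by auto
  then obtain d where d: "\<And>t. t \<in> T \<Longrightarrow> t \<in> leads B (d t)" by metis
  \<comment> \<open>\<open>insert 0\<close> covers the case of an empty set
    \<open>T\<close>.\<close>
  define N where "N = Max (insert 0 (d ` T))"
  have "t \<in> leads B N" if "t \<in> T" for t
    using d[OF that] leads_mono[OF B, of "d t" N] T(1) that by (auto simp: N_def)
  then have TN: "T \<subseteq> leads B N" by (rule subsetI)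
  have "\<exists>T. finite T \<and> T \<subseteq> leads B n \<and> leads B n \<subseteq> Idl\<^bsub>S\<^esub> T" for n
  proof -
    have "leads B n \<subseteq> Idl\<^bsub>S\<^esub> leads B n" using S.genideal_self[of "leads B n"] LC[of n] by simp
    then show ?thesis using fin[OF LC[of n]] by metis
  qed
  then obtain T' where T': "\<And>n. finite (T' n)" "\<And>n. T' n \<subseteq> leads B n" "\<And>n. leads B n \<subseteq> Idl\<^bsub>S\<^esub> (T' n)" by metis
  have "\<forall>n. \<forall>t\<in>leads B n. \<exists>p. p \<in> B \<and> deg_less p (Suc n) \<and> coef p n = t"
    unfolding leads_def by blast
  then obtain w where w: "\<And>n t. t \<in> leads B n \<Longrightarrow> w n t \<in> B \<and> deg_less (w n t) (Suc n) \<and> coef (w n t) n = t" by metis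
  define W where "W = w N ` T \<union> (\<Union>n<N. w n ` T' n)"
  have WB: "W \<subseteq> B" using w subsetD[OF TN] subsetD[OF T'(2)] by (auto simp: W_def)
  then have Wc: "W \<subseteq> carrier R" using ideal_sub[OF B] by blast
  note WI = genideal_ideal[OF Wc] and Wself = genideal_self[OF Wc]
  have leadW: "Idl\<^bsub>S\<^esub> U \<subseteq> leads (Idl W) n" if "U \<subseteq> leads B n" "w n ` U \<subseteq> W" for U n
  proof (rule S.genideal_minimal[OF leads_ideal[OF WI]])
    show "U \<subseteq> leads (Idl W) n"
    proof
      fix t assume "t \<in> U"
      then have "w n t \<in> Idl W" "deg_less (w n t) (Suc n)" "coef (w n t) n = t" using that w Wself by auto
      then show "t \<in> leads (Idl W) n" by (rule mem_leads)
    qed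
  qed
  have "leads B n \<subseteq> leads (Idl W) n" for n
  proof (cases "n < N")
    case True
    then show ?thesis using T'(3) leadW[of "T' n" n] T'(2) by (auto simp: W_def)
  next
    case False
    have "leads B n \<subseteq> L" by (auto simp: L_def)
    also have "\<dots> \<subseteq> Idl\<^bsub>S\<^esub> T" using S.genideal_self[of L] \<open>L \<subseteq> C\<close> T(3) by simp
    also have "\<dots> \<subseteq> leads (Idl W) N" using leadW[OF TN] by (auto simp: W_def)
    also have "\<dots> \<subseteq> leads (Idl W) n" using leads_mono[OF WI] False by simp
    finally show ?thesis .
  qed
  moreover have "Idl W \<subseteq> B" using genideal_minimal[OF B WB] .
  ultimately have "B \<subseteq> Idl W" using subset_by_leads[OF WI B] by blast
  then have "B = Idl W" using \<open>Idl W \<subseteq> B\<close> by blast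
  moreover have "finite W" using T(1) T'(1) by (auto simp: W_def)
  ultimately show "\<exists>A\<subseteq>carrier R. finite A \<and> B = Idl A" using Wc by blast
qed

end

section \<open>Unique factorization\<close>

definition prime_elt :: "('a, 'b) ring_scheme \<Rightarrow> 'a \<Rightarrow> bool" where
  "prime_elt R p \<longleftrightarrow> p \<in> carrier R \<and> p \<noteq> \<zero>\<^bsub>R\<^esub> \<and> primeideal (PIdl\<^bsub>R\<^esub> p) R"

text \<open>Factors are prime rather than irreducible, so that cancellation follows directly from
  primality. The length of the list drives the inductions, and its members are the primes to be
  avoided in \<open>factorial_ideal\<close>.\<close>

inductive prime_fact :: "('a, 'b) ring_scheme \<Rightarrow> 'a \<Rightarrow> 'a list \<Rightarrow> bool" for R where
  unit: "u \<in> Units R \<Longrightarrow> prime_fact R u []"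
| step: "\<lbrakk>prime_fact R a ps; prime_elt R p\<rbrakk> \<Longrightarrow> prime_fact R (p \<otimes>\<^bsub>R\<^esub> a) (p # ps)"

definition factorial :: "('a, 'b) ring_scheme \<Rightarrow> bool" where
  "factorial R \<longleftrightarrow> (\<forall>a\<in>carrier R. a \<noteq> \<zero>\<^bsub>R\<^esub> \<longrightarrow> (\<exists>ps. prime_fact R a ps))"

context domain
begin

lemma prime_elt_closed: "prime_elt R p \<Longrightarrow> p \<in> carrier R"
  and prime_elt_nonzero: "prime_elt R p \<Longrightarrow> p \<noteq> \<zero>"
  by (simp_all add: prime_elt_def)

lemma prime_elt_mult:
  "\<lbrakk>prime_elt R p; a \<in> carrier R; b \<in> carrier R; a \<otimes> b \<in> PIdl p\<rbrakk> \<Longrightarrow> a \<in> PIdl p \<or> b \<in> PIdl p"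
  using primeideal.I_prime[of "PIdl p" R a b] by (auto simp: prime_elt_def)

lemma mem_PIdl: "a \<in> PIdl p \<longleftrightarrow> (\<exists>h\<in>carrier R. a = h \<otimes> p)"
  by (auto simp: cgenideal_def)

lemma PIdlE:
  assumes "a \<in> PIdl p" "p \<in> carrier R"
  obtains h where "h \<in> carrier R" "a = p \<otimes> h"
  using assms m_comm by (auto simp: mem_PIdl)

lemma mult_mem_PIdl: "\<lbrakk>p \<in> carrier R; h \<in> carrier R\<rbrakk> \<Longrightarrow> p \<otimes> h \<in> PIdl p"
  using m_comm by (auto simp: mem_PIdl)

lemma prime_elt_not_unit: "\<lbrakk>prime_elt R p; u \<in> Units R\<rbrakk> \<Longrightarrow> u \<notin> PIdl p"
proof
  assume p: "prime_elt R p" and u: "u \<in> Units R" "u \<in> PIdl p"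
  have id: "ideal (PIdl p) R" using p primeideal.axioms(1) by (auto simp: prime_elt_def)
  have "\<one> \<in> PIdl p"
    using ideal_mult[OF id u(2) Units_inv_closed[OF u(1)]] Units_l_inv[OF u(1)] by simp
  then have "PIdl p = carrier R" using ideal.one_imp_carrier[OF id] u by simp
  then show False using p primeideal.I_notcarr by (fastforce simp: prime_elt_def)
qed

lemma prime_fact_closed: "prime_fact R a ps \<Longrightarrow> a \<in> carrier R \<and> a \<noteq> \<zero>"
proof (induction rule: prime_fact.induct)
  case (unit u)
  then show ?case using Units_inv_closed Units_l_inv by (metis Units_closed l_null r_null one_not_zero Units_r_inv)
next
  case (step a ps p)
  then show ?case using integral prime_elt_closed prime_elt_nonzero by (metis m_closed)
qed

lemma prime_fact_unit_mult: "\<lbrakk>prime_fact R a ps; u \<in> Units R\<rbrakk> \<Longrightarrow> prime_fact R (u \<otimes> a) ps"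
proof (induction rule: prime_fact.induct)
  case (unit v)
  then show ?case by (intro prime_fact.unit Units_m_closed)
next
  case (step a ps p)
  have "u \<otimes> (p \<otimes> a) = p \<otimes> (u \<otimes> a)"
    using prime_fact_closed[OF step.hyps(1)] prime_elt_closed[OF step.hyps(2)] Units_closed[OF step.prems]
    by (intro m_lcomm) auto
  then show ?case using step prime_fact.step by metis
qed

lemma prime_fact_mult: "\<lbrakk>prime_fact R a ps; prime_fact R b qs\<rbrakk> \<Longrightarrow> prime_fact R (a \<otimes> b) (ps @ qs)"
proof (induction rule: prime_fact.induct)
  case (unit u)
  then show ?case using prime_fact_unit_mult by simp
next
  case (step a ps p)
  have "(p \<otimes> a) \<otimes> b = p \<otimes> (a \<otimes> b)"
    using prime_fact_closed[OF step.hyps(1)] prime_fact_closed[OF step.prems] prime_elt_closed[OF step.hyps(2)]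
    by (intro m_assoc) auto
  then show ?case using step prime_fact.step[of R "a \<otimes> b" "ps @ qs" p] by simp
qed

text \<open>A prime q dividing pa divides a or p. In the second case p = qw; primality of p makes w
  a unit, and b is a unit multiple of a.\<close>

lemma prime_fact_divide:
  "\<lbrakk>prime_fact R a ps; prime_elt R q; a = q \<otimes> b; b \<in> carrier R\<rbrakk> \<Longrightarrow>
    \<exists>qs. prime_fact R b qs \<and> length ps = Suc (length qs)"
proof (induction arbitrary: b rule: prime_fact.induct)
  case (unit u)
  then show ?case using prime_elt_not_unit mult_mem_PIdl prime_elt_closed by metis
next
  case (step a ps p)
  have c: "a \<in> carrier R" "p \<in> carrier R" "q \<in> carrier R" "p \<noteq> \<zero>" "q \<noteq> \<zero>"
    using step prime_fact_closed prime_elt_closed prime_elt_nonzero by auto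
  have "p \<otimes> a \<in> PIdl q" using step mult_mem_PIdl c by simp
  then consider "a \<in> PIdl q" | "p \<in> PIdl q" using prime_elt_mult[OF step.prems(1)] c by blast
  then show ?case
  proof cases
    case 1
    then obtain a' where a': "a' \<in> carrier R" "a = q \<otimes> a'" using PIdlE c by blast
    then obtain qs where qs: "prime_fact R a' qs" "length ps = Suc (length qs)"
      using step.IH[OF step.prems(1)] by blast
    have "q \<otimes> b = q \<otimes> (p \<otimes> a')" using step.prems(2) a' c m_lcomm by metis
    then have "b = p \<otimes> a'" using m_lcancel[OF c(5,3)] step.prems(3) a' c by auto
    then show ?thesis using prime_fact.step[OF qs(1) step.hyps(2)] qs(2) by auto
  next
    case 2
    then obtain w where w: "w \<in> carrier R" "p = q \<otimes> w" using PIdlE c by blast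
    have "q \<otimes> w \<in> PIdl p" using w cgenideal_self c by metis
    then consider "q \<in> PIdl p" | "w \<in> PIdl p" using prime_elt_mult[OF step.hyps(2)] c w by blast
    then have "w \<in> Units R"
    proof cases
      case 1
      then obtain v where v: "v \<in> carrier R" "q = p \<otimes> v" using PIdlE c by blast
      have "p \<otimes> (v \<otimes> w) = (p \<otimes> v) \<otimes> w" using v(1) w(1) c(2) by (intro m_assoc[symmetric])
      also have "\<dots> = p" unfolding v(2)[symmetric] w(2)[symmetric] ..
      finally have "p \<otimes> \<one> = p \<otimes> (v \<otimes> w)" using c(2) by (simp only: r_one)
      then have "\<one> = v \<otimes> w" using m_lcancel[OF c(4,2) one_closed, of "v \<otimes> w"] v(1) w(1) by blast
      then show ?thesis using v w m_comm by (metis Units_one_closed unit_factor)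
    next
      \<comment> \<open>Here w = pv, which would give 1 = qv; but a prime element is not a
        unit.\<close>
      case 2
      then obtain v where v: "v \<in> carrier R" "w = p \<otimes> v" using PIdlE c by blast
      have "p \<otimes> (q \<otimes> v) = q \<otimes> (p \<otimes> v)" using v(1) c by (intro m_lcomm)
      also have "\<dots> = p" unfolding v(2)[symmetric] w(2)[symmetric] ..
      finally have "p \<otimes> \<one> = p \<otimes> (q \<otimes> v)" using c(2) by (simp only: r_one)
      then have "\<one> = q \<otimes> v" using m_lcancel[OF c(4,2) one_closed, of "q \<otimes> v"] v(1) c by blast
      then have "\<one> \<in> PIdl q" using mult_mem_PIdl c v by metis
      then show ?thesis using prime_elt_not_unit[OF step.prems(1)] by auto
    qed
    have "q \<otimes> b = q \<otimes> (w \<otimes> a)" using step.prems(2) w c m_assoc by metis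
    then have "b = w \<otimes> a" using m_lcancel[OF c(5,3)] step.prems(3) w c by auto
    then show ?thesis using prime_fact_unit_mult[OF step.hyps(1) \<open>w \<in> Units R\<close>] by auto
  qed
qed

text \<open>Regularity of h modulo a: the prime factors of a, none of which divides h, are cancelled
  one after the other.\<close>

lemma prime_fact_nzd:
  "\<lbrakk>prime_fact R a ps; \<forall>p\<in>set ps. h \<notin> PIdl p; h \<in> carrier R; g \<in> carrier R; h \<otimes> g \<in> PIdl a\<rbrakk> \<Longrightarrow> g \<in> PIdl a"
proof (induction arbitrary: g rule: prime_fact.induct)
  case (unit u)
  have "g = (u \<otimes> inv u) \<otimes> g" using unit by simp
  also have "\<dots> = u \<otimes> (inv u \<otimes> g)" using unit by (intro m_assoc) auto
  finally have "g = u \<otimes> (inv u \<otimes> g)" .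
  then show ?case using unit mult_mem_PIdl by (metis Units_closed Units_inv_closed m_closed)
next
  case (step a ps p)
  have c: "a \<in> carrier R" "p \<in> carrier R" "p \<noteq> \<zero>"
    using step prime_fact_closed prime_elt_closed prime_elt_nonzero by auto
  obtain w where w: "w \<in> carrier R" "h \<otimes> g = (p \<otimes> a) \<otimes> w" using PIdlE[OF step.prems(4)] c by auto
  then have "h \<otimes> g \<in> PIdl p" using mult_mem_PIdl c by (simp add: m_assoc)
  then have "g \<in> PIdl p" using prime_elt_mult[OF step.hyps(2)] step.prems by auto
  then obtain g' where g': "g' \<in> carrier R" "g = p \<otimes> g'" using PIdlE c by blast
  have "p \<otimes> (h \<otimes> g') = p \<otimes> (a \<otimes> w)" using w g' c step.prems(2) by (metis m_assoc m_lcomm)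
  then have "h \<otimes> g' = a \<otimes> w" using m_lcancel[OF c(3,2)] w g' c step.prems(2) by auto
  then have "g' \<in> PIdl a" using step.IH[OF _ step.prems(2) g'(1)] step.prems(1) mult_mem_PIdl c w by auto
  then obtain v where "v \<in> carrier R" "g' = a \<otimes> v" using PIdlE c by blast
  then show ?case using g' c mult_mem_PIdl[of "p \<otimes> a" v] by (simp add: m_assoc)
qed

text \<open>Constructs a gcd of \<open>A\<close>: as long as some prime q divides all of
  \<open>A\<close>, replace \<open>A\<close> by (A : q). The number of prime factors of one fixed
  element of \<open>A\<close> bounds the number of rounds.\<close>

lemma pull_out_primes:
  "\<lbrakk>ideal A R; a \<in> A; prime_fact R a ps\<rbrakk> \<Longrightarrow>
    \<exists>f\<in>carrier R. f \<noteq> \<zero> \<and> A \<subseteq> PIdl f \<and> (\<forall>q. prime_elt R q \<longrightarrow> \<not> {g \<in> carrier R. f \<otimes> g \<in> A} \<subseteq> PIdl q)"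
proof (induction "length ps" arbitrary: A a ps rule: less_induct)
  case less
  note A = less.prems(1)
  show ?case
  proof (cases "\<exists>q. prime_elt R q \<and> A \<subseteq> PIdl q")
    case False
    have "{g \<in> carrier R. \<one> \<otimes> g \<in> A} = A" using ideal_sub[OF A] by auto
    moreover have "A \<subseteq> PIdl \<one>" using ideal_sub[OF A] by (auto simp: mem_PIdl)
    ultimately show ?thesis using False by (intro bexI[of _ \<one>]) auto
  next
    case True
    then obtain q where q: "prime_elt R q" "A \<subseteq> PIdl q" by blast
    have c: "q \<in> carrier R" "q \<noteq> \<zero>" using q prime_elt_closed prime_elt_nonzero by auto
    define B where "B = {g \<in> carrier R. q \<otimes> g \<in> A}"
    have B: "ideal B R"
      unfolding B_def by (rule ideal_intro)
        (use c in \<open>auto simp: r_distr ideal_add[OF A] ideal_zero[OF A] m_lcomm ideal_mult[OF A]\<close>)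
    obtain b where b: "b \<in> carrier R" "a = q \<otimes> b" using PIdlE q less.prems(2) c by blast
    obtain qs where qs: "prime_fact R b qs" "length ps = Suc (length qs)"
      using prime_fact_divide[OF less.prems(3) q(1) b(2,1)] by blast
    have "b \<in> B" using b less.prems(2) by (simp add: B_def)
    then obtain f where f: "f \<in> carrier R" "f \<noteq> \<zero>" "B \<subseteq> PIdl f"
      "\<And>q. prime_elt R q \<Longrightarrow> \<not> {g \<in> carrier R. f \<otimes> g \<in> B} \<subseteq> PIdl q"
      using less.hyps[OF _ B _ qs(1)] qs(2) by auto
    have "A \<subseteq> PIdl (q \<otimes> f)"
    proof
      fix d assume d: "d \<in> A"
      then obtain e where e: "e \<in> carrier R" "d = q \<otimes> e" using PIdlE q c by blast
      then have "e \<in> PIdl f" using d f(3) by (auto simp: B_def)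
      then obtain h where "h \<in> carrier R" "e = f \<otimes> h" using PIdlE f(1) by blast
      then show "d \<in> PIdl (q \<otimes> f)" using e c f(1) mult_mem_PIdl[of "q \<otimes> f" h] by (simp add: m_assoc)
    qed
    moreover have "{g \<in> carrier R. (q \<otimes> f) \<otimes> g \<in> A} = {g \<in> carrier R. f \<otimes> g \<in> B}"
      using c f(1) by (auto simp: B_def m_assoc)
    moreover have "q \<otimes> f \<noteq> \<zero>" using integral c f by blast
    ultimately show ?thesis using f c by (intro bexI[of _ "q \<otimes> f"]) auto
  qed
qed

text \<open>z is a/f. Since (A : f) lies in no ideal generated by a prime element, prime avoidance
  yields a w in it outside all prime factors of z; thus z, w is a regular sequence in (A :
  f).\<close>

lemma factorial_ideal:
  assumes "factorial R" "ideal A R" "a \<in> A" "a \<noteq> \<zero>"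
  obtains f z w where "f \<in> carrier R" "A \<subseteq> PIdl f" "z \<in> carrier R" "w \<in> carrier R" "f \<noteq> \<zero>" "z \<noteq> \<zero>"
    "f \<otimes> z \<in> A" "f \<otimes> w \<in> A" "\<And>g. \<lbrakk>g \<in> carrier R; w \<otimes> g \<in> PIdl z\<rbrakk> \<Longrightarrow> g \<in> PIdl z"
proof -
  obtain ps where "prime_fact R a ps" using assms ideal_carrier by (metis factorial_def)
  then obtain f where f: "f \<in> carrier R" "f \<noteq> \<zero>" "A \<subseteq> PIdl f"
    "\<And>q. prime_elt R q \<Longrightarrow> \<not> {g \<in> carrier R. f \<otimes> g \<in> A} \<subseteq> PIdl q"
    using pull_out_primes[OF assms(2,3)] by blast
  obtain z where z: "z \<in> carrier R" "a = f \<otimes> z" using PIdlE f assms(3) by blast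
  have z0: "z \<noteq> \<zero>" using z assms(4) f by auto
  obtain qs where qs: "prime_fact R z qs" using assms(1) z z0 by (auto simp: factorial_def)
  have qs_prime: "\<forall>q\<in>set qs. prime_elt R q" using qs by (induction rule: prime_fact.induct) auto
  have "ideal {g \<in> carrier R. f \<otimes> g \<in> A} R"
    by (rule ideal_intro)
      (use f in \<open>auto simp: r_distr ideal_add[OF assms(2)] ideal_zero[OF assms(2)] m_lcomm ideal_mult[OF assms(2)]\<close>)
  then obtain w where w: "w \<in> {g \<in> carrier R. f \<otimes> g \<in> A}" "\<And>\<pp>. \<pp> \<in> (\<lambda>q. PIdl q) ` set qs \<Longrightarrow> w \<notin> \<pp>"
    using prime_avoidance[of "(\<lambda>q. PIdl q) ` set qs" "{g \<in> carrier R. f \<otimes> g \<in> A}"] qs_prime f(4)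
    by (metis (no_types, lifting) List.finite_set finite_imageI imageE prime_elt_def)
  show ?thesis
    using that[OF f(1,3) z(1) _ f(2) z0, of w] w z(2) assms(3) prime_fact_nzd[OF qs, of w] by blast
qed

end

locale simple_ext_domain = simple_ext + domain R
begin

section \<open>Gauss's lemma\<close>

lemma S_domain: "domain S"
  using S_cring one_not_zero integral C_sub by (intro domain.intro domain_axioms.intro) auto

sublocale S: domain S by (rule S_domain)

lemma units_S: "u \<in> Units S \<Longrightarrow> u \<in> Units R"
  using C_sub by (auto simp: Units_def)

text \<open>If c = ph with c and p constant, the constant coefficient of h is already a
  cofactor.\<close>

lemma PIdl_S: "\<lbrakk>p \<in> C; c \<in> C; c \<in> PIdl p\<rbrakk> \<Longrightarrow> c \<in> PIdl\<^bsub>S\<^esub> p"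
proof -
  assume p: "p \<in> C" and c: "c \<in> C" "c \<in> PIdl p"
  obtain h where h: "h \<in> carrier R" "c = p \<otimes> h" using c p C_carrier PIdlE by blast
  have "c = coef (p \<otimes> h) 0" using c(1) h(2) coef_const by simp
  also have "\<dots> = coef h 0 \<otimes> p" using coef_scale[OF p h(1)] coef_carrier[OF h(1)] C_carrier[OF p] m_comm by simp
  finally show "c \<in> PIdl\<^bsub>S\<^esub> p" using coef_C[OF h(1)] by (auto simp: cgenideal_def)
qed

lemma PIdl_S_sub: "PIdl\<^bsub>S\<^esub> p \<subseteq> PIdl p"
  using C_sub by (auto simp: cgenideal_def)

text \<open>The ideal generated by p is extended from \<open>C\<close>, so
  \<open>stable_prime\<close> applies; \<open>PIdl_S\<close> shows that it stays proper.\<close>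

lemma prime_elt_S: "prime_elt S p \<Longrightarrow> prime_elt R p"
proof -
  assume "prime_elt S p"
  then have p: "p \<in> C" "p \<noteq> \<zero>" and prime: "primeideal (PIdl\<^bsub>S\<^esub> p) S" by (auto simp: prime_elt_def)
  have pc: "p \<in> carrier R" using p C_carrier by blast
  have st: "stable (PIdl p)" using genideal_stable[of "{p}"] p cgenideal_eq_genideal[OF pc] by simp
  have "primeideal (PIdl p) R"
  proof (rule primeidealI[OF stable_ideal[OF st] is_cring])
    have "\<one> \<notin> PIdl p"
    proof
      assume "\<one> \<in> PIdl p"
      then have "\<one> \<in> PIdl\<^bsub>S\<^esub> p" using PIdl_S[OF p(1) C_one] by blast
      then show False using primeideal.I_notcarr[OF prime] ideal.one_imp_carrier[OF primeideal.axioms(1)[OF prime]] by simp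
    qed
    then show "carrier R \<noteq> PIdl p" by blast
    fix a b assume ab: "a \<in> carrier R" "b \<in> carrier R" "a \<otimes> b \<in> PIdl p"
    have "a \<in> PIdl p \<or> b \<in> PIdl p" if "a \<in> C" "b \<in> C" "a \<otimes> b \<in> PIdl p" for a b
      using primeideal.I_prime[OF prime, of a b] PIdl_S[OF p(1) C_mult[OF that(1,2)] that(3)] that(1,2) PIdl_S_sub by auto
    then show "a \<in> PIdl p \<or> b \<in> PIdl p" using stable_prime[OF st _ ab] by blast
  qed
  then show ?thesis using p pc by (simp add: prime_elt_def)
qed

lemma prime_fact_S: "prime_fact S a ps \<Longrightarrow> prime_fact R a ps"
  by (induction rule: prime_fact.induct) (auto intro: prime_fact.intros units_S prime_elt_S)

text \<open>Content one, expressed without gcds.\<close>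

definition primitive :: "'a \<Rightarrow> bool" where
  "primitive r \<longleftrightarrow> r \<in> carrier R \<and> r \<noteq> \<zero> \<and> (\<forall>p. prime_elt S p \<longrightarrow> r \<notin> PIdl p)"

text \<open>Gauss's lemma as a cancellation rule: in cq = rh a prime factor p of c does not divide
  the primitive r, so it divides h and can be removed on both sides.\<close>

lemma primitive_cancel:
  assumes r: "primitive r"
  shows "\<lbrakk>prime_fact S c ps; q \<in> carrier R; c \<otimes> q \<in> PIdl r\<rbrakk> \<Longrightarrow> q \<in> PIdl r"
proof (induction arbitrary: q rule: prime_fact.induct)
  case (unit u)
  have rc: "r \<in> carrier R" using r by (simp add: primitive_def)
  have u: "u \<in> Units R" using unit units_S by blast
  have "inv u \<otimes> (u \<otimes> q) \<in> PIdl r" using ideal_mult[OF cgenideal_ideal[OF rc] unit(3)] u by simp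
  moreover have "inv u \<otimes> (u \<otimes> q) = (inv u \<otimes> u) \<otimes> q" using u unit by (intro m_assoc[symmetric]) auto
  ultimately show ?case using u unit by simp
next
  case (step a ps p)
  have rc: "r \<in> carrier R" using r by (simp add: primitive_def)
  have p: "prime_elt R p" "p \<in> carrier R" "p \<noteq> \<zero>"
    using step.hyps(2) prime_elt_S prime_elt_closed prime_elt_nonzero by auto
  have a: "a \<in> carrier R" using S.prime_fact_closed[OF step.hyps(1)] C_carrier by simp
  obtain h where h: "h \<in> carrier R" "p \<otimes> a \<otimes> q = r \<otimes> h" using step.prems rc PIdlE by auto
  have "r \<otimes> h \<in> PIdl p" using h(2) mult_mem_PIdl[of p "a \<otimes> q"] p a step.prems(1) by (simp add: m_assoc)
  moreover have "r \<notin> PIdl p" using r step.hyps(2) by (simp add: primitive_def)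
  ultimately have "h \<in> PIdl p" using prime_elt_mult[OF p(1) rc h(1)] by blast
  then obtain h' where h': "h' \<in> carrier R" "h = p \<otimes> h'" using PIdlE p by blast
  have "p \<otimes> (a \<otimes> q) = p \<otimes> (r \<otimes> h')" using h h' p a rc step.prems(1) by (metis m_assoc m_lcomm)
  then have "a \<otimes> q = r \<otimes> h'" using m_lcancel[OF p(3,2)] a rc h' step.prems(1) by auto
  then show ?case using step.IH[OF step.prems(1)] mult_mem_PIdl rc h' by simp
qed

text \<open>A prime constant dividing r divides each coefficient, so the number of prime factors of
  one nonzero coefficient bounds the extraction.\<close>

lemma content_extraction:
  "\<lbrakk>prime_fact S c ps; r \<in> carrier R; coef r n = c\<rbrakk> \<Longrightarrow> \<exists>c' r'. c' \<in> C \<and> c' \<noteq> \<zero> \<and> primitive r' \<and> r = c' \<otimes> r'"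
proof (induction "length ps" arbitrary: c ps r rule: less_induct)
  case less
  have c0: "c \<in> C" "c \<noteq> \<zero>" using S.prime_fact_closed[OF less.prems(1)] by auto
  then have r0: "r \<noteq> \<zero>" using less.prems coef_zero by auto
  show ?case
  proof (cases "primitive r")
    case True
    then show ?thesis using less.prems(2) C_one by (intro exI[of _ \<one>] exI[of _ r]) auto
  next
    case False
    then obtain p where p: "prime_elt S p" "r \<in> PIdl p" using r0 less.prems(2) by (auto simp: primitive_def)
    have pC: "p \<in> C" using p S.prime_elt_closed by auto
    obtain r' where r': "r' \<in> carrier R" "r = p \<otimes> r'" using p PIdlE C_carrier[OF pC] by blast
    have "c = p \<otimes> coef r' n" using less.prems(3) r' coef_scale[OF pC] by simp
    then obtain qs where qs: "prime_fact S (coef r' n) qs" "length ps = Suc (length qs)"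
      using S.prime_fact_divide[OF less.prems(1) p(1), of "coef r' n"] coef_C[OF r'(1)] by auto
    then obtain c' r'' where *: "c' \<in> C" "c' \<noteq> \<zero>" "primitive r''" "r' = c' \<otimes> r''"
      using less.hyps[OF _ qs(1) r'(1) refl] by auto
    have "r = (p \<otimes> c') \<otimes> r''" using r' * C_carrier pC by (simp add: m_assoc primitive_def)
    moreover have "p \<otimes> c' \<noteq> \<zero>" using * integral C_carrier pC S.prime_elt_nonzero[OF p(1)] by auto
    ultimately show ?thesis using * C_mult[OF pC] by blast
  qed
qed

lemma exists_degree:
  assumes "p \<in> carrier R" "p \<noteq> \<zero>"
  obtains n where "deg_less p (Suc n)" "coef p n \<noteq> \<zero>"
proof -
  define n where "n = (LEAST n. deg_less p n)"
  have n: "deg_less p n" unfolding n_def using deg_less_ex[OF assms(1)] LeastI_ex by metis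
  then have "n \<noteq> 0" using deg_less_0[of p] assms by metis
  then obtain k where k: "n = Suc k" using not0_implies_Suc by blast
  have "coef p k \<noteq> \<zero>"
  proof
    assume "coef p k = \<zero>"
    then have "deg_less p k" using n k unfolding deg_less_def by (metis not_less_eq_eq order_antisym)
    then show False using Least_le[of "deg_less p" k] k n_def by simp
  qed
  then show ?thesis using that n k by blast
qed

text \<open>Division with remainder that does not invert the leading coefficient of r: each round
  multiplies s by it, and c collects these factors.\<close>

lemma pseudo_division:
  assumes r: "deg_less r (Suc n)" "coef r n \<noteq> \<zero>"
  shows "deg_less s k \<Longrightarrow> \<exists>c h. c \<in> C \<and> c \<noteq> \<zero> \<and> h \<in> carrier R \<and> deg_less (c \<otimes> s \<ominus> r \<otimes> h) n"
proof (induction k arbitrary: s)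
  case 0
  then show ?case using deg_less_0[OF 0] deg_less_carrier[OF r(1)] C_one deg_less_zero
    by (intro exI[of _ \<one>] exI[of _ \<zero>]) (auto simp: a_minus_def)
next
  case (Suc k)
  have rc: "r \<in> carrier R" and sc: "s \<in> carrier R" using r Suc.prems deg_less_carrier by auto
  show ?case
  proof (cases "Suc k \<le> n")
    case True
    then show ?thesis using deg_less_mono[OF Suc.prems True] sc rc C_one
      by (intro exI[of _ \<one>] exI[of _ \<zero>]) (auto simp: a_minus_def)
  next
    case False
    then have nk: "n \<le> k" by simp
    \<comment> \<open>t is chosen so that l s and r t have the same coefficient in degree k.\<close>
    define l t where "l = coef r n" and "t = coef s k \<otimes> x [^] (k - n)"
    have l: "l \<in> C" "l \<in> carrier R" "l \<noteq> \<zero>" using r coef_C[OF rc] C_carrier by (auto simp: l_def)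
    have t: "t \<in> carrier R" using coef_carrier[OF sc] x by (simp add: t_def)
    define s' where "s' = l \<otimes> s \<ominus> r \<otimes> t"
    have s'c: "s' \<in> carrier R" using l sc rc t by (simp add: s'_def)
    have rt: "coef (r \<otimes> t) j = (if j < k - n then \<zero> else coef s k \<otimes> coef r (j - (k - n)))" for j
      using coef_monom_mult[OF coef_C[OF sc] rc, of k "k - n" j] m_comm[OF rc t] by (simp add: t_def)
    have "coef s' j = \<zero>" if j: "j \<ge> k" for j
    proof -
      have s': "coef s' j = l \<otimes> coef s j \<ominus> coef (r \<otimes> t) j"
        unfolding s'_def using l sc rc t coef_diff coef_scale by simp
      show ?thesis
      proof (cases "j = k")
        case True
        have "\<not> k < k - n" "k - (k - n) = n" using nk by auto
        then show ?thesis unfolding s' rt using True l coef_carrier[OF sc, of k]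
          by (simp add: l_def[symmetric] m_comm a_minus_def r_neg)
      next
        case False
        then have "coef s j = \<zero>" "coef r (j - (k - n)) = \<zero>"
          using j Suc.prems r(1) nk by (auto simp: deg_less_def)
        then show ?thesis unfolding s' rt using l coef_carrier[OF sc, of k] by (simp add: a_minus_def)
      qed
    qed
    then have "deg_less s' k" using s'c by (simp add: deg_less_def)
    then obtain c h where ch: "c \<in> C" "c \<noteq> \<zero>" "h \<in> carrier R" "deg_less (c \<otimes> s' \<ominus> r \<otimes> h) n"
      using Suc.IH by blast
    have "c \<otimes> s' \<ominus> r \<otimes> h = (c \<otimes> l) \<otimes> s \<ominus> r \<otimes> (c \<otimes> t \<oplus> h)"
      unfolding s'_def using C_carrier[OF ch(1)] l(2) sc rc t ch(3) by algebra
    moreover have "c \<otimes> l \<in> C" using ch l C_mult by auto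
    moreover have "c \<otimes> l \<noteq> \<zero>" using integral[of c l] ch(2) l(2,3) C_carrier[OF ch(1)] by blast
    ultimately show ?thesis using ch C_carrier t by (intro exI[of _ "c \<otimes> l"] exI[of _ "c \<otimes> t \<oplus> h"]) auto
  qed
qed

text \<open>A prime factor of the constant a would divide the primitive product, so the
  factorization of a is empty.\<close>

lemma primitive_C_unit:
  assumes "factorial S" "a \<in> C" "a \<noteq> \<zero>" "b \<in> carrier R" "primitive (a \<otimes> b)"
  shows "a \<in> Units R"
proof -
  obtain ps where ps: "prime_fact S a ps" using assms by (auto simp: factorial_def)
  then show ?thesis
  proof cases
    case unit then show ?thesis using units_S by blast
  next
    case (step a' ps' p)
    have c: "p \<in> carrier R" "a' \<in> carrier R"
      using S.prime_elt_closed[OF step(4)] S.prime_fact_closed[OF step(3)] C_carrier by auto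
    have "a \<otimes> b \<in> PIdl p" using mult_mem_PIdl[of p "a' \<otimes> b"] step(1) c assms(4) by (simp add: m_assoc)
    then show ?thesis using assms(5) step(4) by (simp add: primitive_def)
  qed
qed

text \<open>
  If \<open>q\<close> divides \<open>ab\<close> but not \<open>a\<close>, an element \<open>r\<close> of minimal degree in \<open>(q, a)\<close> divides
  \<open>q\<close> and \<open>a\<close> up to constants; indecomposability of \<open>q\<close> forces \<open>r\<close> to be constant.
\<close>

lemma indecomposable_prime:
  assumes fact: "factorial S" and q: "primitive q" "q \<notin> C"
    and indec: "\<And>a b. \<lbrakk>a \<in> carrier R; b \<in> carrier R; q = a \<otimes> b\<rbrakk> \<Longrightarrow> a \<in> C \<or> b \<in> C"
  shows "prime_elt R q"
proof -
  have qc: "q \<in> carrier R" "q \<noteq> \<zero>" using q by (auto simp: primitive_def)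
  have "b \<in> PIdl q" if ab: "a \<in> carrier R" "b \<in> carrier R" "a \<otimes> b \<in> PIdl q" "a \<notin> PIdl q" for a b
  proof -
    define I where "I = set_add R (PIdl q) (PIdl a)"
    have I: "ideal I R" unfolding I_def using add_ideals cgenideal_ideal qc ab by blast
    have I_iff: "s \<in> I \<longleftrightarrow> (\<exists>u\<in>carrier R. \<exists>v\<in>carrier R. s = u \<otimes> q \<oplus> v \<otimes> a)" for s
      unfolding I_def set_add_def' cgenideal_def by blast
    have "q = \<one> \<otimes> q \<oplus> \<zero> \<otimes> a" "a = \<zero> \<otimes> q \<oplus> \<one> \<otimes> a" using qc ab by auto
    then have qI: "q \<in> I" and aI: "a \<in> I" using I_iff by blast+
    define \<Psi> where "\<Psi> = (\<lambda>n. \<exists>r\<in>I. r \<noteq> \<zero> \<and> deg_less r (Suc n))"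
    have "\<exists>n. \<Psi> n" using qI qc exists_degree unfolding \<Psi>_def by metis
    then have "\<Psi> (LEAST n. \<Psi> n)" by (rule LeastI_ex)
    then obtain r where r: "r \<in> I" "r \<noteq> \<zero>" "deg_less r (Suc (LEAST n. \<Psi> n))" unfolding \<Psi>_def by blast
    have rc: "r \<in> carrier R" using r deg_less_carrier by blast
    obtain n where n: "deg_less r (Suc n)" "coef r n \<noteq> \<zero>" using exists_degree[OF rc r(2)] .
    have min: "s = \<zero>" if s: "s \<in> I" "deg_less s n" for s
    proof (rule ccontr)
      assume "s \<noteq> \<zero>"
      then obtain m where m: "deg_less s (Suc m)" "coef s m \<noteq> \<zero>"
        using exists_degree[of s] ideal_carrier[OF I s(1)] by blast
      have "m < n" using m(2) s(2) by (auto simp: deg_less_def) (metis not_le)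
      moreover have "\<Psi> m" using s(1) \<open>s \<noteq> \<zero>\<close> m(1) unfolding \<Psi>_def by blast
      then have "(LEAST n. \<Psi> n) \<le> m" by (rule Least_le)
      then have "coef r n = \<zero>" using r(3) \<open>m < n\<close> by (auto simp: deg_less_def)
      then show False using n(2) by blast
    qed
    \<comment> \<open>Pseudo-division only shows that r divides a constant multiple of each element
      of \<open>I\<close>. For the primitive part r0 of r, Gauss's lemma removes that
      constant.\<close>
    obtain ps where "prime_fact S (coef r n) ps" using fact n(2) coef_C[OF rc] by (auto simp: factorial_def)
    then obtain c0 r0 where r0: "c0 \<in> C" "c0 \<noteq> \<zero>" "primitive r0" "r = c0 \<otimes> r0"
      using content_extraction[OF _ rc refl] by blast
    have r0c: "r0 \<in> carrier R" using r0(3) by (simp add: primitive_def)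
    have div: "s \<in> PIdl r0" if s: "s \<in> I" for s
    proof -
      have sc: "s \<in> carrier R" using s I ideal_carrier by blast
      obtain k where "deg_less s k" using deg_less_ex[OF sc] by blast
      then obtain c h where ch: "c \<in> C" "c \<noteq> \<zero>" "h \<in> carrier R" "deg_less (c \<otimes> s \<ominus> r \<otimes> h) n"
        using pseudo_division[OF n] by blast
      have "c \<otimes> s \<ominus> r \<otimes> h \<in> I"
        using ideal_diff[OF I ideal_mult[OF I s C_carrier[OF ch(1)]] ideal_mult_right[OF I r(1) ch(3)]] .
      then have "c \<otimes> s \<ominus> r \<otimes> h = \<zero>" using min ch(4) by blast
      then have "c \<otimes> s = r \<otimes> h" using C_carrier[OF ch(1)] sc rc ch(3) by simp
      also have "\<dots> = r0 \<otimes> (c0 \<otimes> h)" unfolding r0(4) using C_carrier[OF r0(1)] r0c ch(3) by algebra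
      finally have "c \<otimes> s \<in> PIdl r0" using mult_mem_PIdl r0c C_carrier[OF r0(1)] ch(3) by simp
      moreover obtain ps where "prime_fact S c ps" using fact ch(1,2) by (auto simp: factorial_def)
      ultimately show ?thesis using primitive_cancel[OF r0(3) _ sc] by blast
    qed
    obtain h1 where h1: "h1 \<in> carrier R" "q = r0 \<otimes> h1" using div[OF qI] PIdlE r0c by blast
    obtain h2 where h2: "h2 \<in> carrier R" "a = r0 \<otimes> h2" using div[OF aI] PIdlE r0c by blast
    have "r0 \<in> C"
    proof (rule ccontr)
      assume "r0 \<notin> C"
      then have "h1 \<in> C" using indec[OF r0c h1] by blast
      moreover have "h1 \<noteq> \<zero>" using h1 qc r0c by auto
      ultimately have u: "h1 \<in> Units R" using primitive_C_unit[OF fact, of h1 r0] q(1) h1 r0c m_comm by metis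
      have "a = q \<otimes> (inv h1 \<otimes> h2)"
        using h1 h2 r0c u by (simp add: m_assoc) (simp add: m_assoc[symmetric])
      then show False using ab(4) mult_mem_PIdl qc u h2 by (metis Units_inv_closed m_closed)
    qed
    then have rC: "r \<in> C" "r \<noteq> \<zero>" using r0 C_mult r(2) by auto
    \<comment> \<open>Now r is a nonzero constant in (q, a). Then rb is a multiple of q, and r
      cancels because q is primitive.\<close>
    obtain u v where uv: "u \<in> carrier R" "v \<in> carrier R" "r = u \<otimes> q \<oplus> v \<otimes> a" using r(1) I_iff by blast
    have "r \<otimes> b = (u \<otimes> b) \<otimes> q \<oplus> v \<otimes> (a \<otimes> b)" unfolding uv(3) using uv(1,2) qc ab by algebra
    then have "r \<otimes> b \<in> PIdl q"
      using cgenideal_ideal[OF qc(1)] ideal_add ideal_mult ab uv cgenideal_self[OF qc(1)] by simp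
    moreover obtain ps where "prime_fact S r ps" using fact rC by (auto simp: factorial_def)
    ultimately show ?thesis using primitive_cancel[OF q(1) _ ab(2)] by blast
  qed
  moreover have "\<one> \<notin> PIdl q"
  proof
    assume "\<one> \<in> PIdl q"
    then obtain h where h: "h \<in> carrier R" "\<one> = q \<otimes> h" using PIdlE qc by blast
    obtain n where n: "deg_less q (Suc n)" "coef q n \<noteq> \<zero>" using exists_degree qc by blast
    have "h \<noteq> \<zero>" using h qc by auto
    then obtain m where m: "deg_less h (Suc m)" "coef h m \<noteq> \<zero>" using exists_degree h by blast
    have "n \<noteq> 0" using n q(2) deg_less_1 by metis
    then have "coef (q \<otimes> h) (n + m) = \<zero>" using h(2) coef_const[OF C_one] by simp
    then show False using coef_mult_top[OF n(1) m(1)] n(2) m(2) integral coef_carrier qc h by metis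
  qed
  ultimately have "primeideal (PIdl q) R"
    by (intro primeidealI[OF cgenideal_ideal[OF qc(1)] is_cring]) blast+
  then show ?thesis using qc by (simp add: prime_elt_def)
qed

text \<open>Induction on the degree. After the content has been split off, the primitive part either
  is a product of two nonconstant factors, both of smaller degree because degrees add in a domain,
  or it is indecomposable and then prime.\<close>

lemma factorial_ext:
  assumes fact: "factorial S"
  shows "factorial R"
proof -
  have C_fact: "\<exists>ps. prime_fact R c ps" if c: "c \<in> C" "c \<noteq> \<zero>" for c
  proof -
    obtain ps where "prime_fact S c ps" using fact c unfolding factorial_def by auto
    then show ?thesis using prime_fact_S by blast
  qed
  have "\<lbrakk>deg_less q (Suc n); coef q n \<noteq> \<zero>\<rbrakk> \<Longrightarrow> \<exists>ps. prime_fact R q ps" for q n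
  proof (induction n arbitrary: q rule: less_induct)
    case (less n)
    have qc: "q \<in> carrier R" using less.prems deg_less_carrier by blast
    show ?case
    proof (cases "q \<in> C")
      case True
      then show ?thesis using C_fact less.prems(2) coef_zero by blast
    next
      case False
      obtain ps where "prime_fact S (coef q n) ps" using fact less.prems(2) coef_C[OF qc] by (auto simp: factorial_def)
      then obtain c q0 where q0: "c \<in> C" "c \<noteq> \<zero>" "primitive q0" "q = c \<otimes> q0"
        using content_extraction[OF _ qc refl] by blast
      have q0c: "q0 \<in> carrier R" "q0 \<noteq> \<zero>" using q0(3) by (auto simp: primitive_def)
      have "\<exists>ps. prime_fact R q0 ps"
      proof (cases "\<exists>a\<in>carrier R. \<exists>b\<in>carrier R. q0 = a \<otimes> b \<and> a \<notin> C \<and> b \<notin> C")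
        case True
        then obtain a b where ab: "a \<in> carrier R" "b \<in> carrier R" "q0 = a \<otimes> b" "a \<notin> C" "b \<notin> C" by blast
        have nz: "a \<noteq> \<zero>" "b \<noteq> \<zero>" using ab q0c by auto
        obtain i where i: "deg_less a (Suc i)" "coef a i \<noteq> \<zero>" using exists_degree ab(1) nz(1) by blast
        obtain j where j: "deg_less b (Suc j)" "coef b j \<noteq> \<zero>" using exists_degree ab(2) nz(2) by blast
        have ij: "i \<noteq> 0" "j \<noteq> 0" using i j ab deg_less_1 by metis+
        have "coef q (i + j) = c \<otimes> (coef a i \<otimes> coef b j)"
          using coef_scale[OF q0(1) q0c(1), of "i + j"] coef_mult_top[OF i(1) j(1)] q0(4) ab(3) by metis
        moreover have "c \<otimes> (coef a i \<otimes> coef b j) \<noteq> \<zero>"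
          using q0(1,2) i(2) j(2) integral C_carrier coef_carrier ab(1,2) by (metis m_closed)
        ultimately have "i + j < Suc n" using less.prems(1) by (auto simp: deg_less_def) (metis not_le)
        then have "i < n" "j < n" using ij by auto
        then show ?thesis using less.IH i j prime_fact_mult ab(3) by metis
      next
        case F: False
        have "q0 \<notin> C" using False q0 C_mult by blast
        then have "prime_elt R q0" using indecomposable_prime[OF fact q0(3)] F by blast
        then have "prime_fact R (q0 \<otimes> \<one>) [q0]" by (intro prime_fact.intros) auto
        then show ?thesis using q0c by auto
      qed
      then show ?thesis using C_fact[OF q0(1,2)] prime_fact_mult q0(4) by blast
    qed
  qed
  then show ?thesis unfolding factorial_def using exists_degree by metis
qed

end

section \<open>Polynomial rings in finitely many variables\<close>

lemma noetherian_surj_image: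
  assumes hom: "ring_hom_cring R S h" and surj: "h ` carrier R = carrier S" and noeth: "noetherian_ring R"
  shows "noetherian_ring S"
proof -
  interpret R: cring R by (rule ring_hom_cring.axioms(1)[OF hom])
  interpret S: cring S by (rule ring_hom_cring.axioms(2)[OF hom])
  interpret h: ring_hom_cring R S h by (rule hom)
  note vimage = ring_hom_ring.ideal_vimage[OF ring_hom_ringI2[OF R.ring_axioms S.ring_axioms h.homh]]
  show ?thesis
  proof (rule S.noetherian_ringI)
    fix I assume I: "ideal I S"
    have "ideal {r \<in> carrier R. h r \<in> I} R" by (rule vimage[OF I])
    then obtain A where A: "A \<subseteq> carrier R" "finite A" "{r \<in> carrier R. h r \<in> I} = Idl\<^bsub>R\<^esub> A"
      using noetherian_ring.finetely_gen[OF noeth] by metis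
    have hA: "h ` A \<subseteq> carrier S" using A by auto
    have "h ` A \<subseteq> I" using R.genideal_self[OF A(1)] unfolding A(3)[symmetric] by blast
    then have 1: "Idl\<^bsub>S\<^esub> (h ` A) \<subseteq> I" by (rule S.genideal_minimal[OF I])
    have "A \<subseteq> {r \<in> carrier R. h r \<in> Idl\<^bsub>S\<^esub> (h ` A)}"
      using A(1) subsetD[OF S.genideal_self[OF hA]] by blast
    then have "Idl\<^bsub>R\<^esub> A \<subseteq> {r \<in> carrier R. h r \<in> Idl\<^bsub>S\<^esub> (h ` A)}"
      by (rule R.genideal_minimal[OF vimage[OF S.genideal_ideal[OF hA]]])
    then have *: "{r \<in> carrier R. h r \<in> I} \<subseteq> {r \<in> carrier R. h r \<in> Idl\<^bsub>S\<^esub> (h ` A)}" unfolding A(3) .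
    have "I \<subseteq> Idl\<^bsub>S\<^esub> (h ` A)"
    proof
      fix i assume i: "i \<in> I"
      then obtain r where "r \<in> carrier R" "i = h r" using S.ideal_carrier[OF I] surj by (metis imageE)
      then show "i \<in> Idl\<^bsub>S\<^esub> (h ` A)" using * i by blast
    qed
    then show "\<exists>A\<subseteq>carrier S. finite A \<and> I = Idl\<^bsub>S\<^esub> A" using 1 hA A(2) by blast
  qed
qed

context cring
begin

section \<open>The polynomial ring as an extension by one of its variables\<close>

definition pcoef :: "'c \<Rightarrow> ('c multiset \<Rightarrow> 'a) \<Rightarrow> nat \<Rightarrow> ('c multiset \<Rightarrow> 'a)" where
  "pcoef x P k = (\<lambda>u. if x \<in># u then \<zero> else P (u + replicate_mset k x))"

lemma PR_neg_apply:
  assumes "P \<in> carrier (PR V)"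
  shows "(\<ominus>\<^bsub>PR V\<^esub> P) = (\<lambda>u. \<ominus> P u)"
proof -
  interpret P: cring "PR V" by (rule PR_cring)
  have "(\<lambda>u. \<ominus> P u) \<in> carrier (PR V)" using assms by (auto simp: PR_simps poly_set_def)
  moreover have "(\<lambda>u. \<ominus> P u) \<oplus>\<^bsub>PR V\<^esub> P = \<zero>\<^bsub>PR V\<^esub>"
    using PR_apply[OF assms] by (auto simp: PR_add_apply PR_zero_apply l_neg)
  ultimately show ?thesis using P.minus_equality assms by blast
qed

lemma PR_supp: "\<lbrakk>P \<in> carrier (PR V); P u \<noteq> \<zero>\<rbrakk> \<Longrightarrow> set_mset u \<subseteq> V"
  by (simp add: PR_simps poly_set_def)

lemma PR_supp_finite: "P \<in> carrier (PR V) \<Longrightarrow> finite {u. P u \<noteq> \<zero>}"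
  by (simp add: PR_simps poly_set_def)

lemma PR_subring: "V \<subseteq> W \<Longrightarrow> subring (carrier (PR V)) (PR W)"
proof -
  assume VW: "V \<subseteq> W"
  interpret V: cring "PR V" by (rule PR_cring)
  interpret W: cring "PR W" by (rule PR_cring)
  note sub = subsetD[OF PR_mono[OF VW]]
  show ?thesis
  proof (rule W.subringI[OF PR_mono[OF VW]])
    show "\<one>\<^bsub>PR W\<^esub> \<in> carrier (PR V)" using V.one_closed by (simp add: PR_simps(3))
    show "\<ominus>\<^bsub>PR W\<^esub> h \<in> carrier (PR V)" if "h \<in> carrier (PR V)" for h
      using V.a_inv_closed[OF that] PR_neg_apply[OF that] PR_neg_apply[OF sub[OF that]] by simp
    show "h \<otimes>\<^bsub>PR W\<^esub> h' \<in> carrier (PR V)" if "h \<in> carrier (PR V)" "h' \<in> carrier (PR V)" for h h'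
      using V.m_closed[OF that] by (simp add: PR_simps(2))
    show "h \<oplus>\<^bsub>PR W\<^esub> h' \<in> carrier (PR V)" if "h \<in> carrier (PR V)" "h' \<in> carrier (PR V)" for h h'
      using V.a_closed[OF that] by (simp add: PR_simps(5))
  qed
qed

lemma pcoef_closed:
  assumes "P \<in> carrier (PR W)"
  shows "pcoef x P k \<in> carrier (PR (W - {x}))"
proof -
  have "{u. pcoef x P k u \<noteq> \<zero>} \<subseteq> (\<lambda>v. v - replicate_mset k x) ` {u. P u \<noteq> \<zero>}"
    by (auto simp: pcoef_def image_iff split: if_splits) (metis add_diff_cancel_right')
  then have "finite {u. pcoef x P k u \<noteq> \<zero>}"
    using PR_supp_finite[OF assms] by (meson finite_imageI finite_subset)
  moreover have "set_mset u \<subseteq> W - {x}" if u: "pcoef x P k u \<noteq> \<zero>" for u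
  proof -
    have "x \<notin># u" "P (u + replicate_mset k x) \<noteq> \<zero>" using u by (auto simp: pcoef_def split: if_splits)
    then show ?thesis using PR_supp[OF assms] by fastforce
  qed
  ultimately show ?thesis using PR_apply[OF assms] by (auto simp: PR_simps(1) poly_set_def pcoef_def)
qed

text \<open>A monomial without x neither creates nor removes occurrences of x, so multiplication by
  it commutes with extracting a coefficient.\<close>

lemma pcoef_scale:
  assumes "Q \<in> carrier (PR (W - {x}))" "P \<in> carrier (PR W)"
  shows "pcoef x (Q \<otimes>\<^bsub>PR W\<^esub> P) k = Q \<otimes>\<^bsub>PR W\<^esub> pcoef x P k"
  using assms(1)
proof (induction Q rule: PR_induct)
  case (mon r v)
  show ?case
  proof
    fix u
    have PP: "\<And>u. P u \<in> carrier R" "\<And>u. pcoef x P k u \<in> carrier R" using PR_apply[OF assms(2)] by (auto simp: pcoef_def)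
    have xv: "x \<notin># v" using mon by auto
    have 1: "v \<subseteq># u + replicate_mset k x \<longleftrightarrow> v \<subseteq># u" if "x \<notin># u"
    proof
      assume le: "v \<subseteq># u + replicate_mset k x"
      show "v \<subseteq># u"
      proof (rule mset_subset_eqI)
        fix y show "count v y \<le> count u y"
          using mset_subset_eq_count[OF le, of y] xv by (cases "y = x") (auto simp: not_in_iff)
      qed
    qed (simp add: subset_mset.add_increasing2)
    have 2: "u + replicate_mset k x - v = u - v + replicate_mset k x" if "v \<subseteq># u"
      using that by (simp add: subset_mset.add_diff_assoc2)
    have 3: "x \<in># u - v \<longleftrightarrow> x \<in># u" using xv by (metis count_diff diff_zero not_in_iff)
    show "pcoef x (mon r v \<otimes>\<^bsub>PR W\<^esub> P) k u = (mon r v \<otimes>\<^bsub>PR W\<^esub> pcoef x P k) u"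
      using mon(1) 1 2 3 PP unfolding pcoef_def[of x "mon r v \<otimes>\<^bsub>PR W\<^esub> P"]
        mon_mult[OF mon(1), of P, OF PP(1)] mon_mult[OF mon(1), of "pcoef x P k", OF PP(2)]
      by (auto simp: pcoef_def)
  qed
next
  case (add Q Q')
  have Q: "Q \<in> carrier (PR W)" "Q' \<in> carrier (PR W)" using add PR_mono[of "W - {x}" W] by auto
  have c: "pcoef x P k \<in> carrier (PR W)" using pcoef_closed[OF assms(2)] PR_mono[of "W - {x}" W] by blast
  have e: "Q \<oplus>\<^bsub>PR (W - {x})\<^esub> Q' = Q \<oplus>\<^bsub>PR W\<^esub> Q'" by (simp add: PR_simps(5))
  have "pcoef x (A \<oplus>\<^bsub>PR W\<^esub> B) k = pcoef x A k \<oplus>\<^bsub>PR W\<^esub> pcoef x B k" for A B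
    by (auto simp: pcoef_def PR_add_apply)
  then show ?case unfolding e using add.IH Q assms(2) c by (simp add: PR_l_distr)
qed

text \<open>Any variable may be singled out, so that one and the same ring can be read as a
  polynomial ring in \<open>T j\<close> for every j.\<close>

lemma PR_simple_ext:
  assumes xW: "x \<in> W"
  shows "simple_ext (PR W) (carrier (PR (W - {x}))) (indexed_var x) (pcoef x)"
proof (intro simple_ext.intro simple_ext_axioms.intro)
  have sub: "carrier (PR (W - {x})) \<subseteq> carrier (PR W)" by (rule PR_mono) auto
  show "cring (PR W)" by (rule PR_cring)
  show "subring (carrier (PR (W - {x}))) (PR W)" by (rule PR_subring) auto
  show "indexed_var x \<in> carrier (PR W)" by (rule var_closed[OF xW])
  show "pcoef x P k \<in> carrier (PR (W - {x}))" if "P \<in> carrier (PR W)" for P k using pcoef_closed that .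
  show "pcoef x (P \<oplus>\<^bsub>PR W\<^esub> Q) k = pcoef x P k \<oplus>\<^bsub>PR W\<^esub> pcoef x Q k" for P Q k
    by (auto simp: pcoef_def PR_add_apply)
  show "pcoef x (c \<otimes>\<^bsub>PR W\<^esub> P) k = c \<otimes>\<^bsub>PR W\<^esub> pcoef x P k"
    if "c \<in> carrier (PR (W - {x}))" "P \<in> carrier (PR W)" for c P k using pcoef_scale that .
  show "pcoef x (indexed_var x \<otimes>\<^bsub>PR W\<^esub> P) 0 = \<zero>\<^bsub>PR W\<^esub>" if "P \<in> carrier (PR W)" for P
    using that by (auto simp: pcoef_def var_mult_apply PR_zero_apply)
  show "pcoef x (indexed_var x \<otimes>\<^bsub>PR W\<^esub> P) (Suc k) = pcoef x P k" if "P \<in> carrier (PR W)" for P k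
    using that by (auto simp: pcoef_def var_mult_apply)
  show "pcoef x c k = (if k = 0 then c else \<zero>\<^bsub>PR W\<^esub>)" if c: "c \<in> carrier (PR (W - {x}))" for c k
  proof -
    have "c u = \<zero>" if "x \<in># u" for u using PR_supp[OF c, of u] that by blast
    then show ?thesis by (auto simp: pcoef_def PR_zero_apply)
  qed
  show "\<exists>n. \<forall>k\<ge>n. pcoef x P k = \<zero>\<^bsub>PR W\<^esub>" if P: "P \<in> carrier (PR W)" for P
  proof -
    \<comment> \<open>One more than the largest exponent of x; \<open>insert 0\<close> covers the
      zero polynomial, whose support is empty.\<close>
    define n where "n = Suc (Max (insert 0 ((\<lambda>u. count u x) ` {u. P u \<noteq> \<zero>})))"
    have fin: "finite (insert 0 ((\<lambda>u. count u x) ` {u. P u \<noteq> \<zero>}))" using PR_supp_finite[OF P] by simp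
    have "P (u + replicate_mset k x) = \<zero>" if "k \<ge> n" for u k
    proof (rule ccontr)
      assume "P (u + replicate_mset k x) \<noteq> \<zero>"
      then have "count (u + replicate_mset k x) x < n"
        unfolding n_def using Max_ge[OF fin, of "count (u + replicate_mset k x) x"] by (auto simp: less_Suc_eq_le simp del: count_union)
      then show False using that by simp
    qed
    then show ?thesis by (intro exI[of _ n]) (auto simp: pcoef_def PR_zero_apply)
  qed
  show "P = \<zero>\<^bsub>PR W\<^esub>" if P: "P \<in> carrier (PR W)" "\<forall>k. pcoef x P k = \<zero>\<^bsub>PR W\<^esub>" for P
  proof
    fix u
    have "u = filter_mset (\<lambda>y. y \<noteq> x) u + replicate_mset (count u x) x"
      by (rule multiset_eqI) auto
    moreover have "pcoef x P (count u x) (filter_mset (\<lambda>y. y \<noteq> x) u) = \<zero>"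
      using P(2) PR_zero_apply by metis
    ultimately show "P u = \<zero>\<^bsub>PR W\<^esub> u" by (simp add: pcoef_def PR_zero_apply)
  qed
qed

lemma PR_empty_const: "P \<in> carrier (PR {}) \<Longrightarrow> P = indexed_const (P {#})"
  using PR_supp[of P "{}"] by (fastforce simp: indexed_const_def)

lemma PR_empty_zero: "\<lbrakk>P \<in> carrier (PR {}); P {#} = \<zero>\<rbrakk> \<Longrightarrow> P = \<zero>\<^bsub>PR {}\<^esub>"
  using PR_supp[of P "{}"] by (fastforce simp: PR_zero_apply)

lemma PR_S_eq: "(PR W)\<lparr>carrier := carrier (PR (W - {x}))\<rparr> = PR (W - {x})"
  using PR_restrict[of "W - {x}" W] by simp

lemma PR_noetherian:
  assumes "noetherian_ring R" "finite V"
  shows "noetherian_ring (PR V)"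
  using assms(2)
proof (induction V rule: finite_induct)
  case empty
  have "indexed_const ` carrier R = carrier (PR {})"
  proof
    show "carrier (PR {}) \<subseteq> indexed_const ` carrier R"
      using PR_empty_const PR_apply by blast
  qed (auto simp: const_closed)
  then show ?case using noetherian_surj_image[OF const_hom _ assms(1)] by blast
next
  case (insert x V)
  interpret E: simple_ext "PR (insert x V)" "carrier (PR (insert x V - {x}))" "indexed_var x" "pcoef x"
    by (rule PR_simple_ext) simp
  have "insert x V - {x} = V" using insert.hyps by auto
  then show ?case using E.noetherian_ext insert.IH PR_S_eq[of "insert x V" x] by metis
qed

subsection \<open>Extended ideals\<close>

definition ext_ideal :: "'c set \<Rightarrow> 'a set \<Rightarrow> ('c multiset \<Rightarrow> 'a) set" where
  "ext_ideal V I = {P \<in> carrier (PR V). \<forall>u. P u \<in> I}"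

text \<open>The coefficientwise form decides membership; the generated form reduces an inclusion of
  the extended ideal to constants.\<close>

lemma ext_ideal_eq:
  assumes "ideal I R"
  shows "ext_ideal V I = Idl\<^bsub>PR V\<^esub> (indexed_const ` I)"
proof
  interpret P: cring "PR V" by (rule PR_cring)
  have sub: "indexed_const ` I \<subseteq> carrier (PR V)" using ideal_sub[OF assms] const_closed by blast
  note id = P.genideal_ideal[OF sub]
  show "ext_ideal V I \<subseteq> Idl\<^bsub>PR V\<^esub> (indexed_const ` I)"
  proof
    fix P assume P: "P \<in> ext_ideal V I"
    have "finite F \<Longrightarrow> P \<in> ext_ideal V I \<Longrightarrow> {u. P u \<noteq> \<zero>} = F \<Longrightarrow> P \<in> Idl\<^bsub>PR V\<^esub> (indexed_const ` I)" for F
    proof (induction F arbitrary: P rule: finite_induct)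
      case empty
      then have "P = \<zero>\<^bsub>PR V\<^esub>" by (auto simp: PR_zero_apply)
      then show ?case using P.ideal_zero[OF id] by simp
    next
      case (insert u F)
      then have u: "P u \<noteq> \<zero>" by auto
      have Pc: "P \<in> poly_set V" "P u \<in> I" using insert.prems(1) by (auto simp: ext_ideal_def PR_simps)
      note split = finite_supp_split[OF Pc(1) u]
      have "P(u := \<zero>) \<in> Idl\<^bsub>PR V\<^esub> (indexed_const ` I)"
      proof (rule insert.IH)
        show "P(u := \<zero>) \<in> ext_ideal V I"
          using split(1) insert.prems(1) ideal_zero[OF assms] by (auto simp: ext_ideal_def PR_simps(1))
        show "{v. (P(u := \<zero>)) v \<noteq> \<zero>} = F" unfolding split(3) using insert.prems(2) insert.hyps(2) by auto
      qed
      moreover have uV: "set_mset u \<subseteq> V" using Pc u by (auto simp: poly_set_def)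
      have "mon (P u) u = mon \<one> u \<otimes>\<^bsub>PR V\<^esub> indexed_const (P u)"
        using mon_mult_mon[where r = \<one> and s = "P u" and u = u and V = V and v = "{#}"] ideal_carrier[OF assms Pc(2)]
        by (simp add: mon_empty)
      then have "mon (P u) u \<in> Idl\<^bsub>PR V\<^esub> (indexed_const ` I)"
        using P.ideal_mult[OF id, of "indexed_const (P u)" "mon \<one> u"] P.genideal_self[OF sub] Pc(2)
          mon_closed[OF one_closed uV] by auto
      ultimately have "mon (P u) u \<oplus>\<^bsub>PR V\<^esub> P(u := \<zero>) \<in> Idl\<^bsub>PR V\<^esub> (indexed_const ` I)"
        using P.ideal_add[OF id] by blast
      then show ?case using split(2) by (simp add: PR_simps(5))
    qed
    then show "P \<in> Idl\<^bsub>PR V\<^esub> (indexed_const ` I)"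
      using P PR_supp_finite by (auto simp: ext_ideal_def)
  qed
  have "ideal (ext_ideal V I) (PR V)"
  proof (rule P.ideal_intro)
    fix P Q assume P: "P \<in> ext_ideal V I" and Q: "Q \<in> carrier (PR V)"
    have Pc: "P \<in> carrier (PR V)" "\<And>u. P u \<in> I" using P by (auto simp: ext_ideal_def)
    from Q have "\<forall>u. (Q \<otimes>\<^bsub>PR V\<^esub> P) u \<in> I"
    proof (induction Q rule: PR_induct)
      case (mon r v)
      show ?case
        using mon(1) Pc(2) ideal_mult[OF assms] ideal_zero[OF assms] mon_mult[OF mon(1), of P, OF PR_apply[OF Pc(1)]] by simp
    next
      case (add Q Q')
      then show ?case
        unfolding PR_l_distr[OF add(1,2) Pc(1)] by (simp add: PR_add_apply ideal_add[OF assms])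
    qed
    then show "Q \<otimes>\<^bsub>PR V\<^esub> P \<in> ext_ideal V I" using Q Pc by (simp add: ext_ideal_def)
  qed (auto simp: ext_ideal_def PR_zero_apply PR_add_apply ideal_zero[OF assms] ideal_add[OF assms])
  moreover have "indexed_const ` I \<subseteq> ext_ideal V I"
    using ideal_sub[OF assms] const_closed ideal_zero[OF assms] by (auto simp: ext_ideal_def) (auto simp: indexed_const_def)
  ultimately show "Idl\<^bsub>PR V\<^esub> (indexed_const ` I) \<subseteq> ext_ideal V I" by (rule P.genideal_minimal)
qed

lemma ext_ideal_ideal: "ideal I R \<Longrightarrow> ideal (ext_ideal V I) (PR V)"
  unfolding ext_ideal_eq using ideal_sub const_closed by (intro ring.genideal_ideal cring.axioms(1)[OF PR_cring]) blast

lemma ext_ideal_mono: "I \<subseteq> J \<Longrightarrow> ext_ideal V I \<subseteq> ext_ideal V J"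
  by (auto simp: ext_ideal_def)

lemma const_mem_ext_ideal: "ideal I R \<Longrightarrow> r \<in> carrier R \<Longrightarrow> indexed_const r \<in> ext_ideal V I \<longleftrightarrow> r \<in> I"
  using ideal_zero const_closed by (auto simp: ext_ideal_def indexed_const_def)

lemma ext_ideal_nzd:
  assumes "ideal I R" "c \<in> carrier R" "nzd_on c (carrier R) I"
  shows "cring.nzd_on (PR V) (indexed_const c) (carrier (PR V)) (ext_ideal V I)"
  unfolding cring.nzd_on_def[OF PR_cring]
  by (auto simp: ext_ideal_def const_mult_apply[OF assms(2)] intro: nzd_onD[OF assms(3)] PR_apply)

lemma ext_ideal_extend:
  assumes "ideal I R" "c \<in> carrier R"
  shows "cring.extend (PR V) (carrier (PR V)) (ext_ideal V I) (indexed_const c) = ext_ideal V (extend (carrier R) I c)"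
proof
  interpret P: cring "PR V" by (rule PR_cring)
  interpret const: ring_hom_cring R "PR V" indexed_const by (rule const_hom)
  note id = extend_ideal[OF oneideal assms(1,2)]
  note eid = ext_ideal_ideal[OF id]
  note cc = const_closed[OF assms(2)]
  note eid' = P.extend_ideal[OF P.oneideal ext_ideal_ideal[OF assms(1)] cc]
  show "P.extend (carrier (PR V)) (ext_ideal V I) (indexed_const c) \<subseteq> ext_ideal V (extend (carrier R) I c)"
  proof (rule P.extend_least[OF eid])
    show "ext_ideal V I \<subseteq> ext_ideal V (extend (carrier R) I c)"
      by (rule ext_ideal_mono[OF extend_upper1[OF oneideal assms]])
    have "c \<otimes> \<one> \<in> extend (carrier R) I c" by (rule extend_upper2[OF oneideal assms one_closed])
    then have "indexed_const c \<in> ext_ideal V (extend (carrier R) I c)"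
      using const_mem_ext_ideal[OF id assms(2), of V] assms(2) by simp
    then show "indexed_const c \<otimes>\<^bsub>PR V\<^esub> x \<in> ext_ideal V (extend (carrier R) I c)" if "x \<in> carrier (PR V)" for x
      using P.ideal_mult_right[OF eid] that by blast
  qed
  show "ext_ideal V (extend (carrier R) I c) \<subseteq> P.extend (carrier (PR V)) (ext_ideal V I) (indexed_const c)"
    unfolding ext_ideal_eq[OF id]
  proof (rule P.genideal_minimal[OF eid'], rule subsetI)
    fix p :: "'c multiset \<Rightarrow> 'a" assume "p \<in> indexed_const ` extend (carrier R) I c"
    then obtain a r where ar: "p = indexed_const (a \<oplus> c \<otimes> r)" "a \<in> I" "r \<in> carrier R" by (auto simp: extend_def)
    have ac: "a \<in> carrier R" using ideal_carrier[OF assms(1)] ar by blast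
    have "p = indexed_const a \<oplus>\<^bsub>PR V\<^esub> indexed_const c \<otimes>\<^bsub>PR V\<^esub> indexed_const r"
      unfolding ar(1) using ac ar(3) assms(2) by simp
    then show "p \<in> P.extend (carrier (PR V)) (ext_ideal V I) (indexed_const c)"
      unfolding P.extend_def using ar const_mem_ext_ideal[OF assms(1) ac] const_closed by blast
  qed
qed

end

text \<open>The zero ideal is stable, so \<open>stable_prime\<close> lifts the absence of zero
  divisors from one variable fewer.\<close>

lemma (in domain) PR_domain:
  assumes "finite V"
  shows "domain (indexed_poly_ring R V)"
  using assms
proof (induction V rule: finite_induct)
  case empty
  interpret P: cring "PR {}" by (rule PR_cring)
  interpret const: ring_hom_cring R "PR {}" indexed_const by (rule const_hom)
  show ?case
  proof (intro domain.intro domain_axioms.intro PR_cring)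
    show "\<one>\<^bsub>PR {}\<^esub> \<noteq> \<zero>\<^bsub>PR {}\<^esub>"
      by (auto simp: PR_simps indexed_const_def fun_eq_iff)
    fix P Q assume PQ: "P \<otimes>\<^bsub>PR {}\<^esub> Q = \<zero>\<^bsub>PR {}\<^esub>" "P \<in> carrier (PR {})" "Q \<in> carrier (PR {})"
    have "P {#} \<otimes> Q {#} = (indexed_const (P {#}) \<otimes>\<^bsub>PR {}\<^esub> Q) {#}"
      using const_mult_apply[OF PR_apply[OF PQ(2)] PQ(3)] by simp
    also have "\<dots> = \<zero>" unfolding PR_empty_const[OF PQ(2), symmetric] PQ(1) by (rule PR_zero_apply)
    finally have "P {#} = \<zero> \<or> Q {#} = \<zero>"
      using integral[of "P {#}" "Q {#}"] PR_apply[OF PQ(2)] PR_apply[OF PQ(3)] by blast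
    then show "P = \<zero>\<^bsub>PR {}\<^esub> \<or> Q = \<zero>\<^bsub>PR {}\<^esub>"
      using PR_empty_zero[OF PQ(2)] PR_empty_zero[OF PQ(3)] by blast
  qed
next
  case (insert x V)
  interpret E: simple_ext "PR (insert x V)" "carrier (PR (insert x V - {x}))" "indexed_var x" "pcoef x"
    by (rule PR_simple_ext) simp
  have V: "insert x V - {x} = V" using insert.hyps by auto
  interpret D: domain "PR V" by (rule insert.IH)
  have st: "E.stable {\<zero>\<^bsub>PR (insert x V)\<^esub>}"
    using E.coef_zero E.zeroideal by (auto simp: E.stable_def)
  show ?case
  proof (intro domain.intro domain_axioms.intro PR_cring)
    show "\<one>\<^bsub>PR (insert x V)\<^esub> \<noteq> \<zero>\<^bsub>PR (insert x V)\<^esub>"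
      using D.one_not_zero by (simp add: PR_simps)
    fix P Q assume PQ: "P \<otimes>\<^bsub>PR (insert x V)\<^esub> Q = \<zero>\<^bsub>PR (insert x V)\<^esub>"
      "P \<in> carrier (PR (insert x V))" "Q \<in> carrier (PR (insert x V))"
    have "a \<in> {\<zero>\<^bsub>PR (insert x V)\<^esub>} \<or> b \<in> {\<zero>\<^bsub>PR (insert x V)\<^esub>}"
      if "a \<in> carrier (PR (insert x V - {x}))" "b \<in> carrier (PR (insert x V - {x}))"
        "a \<otimes>\<^bsub>PR (insert x V)\<^esub> b \<in> {\<zero>\<^bsub>PR (insert x V)\<^esub>}" for a b
      using D.integral[of a b] that unfolding V by (simp add: PR_simps)
    then show "P = \<zero>\<^bsub>PR (insert x V)\<^esub> \<or> Q = \<zero>\<^bsub>PR (insert x V)\<^esub>"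
      using E.stable_prime[OF st _ PQ(2,3)] PQ(1) by blast
  qed
qed

lemma (in field) PR_factorial:
  fixes V :: "'c set"
  assumes "finite V"
  shows "factorial (indexed_poly_ring R V)"
  using assms
proof (induction V rule: finite_induct)
  case empty
  interpret P: cring "PR ({} :: 'c set)" by (rule PR_cring)
  interpret const: ring_hom_cring R "PR ({} :: 'c set)" indexed_const by (rule const_hom)
  have "\<exists>ps. prime_fact (PR ({} :: 'c set)) P ps" if P: "P \<in> carrier (PR ({} :: 'c set))" "P \<noteq> \<zero>\<^bsub>PR ({} :: 'c set)\<^esub>" for P
  proof -
    note e = PR_empty_const[OF P(1), symmetric]
    have "P {#} \<noteq> \<zero>" using PR_empty_zero[OF P(1)] P(2) by blast
    then have u: "P {#} \<in> Units R" using PR_apply[OF P(1), of "{#}"] by (simp only: field_Units Diff_iff singleton_iff simp_thms)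
    let ?Q = "indexed_const (inv (P {#}))"
    have Q: "?Q \<in> carrier (PR ({} :: 'c set))" using u by (intro const_closed) simp
    have "indexed_const (P {#}) \<otimes>\<^bsub>PR ({} :: 'c set)\<^esub> ?Q = indexed_const (P {#} \<otimes> inv (P {#}))"
      by (rule const.hom_mult[symmetric]) (use u in auto)
    also have "\<dots> = \<one>\<^bsub>PR ({} :: 'c set)\<^esub>" using u by simp
    finally have "P \<otimes>\<^bsub>PR ({} :: 'c set)\<^esub> ?Q = \<one>\<^bsub>PR ({} :: 'c set)\<^esub>" unfolding e .
    then have "P \<in> Units (PR ({} :: 'c set))"
      using P.unit_factor[OF _ P(1) Q] P.Units_one_closed by simp
    then show ?thesis by (intro exI[of _ "[]"] prime_fact.unit)
  qed
  then show ?case by (auto simp: factorial_def)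
next
  case (insert x V)
  interpret E: simple_ext_domain "PR (insert x V)" "carrier (PR (insert x V - {x}))" "indexed_var x" "pcoef x"
    by (intro simple_ext_domain.intro PR_simple_ext PR_domain) (use insert.hyps in auto)
  have "insert x V - {x} = V" using insert.hyps by auto
  then show ?case using E.factorial_ext insert.IH PR_S_eq[of "insert x V" x] by metis
qed

context cring
begin

section \<open>Reduction modulo the maximal ideal\<close>

lemma coset_map_zero:
  assumes "ideal m R"
  shows "\<lbrakk>P \<in> carrier (PR V)\<rbrakk> \<Longrightarrow> (+>) m \<circ> P = \<zero>\<^bsub>indexed_poly_ring (R Quot m) V\<^esub> \<longleftrightarrow> P \<in> ext_ideal V m"
proof -
  assume P: "P \<in> carrier (PR V)"
  interpret Q: cring "R Quot m" by (rule ideal.quotient_is_cring[OF assms is_cring])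
  have "m +> r = \<zero>\<^bsub>R Quot m\<^esub> \<longleftrightarrow> r \<in> m" if "r \<in> carrier R" for r
    using ideal.rcos_const_imp_mem[OF assms that] a_rcos_zero[OF assms] by (auto simp: FactRing_def)
  then show ?thesis using PR_apply[OF P] P
    by (auto simp: fun_eq_iff Q.PR_zero_apply ext_ideal_def)
qed

lemma ext_maximal_prime:
  assumes "maximalideal m R" "finite V"
  shows "primeideal (ext_ideal V m) (PR V)"
proof -
  interpret m: maximalideal m R by (rule assms)
  interpret k: field "R Quot m" by (rule m.quotient_is_field[OF is_cring])
  interpret c: ring_hom_cring "PR V" "k.PR V" "(\<circ>) ((+>) m)"
    by (rule coefficient_map_hom[OF m.rcos_ring_hom_cring[OF is_cring]])
  interpret G: domain "k.PR V" by (rule k.PR_domain[OF assms(2)])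
  note id = m.is_ideal
  show ?thesis
  proof (rule primeidealI[OF ext_ideal_ideal[OF id] PR_cring])
    have "indexed_const \<one> \<notin> ext_ideal V m"
      using const_mem_ext_ideal[OF id one_closed] m.I_notcarr m.one_imp_carrier by blast
    then show "carrier (PR V) \<noteq> ext_ideal V m" using const_closed[OF one_closed] by blast
    fix P Q assume PQ: "P \<in> carrier (PR V)" "Q \<in> carrier (PR V)" "P \<otimes>\<^bsub>PR V\<^esub> Q \<in> ext_ideal V m"
    have "((+>) m \<circ> P) \<otimes>\<^bsub>k.PR V\<^esub> ((+>) m \<circ> Q) = \<zero>\<^bsub>k.PR V\<^esub>"
      using coset_map_zero[OF id c.R.m_closed[OF PQ(1,2)]] PQ by simp
    then show "P \<in> ext_ideal V m \<or> Q \<in> ext_ideal V m"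
      using G.integral[of "(+>) m \<circ> P" "(+>) m \<circ> Q"] coset_map_zero[OF id, where V = V] PQ(1,2) by auto
  qed
qed

text \<open>\<open>factorial_ideal\<close> over the field R/m, lifted along the reduction. Its
  kernel \<open>ext_ideal V m\<close> lies in \<open>A\<close>, so membership in \<open>A\<close>
  can be tested after reduction. As the kernel is prime, \<open>z\<close> and \<open>w\<close> form
  a regular sequence modulo it.\<close>

lemma ideal_mod_maximal_gcd:
  assumes max: "maximalideal m R" "finite V" and A: "ideal A (PR V)" "ext_ideal V m \<subseteq> A"
    and a: "a \<in> A" "a \<notin> ext_ideal V m"
  obtains f z w where "f \<in> carrier (PR V)" "z \<in> carrier (PR V)" "w \<in> carrier (PR V)"
    "f \<notin> ext_ideal V m" "z \<notin> ext_ideal V m" "f \<otimes>\<^bsub>PR V\<^esub> z \<in> A" "f \<otimes>\<^bsub>PR V\<^esub> w \<in> A"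
    "\<And>b. b \<in> A \<Longrightarrow> \<exists>g\<in>carrier (PR V). b \<ominus>\<^bsub>PR V\<^esub> f \<otimes>\<^bsub>PR V\<^esub> g \<in> ext_ideal V m"
    "cring.nzd_on (PR V) w (carrier (PR V)) (cring.extend (PR V) (carrier (PR V)) (ext_ideal V m) z)"
proof -
  interpret P: cring "PR V" by (rule PR_cring)
  interpret m: maximalideal m R by (rule assms)
  interpret k: field "R Quot m" by (rule m.quotient_is_field[OF is_cring])
  note hom = m.rcos_ring_hom_cring[OF is_cring]
  interpret G: domain "k.PR V" by (rule k.PR_domain[OF max(2)])
  interpret c: ring_hom_cring "PR V" "k.PR V" "(\<circ>) ((+>) m)"
    by (rule coefficient_map_hom[OF hom])
  note id = m.is_ideal
  note zero = coset_map_zero[OF id, where V = V]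
  note Ac = P.ideal_sub[OF A(1)]
  note eid = ext_ideal_ideal[OF id, of V]
  let ?c = "(\<circ>) ((+>) m)"
  have surj: "\<exists>P\<in>carrier (PR V). ?c P = Q" if "Q \<in> carrier (k.PR V)" for Q
  proof -
    have "(+>) m ` carrier R = carrier (R Quot m)" by (auto simp: FactRing_def A_RCOSETS_def')
    then show ?thesis using coefficient_map_surj[OF hom _ that] by metis
  qed
  have eq: "?c P = ?c Q \<longleftrightarrow> P \<ominus>\<^bsub>PR V\<^esub> Q \<in> ext_ideal V m" if "P \<in> carrier (PR V)" "Q \<in> carrier (PR V)" for P Q
  proof -
    have "?c (P \<ominus>\<^bsub>PR V\<^esub> Q) = ?c P \<ominus>\<^bsub>k.PR V\<^esub> ?c Q" using that by (simp add: a_minus_def)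
    then show ?thesis using zero[of "P \<ominus>\<^bsub>PR V\<^esub> Q"] that by (metis G.r_right_minus_eq P.minus_closed c.hom_closed)
  qed
  have memA: "P \<in> A" if P: "P \<in> carrier (PR V)" and cP: "?c P \<in> ?c ` A" for P
  proof -
    obtain b where b: "b \<in> A" "?c P = ?c b" using cP by blast
    have "P \<ominus>\<^bsub>PR V\<^esub> b \<in> A" using eq[of P b] P b Ac A(2) by blast
    then show ?thesis using P.ideal_diff_cancel[OF A(1) _ b(1) P] by blast
  qed
  have "ideal (?c ` A) (k.PR V)"
  proof (rule G.ideal_intro)
    show "?c ` A \<subseteq> carrier (k.PR V)" using Ac by auto
    show "\<zero>\<^bsub>k.PR V\<^esub> \<in> ?c ` A" using P.ideal_zero[OF A(1)] c.hom_zero by (metis image_eqI)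
    fix x assume "x \<in> ?c ` A"
    then obtain p where p: "p \<in> A" "x = ?c p" by blast
    have pc: "p \<in> carrier (PR V)" using p Ac by blast
    show "x \<oplus>\<^bsub>k.PR V\<^esub> y \<in> ?c ` A" if y: "y \<in> ?c ` A" for y
    proof -
      obtain q where q: "q \<in> A" "y = ?c q" using y by blast
      have "?c (p \<oplus>\<^bsub>PR V\<^esub> q) = x \<oplus>\<^bsub>k.PR V\<^esub> y"
        unfolding p(2) q(2) by (rule c.hom_add[OF pc]) (use q Ac in blast)
      then show ?thesis using P.ideal_add[OF A(1) p(1) q(1)] by (metis image_eqI)
    qed
    show "y \<otimes>\<^bsub>k.PR V\<^esub> x \<in> ?c ` A" if y: "y \<in> carrier (k.PR V)" for y
    proof -
      obtain q where q: "q \<in> carrier (PR V)" "?c q = y" using surj[OF y] by blast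
      have "?c (q \<otimes>\<^bsub>PR V\<^esub> p) = y \<otimes>\<^bsub>k.PR V\<^esub> x" using p q pc by auto
      then show ?thesis using P.ideal_mult[OF A(1) p(1) q(1)] by (metis image_eqI)
    qed
  qed
  moreover have "?c a \<noteq> \<zero>\<^bsub>k.PR V\<^esub>" using zero a Ac by blast
  ultimately obtain f' z' w' where *: "f' \<in> carrier (k.PR V)" "?c ` A \<subseteq> PIdl\<^bsub>k.PR V\<^esub> f'"
    "z' \<in> carrier (k.PR V)" "w' \<in> carrier (k.PR V)" "f' \<noteq> \<zero>\<^bsub>k.PR V\<^esub>" "z' \<noteq> \<zero>\<^bsub>k.PR V\<^esub>"
    "f' \<otimes>\<^bsub>k.PR V\<^esub> z' \<in> ?c ` A" "f' \<otimes>\<^bsub>k.PR V\<^esub> w' \<in> ?c ` A"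
    "\<And>g. \<lbrakk>g \<in> carrier (k.PR V); w' \<otimes>\<^bsub>k.PR V\<^esub> g \<in> PIdl\<^bsub>k.PR V\<^esub> z'\<rbrakk> \<Longrightarrow> g \<in> PIdl\<^bsub>k.PR V\<^esub> z'"
    using G.factorial_ideal[OF k.PR_factorial[OF max(2)] _ _, of "?c ` A" "?c a"] a(1) by blast
  obtain f where f: "f \<in> carrier (PR V)" "?c f = f'" using surj * by blast
  obtain z where z: "z \<in> carrier (PR V)" "?c z = z'" using surj * by blast
  obtain w where w: "w \<in> carrier (PR V)" "?c w = w'" using surj * by blast
  show ?thesis
  proof (rule that[OF f(1) z(1) w(1)])
    show "f \<notin> ext_ideal V m" using zero[OF f(1)] f(2) *(5) by simp
    show "z \<notin> ext_ideal V m" using zero[OF z(1)] z(2) *(6) by simp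
    have "?c (f \<otimes>\<^bsub>PR V\<^esub> z) \<in> ?c ` A" "?c (f \<otimes>\<^bsub>PR V\<^esub> w) \<in> ?c ` A"
      using *(7,8) f z w by simp_all
    then show "f \<otimes>\<^bsub>PR V\<^esub> z \<in> A" "f \<otimes>\<^bsub>PR V\<^esub> w \<in> A"
      using memA P.m_closed[OF f(1) z(1)] P.m_closed[OF f(1) w(1)] by blast+
    show "\<exists>g\<in>carrier (PR V). b \<ominus>\<^bsub>PR V\<^esub> f \<otimes>\<^bsub>PR V\<^esub> g \<in> ext_ideal V m" if b: "b \<in> A" for b
    proof -
      obtain h where h: "h \<in> carrier (k.PR V)" "?c b = f' \<otimes>\<^bsub>k.PR V\<^esub> h" using *(1,2) b G.PIdlE by blast
      obtain g where g: "g \<in> carrier (PR V)" "?c g = h" using surj h by blast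
      have "?c b = ?c (f \<otimes>\<^bsub>PR V\<^esub> g)" using h f g by simp
      then show ?thesis using eq[of b "f \<otimes>\<^bsub>PR V\<^esub> g"] b Ac f g by blast
    qed
    show "P.nzd_on w (carrier (PR V)) (P.extend (carrier (PR V)) (ext_ideal V m) z)"
      unfolding P.nzd_on_def
    proof (intro ballI impI)
      fix p assume p: "p \<in> carrier (PR V)" "w \<otimes>\<^bsub>PR V\<^esub> p \<in> P.extend (carrier (PR V)) (ext_ideal V m) z"
      then obtain e g where e: "w \<otimes>\<^bsub>PR V\<^esub> p = e \<oplus>\<^bsub>PR V\<^esub> z \<otimes>\<^bsub>PR V\<^esub> g" "e \<in> ext_ideal V m" "g \<in> carrier (PR V)"
        by (auto simp: P.extend_def)
      have ec: "e \<in> carrier (PR V)" using e(2) by (simp add: ext_ideal_def)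
      have "w' \<otimes>\<^bsub>k.PR V\<^esub> ?c p = ?c (w \<otimes>\<^bsub>PR V\<^esub> p)" using w p by simp
      also have "\<dots> = z' \<otimes>\<^bsub>k.PR V\<^esub> ?c g" unfolding e(1) using e(3) ec z zero[OF ec] e(2) c.hom_closed[OF e(3)] *(3) by simp
      finally have "w' \<otimes>\<^bsub>k.PR V\<^esub> ?c p \<in> PIdl\<^bsub>k.PR V\<^esub> z'" using G.mult_mem_PIdl *(3) e(3) by simp
      then have "?c p \<in> PIdl\<^bsub>k.PR V\<^esub> z'" using *(9) p by simp
      then obtain h where h: "h \<in> carrier (k.PR V)" "?c p = z' \<otimes>\<^bsub>k.PR V\<^esub> h" using *(3) G.PIdlE by blast
      obtain q where q: "q \<in> carrier (PR V)" "?c q = h" using surj h by blast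
      have "?c p = ?c (z \<otimes>\<^bsub>PR V\<^esub> q)" using h z q by simp
      then have "p \<ominus>\<^bsub>PR V\<^esub> z \<otimes>\<^bsub>PR V\<^esub> q \<in> ext_ideal V m" using eq[of p "z \<otimes>\<^bsub>PR V\<^esub> q"] p z q by simp
      moreover have "p = (p \<ominus>\<^bsub>PR V\<^esub> z \<otimes>\<^bsub>PR V\<^esub> q) \<oplus>\<^bsub>PR V\<^esub> z \<otimes>\<^bsub>PR V\<^esub> q"
        using p(1) z(1) q(1) by (simp add: a_minus_def P.a_assoc P.l_neg)
      ultimately show "p \<in> P.extend (carrier (PR V)) (ext_ideal V m) z"
        unfolding P.extend_def using q(1) by blast
    qed
  qed
qed

end

section \<open>The ideal of linear relations\<close>

context simple_ext
begin

lemma coef_linear_mult: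
  assumes "c \<in> C" "w \<in> C" "p \<in> carrier R"
  shows "coef ((c \<otimes> x \<oplus> w) \<otimes> p) (Suc k) = c \<otimes> coef p k \<oplus> w \<otimes> coef p (Suc k)"
    "coef ((c \<otimes> x \<oplus> w) \<otimes> p) 0 = w \<otimes> coef p 0"
proof -
  have "(c \<otimes> x \<oplus> w) \<otimes> p = c \<otimes> (x \<otimes> p) \<oplus> w \<otimes> p"
    using C_carrier[OF assms(1)] C_carrier[OF assms(2)] assms(3) x by algebra
  then show "coef ((c \<otimes> x \<oplus> w) \<otimes> p) (Suc k) = c \<otimes> coef p k \<oplus> w \<otimes> coef p (Suc k)"
    "coef ((c \<otimes> x \<oplus> w) \<otimes> p) 0 = w \<otimes> coef p 0"
    using C_carrier assms x coef_carrier by (simp_all add: coef_add coef_scale coef_xS coef_x0)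
qed

text \<open>The top coefficient of (cx + w)p is c times that of p. Regularity of c puts the latter
  into \<open>Y\<close>, and the top term of p can be removed.\<close>

lemma nzd_linear:
  assumes cw: "c \<in> C" "w \<in> C" and Y: "stable Y" and reg: "nzd_on c (carrier R) Y"
  shows "nzd_on (c \<otimes> x \<oplus> w) (carrier R) Y"
proof -
  note id = stable_ideal[OF Y]
  let ?v = "c \<otimes> x \<oplus> w"
  have v: "?v \<in> carrier R" using C_carrier cw x by simp
  have "deg_less p n \<Longrightarrow> ?v \<otimes> p \<in> Y \<Longrightarrow> p \<in> Y" for p n
  proof (induction n arbitrary: p)
    case 0 then show ?case using deg_less_0 ideal_zero[OF id] by blast
  next
    case (Suc n)
    let ?t = "coef p n \<otimes> x [^] n"
    have pc: "p \<in> carrier R" using Suc.prems deg_less_carrier by blast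
    have tc: "?t \<in> carrier R" using coef_carrier[OF pc] x by simp
    have "coef (?v \<otimes> p) (Suc n) = c \<otimes> coef p n"
      using coef_linear_mult(1)[OF cw pc, of n] Suc.prems(1) C_carrier cw coef_carrier[OF pc] by (simp add: deg_less_def)
    then have "c \<otimes> coef p n \<in> Y" using stable_coef[OF Y Suc.prems(2)] by metis
    then have "coef p n \<in> Y" using nzd_onD[OF reg coef_carrier[OF pc]] by blast
    then have t: "?t \<in> Y" using ideal_mult_right[OF id] x by simp
    have "?v \<otimes> (p \<ominus> ?t) = ?v \<otimes> p \<ominus> ?v \<otimes> ?t" using v pc tc by algebra
    then have "?v \<otimes> (p \<ominus> ?t) \<in> Y" using ideal_diff[OF id Suc.prems(2) ideal_mult[OF id t v]] by simp
    then have "p \<ominus> ?t \<in> Y" using Suc.IH[OF deg_less_reduce[OF Suc.prems(1)]] by blast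
    then show ?case using ideal_diff_cancel[OF id _ t pc] by blast
  qed
  then show ?thesis using deg_less_ex unfolding nzd_on_def by blast
qed

lemma extend_stable:
  assumes "c \<in> C" "stable Y"
  shows "stable (extend (carrier R) Y c)"
  unfolding stable_def
proof (intro conjI ballI allI)
  note id = stable_ideal[OF assms(2)]
  show "ideal (extend (carrier R) Y c) R" by (rule extend_ideal[OF oneideal id C_carrier[OF assms(1)]])
  fix p k assume "p \<in> extend (carrier R) Y c"
  then obtain y g where p: "p = y \<oplus> c \<otimes> g" "y \<in> Y" "g \<in> carrier R" by (auto simp: extend_def)
  have "coef p k = coef y k \<oplus> c \<otimes> coef g k"
    unfolding p(1) using ideal_carrier[OF id p(2)] p(3) assms(1) C_carrier by (simp add: coef_add coef_scale)
  then show "coef p k \<in> extend (carrier R) Y c"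
    unfolding extend_def using stable_coef[OF assms(2) p(2)] coef_carrier[OF p(3)] by blast
qed

text \<open>The coefficients of \<open>p\<close> are treated from the top: each of them turns out to lie in \<open>cB + Y\<close>.\<close>

lemma linear_mult_mem:
  assumes cw: "c \<in> C" "w \<in> C" and Y: "stable Y" and B: "stable B" "Y \<subseteq> B" "c \<in> B"
    and reg: "nzd_on c (carrier R) Y" and regw: "nzd_on w (carrier R) B"
    and wB: "\<And>y. y \<in> B \<Longrightarrow> w \<otimes> y \<in> extend (carrier R) Y c"
    and p: "p \<in> B" "(c \<otimes> x \<oplus> w) \<otimes> p \<in> extend (carrier R) Y (c \<otimes> c)"
  shows "p \<in> extend B Y c"
proof -
  note Yid = stable_ideal[OF Y] and Bid = stable_ideal[OF B(1)]
  let ?v = "c \<otimes> x \<oplus> w" and ?X = "extend (carrier R) Y (c \<otimes> c)"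
  have cc: "c \<in> carrier R" "w \<in> carrier R" using C_carrier cw by auto
  have v: "?v \<in> carrier R" using cc x by simp
  have Xst: "stable ?X" by (rule extend_stable[OF C_mult[OF cw(1) cw(1)] Y])
  note Xid = stable_ideal[OF Xst]
  have Eid: "ideal (extend B Y c) R" by (rule extend_ideal[OF Bid Yid cc(1)])
  \<comment> \<open>Regularity of c modulo \<open>Y\<close> cancels one factor: ca in Y + c^2 R
    gives a in Y + cR.\<close>
  have cancel: "a \<in> extend (carrier R) Y c" if a: "a \<in> carrier R" "c \<otimes> a \<in> ?X" for a
  proof -
    obtain y g where yg: "c \<otimes> a = y \<oplus> (c \<otimes> c) \<otimes> g" "y \<in> Y" "g \<in> carrier R" using a(2) by (auto simp: extend_def)
    note yc = ideal_carrier[OF Yid yg(2)]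
    have "c \<otimes> (a \<ominus> c \<otimes> g) = c \<otimes> a \<ominus> (c \<otimes> c) \<otimes> g" using cc a(1) yg(3) by algebra
    also have "\<dots> = y" unfolding yg(1) using yc cc yg(3) by algebra
    finally have "c \<otimes> (a \<ominus> c \<otimes> g) \<in> Y" using yg(2) by simp
    moreover have "a \<ominus> c \<otimes> g \<in> carrier R" using cc a(1) yg(3) by simp
    ultimately have "a \<ominus> c \<otimes> g \<in> Y" using nzd_onD[OF reg] by blast
    moreover have "a = (a \<ominus> c \<otimes> g) \<oplus> c \<otimes> g" using cc a(1) yg(3) by algebra
    ultimately show ?thesis unfolding extend_def using yg(3) by blast
  qed
  have EB: "extend (carrier R) Y c \<subseteq> B"
    by (rule extend_least[OF Bid B(2) ideal_mult_right[OF Bid B(3)]])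
  have "deg_less p n \<Longrightarrow> p \<in> B \<Longrightarrow> ?v \<otimes> p \<in> ?X \<Longrightarrow> p \<in> extend B Y c" for n p
  proof (induction n arbitrary: p)
    case 0 then show ?case using deg_less_0 ideal_zero[OF Eid] by blast
  next
    case (Suc n)
    let ?t = "coef p n \<otimes> x [^] n"
    have pc: "p \<in> carrier R" using Suc.prems deg_less_carrier by blast
    have tc: "?t \<in> carrier R" and pn: "coef p n \<in> carrier R" using coef_carrier[OF pc] x by auto
    have top: "coef p (Suc n) = \<zero>" using Suc.prems(1) by (simp add: deg_less_def)
    have "coef (?v \<otimes> p) (Suc n) = c \<otimes> coef p n"
      using coef_linear_mult(1)[OF cw pc, of n] top cc pn by simp
    then have "c \<otimes> coef p n \<in> ?X" using stable_coef[OF Xst Suc.prems(3)] by metis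
    then have "coef p n \<in> extend (carrier R) Y c" using cancel pn by blast
    then obtain y g where yg: "coef p n = y \<oplus> c \<otimes> g" "y \<in> Y" "g \<in> carrier R" by (auto simp: extend_def)
    note yc = ideal_carrier[OF Yid yg(2)]
    \<comment> \<open>The coefficient of degree n of the product contains w times the top
      coefficient of p. Cancelling c shows that the next lower coefficient of p plus wg lies in Y +
      cR, hence in \<open>B\<close>. For n = 0 there is no lower coefficient, and wg itself is
      obtained.\<close>
    have "w \<otimes> g \<in> B"
    proof (cases n)
      case 0
      have "coef (?v \<otimes> p) 0 = w \<otimes> y \<oplus> c \<otimes> (w \<otimes> g)"
        using coef_linear_mult(2)[OF cw pc] yg cc yc 0 by (simp add: r_distr m_lcomm)
      then have "w \<otimes> y \<oplus> c \<otimes> (w \<otimes> g) \<in> ?X" using stable_coef[OF Xst Suc.prems(3)] by metis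
      moreover have "w \<otimes> y \<in> ?X" using extend_upper1[OF oneideal Yid] cc ideal_mult[OF Yid yg(2) cc(2)] by blast
      ultimately have "c \<otimes> (w \<otimes> g) \<in> ?X"
        using ideal_add_cancel[OF Xid, of "c \<otimes> (w \<otimes> g)" "w \<otimes> y"] a_comm cc yc yg(3) by simp
      then show ?thesis using cancel[of "w \<otimes> g"] EB cc yg(3) by blast
    next
      case (Suc k)
      have qk: "coef p k \<in> carrier R" using coef_carrier[OF pc] .
      have "coef (?v \<otimes> p) n = c \<otimes> coef p k \<oplus> w \<otimes> (y \<oplus> c \<otimes> g)"
        using coef_linear_mult(1)[OF cw pc, of k] yg(1) Suc by simp
      also have "\<dots> = c \<otimes> (coef p k \<oplus> w \<otimes> g) \<oplus> w \<otimes> y" using cc qk yc yg(3) by algebra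
      finally have "c \<otimes> (coef p k \<oplus> w \<otimes> g) \<oplus> w \<otimes> y \<in> ?X"
        using stable_coef[OF Xst Suc.prems(3)] by metis
      moreover have "w \<otimes> y \<in> ?X" using extend_upper1[OF oneideal Yid] cc ideal_mult[OF Yid yg(2) cc(2)] by blast
      ultimately have "c \<otimes> (coef p k \<oplus> w \<otimes> g) \<in> ?X"
        using ideal_add_cancel[OF Xid] cc qk yg(3) by simp
      then have "coef p k \<oplus> w \<otimes> g \<in> B" using cancel[of "coef p k \<oplus> w \<otimes> g"] EB cc qk yg(3) by blast
      then show ?thesis
        using ideal_add_cancel[OF Bid, of "w \<otimes> g" "coef p k"] stable_coef[OF B(1) Suc.prems(2)] a_comm cc qk yg(3) by simp
    qed
    then have g: "g \<in> B" using nzd_onD[OF regw yg(3)] by blast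
    then have "coef p n \<in> extend B Y c" unfolding yg(1) extend_def using yg(2) by blast
    then have t: "?t \<in> extend B Y c" using ideal_mult_right[OF Eid] x by simp
    have tB: "?t \<in> B" using stable_coef[OF B(1) Suc.prems(2)] ideal_mult_right[OF Bid] x by simp
    \<comment> \<open>The hypothesis on wB makes the product with the top term a member of Y + c^2
      R, so this term may be subtracted and the degree drops.\<close>
    obtain y' g' where yg': "w \<otimes> g = y' \<oplus> c \<otimes> g'" "y' \<in> Y" "g' \<in> carrier R" using wB[OF g] by (auto simp: extend_def)
    note yc' = ideal_carrier[OF Yid yg'(2)]
    have xn: "x [^] n \<in> carrier R" using x by simp
    have "?v \<otimes> ?t = (?v \<otimes> x [^] n) \<otimes> y \<oplus> (c \<otimes> x [^] n) \<otimes> (w \<otimes> g) \<oplus> (c \<otimes> c) \<otimes> (x \<otimes> x [^] n \<otimes> g)"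
      unfolding yg(1) using cc x xn yc yg(3) by algebra
    also have "\<dots> = ((?v \<otimes> x [^] n) \<otimes> y \<oplus> (c \<otimes> x [^] n) \<otimes> y') \<oplus> (c \<otimes> c) \<otimes> (x [^] n \<otimes> g' \<oplus> x \<otimes> x [^] n \<otimes> g)"
      unfolding yg'(1) using cc x xn yc yg(3) yc' yg'(3) by algebra
    finally have "?v \<otimes> ?t = ((?v \<otimes> x [^] n) \<otimes> y \<oplus> (c \<otimes> x [^] n) \<otimes> y') \<oplus> (c \<otimes> c) \<otimes> (x [^] n \<otimes> g' \<oplus> x \<otimes> x [^] n \<otimes> g)" .
    moreover have "(?v \<otimes> x [^] n) \<otimes> y \<oplus> (c \<otimes> x [^] n) \<otimes> y' \<in> Y"
      using ideal_add[OF Yid] ideal_mult[OF Yid yg(2), of "?v \<otimes> x [^] n"] ideal_mult[OF Yid yg'(2), of "c \<otimes> x [^] n"] cc xn v by simp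
    moreover have "x [^] n \<otimes> g' \<oplus> x \<otimes> x [^] n \<otimes> g \<in> carrier R" using x xn yg(3) yg'(3) by simp
    ultimately have "?v \<otimes> ?t \<in> ?X" unfolding extend_def by blast
    moreover have "?v \<otimes> (p \<ominus> ?t) = ?v \<otimes> p \<ominus> ?v \<otimes> ?t" using v pc tc by algebra
    ultimately have "?v \<otimes> (p \<ominus> ?t) \<in> ?X" using ideal_diff[OF Xid Suc.prems(3)] by simp
    then have "p \<ominus> ?t \<in> extend B Y c"
      using Suc.IH[OF deg_less_reduce[OF Suc.prems(1)] ideal_diff[OF Bid Suc.prems(2) tB]] by blast
    then show ?case using ideal_diff_cancel[OF Eid _ t pc] by blast
  qed
  then show ?thesis using deg_less_ex[OF ideal_carrier[OF Bid p(1)]] p by blast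
qed

end

text \<open>Used twice: in R it evaluates a relation at the elements c_i, in the polynomial ring it
  is the linear form in the variables. The recursion on the length matches the step from
  \<open>J j\<close> to \<open>J (Suc j)\<close>.\<close>

primrec csum :: "('a, 'b) ring_scheme \<Rightarrow> (nat \<Rightarrow> 'a) \<Rightarrow> (nat \<Rightarrow> 'a) \<Rightarrow> nat \<Rightarrow> 'a" where
  "csum R s c 0 = \<zero>\<^bsub>R\<^esub>"
| "csum R s c (Suc j) = csum R s c j \<oplus>\<^bsub>R\<^esub> s j \<otimes>\<^bsub>R\<^esub> c j"

context cring
begin

lemma csum_closed: "\<lbrakk>\<And>i. i < j \<Longrightarrow> s i \<in> carrier R; \<And>i. i < j \<Longrightarrow> c i \<in> carrier R\<rbrakk> \<Longrightarrow> csum R s c j \<in> carrier R"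
  by (induction j) auto

lemma csum_cong: "(\<And>i. i < j \<Longrightarrow> s i = s' i) \<Longrightarrow> csum R s c j = csum R s' c j"
  by (induction j) auto

lemma csum_add:
  "\<lbrakk>\<And>i. i < j \<Longrightarrow> s i \<in> carrier R; \<And>i. i < j \<Longrightarrow> s' i \<in> carrier R; \<And>i. i < j \<Longrightarrow> c i \<in> carrier R\<rbrakk> \<Longrightarrow>
    csum R (\<lambda>i. s i \<oplus> s' i) c j = csum R s c j \<oplus> csum R s' c j"
proof (induction j)
  case (Suc j)
  have c: "csum R s c j \<in> carrier R" "csum R s' c j \<in> carrier R" "s j \<in> carrier R" "s' j \<in> carrier R" "c j \<in> carrier R"
    using Suc by (auto intro!: csum_closed)
  have "csum R (\<lambda>i. s i \<oplus> s' i) c (Suc j) = (csum R s c j \<oplus> csum R s' c j) \<oplus> (s j \<oplus> s' j) \<otimes> c j" using Suc by simp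
  also have "\<dots> = csum R s c (Suc j) \<oplus> csum R s' c (Suc j)" unfolding csum.simps using c by algebra
  finally show ?case .
qed simp

lemma csum_scale:
  "\<lbrakk>r \<in> carrier R; \<And>i. i < j \<Longrightarrow> s i \<in> carrier R; \<And>i. i < j \<Longrightarrow> c i \<in> carrier R\<rbrakk> \<Longrightarrow>
    csum R (\<lambda>i. r \<otimes> s i) c j = r \<otimes> csum R s c j"
proof (induction j)
  case (Suc j)
  have c: "csum R s c j \<in> carrier R" "s j \<in> carrier R" "c j \<in> carrier R"
    using Suc by (auto intro!: csum_closed)
  have "csum R (\<lambda>i. r \<otimes> s i) c (Suc j) = r \<otimes> csum R s c j \<oplus> (r \<otimes> s j) \<otimes> c j" using Suc by simp
  also have "\<dots> = r \<otimes> csum R s c (Suc j)" unfolding csum.simps using c Suc.prems(1) by algebra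
  finally show ?case .
qed simp

lemma csum_delta:
  "\<lbrakk>r \<in> carrier R; \<And>i. i < j \<Longrightarrow> c i \<in> carrier R\<rbrakk> \<Longrightarrow>
    csum R (\<lambda>k. if k = i then r else \<zero>) c j = (if i < j then r \<otimes> c i else \<zero>)"
  by (induction j) (auto simp: less_Suc_eq)

lemma csum_ideal: "\<lbrakk>ideal I R; \<And>i. i < j \<Longrightarrow> s i \<otimes> c i \<in> I\<rbrakk> \<Longrightarrow> csum R s c j \<in> I"
  by (induction j) (auto simp: ideal_zero ideal_add)

lemma mem_genideal_csum:
  assumes "\<And>i. c i \<in> carrier R"
  shows "r \<in> Idl (c ` {..<j}) \<longleftrightarrow> (\<exists>s. (\<forall>i. s i \<in> carrier R) \<and> r = csum R s c j)"
proof
  have sub: "c ` {..<j} \<subseteq> carrier R" using assms by auto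
  note id = genideal_ideal[OF sub]
  show "r \<in> Idl (c ` {..<j})" if *: "\<exists>s. (\<forall>i. s i \<in> carrier R) \<and> r = csum R s c j"
  proof -
    obtain s where s: "\<forall>i. s i \<in> carrier R" "r = csum R s c j" using * by blast
    show ?thesis unfolding s(2)
    proof (rule csum_ideal[OF id])
      show "s i \<otimes> c i \<in> Idl (c ` {..<j})" if "i < j" for i
        using ideal_mult[OF id, of "c i" "s i"] s(1) subsetD[OF genideal_self[OF sub], of "c i"] that by simp
    qed
  qed
  have "ideal {csum R s c j | s. \<forall>i. s i \<in> carrier R} R"
  proof (rule ideal_intro)
    show "{csum R s c j | s. \<forall>i. s i \<in> carrier R} \<subseteq> carrier R" using assms by (auto intro!: csum_closed)
    have "csum R (\<lambda>i. \<zero>) c j = \<zero>" using assms by (induction j) auto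
    then show "\<zero> \<in> {csum R s c j | s. \<forall>i. s i \<in> carrier R}" by (intro CollectI exI[of _ "\<lambda>i. \<zero>"]) auto
    fix a assume "a \<in> {csum R s c j | s. \<forall>i. s i \<in> carrier R}"
    then obtain s where s: "a = csum R s c j" "\<forall>i. s i \<in> carrier R" by blast
    show "a \<oplus> b \<in> {csum R s c j | s. \<forall>i. s i \<in> carrier R}" if b: "b \<in> {csum R s c j | s. \<forall>i. s i \<in> carrier R}" for b
    proof -
      obtain s' where "b = csum R s' c j" "\<forall>i. s' i \<in> carrier R" using b by blast
      then show ?thesis using s csum_add[of j s s' c] assms by (intro CollectI exI[of _ "\<lambda>i. s i \<oplus> s' i"]) auto
    qed
    show "t \<otimes> a \<in> {csum R s c j | s. \<forall>i. s i \<in> carrier R}" if "t \<in> carrier R" for t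
      using s csum_scale[of t j s c] assms that by (intro CollectI exI[of _ "\<lambda>i. t \<otimes> s i"]) auto
  qed
  moreover have "c ` {..<j} \<subseteq> {csum R s c j | s. \<forall>i. s i \<in> carrier R}"
  proof
    fix y assume "y \<in> c ` {..<j}"
    then obtain i where "i < j" "y = c i" by blast
    then show "y \<in> {csum R s c j | s. \<forall>i. s i \<in> carrier R}"
      using csum_delta[OF one_closed, of j c i] assms by (intro CollectI exI[of _ "\<lambda>k. if k = i then \<one> else \<zero>"]) auto
  qed
  ultimately have "Idl (c ` {..<j}) \<subseteq> {csum R s c j | s. \<forall>i. s i \<in> carrier R}" by (rule genideal_minimal)
  then show "\<exists>s. (\<forall>i. s i \<in> carrier R) \<and> r = csum R s c j" if "r \<in> Idl (c ` {..<j})" using that by blast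
qed

lemma genideal_csum_Suc:
  assumes "\<And>i. c i \<in> carrier R"
  shows "Idl (c ` {..<Suc j}) = extend (carrier R) (Idl (c ` {..<j})) (c j)"
proof
  show "Idl (c ` {..<Suc j}) \<subseteq> extend (carrier R) (Idl (c ` {..<j})) (c j)"
  proof
    fix r assume "r \<in> Idl (c ` {..<Suc j})"
    then obtain s where s: "\<forall>i. s i \<in> carrier R" "r = csum R s c (Suc j)"
      using iffD1[OF mem_genideal_csum[where c = c, OF assms]] by metis
    have "csum R s c j \<in> Idl (c ` {..<j})"
      using s(1) by (intro iffD2[OF mem_genideal_csum[where c = c, OF assms]] exI[of _ s]) simp
    then show "r \<in> extend (carrier R) (Idl (c ` {..<j})) (c j)"
      unfolding s(2) csum.simps extend_def m_comm[OF s(1)[rule_format] assms] using s(1) by blast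
  qed
  show "extend (carrier R) (Idl (c ` {..<j})) (c j) \<subseteq> Idl (c ` {..<Suc j})"
  proof
    fix r assume "r \<in> extend (carrier R) (Idl (c ` {..<j})) (c j)"
    then obtain y t where yt: "r = y \<oplus> c j \<otimes> t" "y \<in> Idl (c ` {..<j})" "t \<in> carrier R"
      unfolding extend_def by blast
    obtain s where s: "\<forall>i. s i \<in> carrier R" "y = csum R s c j"
      using iffD1[OF mem_genideal_csum[where c = c, OF assms] yt(2)] by blast
    have "csum R (s(j := t)) c (Suc j) = r"
      using csum_cong[of j "s(j := t)" s c] m_comm[OF assms yt(3)] by (simp add: yt(1) s(2))
    moreover have "\<forall>i. (s(j := t)) i \<in> carrier R" using s(1) yt(3) by simp
    ultimately show "r \<in> Idl (c ` {..<Suc j})"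
      by (intro iffD2[OF mem_genideal_csum[where c = c, OF assms]] exI[of _ "s(j := t)"]) simp
  qed
qed

text \<open>The domain of a congruence as in \<open>grade_ge_iso\<close> is an ideal, so totality
  has to be checked on generators only. The identification of \<open>L (Suc j)/L j\<close> rests on
  this.\<close>

lemma relation_ideal:
  assumes "ideal B R" "ideal Z R" "\<alpha> \<in> carrier R" "\<beta> \<in> carrier R"
  shows "ideal {p \<in> carrier R. \<exists>q\<in>B. \<alpha> \<otimes> p \<ominus> \<beta> \<otimes> q \<in> Z} R"
proof (rule ideal_intro)
  show "\<zero> \<in> {p \<in> carrier R. \<exists>q\<in>B. \<alpha> \<otimes> p \<ominus> \<beta> \<otimes> q \<in> Z}"
    using assms ideal_zero by (auto simp: a_minus_def intro!: bexI[of _ \<zero>])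
  fix a assume "a \<in> {p \<in> carrier R. \<exists>q\<in>B. \<alpha> \<otimes> p \<ominus> \<beta> \<otimes> q \<in> Z}"
  then obtain q where q: "a \<in> carrier R" "q \<in> B" "\<alpha> \<otimes> a \<ominus> \<beta> \<otimes> q \<in> Z" by blast
  note qc = ideal_carrier[OF assms(1) q(2)]
  show "a \<oplus> b \<in> {p \<in> carrier R. \<exists>q\<in>B. \<alpha> \<otimes> p \<ominus> \<beta> \<otimes> q \<in> Z}" if b: "b \<in> {p \<in> carrier R. \<exists>q\<in>B. \<alpha> \<otimes> p \<ominus> \<beta> \<otimes> q \<in> Z}" for b
  proof -
    obtain q' where q': "b \<in> carrier R" "q' \<in> B" "\<alpha> \<otimes> b \<ominus> \<beta> \<otimes> q' \<in> Z" using b by blast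
    note qc' = ideal_carrier[OF assms(1) q'(2)]
    have "\<alpha> \<otimes> (a \<oplus> b) \<ominus> \<beta> \<otimes> (q \<oplus> q') = (\<alpha> \<otimes> a \<ominus> \<beta> \<otimes> q) \<oplus> (\<alpha> \<otimes> b \<ominus> \<beta> \<otimes> q')"
      using assms(3,4) q(1) qc q'(1) qc' by algebra
    then have "\<alpha> \<otimes> (a \<oplus> b) \<ominus> \<beta> \<otimes> (q \<oplus> q') \<in> Z" using ideal_add[OF assms(2) q(3) q'(3)] by simp
    then show ?thesis using ideal_add[OF assms(1) q(2) q'(2)] q(1) q'(1) by blast
  qed
  show "t \<otimes> a \<in> {p \<in> carrier R. \<exists>q\<in>B. \<alpha> \<otimes> p \<ominus> \<beta> \<otimes> q \<in> Z}" if t: "t \<in> carrier R" for t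
  proof -
    have "\<alpha> \<otimes> (t \<otimes> a) \<ominus> \<beta> \<otimes> (t \<otimes> q) = t \<otimes> (\<alpha> \<otimes> a \<ominus> \<beta> \<otimes> q)" using assms(3,4) q(1) qc t by algebra
    then have "\<alpha> \<otimes> (t \<otimes> a) \<ominus> \<beta> \<otimes> (t \<otimes> q) \<in> Z" using ideal_mult[OF assms(2) q(3) t] by simp
    then show ?thesis using ideal_mult[OF assms(1) q(2) t] q(1) t by blast
  qed
qed auto

text \<open>On the zero module even 0 is regular.\<close>

lemma grade_ge_full: "\<lbrakk>ideal Q R; U \<subseteq> Y; ideal U R; ideal Y R\<rbrakk> \<Longrightarrow> grade_ge Q n U Y"
proof (induction n arbitrary: Y)
  case (Suc n)
  have "nzd_on \<zero> U Y" using Suc.prems by (auto simp: nzd_on_def)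
  moreover have "U \<subseteq> extend U Y \<zero>" using extend_upper1[OF Suc.prems(3,4) zero_closed] Suc.prems by blast
  then have "grade_ge Q n U (extend U Y \<zero>)"
    using Suc.IH[of "extend U Y \<zero>"] Suc.prems extend_ideal[OF Suc.prems(3,4)] by blast
  ultimately show ?case using ideal_zero[OF Suc.prems(1)] by auto
qed simp

end

text \<open>The regular sequence is \<open>c 0\<close>, ..., \<open>c (d - 1)\<close>, generating
  \<open>m\<close> up to radical, and \<open>c d\<close> is the additional generator, so that
  \<open>J (Suc d)\<close> below is the almost complete intersection. Positivity of \<open>d\<close>
  makes \<open>c 0\<close> a member of the regular sequence, which serves as denominator.\<close>

locale parameter_system = cring R for R (structure) +
  fixes m :: "'a set" and c :: "nat \<Rightarrow> 'a" and d :: nat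
  assumes noeth: "noetherian_ring R" and max: "maximalideal m R"
    and c_closed: "c i \<in> carrier R" and c_m: "i < d \<Longrightarrow> c i \<in> m"
    and c_reg: "\<lbrakk>i < d; r \<in> carrier R; c i \<otimes> r \<in> Idl (c ` {..<i})\<rbrakk> \<Longrightarrow> r \<in> Idl (c ` {..<i})"
    and c_rad: "r \<in> m \<Longrightarrow> \<exists>n::nat. r [^] n \<in> Idl (c ` {..<d})"
    and d_pos: "0 < d"
begin

abbreviation "P \<equiv> indexed_poly_ring R {..d}"
abbreviation \<kappa> :: "'a \<Rightarrow> nat multiset \<Rightarrow> 'a" where "\<kappa> \<equiv> indexed_const"
abbreviation T :: "nat \<Rightarrow> nat multiset \<Rightarrow> 'a" where "T \<equiv> indexed_var"
abbreviation "J j \<equiv> Idl (c ` {..<j})"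
abbreviation "ext I \<equiv> ext_ideal {..d} I"

sublocale P: cring P by (rule PR_cring)
sublocale const: ring_hom_cring R P \<kappa> by (rule const_hom)

definition lin :: "(nat \<Rightarrow> 'a) \<Rightarrow> nat \<Rightarrow> nat multiset \<Rightarrow> 'a" where
  "lin s j = csum P (\<lambda>i. \<kappa> (s i)) T j"

definition L :: "nat \<Rightarrow> (nat multiset \<Rightarrow> 'a) set" where
  "L j = Idl\<^bsub>P\<^esub> {lin s j | s. (\<forall>i. s i \<in> carrier R) \<and> csum R s c j = \<zero>}"

definition K :: "nat \<Rightarrow> 'a set" where
  "K j = colon (J j) (c j)"

lemma noeth_P: "noetherian_ring P"
  by (rule PR_noetherian[OF noeth]) simp

lemma J_ideal: "ideal (J j) R"
  using c_closed by (intro genideal_ideal) auto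

lemma J_mem: "r \<in> J j \<longleftrightarrow> (\<exists>s. (\<forall>i. s i \<in> carrier R) \<and> r = csum R s c j)"
  by (rule mem_genideal_csum[OF c_closed])

lemma csum_in_J: "(\<forall>i. s i \<in> carrier R) \<Longrightarrow> csum R s c j \<in> J j"
  using J_mem by blast

lemma J_Suc: "J (Suc j) = extend (carrier R) (J j) (c j)"
  by (rule genideal_csum_Suc[OF c_closed])

lemma J_0: "J 0 = {\<zero>}"
  using J_mem[of _ 0] by (auto intro!: exI[of _ "\<lambda>_. \<zero>"])

lemma J_Suc_sub: "J j \<subseteq> J (Suc j)"
  unfolding J_Suc by (rule extend_upper1[OF oneideal J_ideal c_closed])

lemma J_mono: "i \<le> j \<Longrightarrow> J i \<subseteq> J j"
  using J_Suc_sub by (rule lift_Suc_mono_le)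

lemma c_in_J: "i < j \<Longrightarrow> c i \<in> J j"
  using genideal_self[of "c ` {..<j}"] c_closed by auto

lemma K_ideal: "ideal (K j) R"
  unfolding K_def by (rule colon_ideal[OF J_ideal c_closed])

lemma J_sub_K: "J j \<subseteq> K j"
  using ideal_carrier[OF J_ideal] ideal_mult_right[OF J_ideal _ c_closed] by (auto simp: K_def colon_def)

lemma K_eq_J: "j < d \<Longrightarrow> K j = J j"
  using J_sub_K c_reg m_comm c_closed by (fastforce simp: K_def colon_def)

lemma c_nzd: "j < d \<Longrightarrow> nzd_on (c j) (carrier R) (J j)"
  using c_reg by (auto simp: nzd_on_def)

lemma T_closed: "i \<le> d \<Longrightarrow> T i \<in> carrier P"
  by (rule var_closed) simp

lemma lin_closed: "\<lbrakk>\<forall>i. s i \<in> carrier R; j \<le> Suc d\<rbrakk> \<Longrightarrow> lin s j \<in> carrier P"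
  unfolding lin_def by (rule P.csum_closed) (auto simp: const_closed T_closed)

lemma lin_Suc: "lin s (Suc j) = lin s j \<oplus>\<^bsub>P\<^esub> \<kappa> (s j) \<otimes>\<^bsub>P\<^esub> T j"
  by (simp add: lin_def)

lemma lin_cong: "(\<And>i. i < j \<Longrightarrow> s i = s' i) \<Longrightarrow> lin s j = lin s' j"
  unfolding lin_def by (rule P.csum_cong) simp

lemma lin_add:
  "\<lbrakk>\<forall>i. s i \<in> carrier R; \<forall>i. s' i \<in> carrier R; j \<le> Suc d\<rbrakk> \<Longrightarrow> lin (\<lambda>i. s i \<oplus> s' i) j = lin s j \<oplus>\<^bsub>P\<^esub> lin s' j"
  unfolding lin_def using P.csum_add[of j "\<lambda>i. \<kappa> (s i)" "\<lambda>i. \<kappa> (s' i)" T] by (simp add: const_closed T_closed)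

lemma lin_scale:
  "\<lbrakk>\<forall>i. s i \<in> carrier R; r \<in> carrier R; j \<le> Suc d\<rbrakk> \<Longrightarrow> lin (\<lambda>i. r \<otimes> s i) j = \<kappa> r \<otimes>\<^bsub>P\<^esub> lin s j"
  unfolding lin_def using P.csum_scale[of "\<kappa> r" j "\<lambda>i. \<kappa> (s i)" T] by (simp add: const_closed T_closed)

lemma lin_delta:
  "\<lbrakk>r \<in> carrier R; i < j; j \<le> Suc d\<rbrakk> \<Longrightarrow> lin (\<lambda>k. if k = i then r else \<zero>) j = \<kappa> r \<otimes>\<^bsub>P\<^esub> T i"
  unfolding lin_def using P.csum_delta[of "\<kappa> r" j T i] by (simp add: const_closed T_closed if_distrib cong: if_cong)

lemma L_gens_closed: "j \<le> Suc d \<Longrightarrow> {lin s j | s. (\<forall>i. s i \<in> carrier R) \<and> csum R s c j = \<zero>} \<subseteq> carrier P"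
  using lin_closed by blast

lemma L_ideal: "j \<le> Suc d \<Longrightarrow> ideal (L j) P"
  unfolding L_def by (rule P.genideal_ideal[OF L_gens_closed])

lemma lin_in_L: "\<lbrakk>\<forall>i. s i \<in> carrier R; csum R s c j = \<zero>; j \<le> Suc d\<rbrakk> \<Longrightarrow> lin s j \<in> L j"
  unfolding L_def using P.genideal_self[OF L_gens_closed] by blast

lemma L_least:
  assumes "ideal I P" "\<And>s. \<lbrakk>\<forall>i. s i \<in> carrier R; csum R s c j = \<zero>\<rbrakk> \<Longrightarrow> lin s j \<in> I"
  shows "L j \<subseteq> I"
  unfolding L_def by (rule P.genideal_minimal[OF assms(1)]) (use assms(2) in blast)

text \<open>The linear form of the trivial relation c_i c_l - c_l c_i = 0.\<close>

lemma koszul_in_L: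
  assumes "i < j" "l < j" "j \<le> Suc d"
  shows "\<kappa> (c i) \<otimes>\<^bsub>P\<^esub> T l \<ominus>\<^bsub>P\<^esub> \<kappa> (c l) \<otimes>\<^bsub>P\<^esub> T i \<in> L j"
proof -
  let ?s = "\<lambda>k. if k = l then c i else \<zero>" and ?s' = "\<lambda>k. if k = i then \<ominus> c l else \<zero>"
  have s: "\<forall>k. ?s k \<in> carrier R" "\<forall>k. ?s' k \<in> carrier R" using c_closed by auto
  have "csum R (\<lambda>k. ?s k \<oplus> ?s' k) c j = csum R ?s c j \<oplus> csum R ?s' c j"
    using c_closed by (intro csum_add) auto
  also have "\<dots> = c i \<otimes> c l \<oplus> (\<ominus> c l) \<otimes> c i"
    using csum_delta[of "c i" j c l] csum_delta[of "\<ominus> c l" j c i] assms c_closed by simp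
  also have "\<dots> = \<zero>" using c_closed[of i] c_closed[of l] by algebra
  finally have "lin (\<lambda>k. ?s k \<oplus> ?s' k) j \<in> L j" using lin_in_L[of "\<lambda>k. ?s k \<oplus> ?s' k" j] s assms(3) by simp
  moreover have "lin (\<lambda>k. ?s k \<oplus> ?s' k) j = \<kappa> (c i) \<otimes>\<^bsub>P\<^esub> T l \<oplus>\<^bsub>P\<^esub> \<kappa> (\<ominus> c l) \<otimes>\<^bsub>P\<^esub> T i"
    using lin_add[OF s assms(3)] lin_delta[of "c i" l j] lin_delta[of "\<ominus> c l" i j] assms c_closed by simp
  moreover have "\<kappa> (\<ominus> c l) \<otimes>\<^bsub>P\<^esub> T i = \<ominus>\<^bsub>P\<^esub> (\<kappa> (c l) \<otimes>\<^bsub>P\<^esub> T i)"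
    using c_closed assms T_closed by (simp add: P.l_minus)
  ultimately show ?thesis by (simp add: a_minus_def)
qed

text \<open>Koszul relations with index 0 replace each term s_i c_i T_0 by c_0 s_i T_i. The
  induction runs over partial sums of length k while \<open>L j\<close> stays fixed.\<close>

lemma shift_in_L:
  assumes "\<forall>i. s i \<in> carrier R" "0 < j" "j \<le> Suc d"
  shows "k \<le> j \<Longrightarrow> \<kappa> (csum R s c k) \<otimes>\<^bsub>P\<^esub> T 0 \<ominus>\<^bsub>P\<^esub> \<kappa> (c 0) \<otimes>\<^bsub>P\<^esub> lin s k \<in> L j"
proof (induction k)
  case 0
  show ?case using P.ideal_zero[OF L_ideal[OF assms(3)]] T_closed[of 0] c_closed by (simp add: lin_def a_minus_def)
next
  case (Suc k)
  have cl: "csum R s c k \<in> carrier R" "s k \<in> carrier R" "c k \<in> carrier R" "c 0 \<in> carrier R"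
    using assms(1) c_closed by (auto intro!: csum_closed)
  have cP: "\<kappa> (csum R s c k) \<in> carrier P" "\<kappa> (s k) \<in> carrier P" "\<kappa> (c k) \<in> carrier P" "\<kappa> (c 0) \<in> carrier P"
    "T 0 \<in> carrier P" "T k \<in> carrier P" "lin s k \<in> carrier P"
    using cl T_closed lin_closed[OF assms(1)] Suc.prems assms(3) by (auto simp: const_closed)
  have "\<kappa> (csum R s c (Suc k)) = \<kappa> (csum R s c k) \<oplus>\<^bsub>P\<^esub> \<kappa> (s k) \<otimes>\<^bsub>P\<^esub> \<kappa> (c k)" using cl by simp
  then have "\<kappa> (csum R s c (Suc k)) \<otimes>\<^bsub>P\<^esub> T 0 \<ominus>\<^bsub>P\<^esub> \<kappa> (c 0) \<otimes>\<^bsub>P\<^esub> lin s (Suc k) =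
      (\<kappa> (csum R s c k) \<oplus>\<^bsub>P\<^esub> \<kappa> (s k) \<otimes>\<^bsub>P\<^esub> \<kappa> (c k)) \<otimes>\<^bsub>P\<^esub> T 0 \<ominus>\<^bsub>P\<^esub> \<kappa> (c 0) \<otimes>\<^bsub>P\<^esub> (lin s k \<oplus>\<^bsub>P\<^esub> \<kappa> (s k) \<otimes>\<^bsub>P\<^esub> T k)"
    by (simp add: lin_Suc)
  also have "\<dots> = (\<kappa> (csum R s c k) \<otimes>\<^bsub>P\<^esub> T 0 \<ominus>\<^bsub>P\<^esub> \<kappa> (c 0) \<otimes>\<^bsub>P\<^esub> lin s k) \<oplus>\<^bsub>P\<^esub>
      \<kappa> (s k) \<otimes>\<^bsub>P\<^esub> (\<kappa> (c k) \<otimes>\<^bsub>P\<^esub> T 0 \<ominus>\<^bsub>P\<^esub> \<kappa> (c 0) \<otimes>\<^bsub>P\<^esub> T k)"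
    using cP by algebra
  also have "\<dots> \<in> L j"
    using Suc koszul_in_L[of k j 0] assms cP
    by (intro P.ideal_add[OF L_ideal[OF assms(3)]] P.ideal_mult[OF L_ideal[OF assms(3)]]) auto
  finally show ?case .
qed

text \<open>Syzygies of a regular sequence have coefficients in its ideal. The last coefficient s_j
  lies in J_j by regularity; substituting s_j = sum u_i c_i leaves a relation of length j with
  coefficients s_i + c_j u_i.\<close>

lemma relation_coefs:
  "\<lbrakk>j \<le> d; \<forall>i. s i \<in> carrier R; csum R s c j = \<zero>; i < j\<rbrakk> \<Longrightarrow> s i \<in> J j"
proof (induction j arbitrary: s i)
  case (Suc j)
  have s: "\<And>i. s i \<in> carrier R" using Suc.prems by blast
  have cs: "csum R s c j \<in> carrier R" using s c_closed by (auto intro!: csum_closed)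
  have "csum R s c j \<oplus> c j \<otimes> s j = \<zero>" using Suc.prems(3) s[of j] c_closed[of j] m_comm by simp
  then have "c j \<otimes> s j = \<ominus> csum R s c j" using cs s c_closed by (metis a_comm m_closed minus_equality)
  then have "c j \<otimes> s j \<in> J j" using ideal_neg[OF J_ideal csum_in_J] s by simp
  then have sj: "s j \<in> J j" using c_reg[of j "s j"] Suc.prems(1) s by simp
  then obtain u where u: "\<forall>i. u i \<in> carrier R" "s j = csum R u c j" using J_mem by blast
  define s' where "s' = (\<lambda>i. s i \<oplus> c j \<otimes> u i)"
  have s': "\<forall>i. s' i \<in> carrier R" using s u c_closed by (simp add: s'_def)
  have "csum R s' c j = csum R s c j \<oplus> c j \<otimes> csum R u c j"
    unfolding s'_def using csum_add[of j s "\<lambda>i. c j \<otimes> u i" c] csum_scale[of "c j" j u c] s u c_closed by simp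
  also have "\<dots> = \<zero>" using \<open>csum R s c j \<oplus> c j \<otimes> s j = \<zero>\<close> u by simp
  finally have IH: "s' k \<in> J j" if "k < j" for k using Suc.IH[OF _ s' _ that] Suc.prems(1) by simp
  show ?case
  proof (cases "i = j")
    case True then show ?thesis using sj J_Suc_sub by blast
  next
    case False
    then have "s i \<oplus> c j \<otimes> u i \<in> J (Suc j)" using IH[of i] J_Suc_sub Suc.prems(4) by (auto simp: s'_def)
    moreover have "c j \<otimes> u i \<in> J (Suc j)" using c_in_J[of j "Suc j"] u ideal_mult_right[OF J_ideal] by simp
    ultimately show ?thesis using ideal_add_cancel[OF J_ideal] s by blast
  qed
qed simp

lemma L_sub_ext: "j \<le> d \<Longrightarrow> L j \<subseteq> ext (J j)"
proof (rule L_least[OF ext_ideal_ideal[OF J_ideal]])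
  fix s assume j: "j \<le> d" and s: "\<forall>i. s i \<in> carrier R" "csum R s c j = \<zero>"
  show "lin s j \<in> ext (J j)"
    unfolding lin_def
  proof (rule P.csum_ideal[OF ext_ideal_ideal[OF J_ideal]])
    fix i assume i: "i < j"
    have "\<kappa> (s i) \<in> ext (J j)"
      using const_mem_ext_ideal[OF J_ideal, of "s i" "{..d}" j] s(1) relation_coefs[OF j s i] by simp
    then show "\<kappa> (s i) \<otimes>\<^bsub>P\<^esub> T i \<in> ext (J j)"
      using P.ideal_mult_right[OF ext_ideal_ideal[OF J_ideal]] T_closed[of i] i j by simp
  qed
qed

lemma L_mono: "j \<le> d \<Longrightarrow> L j \<subseteq> L (Suc j)"
proof (rule L_least[OF L_ideal])
  fix s assume j: "j \<le> d" and s: "\<forall>i. s i \<in> carrier R" "csum R s c j = \<zero>"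
  let ?s = "s(j := \<zero>)"
  have "csum R ?s c (Suc j) = \<zero>" using csum_cong[of j ?s s c] s(2) c_closed by simp
  then have "lin ?s (Suc j) \<in> L (Suc j)" using s(1) j by (intro lin_in_L) auto
  moreover have "lin ?s (Suc j) = lin s j"
    using lin_cong[of j ?s s] lin_closed[OF s(1), of j] T_closed[OF j] j by (simp add: lin_Suc)
  ultimately show "lin s j \<in> L (Suc j)" by simp
qed simp

text \<open>A relation s_0 c_0 = 0 is trivial by regularity, so the induction on j starts from
  \<open>P\<close> itself.\<close>

lemma L_1: "L (Suc 0) = {\<zero>\<^bsub>P\<^esub>}"
proof
  show "L (Suc 0) \<subseteq> {\<zero>\<^bsub>P\<^esub>}"
  proof (rule L_least[OF P.zeroideal])
    fix s assume s: "\<forall>i. s i \<in> carrier R" "csum R s c (Suc 0) = \<zero>"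
    have "s 0 \<in> carrier R" using s by simp
    then have "c 0 \<otimes> s 0 \<in> J 0" using s c_closed[of 0] m_comm[of "s 0" "c 0"] by (simp only: J_0) simp
    then have "s 0 = \<zero>" using c_reg[OF d_pos, of "s 0"] s(1) J_0 by simp
    then show "lin s (Suc 0) \<in> {\<zero>\<^bsub>P\<^esub>}" using T_closed[of 0] by (simp add: lin_def)
  qed
qed (use P.ideal_zero[OF L_ideal] d_pos in auto)

lemma ext_zero: "ext {\<zero>} = {\<zero>\<^bsub>P\<^esub>}"
  by (auto simp: ext_ideal_def PR_zero_apply fun_eq_iff)

section \<open>Regularity of \<open>c 0\<close> modulo \<open>L j\<close>\<close>

abbreviation "Cj j \<equiv> carrier (PR ({..d} - {j}))"

lemma ext_simple: "j \<le> d \<Longrightarrow> simple_ext P (Cj j) (T j) (pcoef j)"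
  by (rule PR_simple_ext) simp

lemma const_Cj: "r \<in> carrier R \<Longrightarrow> \<kappa> r \<in> Cj j"
  by (rule const_closed)

lemma lin_Cj: "\<lbrakk>\<forall>i. s i \<in> carrier R; j \<le> d\<rbrakk> \<Longrightarrow> lin s j \<in> Cj j"
proof -
  assume s: "\<forall>i. s i \<in> carrier R" and j: "j \<le> d"
  interpret E: simple_ext P "Cj j" "T j" "pcoef j" by (rule ext_simple[OF j])
  have "k \<le> j \<Longrightarrow> lin s k \<in> Cj j" for k
  proof (induction k)
    case 0 then show ?case using E.C_zero by (simp add: lin_def)
  next
    case (Suc k)
    have "T k \<in> Cj j" using Suc.prems j by (intro var_closed) auto
    then show ?case unfolding lin_Suc using Suc E.C_add E.C_mult const_Cj s by simp
  qed
  then show ?thesis by simp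
qed

text \<open>The generators of \<open>L j\<close> involve only variables before \<open>T j\<close>,
  so the ideal is extended from the polynomials without \<open>T j\<close>.\<close>

lemma L_stable: "j \<le> d \<Longrightarrow> simple_ext.stable P (pcoef j) (L j)"
proof -
  assume j: "j \<le> d"
  interpret E: simple_ext P "Cj j" "T j" "pcoef j" by (rule ext_simple[OF j])
  show ?thesis unfolding L_def by (rule E.genideal_stable) (use lin_Cj j in blast)
qed

lemma ext_stable: "\<lbrakk>j \<le> d; ideal I R\<rbrakk> \<Longrightarrow> simple_ext.stable P (pcoef j) (ext I)"
proof -
  assume j: "j \<le> d" and I: "ideal I R"
  interpret E: simple_ext P "Cj j" "T j" "pcoef j" by (rule ext_simple[OF j])
  show ?thesis unfolding ext_ideal_eq[OF I] by (rule E.genideal_stable) (use const_Cj ideal_carrier[OF I] in blast)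
qed

text \<open>The constant term of \<open>v j\<close>, read as a polynomial of degree one in
  \<open>T j\<close> with leading coefficient c_0. This is the shape required by
  \<open>nzd_linear\<close> and \<open>linear_mult_mem\<close>.\<close>

definition w :: "nat \<Rightarrow> nat multiset \<Rightarrow> 'a" where
  "w j = \<ominus>\<^bsub>P\<^esub> (\<kappa> (c j) \<otimes>\<^bsub>P\<^esub> T 0)"

definition v :: "nat \<Rightarrow> nat multiset \<Rightarrow> 'a" where
  "v j = \<kappa> (c 0) \<otimes>\<^bsub>P\<^esub> T j \<oplus>\<^bsub>P\<^esub> w j"

lemma w_Cj: "\<lbrakk>0 < j; j \<le> d\<rbrakk> \<Longrightarrow> w j \<in> Cj j"
proof -
  assume j: "0 < j" "j \<le> d"
  interpret E: simple_ext P "Cj j" "T j" "pcoef j" by (rule ext_simple[OF j(2)])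
  have "T 0 \<in> Cj j" using j by (intro var_closed) auto
  then show ?thesis unfolding w_def using E.C_neg E.C_mult const_Cj c_closed by simp
qed

lemma w_closed: "w j \<in> carrier P"
  unfolding w_def using c_closed T_closed[of 0] by (simp add: const_closed)

lemma v_closed: "j \<le> d \<Longrightarrow> v j \<in> carrier P"
  unfolding v_def using c_closed T_closed w_closed by (simp add: const_closed)

lemma v_nzd:
  assumes "0 < j" "j \<le> d" "P.nzd_on (\<kappa> (c 0)) (carrier P) (L j)"
  shows "P.nzd_on (v j) (carrier P) (L j)"
proof -
  interpret E: simple_ext P "Cj j" "T j" "pcoef j" by (rule ext_simple[OF assms(2)])
  show ?thesis unfolding v_def
    by (rule E.nzd_linear[OF const_Cj[OF c_closed] w_Cj[OF assms(1,2)] L_stable[OF assms(2)] assms(3)])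
qed

text \<open>For r in K_j with r c_j = sum s_i c_i the partner is the linear form r T_j - sum s_i
  T_i, which vanishes at the c_i. The difference to be placed in L_j is, up to sign, that of
  \<open>shift_in_L\<close>.\<close>

lemma relation_K_to_L:
  assumes j: "0 < j" "j \<le> d"
  shows "p \<in> ext (K j) \<Longrightarrow> \<exists>q\<in>L (Suc j). v j \<otimes>\<^bsub>P\<^esub> p \<ominus>\<^bsub>P\<^esub> \<kappa> (c 0) \<otimes>\<^bsub>P\<^esub> q \<in> L j"
proof -
  have j': "j \<le> Suc d" "Suc j \<le> Suc d" using j by auto
  note cc = const_closed[OF c_closed[of 0], of "{..d}"]
  let ?B = "{p \<in> carrier P. \<exists>q\<in>L (Suc j). v j \<otimes>\<^bsub>P\<^esub> p \<ominus>\<^bsub>P\<^esub> \<kappa> (c 0) \<otimes>\<^bsub>P\<^esub> q \<in> L j}"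
  have "ext (K j) \<subseteq> ?B"
    unfolding ext_ideal_eq[OF K_ideal]
  proof (rule P.genideal_minimal[OF P.relation_ideal[OF L_ideal[OF j'(2)] L_ideal[OF j'(1)] v_closed[OF j(2)] cc]], rule subsetI)
    fix p :: "nat multiset \<Rightarrow> 'a" assume "p \<in> \<kappa> ` K j"
    then obtain r where r: "p = \<kappa> r" "r \<in> carrier R" "r \<otimes> c j \<in> J j" by (auto simp: K_def colon_def)
    obtain s where s: "\<forall>i. s i \<in> carrier R" "r \<otimes> c j = csum R s c j" using r(3) J_mem by blast
    let ?s = "\<lambda>i. if i = j then r else \<ominus> \<one> \<otimes> s i"
    have s': "\<forall>i. ?s i \<in> carrier R" "\<forall>i. \<ominus> \<one> \<otimes> s i \<in> carrier R" using r s by auto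
    have cs: "csum R s c j \<in> carrier R" using s(2) r(2) c_closed by (metis m_closed)
    have "csum R ?s c j = csum R (\<lambda>i. \<ominus> \<one> \<otimes> s i) c j" by (rule csum_cong) simp
    also have "\<dots> = \<ominus> csum R s c j" using csum_scale[of "\<ominus> \<one>" j s c] s c_closed cs by (simp add: l_minus)
    finally have "csum R ?s c (Suc j) = \<zero>" using s(2) cs by (simp add: l_neg)
    then have q: "lin ?s (Suc j) \<in> L (Suc j)" using lin_in_L[OF s'(1)] j by simp
    have lc: "lin s j \<in> carrier P" using lin_closed[OF s(1)] j by simp
    have "lin ?s j = lin (\<lambda>i. \<ominus> \<one> \<otimes> s i) j" by (rule lin_cong) simp
    also have "\<dots> = \<ominus>\<^bsub>P\<^esub> lin s j" using lin_scale[of s "\<ominus> \<one>" j] s(1) j' lc by (simp add: P.l_minus)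
    finally have linq: "lin ?s (Suc j) = \<ominus>\<^bsub>P\<^esub> lin s j \<oplus>\<^bsub>P\<^esub> \<kappa> r \<otimes>\<^bsub>P\<^esub> T j" by (simp add: lin_Suc)
    have cP: "\<kappa> r \<in> carrier P" "\<kappa> (c 0) \<in> carrier P" "\<kappa> (c j) \<in> carrier P" "T 0 \<in> carrier P" "T j \<in> carrier P"
      using r(2) c_closed T_closed j by (auto simp: const_closed)
    have "v j \<otimes>\<^bsub>P\<^esub> p \<ominus>\<^bsub>P\<^esub> \<kappa> (c 0) \<otimes>\<^bsub>P\<^esub> lin ?s (Suc j) =
        \<ominus>\<^bsub>P\<^esub> ((\<kappa> r \<otimes>\<^bsub>P\<^esub> \<kappa> (c j)) \<otimes>\<^bsub>P\<^esub> T 0 \<ominus>\<^bsub>P\<^esub> \<kappa> (c 0) \<otimes>\<^bsub>P\<^esub> lin s j)"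
      unfolding linq r(1) v_def w_def using cP lc by algebra
    also have "\<kappa> r \<otimes>\<^bsub>P\<^esub> \<kappa> (c j) = \<kappa> (csum R s c j)" using r(2) c_closed s(2) by (metis const.hom_mult)
    finally have "v j \<otimes>\<^bsub>P\<^esub> p \<ominus>\<^bsub>P\<^esub> \<kappa> (c 0) \<otimes>\<^bsub>P\<^esub> lin ?s (Suc j) \<in> L j"
      using P.ideal_neg[OF L_ideal[OF j'(1)] shift_in_L[OF s(1) j(1) j'(1) order_refl]] by simp
    then show "p \<in> ?B" using q r(1) cP by blast
  qed
  then show "p \<in> ext (K j) \<Longrightarrow> \<exists>q\<in>L (Suc j). v j \<otimes>\<^bsub>P\<^esub> p \<ominus>\<^bsub>P\<^esub> \<kappa> (c 0) \<otimes>\<^bsub>P\<^esub> q \<in> L j" by blast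
qed

text \<open>Conversely, the last coefficient s_j of a relation of length j + 1 lies in (J_j : c_j)
  and is the partner of its linear form.\<close>

lemma relation_L_to_K:
  assumes j: "0 < j" "j \<le> d"
  shows "q \<in> L (Suc j) \<Longrightarrow> \<exists>p\<in>ext (K j). v j \<otimes>\<^bsub>P\<^esub> p \<ominus>\<^bsub>P\<^esub> \<kappa> (c 0) \<otimes>\<^bsub>P\<^esub> q \<in> L j"
proof -
  have j': "j \<le> Suc d" "Suc j \<le> Suc d" using j by auto
  note cc = const_closed[OF c_closed[of 0], of "{..d}"]
  let ?B = "{q \<in> carrier P. \<exists>p\<in>ext (K j). \<kappa> (c 0) \<otimes>\<^bsub>P\<^esub> q \<ominus>\<^bsub>P\<^esub> v j \<otimes>\<^bsub>P\<^esub> p \<in> L j}"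
  have sub: "L (Suc j) \<subseteq> ?B"
  proof (rule L_least[OF P.relation_ideal[OF ext_ideal_ideal[OF K_ideal] L_ideal cc v_closed]])
    fix s assume s: "\<forall>i. s i \<in> carrier R" "csum R s c (Suc j) = \<zero>"
    have sj: "s j \<in> carrier R" "c j \<in> carrier R" "csum R s c j \<in> carrier R"
      using s(1) c_closed by (auto intro!: csum_closed)
    have e: "csum R s c j = \<ominus> (s j \<otimes> c j)"
      using s(2) sj by (metis csum.simps(2) m_closed minus_equality)
    then have "\<ominus> (s j \<otimes> c j) \<in> J j" using csum_in_J[OF s(1), of j] by simp
    then have "s j \<otimes> c j \<in> J j" using ideal_neg[OF J_ideal] sj by (metis m_closed minus_minus)
    then have "s j \<in> K j" using sj by (simp add: K_def colon_def)
    then have p: "\<kappa> (s j) \<in> ext (K j)" using const_mem_ext_ideal[OF K_ideal sj(1), of "{..d}" j] by simp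
    have lc: "lin s j \<in> carrier P" using lin_closed[OF s(1)] j by simp
    have cP: "\<kappa> (s j) \<in> carrier P" "\<kappa> (c 0) \<in> carrier P" "\<kappa> (c j) \<in> carrier P" "T 0 \<in> carrier P" "T j \<in> carrier P"
      using sj c_closed T_closed j by (auto simp: const_closed)
    have k: "\<kappa> (csum R s c j) = \<ominus>\<^bsub>P\<^esub> (\<kappa> (s j) \<otimes>\<^bsub>P\<^esub> \<kappa> (c j))" unfolding e using sj by simp
    have "\<kappa> (c 0) \<otimes>\<^bsub>P\<^esub> lin s (Suc j) \<ominus>\<^bsub>P\<^esub> v j \<otimes>\<^bsub>P\<^esub> \<kappa> (s j) =
        \<ominus>\<^bsub>P\<^esub> (\<kappa> (csum R s c j) \<otimes>\<^bsub>P\<^esub> T 0 \<ominus>\<^bsub>P\<^esub> \<kappa> (c 0) \<otimes>\<^bsub>P\<^esub> lin s j)"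
      unfolding lin_Suc v_def w_def k using cP lc by algebra
    then have "\<kappa> (c 0) \<otimes>\<^bsub>P\<^esub> lin s (Suc j) \<ominus>\<^bsub>P\<^esub> v j \<otimes>\<^bsub>P\<^esub> \<kappa> (s j) \<in> L j"
      using P.ideal_neg[OF L_ideal[OF j'(1)] shift_in_L[OF s(1) j(1) j'(1) order_refl]] by simp
    then show "lin s (Suc j) \<in> ?B" using p lin_closed[OF s(1) j'(2)] by blast
  qed (use j in auto)
  show "\<exists>p\<in>ext (K j). v j \<otimes>\<^bsub>P\<^esub> p \<ominus>\<^bsub>P\<^esub> \<kappa> (c 0) \<otimes>\<^bsub>P\<^esub> q \<in> L j" if "q \<in> L (Suc j)"
  proof -
    obtain p where p: "p \<in> ext (K j)" "\<kappa> (c 0) \<otimes>\<^bsub>P\<^esub> q \<ominus>\<^bsub>P\<^esub> v j \<otimes>\<^bsub>P\<^esub> p \<in> L j" using sub \<open>q \<in> L (Suc j)\<close> by blast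
    have cl: "p \<in> carrier P" "q \<in> carrier P" "v j \<in> carrier P"
      using p(1) that P.ideal_carrier[OF L_ideal[OF j'(2)]] v_closed[OF j(2)] by (auto simp: ext_ideal_def)
    have "v j \<otimes>\<^bsub>P\<^esub> p \<ominus>\<^bsub>P\<^esub> \<kappa> (c 0) \<otimes>\<^bsub>P\<^esub> q = \<ominus>\<^bsub>P\<^esub> (\<kappa> (c 0) \<otimes>\<^bsub>P\<^esub> q \<ominus>\<^bsub>P\<^esub> v j \<otimes>\<^bsub>P\<^esub> p)"
      using cl cc by algebra
    then show ?thesis using P.ideal_neg[OF L_ideal[OF j'(1)] p(2)] p(1) by metis
  qed
qed

text \<open>Another reading of \<open>shift_in_L\<close>: an element of J_j times T_0 is a multiple
  of c_0 modulo L_j. It supplies the hypothesis on \<open>w j\<close> in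
  \<open>linear_mult_mem\<close>.\<close>

lemma c0_T0_mem:
  assumes j: "0 < j" "j \<le> d" and y: "y \<in> ext (J j)"
  shows "T 0 \<otimes>\<^bsub>P\<^esub> y \<in> P.extend (carrier P) (L j) (\<kappa> (c 0))"
proof -
  have j': "j \<le> Suc d" using j by auto
  note cc = const_closed[OF c_closed[of 0], of "{..d}"]
  note Lid = L_ideal[OF j']
  have t0: "T 0 \<in> carrier P" using T_closed by simp
  let ?B = "{y \<in> carrier P. \<exists>g\<in>carrier P. T 0 \<otimes>\<^bsub>P\<^esub> y \<ominus>\<^bsub>P\<^esub> \<kappa> (c 0) \<otimes>\<^bsub>P\<^esub> g \<in> L j}"
  have "ext (J j) \<subseteq> ?B"
    unfolding ext_ideal_eq[OF J_ideal]
  proof (rule P.genideal_minimal[OF P.relation_ideal[OF P.oneideal Lid t0 cc]], rule subsetI)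
    fix p :: "nat multiset \<Rightarrow> 'a" assume "p \<in> \<kappa> ` J j"
    then obtain r where r: "p = \<kappa> r" "r \<in> J j" by blast
    obtain s where s: "\<forall>i. s i \<in> carrier R" "r = csum R s c j" using r(2) J_mem by blast
    have s: "\<forall>i. s i \<in> carrier R" "p = \<kappa> (csum R s c j)" using s r(1) by simp_all
    have cs: "csum R s c j \<in> carrier R" using s(1) c_closed by (auto intro!: csum_closed)
    have "T 0 \<otimes>\<^bsub>P\<^esub> p \<ominus>\<^bsub>P\<^esub> \<kappa> (c 0) \<otimes>\<^bsub>P\<^esub> lin s j \<in> L j"
      using shift_in_L[OF s(1) j(1) j' order_refl] P.m_comm[OF t0 const_closed[OF cs]] s(2) by simp
    then show "p \<in> ?B" using lin_closed[OF s(1) j'] const_closed[OF cs] s(2) by blast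
  qed
  then obtain g where g: "g \<in> carrier P" "T 0 \<otimes>\<^bsub>P\<^esub> y \<ominus>\<^bsub>P\<^esub> \<kappa> (c 0) \<otimes>\<^bsub>P\<^esub> g \<in> L j" using y by blast
  have yc: "y \<in> carrier P" using y by (simp add: ext_ideal_def)
  have "T 0 \<otimes>\<^bsub>P\<^esub> y = (T 0 \<otimes>\<^bsub>P\<^esub> y \<ominus>\<^bsub>P\<^esub> \<kappa> (c 0) \<otimes>\<^bsub>P\<^esub> g) \<oplus>\<^bsub>P\<^esub> \<kappa> (c 0) \<otimes>\<^bsub>P\<^esub> g"
    using t0 yc cc g(1) by algebra
  then show ?thesis unfolding P.extend_def using g by blast
qed

text \<open>c_j is regular modulo J_j, and a variable is regular modulo every extended ideal since
  it only shifts coefficients.\<close>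

lemma w_nzd:
  assumes "j < d"
  shows "P.nzd_on (w j) (carrier P) (ext (J j))"
  unfolding P.nzd_on_def
proof (intro ballI impI)
  fix p assume p: "p \<in> carrier P" "w j \<otimes>\<^bsub>P\<^esub> p \<in> ext (J j)"
  note eid = ext_ideal_ideal[OF J_ideal, of "{..d}" j]
  have cP: "\<kappa> (c j) \<in> carrier P" "T 0 \<in> carrier P" using c_closed T_closed by (auto simp: const_closed)
  have "\<kappa> (c j) \<otimes>\<^bsub>P\<^esub> (T 0 \<otimes>\<^bsub>P\<^esub> p) = \<ominus>\<^bsub>P\<^esub> (w j \<otimes>\<^bsub>P\<^esub> p)" unfolding w_def using cP p(1) by algebra
  then have "\<kappa> (c j) \<otimes>\<^bsub>P\<^esub> (T 0 \<otimes>\<^bsub>P\<^esub> p) \<in> ext (J j)" using P.ideal_neg[OF eid p(2)] by simp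
  then have "T 0 \<otimes>\<^bsub>P\<^esub> p \<in> ext (J j)"
    using P.nzd_onD[OF ext_ideal_nzd[OF J_ideal c_closed c_nzd[OF assms], of "{..d}"]] cP p(1) by simp
  then have "p u \<in> J j" for u
    using var_mult_add_mset[OF p(1), of 0 u] unfolding ext_ideal_def by (metis (no_types, lifting) mem_Collect_eq)
  then show "p \<in> ext (J j)" using p(1) by (simp add: ext_ideal_def)
qed

text \<open>For c_0 p in L_{j+1} the partner p' in J_jP satisfies v_j p' = c_0^2 p modulo L_j.
  \<open>linear_mult_mem\<close> with B = J_jP gives p' = c_0 p2 modulo L_j with p2 again in J_jP.
  If q in L_{j+1} is the partner of p2, cancelling c_0 twice yields p = q modulo L_j. The bound on j
  comes from (J_j : c_j) = J_j.\<close>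

lemma c0_nzd_L: "\<lbrakk>0 < j; j \<le> d\<rbrakk> \<Longrightarrow> P.nzd_on (\<kappa> (c 0)) (carrier P) (L j)"
proof (induction j)
  case (Suc j)
  show ?case
  proof (cases "j = 0")
    case True
    show ?thesis
      using ext_ideal_nzd[OF J_ideal c_closed c_nzd[OF d_pos], of "{..d}"] unfolding True L_1 J_0 ext_zero .
  next
    case False
    then have j: "0 < j" "j < d" "j \<le> d" "j \<le> Suc d" "Suc j \<le> Suc d" using Suc.prems by auto
    interpret E: simple_ext P "Cj j" "T j" "pcoef j" by (rule ext_simple[OF j(3)])
    have cC: "\<kappa> (c 0) \<in> Cj j" by (rule const_Cj[OF c_closed])
    note cc = const_closed[OF c_closed[of 0], of "{..d}"]
    note reg = Suc.IH[OF j(1,3)]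
    note Lid = L_ideal[OF j(4)]
    note vj = v_closed[OF j(3)]
    show ?thesis
      unfolding P.nzd_on_def
    proof (intro ballI impI)
      fix p assume p: "p \<in> carrier P" "\<kappa> (c 0) \<otimes>\<^bsub>P\<^esub> p \<in> L (Suc j)"
      obtain p' where p': "p' \<in> ext (K j)" "v j \<otimes>\<^bsub>P\<^esub> p' \<ominus>\<^bsub>P\<^esub> \<kappa> (c 0) \<otimes>\<^bsub>P\<^esub> (\<kappa> (c 0) \<otimes>\<^bsub>P\<^esub> p) \<in> L j"
        using relation_L_to_K[OF j(1,3) p(2)] by blast
      have p'c: "p' \<in> carrier P" using p'(1) by (simp add: ext_ideal_def)
      have "v j \<otimes>\<^bsub>P\<^esub> p' = (v j \<otimes>\<^bsub>P\<^esub> p' \<ominus>\<^bsub>P\<^esub> \<kappa> (c 0) \<otimes>\<^bsub>P\<^esub> (\<kappa> (c 0) \<otimes>\<^bsub>P\<^esub> p)) \<oplus>\<^bsub>P\<^esub> (\<kappa> (c 0) \<otimes>\<^bsub>P\<^esub> \<kappa> (c 0)) \<otimes>\<^bsub>P\<^esub> p"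
        using vj p'c cc p(1) by algebra
      then have vp: "v j \<otimes>\<^bsub>P\<^esub> p' \<in> P.extend (carrier P) (L j) (\<kappa> (c 0) \<otimes>\<^bsub>P\<^esub> \<kappa> (c 0))"
        unfolding P.extend_def using p'(2) p(1) by blast
      have "p' \<in> P.extend (ext (J j)) (L j) (\<kappa> (c 0))"
      proof (rule E.linear_mult_mem[OF cC w_Cj[OF j(1,3)] L_stable[OF j(3)] ext_stable[OF j(3) J_ideal] L_sub_ext[OF j(3)] _ reg w_nzd[OF j(2)]])
        show "\<kappa> (c 0) \<in> ext (J j)"
          using const_mem_ext_ideal[OF J_ideal c_closed, of 0 "{..d}" j] c_in_J[of 0 j] j(1) by simp
        show "p' \<in> ext (J j)" using p'(1) K_eq_J[OF j(2)] by simp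
        show "(\<kappa> (c 0) \<otimes>\<^bsub>P\<^esub> T j \<oplus>\<^bsub>P\<^esub> w j) \<otimes>\<^bsub>P\<^esub> p' \<in> P.extend (carrier P) (L j) (\<kappa> (c 0) \<otimes>\<^bsub>P\<^esub> \<kappa> (c 0))"
          using vp by (simp add: v_def)
        fix y assume y: "y \<in> ext (J j)"
        have yc: "y \<in> carrier P" using y by (simp add: ext_ideal_def)
        have "w j \<otimes>\<^bsub>P\<^esub> y = (\<ominus>\<^bsub>P\<^esub> \<kappa> (c j)) \<otimes>\<^bsub>P\<^esub> (T 0 \<otimes>\<^bsub>P\<^esub> y)"
          unfolding w_def using const_closed[OF c_closed[of j], of "{..d}"] T_closed[of 0] yc by (simp add: P.l_minus P.m_assoc)
        then show "w j \<otimes>\<^bsub>P\<^esub> y \<in> P.extend (carrier P) (L j) (\<kappa> (c 0))"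
          using P.ideal_mult[OF P.extend_ideal[OF P.oneideal Lid cc] c0_T0_mem[OF j(1,3) y]]
            const_closed[OF c_closed[of j], of "{..d}"] by simp
      qed
      then obtain l p2 where lp: "p' = l \<oplus>\<^bsub>P\<^esub> \<kappa> (c 0) \<otimes>\<^bsub>P\<^esub> p2" "l \<in> L j" "p2 \<in> ext (J j)"
        by (auto simp: P.extend_def)
      have lc: "l \<in> carrier P" "p2 \<in> carrier P" using P.ideal_carrier[OF Lid lp(2)] lp(3) by (auto simp: ext_ideal_def)
      obtain q where q: "q \<in> L (Suc j)" "v j \<otimes>\<^bsub>P\<^esub> p2 \<ominus>\<^bsub>P\<^esub> \<kappa> (c 0) \<otimes>\<^bsub>P\<^esub> q \<in> L j"
        using relation_K_to_L[OF j(1,3)] lp(3) K_eq_J[OF j(2)] by auto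
      have qc: "q \<in> carrier P" using P.ideal_carrier[OF L_ideal[OF j(5)] q(1)] .
      have "\<kappa> (c 0) \<otimes>\<^bsub>P\<^esub> (v j \<otimes>\<^bsub>P\<^esub> p2 \<ominus>\<^bsub>P\<^esub> \<kappa> (c 0) \<otimes>\<^bsub>P\<^esub> p) =
          (v j \<otimes>\<^bsub>P\<^esub> p' \<ominus>\<^bsub>P\<^esub> \<kappa> (c 0) \<otimes>\<^bsub>P\<^esub> (\<kappa> (c 0) \<otimes>\<^bsub>P\<^esub> p)) \<ominus>\<^bsub>P\<^esub> v j \<otimes>\<^bsub>P\<^esub> l"
        unfolding lp(1) using vj lc cc p(1) by algebra
      also have "\<dots> \<in> L j" by (rule P.ideal_diff[OF Lid p'(2) P.ideal_mult[OF Lid lp(2) vj]])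
      finally have 1: "v j \<otimes>\<^bsub>P\<^esub> p2 \<ominus>\<^bsub>P\<^esub> \<kappa> (c 0) \<otimes>\<^bsub>P\<^esub> p \<in> L j"
        using P.nzd_onD[OF reg] vj lc cc p(1) by simp
      have "\<kappa> (c 0) \<otimes>\<^bsub>P\<^esub> (p \<ominus>\<^bsub>P\<^esub> q) =
          (v j \<otimes>\<^bsub>P\<^esub> p2 \<ominus>\<^bsub>P\<^esub> \<kappa> (c 0) \<otimes>\<^bsub>P\<^esub> q) \<ominus>\<^bsub>P\<^esub> (v j \<otimes>\<^bsub>P\<^esub> p2 \<ominus>\<^bsub>P\<^esub> \<kappa> (c 0) \<otimes>\<^bsub>P\<^esub> p)"
        using vj lc cc p(1) qc by algebra
      also have "\<dots> \<in> L j" by (rule P.ideal_diff[OF Lid q(2) 1])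
      finally have "p \<ominus>\<^bsub>P\<^esub> q \<in> L j" using P.nzd_onD[OF reg] p(1) qc by simp
      then have "p \<ominus>\<^bsub>P\<^esub> q \<in> L (Suc j)" using L_mono[OF j(3)] by blast
      then show "p \<in> L (Suc j)" using P.ideal_diff_cancel[OF L_ideal[OF j(5)] _ q(1) p(1)] by blast
    qed
  qed
qed simp

end

text \<open>For \<open>W_Suc\<close>: modulo the variable a polynomial is its constant
  coefficient.\<close>

lemma (in simple_ext) minus_coef0:
  assumes "p \<in> carrier R"
  shows "\<exists>g\<in>carrier R. p = coef p 0 \<oplus> x \<otimes> g"
  using assms
proof (induction p rule: ext_induct)
  case zero
  then show ?case using x by (intro bexI[of _ \<zero>]) (auto simp: coef_zero)
next
  case (add c n q)
  then obtain g where g: "g \<in> carrier R" "q = coef q 0 \<oplus> x \<otimes> g" using deg_less_carrier by blast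
  have cl: "c \<in> carrier R" "q \<in> carrier R" "coef q 0 \<in> carrier R"
    using add C_carrier deg_less_carrier coef_carrier by auto
  have co: "coef (c \<otimes> x [^] n \<oplus> q) 0 = (if n = 0 then c else \<zero>) \<oplus> coef q 0"
    using cl x add(1) by (auto simp: coef_add coef_monom)
  show ?case
  proof (cases n)
    case 0
    have "c \<otimes> x [^] n \<oplus> q = c \<oplus> (coef q 0 \<oplus> x \<otimes> g)" using 0 cl g(2) by simp
    also have "\<dots> = coef (c \<otimes> x [^] n \<oplus> q) 0 \<oplus> x \<otimes> g" unfolding co using 0 cl g(1) x by (simp add: a_assoc)
    finally show ?thesis using g(1) by blast
  next
    case (Suc k)
    have "c \<otimes> x [^] n \<oplus> q = c \<otimes> (x [^] k \<otimes> x) \<oplus> (coef q 0 \<oplus> x \<otimes> g)" using Suc g(2) by simp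
    also have "\<dots> = coef q 0 \<oplus> x \<otimes> (c \<otimes> x [^] k \<oplus> g)"
      using cl g(1) x nat_pow_closed[OF x, of k] by algebra
    also have "\<dots> = coef (c \<otimes> x [^] n \<oplus> q) 0 \<oplus> x \<otimes> (c \<otimes> x [^] k \<oplus> g)" unfolding co using Suc cl by simp
    finally show ?thesis using g(1) cl x by (intro bexI[of _ "c \<otimes> x [^] k \<oplus> g"]) auto
  qed
qed

context parameter_system
begin

lemma m_ideal: "ideal m R"
  by (rule maximalideal.axioms(1)[OF max])

lemma ext_m_prime: "primeideal (ext m) P"
  by (rule ext_maximal_prime[OF max]) simp

lemma ext_m_nzd: "\<lbrakk>z \<in> carrier P; z \<notin> ext m\<rbrakk> \<Longrightarrow> P.nzd_on z (carrier P) (ext m)"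
  unfolding P.nzd_on_def using primeideal.I_prime[OF ext_m_prime] by blast

subsection \<open>The grade of the symmetric algebra\<close>

text \<open>R/I has finite length, so P/IP is filtered with factors P/mP. In place of a filtration a
  maximal counterexample M is taken: a prime (M : q) contains J_d, hence equals m, and
  multiplication by q identifies P/mP with (M + qR)P/MP. As M + qR is no counterexample,
  \<open>grade_ge_extension\<close> gives a contradiction.\<close>

lemma grade_ext_ideal:
  assumes Q: "ideal Q P" and g: "P.grade_ge Q n (carrier P) (ext m)"
    and I: "ideal I R" "J d \<subseteq> I"
  shows "P.grade_ge Q n (carrier P) (ext I)"
proof (rule ccontr)
  assume no: "\<not> ?thesis"
  define SS where "SS = {I. ideal I R \<and> J d \<subseteq> I \<and> \<not> P.grade_ge Q n (carrier P) (ext I)}"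
  have "SS \<noteq> {}" using I no by (auto simp: SS_def)
  moreover have "\<And>I. I \<in> SS \<Longrightarrow> ideal I R" by (simp add: SS_def)
  ultimately obtain M where M: "M \<in> SS" "\<And>N. \<lbrakk>N \<in> SS; M \<subseteq> N\<rbrakk> \<Longrightarrow> N = M"
    using noetherian_maximal[OF noeth] by metis
  then have Mid: "ideal M R" and JM: "J d \<subseteq> M" and nM: "\<not> P.grade_ge Q n (carrier P) (ext M)"
    by (auto simp: SS_def)
  note eM = ext_ideal_ideal[OF Mid, of "{..d}"]
  have "\<one> \<notin> M"
  proof
    assume "\<one> \<in> M"
    then have "M = carrier R" using ideal.one_imp_carrier[OF Mid] by simp
    then have "carrier P \<subseteq> ext M" using PR_apply by (auto simp: ext_ideal_def)
    then show False using P.grade_ge_full[OF Q _ P.oneideal eM] nM by blast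
  qed
  then obtain q where q: "q \<in> carrier R" "q \<notin> M" "primeideal (colon M q) R"
    using exists_prime_colon[OF noeth oneideal Mid one_closed] by metis
  have Mcol: "M \<subseteq> colon M q" using ideal_mult_right[OF Mid _ q(1)] ideal_carrier[OF Mid] by (auto simp: colon_def)
  have "m \<subseteq> colon M q"
  proof
    fix r assume r: "r \<in> m"
    have rc: "r \<in> carrier R" using ideal_carrier[OF m_ideal r] .
    obtain k :: nat where k: "r [^] k \<in> J d" using c_rad[OF r] by blast
    have "r [^] k \<in> colon M q \<Longrightarrow> r \<in> colon M q" for k :: nat
    proof (induction k)
      case 0
      then have "\<one> \<in> colon M q" by simp
      then show ?case using q by (simp add: colon_def)
    next
      case (Suc k)
      then show ?case using primeideal.I_prime[OF q(3), of "r [^] k" r] rc by auto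
    qed
    then show "r \<in> colon M q" using k JM Mcol by blast
  qed
  moreover have "colon M q \<noteq> carrier R" using primeideal.I_notcarr[OF q(3)] by simp
  ultimately have col: "colon M q = m"
    using maximalideal.I_maximal[OF max primeideal.axioms(1)[OF q(3)]] by (auto simp: colon_def)
  define N where "N = extend (carrier R) M q"
  have Nid: "ideal N R" unfolding N_def by (rule extend_ideal[OF oneideal Mid q(1)])
  have MN: "M \<subseteq> N" unfolding N_def by (rule extend_upper1[OF oneideal Mid q(1)])
  have "q \<in> N" unfolding N_def using extend_upper2[OF oneideal Mid q(1) one_closed] q(1) by simp
  then have "N \<notin> SS" using M(2) MN q(2) by blast
  then have gN: "P.grade_ge Q n (carrier P) (ext N)" using Nid MN JM by (auto simp: SS_def)
  note eN = ext_ideal_ideal[OF Nid, of "{..d}"]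
  note qP = const_closed[OF q(1), of "{..d}"]
  have eN_eq: "ext N = P.extend (carrier P) (ext M) (\<kappa> q)"
    unfolding N_def by (rule ext_ideal_extend[OF Mid q(1), symmetric])
  have "P.grade_ge Q n (ext N) (ext M)"
  proof (rule P.grade_ge_iso[OF qP P.one_closed eM P.oneideal eN P.ideal_sub[OF Q] _ _ ext_ideal_ideal[OF m_ideal] eM _ g])
    show "\<exists>r\<in>ext N. \<kappa> q \<otimes>\<^bsub>P\<^esub> p \<ominus>\<^bsub>P\<^esub> \<one>\<^bsub>P\<^esub> \<otimes>\<^bsub>P\<^esub> r \<in> ext M" if p: "p \<in> carrier P" for p
      unfolding eN_eq using P.extend_upper2[OF P.oneideal eM qP p] P.ideal_zero[OF eM] qP p
      by (intro bexI[of _ "\<kappa> q \<otimes>\<^bsub>P\<^esub> p"]) (simp_all add: P.r_neg a_minus_def)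
    show "\<exists>p\<in>carrier P. \<kappa> q \<otimes>\<^bsub>P\<^esub> p \<ominus>\<^bsub>P\<^esub> \<one>\<^bsub>P\<^esub> \<otimes>\<^bsub>P\<^esub> r \<in> ext M" if r: "r \<in> ext N" for r
    proof -
      obtain e p where ep: "r = e \<oplus>\<^bsub>P\<^esub> \<kappa> q \<otimes>\<^bsub>P\<^esub> p" "e \<in> ext M" "p \<in> carrier P"
        using r unfolding eN_eq P.extend_def by blast
      have ec: "e \<in> carrier P" using P.ideal_carrier[OF eM ep(2)] .
      have "\<kappa> q \<otimes>\<^bsub>P\<^esub> p \<ominus>\<^bsub>P\<^esub> \<one>\<^bsub>P\<^esub> \<otimes>\<^bsub>P\<^esub> r = \<ominus>\<^bsub>P\<^esub> e" unfolding ep(1) using ec ep(3) qP by algebra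
      then show ?thesis using P.ideal_neg[OF eM ep(2)] ep(3) by metis
    qed
    fix p r assume pr: "p \<in> carrier P" "r \<in> ext N" "\<kappa> q \<otimes>\<^bsub>P\<^esub> p \<ominus>\<^bsub>P\<^esub> \<one>\<^bsub>P\<^esub> \<otimes>\<^bsub>P\<^esub> r \<in> ext M"
    have rc: "r \<in> carrier P" using P.ideal_carrier[OF eN pr(2)] .
    then have *: "\<kappa> q \<otimes>\<^bsub>P\<^esub> p \<ominus>\<^bsub>P\<^esub> r \<in> ext M" using pr(3) by simp
    have "p \<in> ext m \<longleftrightarrow> \<kappa> q \<otimes>\<^bsub>P\<^esub> p \<in> ext M"
      using pr(1) PR_apply[OF pr(1)] const_mult_apply[OF q(1) pr(1)] qP m_comm[OF q(1)]
      unfolding ext_ideal_def col[symmetric] colon_def by auto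
    also have "\<dots> \<longleftrightarrow> r \<in> ext M"
      using P.ideal_diff_cancel[OF eM *] P.ideal_diff_cancel2[OF eM *] rc qP pr(1) by blast
    finally show "p \<in> ext m \<longleftrightarrow> r \<in> ext M" .
  qed
  then have "P.grade_ge Q n (carrier P) (ext M)"
    using P.grade_ge_extension[OF noeth_P Q P.oneideal eN eM _ _ _ gN] ext_ideal_mono[OF MN] P.ideal_sub[OF eN] by blast
  then show False using nM by blast
qed

text \<open>Going down from J_d, each c_j lies in mP, hence in \<open>Q\<close>, and is regular
  modulo J_jP, which adds one to the grade. The counter i is d - j.\<close>

lemma grade_ext_J:
  assumes Q: "ideal Q P" "ext m \<subseteq> Q" and g: "P.grade_ge Q n (carrier P) (ext m)"
  shows "i \<le> d \<Longrightarrow> P.grade_ge Q (n + i) (carrier P) (ext (J (d - i)))"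
proof (induction i)
  case 0
  then show ?case using grade_ext_ideal[OF Q(1) g J_ideal, of d] by simp
next
  case (Suc i)
  define j where "j = d - Suc i"
  have j: "j < d" "d - i = Suc j" using Suc.prems by (auto simp: j_def)
  have "\<kappa> (c j) \<in> ext m" using const_mem_ext_ideal[OF m_ideal c_closed, of j "{..d}"] c_m[OF j(1)] by simp
  then have "\<kappa> (c j) \<in> Q" using Q(2) by blast
  moreover have "P.extend (carrier P) (ext (J j)) (\<kappa> (c j)) = ext (J (Suc j))"
    unfolding J_Suc by (rule ext_ideal_extend[OF J_ideal c_closed])
  ultimately have "P.grade_ge Q (Suc (n + i)) (carrier P) (ext (J j))"
    using ext_ideal_nzd[OF J_ideal c_closed c_nzd[OF j(1)], of "{..d}"] Suc.IH Suc.prems j(2)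
    by (auto intro!: bexI[of _ "\<kappa> (c j)"])
  then show ?case by (simp add: j_def)
qed

text \<open>K_jP/L_j has grade n + 1, being a submodule of P/L_j with cokernel P/K_jP. It is
  isomorphic to L_{j+1}/L_j, and the quotient of P/L_j by the latter has grade at least n.\<close>

lemma grade_L_step:
  assumes j: "0 < j" "j \<le> d" and Q: "ideal Q P"
    and gL: "P.grade_ge Q (Suc n) (carrier P) (L j)" and gK: "P.grade_ge Q n (carrier P) (ext (K j))"
  shows "P.grade_ge Q n (carrier P) (L (Suc j))"
proof -
  have j': "j \<le> Suc d" "Suc j \<le> Suc d" using j by auto
  note Lid = L_ideal[OF j'(1)] and Lid' = L_ideal[OF j'(2)]
  note Kid = ext_ideal_ideal[OF K_ideal, of "{..d}" j]
  note cc = const_closed[OF c_closed[of 0], of "{..d}"]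
  note vc = v_closed[OF j(2)]
  have LK: "L j \<subseteq> ext (K j)" using L_sub_ext[OF j(2)] ext_ideal_mono[OF J_sub_K] by blast
  have gKL: "P.grade_ge Q (Suc n) (ext (K j)) (L j)"
    by (rule P.grade_ge_sub[OF noeth_P Q P.oneideal Kid Lid LK P.ideal_sub[OF Kid] gL gK])
  have "P.grade_ge Q (Suc n) (L (Suc j)) (L j)"
  proof (rule P.grade_ge_iso[OF vc cc Lid Kid Lid' P.ideal_sub[OF Q] _ _ Lid Lid _ gKL])
    show "\<exists>q\<in>L (Suc j). v j \<otimes>\<^bsub>P\<^esub> p \<ominus>\<^bsub>P\<^esub> \<kappa> (c 0) \<otimes>\<^bsub>P\<^esub> q \<in> L j" if "p \<in> ext (K j)" for p
      using relation_K_to_L[OF j that] .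
    show "\<exists>p\<in>ext (K j). v j \<otimes>\<^bsub>P\<^esub> p \<ominus>\<^bsub>P\<^esub> \<kappa> (c 0) \<otimes>\<^bsub>P\<^esub> q \<in> L j" if "q \<in> L (Suc j)" for q
      using relation_L_to_K[OF j that] .
    fix p q assume pq: "p \<in> ext (K j)" "q \<in> L (Suc j)" "v j \<otimes>\<^bsub>P\<^esub> p \<ominus>\<^bsub>P\<^esub> \<kappa> (c 0) \<otimes>\<^bsub>P\<^esub> q \<in> L j"
    have cl: "p \<in> carrier P" "q \<in> carrier P" using P.ideal_carrier[OF Kid pq(1)] P.ideal_carrier[OF Lid' pq(2)] by auto
    have "p \<in> L j \<longleftrightarrow> v j \<otimes>\<^bsub>P\<^esub> p \<in> L j"
      using P.ideal_mult[OF Lid _ vc] P.nzd_onD[OF v_nzd[OF j c0_nzd_L[OF j]] cl(1)] by blast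
    also have "\<dots> \<longleftrightarrow> \<kappa> (c 0) \<otimes>\<^bsub>P\<^esub> q \<in> L j"
      using P.ideal_diff_cancel[OF Lid pq(3)] P.ideal_diff_cancel2[OF Lid pq(3)] cl vc cc by blast
    also have "\<dots> \<longleftrightarrow> q \<in> L j"
      using P.ideal_mult[OF Lid _ cc] P.nzd_onD[OF c0_nzd_L[OF j] cl(2)] by blast
    finally show "p \<in> L j \<longleftrightarrow> q \<in> L j" .
  qed
  then show ?thesis
    using P.grade_ge_quotient[OF noeth_P Q P.oneideal Lid' Lid L_mono[OF j(2)] P.ideal_sub[OF Lid']]
      P.grade_ge_mono[OF gL, of n] by simp
qed

text \<open>Starting with n + d on P = P/L_1, each step costs one. For j < d the cokernel is P/J_jP,
  of grade n + d - j; for j = d it is P/K_dP with K_d containing J_d, and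
  \<open>grade_ext_ideal\<close> gives n.\<close>

lemma grade_L:
  assumes Q: "ideal Q P" "ext m \<subseteq> Q" and g: "P.grade_ge Q n (carrier P) (ext m)"
  shows "P.grade_ge Q n (carrier P) (L (Suc d))"
proof -
  have "i < d \<Longrightarrow> P.grade_ge Q (n + (d - i)) (carrier P) (L (Suc i))" for i
  proof (induction i)
    case 0
    then show ?case using grade_ext_J[OF Q g order_refl] L_1 J_0 ext_zero by simp
  next
    case (Suc i)
    then have j: "0 < Suc i" "Suc i \<le> d" by auto
    have "P.grade_ge Q (Suc (n + (d - Suc i))) (carrier P) (L (Suc i))" using Suc by (simp add: Suc_diff_Suc)
    moreover have "P.grade_ge Q (n + (d - Suc i)) (carrier P) (ext (K (Suc i)))"
      using grade_ext_J[OF Q g, of "d - Suc i"] K_eq_J[OF Suc.prems] j by simp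
    ultimately show ?case by (rule grade_L_step[OF j Q(1)])
  qed
  from this[of "d - 1"] have "P.grade_ge Q (Suc n) (carrier P) (L d)" using d_pos by simp
  then show ?thesis
    using grade_L_step[OF d_pos order_refl Q(1)] grade_ext_ideal[OF Q(1) g K_ideal J_sub_K] by blast
qed

definition Qh :: "(nat multiset \<Rightarrow> 'a) set" where
  "Qh = Idl\<^bsub>P\<^esub> (\<kappa> ` m \<union> T ` {..d})"

lemma Qh_gens: "\<kappa> ` m \<union> T ` {..d} \<subseteq> carrier P"
  using ideal_carrier[OF m_ideal] const_closed T_closed by auto

lemma Qh_ideal: "ideal Qh P"
  unfolding Qh_def by (rule P.genideal_ideal[OF Qh_gens])

lemma T_Qh: "i \<le> d \<Longrightarrow> T i \<in> Qh"
  unfolding Qh_def using P.genideal_self[OF Qh_gens] by auto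

lemma ext_m_Qh: "ext m \<subseteq> Qh"
  unfolding ext_ideal_eq[OF m_ideal]
  by (rule P.genideal_minimal[OF Qh_ideal]) (use P.genideal_self[OF Qh_gens] in \<open>auto simp: Qh_def\<close>)

text \<open>The ideal generated by mP and the variables with index below i, described by
  coefficients so that regularity of T_i becomes a shift of monomials.\<close>

definition W :: "nat \<Rightarrow> (nat multiset \<Rightarrow> 'a) set" where
  "W i = {p \<in> carrier P. \<forall>u. set_mset u \<inter> {..<i} = {} \<longrightarrow> p u \<in> m}"

lemma W_ideal: "ideal (W i) P"
proof (rule P.ideal_intro)
  fix p q assume p: "p \<in> W i" and q: "q \<in> carrier P"
  have pc: "p \<in> carrier P" using p by (simp add: W_def)
  from q have "\<forall>u. set_mset u \<inter> {..<i} = {} \<longrightarrow> (q \<otimes>\<^bsub>P\<^esub> p) u \<in> m"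
  proof (induction q rule: PR_induct)
    case (mon r v)
    show ?case
    proof (intro allI impI)
      fix u :: "nat multiset" assume u: "set_mset u \<inter> {..<i} = {}"
      have "set_mset (u - v) \<inter> {..<i} = {}" using u by (meson disjoint_iff in_diffD)
      then have "p (u - v) \<in> m" using p by (simp add: W_def)
      then show "(mon r v \<otimes>\<^bsub>P\<^esub> p) u \<in> m"
        using mon_mult[OF mon(1), of p, OF PR_apply[OF pc]] ideal_mult[OF m_ideal _ mon(1)] ideal_zero[OF m_ideal] by simp
    qed
  next
    case (add q q')
    then show ?case unfolding PR_l_distr[OF add(1,2) pc] by (simp add: PR_add_apply ideal_add[OF m_ideal])
  qed
  then show "q \<otimes>\<^bsub>P\<^esub> p \<in> W i" using pc q by (simp add: W_def)
qed (auto simp: W_def PR_zero_apply PR_add_apply ideal_zero[OF m_ideal] ideal_add[OF m_ideal])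

lemma W_nzd: "P.nzd_on (T i) (carrier P) (W i)"
  unfolding P.nzd_on_def
proof (intro ballI impI)
  fix p assume p: "p \<in> carrier P" "T i \<otimes>\<^bsub>P\<^esub> p \<in> W i"
  have "p u \<in> m" if "set_mset u \<inter> {..<i} = {}" for u
  proof -
    have "set_mset (add_mset i u) \<inter> {..<i} = {}" using that by auto
    then have "(T i \<otimes>\<^bsub>P\<^esub> p) (add_mset i u) \<in> m" using p(2) unfolding W_def by blast
    then show ?thesis using var_mult_add_mset[OF p(1)] by simp
  qed
  then show "p \<in> W i" using p(1) by (simp add: W_def)
qed

lemma W_Suc:
  assumes i: "i \<le> d"
  shows "W (Suc i) = P.extend (carrier P) (W i) (T i)"
proof
  interpret E: simple_ext P "Cj i" "T i" "pcoef i" by (rule ext_simple[OF i])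
  show "W (Suc i) \<subseteq> P.extend (carrier P) (W i) (T i)"
  proof
    fix p assume p: "p \<in> W (Suc i)"
    then have pc: "p \<in> carrier P" by (simp add: W_def)
    obtain g where g: "g \<in> carrier P" "p = pcoef i p 0 \<oplus>\<^bsub>P\<^esub> T i \<otimes>\<^bsub>P\<^esub> g" using E.minus_coef0[OF pc] by blast
    have "pcoef i p 0 u \<in> m" if u: "set_mset u \<inter> {..<i} = {}" for u
    proof (cases "i \<in># u")
      case True then show ?thesis using ideal_zero[OF m_ideal] by (simp add: pcoef_def)
    next
      case False
      then have "set_mset u \<inter> {..<Suc i} = {}" using u by (auto simp: less_Suc_eq)
      then show ?thesis using p False by (simp add: pcoef_def W_def)
    qed
    then have "pcoef i p 0 \<in> W i" using E.coef_carrier[OF pc] by (simp add: W_def)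
    then show "p \<in> P.extend (carrier P) (W i) (T i)" unfolding P.extend_def using g by blast
  qed
  show "P.extend (carrier P) (W i) (T i) \<subseteq> W (Suc i)"
  proof (rule P.extend_least[OF W_ideal])
    have "set_mset u \<inter> {..<i} = {}" if "set_mset u \<inter> {..<Suc i} = {}" for u :: "nat multiset" using that by auto
    then show "W i \<subseteq> W (Suc i)" by (auto simp: W_def)
    fix p assume p: "p \<in> carrier P"
    have "(T i \<otimes>\<^bsub>P\<^esub> p) u \<in> m" if "set_mset u \<inter> {..<Suc i} = {}" for u
    proof -
      have "i \<notin># u" using that by auto
      then show ?thesis using var_mult_apply[OF p] ideal_zero[OF m_ideal] by simp
    qed
    then show "T i \<otimes>\<^bsub>P\<^esub> p \<in> W (Suc i)" using p T_closed[OF i] by (simp add: W_def)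
  qed
qed

text \<open>\<open>grade_ge\<close> puts a new element in front, so the sequence T_0, ..., T_d is
  built from its end.\<close>

lemma grade_Qh: "P.grade_ge Qh (Suc d) (carrier P) (ext m)"
proof -
  have "k \<le> Suc d \<Longrightarrow> P.grade_ge Qh k (carrier P) (W (Suc d - k))" for k
  proof (induction k)
    case (Suc k)
    define i where "i = Suc d - Suc k"
    have i: "i \<le> d" "Suc d - k = Suc i" using Suc.prems by (auto simp: i_def)
    have "P.grade_ge Qh (Suc k) (carrier P) (W i)"
      using Suc T_Qh[OF i(1)] W_nzd[of i] W_Suc[OF i(1)] i(2) by auto
    then show ?case by (simp add: i_def)
  qed simp
  from this[of "Suc d"] have "P.grade_ge Qh (Suc d) (carrier P) (W 0)" by simp
  moreover have "W 0 = ext m" by (auto simp: W_def ext_ideal_def)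
  ultimately show ?thesis by simp
qed

subsection \<open>The kernel of the map from the symmetric algebra to the Rees algebra\<close>

lemma grade_torsion_quotient:
  assumes reduced: "\<And>p n::nat. \<lbrakk>p \<in> carrier P; p [^]\<^bsub>P\<^esub> n \<in> L (Suc d)\<rbrakk> \<Longrightarrow> p \<in> L (Suc d)"
    and A: "ideal A P" "L (Suc d) \<subseteq> A"
    and torsion: "\<And>p i. \<lbrakk>p \<in> A; i < d\<rbrakk> \<Longrightarrow> \<exists>n::nat. \<kappa> (c i) [^]\<^bsub>P\<^esub> n \<otimes>\<^bsub>P\<^esub> p \<in> L (Suc d)"
    and A_nzd: "P.nzd_on (\<kappa> (c 0)) (carrier P) A"
  shows "P.grade_ge Qh d (carrier P) A"
proof -
  define Lr where "Lr = L (Suc d)"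
  have Lid: "ideal Lr P" unfolding Lr_def by (rule L_ideal) simp
  note Ac = P.ideal_carrier[OF A(1)]
  note eid = ext_ideal_ideal[OF m_ideal, of "{..d}"]
  note cc = const_closed[OF c_closed[of 0], of "{..d}"]
  \<comment> \<open>(ap)^(n+1) is a multiple of a^n p, and \<open>Lr\<close> is a radical
    ideal.\<close>
  have power: "a \<otimes>\<^bsub>P\<^esub> p \<in> Lr" if ap: "a \<in> carrier P" "p \<in> carrier P" "a [^]\<^bsub>P\<^esub> n \<otimes>\<^bsub>P\<^esub> p \<in> Lr" for a p and n :: nat
  proof -
    have "(a \<otimes>\<^bsub>P\<^esub> p) [^]\<^bsub>P\<^esub> Suc n = (a \<otimes>\<^bsub>P\<^esub> p [^]\<^bsub>P\<^esub> n) \<otimes>\<^bsub>P\<^esub> (a [^]\<^bsub>P\<^esub> n \<otimes>\<^bsub>P\<^esub> p)"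
      using ap P.nat_pow_closed[OF ap(1), of n] P.nat_pow_closed[OF ap(2), of n]
      by (simp add: P.nat_pow_distrib) (simp add: P.m_assoc P.m_comm P.m_lcomm)
    also have "\<dots> \<in> Lr" by (rule P.ideal_mult[OF Lid ap(3)]) (use ap in simp)
    finally show ?thesis using reduced ap unfolding Lr_def by blast
  qed
  have J_kill: "\<kappa> r \<otimes>\<^bsub>P\<^esub> p \<in> Lr" if rp: "r \<in> J d" "p \<in> A" for r p
  proof -
    note pc = Ac[OF rp(2)]
    have "ideal {r \<in> carrier R. \<kappa> r \<otimes>\<^bsub>P\<^esub> p \<in> Lr} R"
      by (rule ideal_intro)
        (use pc P.ideal_zero[OF Lid] P.ideal_add[OF Lid] P.ideal_mult[OF Lid] in
          \<open>auto simp: const_closed P.l_distr P.m_assoc\<close>)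
    moreover have "c ` {..<d} \<subseteq> {r \<in> carrier R. \<kappa> r \<otimes>\<^bsub>P\<^esub> p \<in> Lr}"
    proof
      fix r assume "r \<in> c ` {..<d}"
      then obtain i where i: "i < d" "r = c i" by blast
      obtain n :: nat where n: "\<kappa> (c i) [^]\<^bsub>P\<^esub> n \<otimes>\<^bsub>P\<^esub> p \<in> Lr" using torsion[OF rp(2) i(1)] Lr_def by blast
      then show "r \<in> {r \<in> carrier R. \<kappa> r \<otimes>\<^bsub>P\<^esub> p \<in> Lr}"
        using power[OF const_closed[OF c_closed] pc n] i(2) c_closed by simp
    qed
    ultimately have "J d \<subseteq> {r \<in> carrier R. \<kappa> r \<otimes>\<^bsub>P\<^esub> p \<in> Lr}" by (rule genideal_minimal)
    then show ?thesis using rp(1) by blast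
  qed
  have m_kill: "\<kappa> r \<otimes>\<^bsub>P\<^esub> p \<in> Lr" if rp: "r \<in> m" "p \<in> A" for r p
  proof -
    have rc: "r \<in> carrier R" using ideal_carrier[OF m_ideal rp(1)] .
    obtain n :: nat where "r [^] n \<in> J d" using c_rad[OF rp(1)] by blast
    then have "\<kappa> r [^]\<^bsub>P\<^esub> n \<otimes>\<^bsub>P\<^esub> p \<in> Lr" using J_kill[OF _ rp(2)] const.hom_pow[OF rc] by metis
    then show ?thesis using power[OF const_closed[OF rc] Ac[OF rp(2)]] by blast
  qed
  have kill: "e \<otimes>\<^bsub>P\<^esub> p \<in> Lr" if "e \<in> ext m" "p \<in> A" for e p
  proof -
    have "\<kappa> ` m \<subseteq> P.colon Lr p"
      unfolding P.colon_def using m_kill[OF _ that(2)] const_closed ideal_carrier[OF m_ideal] by blast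
    then have "ext m \<subseteq> P.colon Lr p"
      unfolding ext_ideal_eq[OF m_ideal] by (rule P.genideal_minimal[OF P.colon_ideal[OF Lid Ac[OF that(2)]]])
    then show ?thesis using that(1) by (auto simp: P.colon_def)
  qed
  \<comment> \<open>Such a p kills all of \<open>A\<close> modulo \<open>Lr\<close>, in particular
    itself; so its square lies in the radical ideal \<open>Lr\<close>.\<close>
  have int: "p \<in> Lr" if "p \<in> A" "p \<in> ext m" for p
  proof -
    have "p [^]\<^bsub>P\<^esub> (2::nat) \<in> Lr" using kill[OF that(2,1)] Ac[OF that(1)] by (simp add: numeral_2_eq_2)
    then show ?thesis using reduced Ac[OF that(1)] unfolding Lr_def by blast
  qed
  have gL: "P.grade_ge Qh (Suc d) (carrier P) Lr"
    unfolding Lr_def by (rule grade_L[OF Qh_ideal ext_m_Qh grade_Qh])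
  show ?thesis
  proof (cases "A \<subseteq> Lr")
    case True
    then have "A = Lr" using A(2) Lr_def by blast
    then show ?thesis using P.grade_ge_mono[OF gL, of d] by simp
  next
    case False
    then obtain a where a: "a \<in> A" "a \<notin> Lr" by blast
    have a_ext: "a \<notin> ext m" using int a by blast
    have sum_mem: "x \<in> set_add P (ext m) B \<longleftrightarrow> (\<exists>e\<in>ext m. \<exists>b\<in>B. x = e \<oplus>\<^bsub>P\<^esub> b)" for x B
      unfolding set_add_def' by blast
    have sum_sub: "ext m \<subseteq> set_add P (ext m) B" "B \<subseteq> set_add P (ext m) B" if "ideal B P" for B
    proof -
      show "ext m \<subseteq> set_add P (ext m) B"
      proof
        fix e assume e: "e \<in> ext m"
        then have "e = e \<oplus>\<^bsub>P\<^esub> \<zero>\<^bsub>P\<^esub>" using P.ideal_carrier[OF eid] by simp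
        then show "e \<in> set_add P (ext m) B" unfolding sum_mem using e P.ideal_zero[OF that] by blast
      qed
      show "B \<subseteq> set_add P (ext m) B"
      proof
        fix b assume b: "b \<in> B"
        then have "b = \<zero>\<^bsub>P\<^esub> \<oplus>\<^bsub>P\<^esub> b" using P.ideal_carrier[OF that] by simp
        then show "b \<in> set_add P (ext m) B" unfolding sum_mem using b P.ideal_zero[OF eid] by blast
      qed
    qed
    \<comment> \<open>An element of \<open>Lr\<close> outside mP would be regular on P/mP, so by
      \<open>grade_L\<close> the ideal mP + Lr would contain a regular element of P/Lr. But this
      ideal kills a modulo \<open>Lr\<close>.\<close>
    have L_ext: "Lr \<subseteq> ext m"
    proof (rule ccontr)
      assume "\<not> Lr \<subseteq> ext m"
      then obtain l where l: "l \<in> Lr" "l \<notin> ext m" by blast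
      let ?Q = "set_add P (ext m) Lr"
      have Qid: "ideal ?Q P" by (rule P.add_ideals[OF eid Lid])
      have "P.grade_ge ?Q (Suc 0) (carrier P) (ext m)"
        using ext_m_nzd[OF P.ideal_carrier[OF Lid l(1)] l(2)] sum_sub(2)[OF Lid] l(1) by auto
      then have "P.grade_ge ?Q (Suc 0) (carrier P) Lr"
        unfolding Lr_def using grade_L[of ?Q "Suc 0"] Qid sum_sub(1)[OF Lid] by (simp only: Lr_def)
      then obtain z where z: "z \<in> ?Q" "P.nzd_on z (carrier P) Lr" by auto
      then obtain e l' where el: "e \<in> ext m" "l' \<in> Lr" "z = e \<oplus>\<^bsub>P\<^esub> l'" unfolding sum_mem by blast
      have "z \<otimes>\<^bsub>P\<^esub> a = e \<otimes>\<^bsub>P\<^esub> a \<oplus>\<^bsub>P\<^esub> l' \<otimes>\<^bsub>P\<^esub> a"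
        unfolding el(3) using P.ideal_carrier[OF eid el(1)] P.ideal_carrier[OF Lid el(2)] Ac[OF a(1)] by (rule P.l_distr)
      also have "\<dots> \<in> Lr"
        using P.ideal_add[OF Lid kill[OF el(1) a(1)] P.ideal_mult_right[OF Lid el(2) Ac[OF a(1)]]] .
      finally show False using P.nzd_onD[OF z(2) Ac[OF a(1)]] a(2) by blast
    qed
    define B where "B = set_add P (ext m) A"
    have Bid: "ideal B P" unfolding B_def by (rule P.add_ideals[OF eid A(1)])
    have B_sub: "ext m \<subseteq> B" "A \<subseteq> B" unfolding B_def using sum_sub[OF A(1)] by auto
    obtain f z y where f: "f \<in> carrier P" "z \<in> carrier P" "y \<in> carrier P" "f \<notin> ext m" "z \<notin> ext m"
      "f \<otimes>\<^bsub>P\<^esub> z \<in> B" "f \<otimes>\<^bsub>P\<^esub> y \<in> B"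
      "\<And>b. b \<in> B \<Longrightarrow> \<exists>g\<in>carrier P. b \<ominus>\<^bsub>P\<^esub> f \<otimes>\<^bsub>P\<^esub> g \<in> ext m"
      "P.nzd_on y (carrier P) (P.extend (carrier P) (ext m) z)"
      using ideal_mod_maximal_gcd[OF max finite_atMost Bid B_sub(1) subsetD[OF B_sub(2) a(1)] a_ext] by blast
    \<comment> \<open>The ideal called A' in the overview; z and y show that its grade on P/mP is at
      least 2.\<close>
    define Q where "Q = {g \<in> carrier P. f \<otimes>\<^bsub>P\<^esub> g \<in> B}"
    have Qid: "ideal Q P"
      unfolding Q_def by (rule P.ideal_intro)
        (use f(1) P.ideal_zero[OF Bid] P.ideal_add[OF Bid] P.ideal_mult[OF Bid] in \<open>auto simp: P.r_distr P.m_lcomm\<close>)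
    have eQ: "ext m \<subseteq> Q"
      unfolding Q_def using P.ideal_mult[OF eid _ f(1)] P.ideal_carrier[OF eid] B_sub(1) by blast
    have "P.grade_ge Q (Suc (Suc 0)) (carrier P) (ext m)"
      using f ext_m_nzd[OF f(2,5)] unfolding Q_def by auto
    then have "P.grade_ge Q (Suc (Suc 0)) (carrier P) Lr"
      unfolding Lr_def by (rule grade_L[OF Qid eQ])
    then obtain y1 y2 where y: "y1 \<in> Q" "y2 \<in> Q" "P.nzd_on y1 (carrier P) Lr"
      "P.nzd_on y2 (carrier P) (P.extend (carrier P) Lr y1)" by auto
    have yc: "y1 \<in> carrier P" "y2 \<in> carrier P" using y Q_def by auto
    have "f \<otimes>\<^bsub>P\<^esub> y1 \<in> B" "f \<otimes>\<^bsub>P\<^esub> y2 \<in> B" using y Q_def by auto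
    \<comment> \<open>Modulo mP the elements f y1 and f y2 come from u1 and u2 in \<open>A\<close>.
      Lifting f itself amounts to dividing u1 by y1.\<close>
    then obtain e1 u1 e2 u2 where eu: "e1 \<in> ext m" "u1 \<in> A" "f \<otimes>\<^bsub>P\<^esub> y1 = e1 \<oplus>\<^bsub>P\<^esub> u1"
      "e2 \<in> ext m" "u2 \<in> A" "f \<otimes>\<^bsub>P\<^esub> y2 = e2 \<oplus>\<^bsub>P\<^esub> u2"
      unfolding B_def sum_mem by metis
    have euc: "e1 \<in> carrier P" "u1 \<in> carrier P" "e2 \<in> carrier P" "u2 \<in> carrier P"
      using eu Ac P.ideal_carrier[OF eid] by auto
    have u1: "u1 = f \<otimes>\<^bsub>P\<^esub> y1 \<ominus>\<^bsub>P\<^esub> e1" unfolding eu(3) using euc by algebra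
    have u2: "u2 = f \<otimes>\<^bsub>P\<^esub> y2 \<ominus>\<^bsub>P\<^esub> e2" unfolding eu(6) using euc by algebra
    \<comment> \<open>The difference lies in \<open>A\<close> and in mP, hence in \<open>Lr\<close>.
      Regularity of y2 modulo y1 then makes u1 divisible by y1 modulo \<open>Lr\<close>, and the
      quotient h is the desired lift.\<close>
    have "y2 \<otimes>\<^bsub>P\<^esub> u1 \<ominus>\<^bsub>P\<^esub> y1 \<otimes>\<^bsub>P\<^esub> u2 = y1 \<otimes>\<^bsub>P\<^esub> e2 \<ominus>\<^bsub>P\<^esub> y2 \<otimes>\<^bsub>P\<^esub> e1"
      unfolding u1 u2 using yc euc f(1) by algebra
    also have "\<dots> \<in> ext m" using P.ideal_diff[OF eid P.ideal_mult[OF eid eu(4) yc(1)] P.ideal_mult[OF eid eu(1) yc(2)]] .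
    finally have "y2 \<otimes>\<^bsub>P\<^esub> u1 \<ominus>\<^bsub>P\<^esub> y1 \<otimes>\<^bsub>P\<^esub> u2 \<in> Lr"
      using int[OF P.ideal_diff[OF A(1) P.ideal_mult[OF A(1) eu(2) yc(2)] P.ideal_mult[OF A(1) eu(5) yc(1)]]] by blast
    moreover have "y2 \<otimes>\<^bsub>P\<^esub> u1 = (y2 \<otimes>\<^bsub>P\<^esub> u1 \<ominus>\<^bsub>P\<^esub> y1 \<otimes>\<^bsub>P\<^esub> u2) \<oplus>\<^bsub>P\<^esub> y1 \<otimes>\<^bsub>P\<^esub> u2"
      using yc euc by algebra
    ultimately have "y2 \<otimes>\<^bsub>P\<^esub> u1 \<in> P.extend (carrier P) Lr y1"
      unfolding P.extend_def using euc(4) by blast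
    then have "u1 \<in> P.extend (carrier P) Lr y1" using P.nzd_onD[OF y(4) euc(2)] by blast
    then obtain l h where lh: "u1 = l \<oplus>\<^bsub>P\<^esub> y1 \<otimes>\<^bsub>P\<^esub> h" "l \<in> Lr" "h \<in> carrier P" by (auto simp: P.extend_def)
    have lc: "l \<in> carrier P" using P.ideal_carrier[OF Lid lh(2)] .
    have "y1 \<otimes>\<^bsub>P\<^esub> h = u1 \<ominus>\<^bsub>P\<^esub> l" unfolding lh(1) using lc yc lh(3) by algebra
    also have "\<dots> \<in> A" using P.ideal_diff[OF A(1) eu(2)] lh(2) A(2) Lr_def by blast
    \<comment> \<open>As m kills \<open>A\<close> modulo \<open>Lr\<close>, cancelling y1 leaves c_0
      h in \<open>Lr\<close>; regularity of c_0 on P/A then gives h in \<open>A\<close>.\<close>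
    finally have "\<kappa> (c 0) \<otimes>\<^bsub>P\<^esub> (y1 \<otimes>\<^bsub>P\<^esub> h) \<in> Lr" using m_kill[OF c_m[OF d_pos]] by blast
    then have "y1 \<otimes>\<^bsub>P\<^esub> (\<kappa> (c 0) \<otimes>\<^bsub>P\<^esub> h) \<in> Lr" using P.m_lcomm[OF cc yc(1) lh(3)] by simp
    then have "\<kappa> (c 0) \<otimes>\<^bsub>P\<^esub> h \<in> Lr" using P.nzd_onD[OF y(3)] cc lh(3) by simp
    then have hA: "h \<in> A" using P.nzd_onD[OF A_nzd lh(3)] A(2) Lr_def by blast
    have "y1 \<otimes>\<^bsub>P\<^esub> (h \<ominus>\<^bsub>P\<^esub> f) = y1 \<otimes>\<^bsub>P\<^esub> h \<ominus>\<^bsub>P\<^esub> f \<otimes>\<^bsub>P\<^esub> y1" using yc lh(3) f(1) by algebra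
    also have "\<dots> = \<ominus>\<^bsub>P\<^esub> (e1 \<oplus>\<^bsub>P\<^esub> l)" unfolding eu(3) lh(1) using yc lh(3) euc lc by algebra
    also have "\<dots> \<in> ext m" using P.ideal_neg[OF eid P.ideal_add[OF eid eu(1)]] lh(2) L_ext by blast
    finally have "y1 \<otimes>\<^bsub>P\<^esub> (h \<ominus>\<^bsub>P\<^esub> f) \<in> ext m" .
    \<comment> \<open>A regular element of P/Lr is not in mP, which kills the nonzero class of
      a.\<close>
    moreover have "y1 \<notin> ext m" using kill[of y1 a] P.nzd_onD[OF y(3) Ac[OF a(1)]] a by blast
    ultimately have hf: "h \<ominus>\<^bsub>P\<^esub> f \<in> ext m"
      using primeideal.I_prime[OF ext_m_prime yc(1)] lh(3) f(1) by blast
    then have h_ext: "h \<notin> ext m" using P.ideal_diff_cancel2[OF eid hf _ f(1)] f(4) by blast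
    have gen: "\<exists>g\<in>carrier P. b \<ominus>\<^bsub>P\<^esub> h \<otimes>\<^bsub>P\<^esub> g \<in> Lr" if b: "b \<in> A" for b
    proof -
      obtain g where g: "g \<in> carrier P" "b \<ominus>\<^bsub>P\<^esub> f \<otimes>\<^bsub>P\<^esub> g \<in> ext m" using f(8) B_sub(2) b by blast
      have "b \<ominus>\<^bsub>P\<^esub> h \<otimes>\<^bsub>P\<^esub> g = (b \<ominus>\<^bsub>P\<^esub> f \<otimes>\<^bsub>P\<^esub> g) \<ominus>\<^bsub>P\<^esub> (h \<ominus>\<^bsub>P\<^esub> f) \<otimes>\<^bsub>P\<^esub> g"
        using Ac[OF b] lh(3) f(1) g(1) by algebra
      also have "\<dots> \<in> ext m" by (rule P.ideal_diff[OF eid g(2) P.ideal_mult_right[OF eid hf g(1)]])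
      finally have "b \<ominus>\<^bsub>P\<^esub> h \<otimes>\<^bsub>P\<^esub> g \<in> Lr"
        using int[OF P.ideal_diff[OF A(1) b P.ideal_mult_right[OF A(1) hA g(1)]]] by blast
      then show ?thesis using g(1) by blast
    qed
    have "P.grade_ge Qh (Suc d) A Lr"
    proof (rule P.grade_ge_iso[OF lh(3) P.one_closed Lid P.oneideal A(1) P.ideal_sub[OF Qh_ideal] _ _ eid Lid _ grade_Qh])
      show "\<exists>q\<in>A. h \<otimes>\<^bsub>P\<^esub> p \<ominus>\<^bsub>P\<^esub> \<one>\<^bsub>P\<^esub> \<otimes>\<^bsub>P\<^esub> q \<in> Lr" if p: "p \<in> carrier P" for p
        using P.ideal_mult_right[OF A(1) hA p] P.ideal_zero[OF Lid] lh(3) p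
        by (intro bexI[of _ "h \<otimes>\<^bsub>P\<^esub> p"]) (simp_all add: a_minus_def P.r_neg)
      show "\<exists>p\<in>carrier P. h \<otimes>\<^bsub>P\<^esub> p \<ominus>\<^bsub>P\<^esub> \<one>\<^bsub>P\<^esub> \<otimes>\<^bsub>P\<^esub> q \<in> Lr" if q: "q \<in> A" for q
      proof -
        obtain g where g: "g \<in> carrier P" "q \<ominus>\<^bsub>P\<^esub> h \<otimes>\<^bsub>P\<^esub> g \<in> Lr" using gen[OF q] by blast
        have "h \<otimes>\<^bsub>P\<^esub> g \<ominus>\<^bsub>P\<^esub> \<one>\<^bsub>P\<^esub> \<otimes>\<^bsub>P\<^esub> q = \<ominus>\<^bsub>P\<^esub> (q \<ominus>\<^bsub>P\<^esub> h \<otimes>\<^bsub>P\<^esub> g)" using Ac[OF q] lh(3) g(1) by algebra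
        then show ?thesis using P.ideal_neg[OF Lid g(2)] g(1) by metis
      qed
      fix p q assume pq: "p \<in> carrier P" "q \<in> A" "h \<otimes>\<^bsub>P\<^esub> p \<ominus>\<^bsub>P\<^esub> \<one>\<^bsub>P\<^esub> \<otimes>\<^bsub>P\<^esub> q \<in> Lr"
      have *: "h \<otimes>\<^bsub>P\<^esub> p \<ominus>\<^bsub>P\<^esub> q \<in> Lr" using pq Ac by simp
      \<comment> \<open>Injectivity of multiplication by h from P/mP to A/Lr: m kills h, and
        conversely \<open>Lr\<close> lies in the prime ideal mP, which does not contain h.\<close>
      have "p \<in> ext m \<longleftrightarrow> h \<otimes>\<^bsub>P\<^esub> p \<in> Lr"
      proof
        assume "p \<in> ext m"
        then show "h \<otimes>\<^bsub>P\<^esub> p \<in> Lr" using kill[OF _ hA] P.m_comm[OF lh(3) pq(1)] by simp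
      next
        assume "h \<otimes>\<^bsub>P\<^esub> p \<in> Lr"
        then show "p \<in> ext m" using L_ext primeideal.I_prime[OF ext_m_prime lh(3) pq(1)] h_ext by blast
      qed
      also have "\<dots> \<longleftrightarrow> q \<in> Lr"
        using P.ideal_diff_cancel[OF Lid *] P.ideal_diff_cancel2[OF Lid *] lh(3) pq(1) Ac[OF pq(2)] by blast
      finally show "p \<in> ext m \<longleftrightarrow> q \<in> Lr" .
    qed
    then show ?thesis
      using P.grade_ge_quotient[OF noeth_P Qh_ideal P.oneideal A(1) Lid _ P.ideal_sub[OF A(1)]]
        P.grade_ge_mono[OF gL, of d] A(2) Lr_def by simp
  qed
qed

end

lemma (in cring) coset_zero_iff:
  assumes "ideal I R" "r \<in> carrier R"
  shows "I +> r = \<zero>\<^bsub>R Quot I\<^esub> \<longleftrightarrow> r \<in> I"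
  using ideal.rcos_const_imp_mem[OF assms] a_rcos_zero[OF assms(1)] by (auto simp: FactRing_def)

context parameter_system
begin

section \<open>The symmetric algebra\<close>

text \<open>Makes the class modulo L_j of a linear form depend only on the element of R that it
  represents.\<close>

lemma lin_diff_in_L:
  assumes "\<forall>i. s i \<in> carrier R" "\<forall>i. s' i \<in> carrier R" "j \<le> Suc d" "csum R s c j = csum R s' c j"
  shows "lin s j \<ominus>\<^bsub>P\<^esub> lin s' j \<in> L j"
proof -
  have t: "\<forall>i. \<ominus> \<one> \<otimes> s' i \<in> carrier R" "\<forall>i. s i \<oplus> \<ominus> \<one> \<otimes> s' i \<in> carrier R" using assms by auto
  have cl: "csum R s c j \<in> carrier R" "csum R s' c j \<in> carrier R" using assms c_closed by (auto intro!: csum_closed)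
  have "csum R (\<lambda>i. s i \<oplus> \<ominus> \<one> \<otimes> s' i) c j = csum R s c j \<oplus> \<ominus> \<one> \<otimes> csum R s' c j"
    using csum_add[of j s "\<lambda>i. \<ominus> \<one> \<otimes> s' i" c] csum_scale[of "\<ominus> \<one>" j s' c] assms(1,2) c_closed by simp
  also have "\<dots> = \<zero>" using cl assms(4) by (simp add: l_minus r_neg)
  finally have "lin (\<lambda>i. s i \<oplus> \<ominus> \<one> \<otimes> s' i) j \<in> L j" using lin_in_L[OF t(2)] assms(3) by simp
  moreover have "lin (\<lambda>i. s i \<oplus> \<ominus> \<one> \<otimes> s' i) j = lin s j \<ominus>\<^bsub>P\<^esub> lin s' j"
    using lin_add[OF assms(1) t(1) assms(3)] lin_scale[OF assms(2) _ assms(3), of "\<ominus> \<one>"] lin_closed assms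
    by (simp add: a_minus_def P.l_minus)
  ultimately show ?thesis by simp
qed

text \<open>It suffices to embed P/L into the generator-free algebra. \<pi> sends T_i to the symbol
  of c_i, and \<rho> sends the symbol of x to the class of a linear form representing x. \<pi> maps
  L into the relations, \<rho> kills the relations, and \<rho> after \<pi> is the residue
  map.\<close>

lemma symmetric_algebra_reduced_imp:
  assumes red: "reduced_ring (symmetric_algebra R (ideal_module R (J (Suc d))))"
    and p: "p \<in> carrier P" "p [^]\<^bsub>P\<^esub> (n::nat) \<in> L (Suc d)"
  shows "p \<in> L (Suc d)"
proof -
  define I where "I = J (Suc d)"
  define M where "M = ideal_module R I"
  note Iid = J_ideal[of "Suc d", folded I_def]
  have M: "carrier M = I" "x \<oplus>\<^bsub>M\<^esub> y = x \<oplus> y" "a \<odot>\<^bsub>M\<^esub> x = a \<otimes> x" for a x y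
    by (auto simp: M_def ideal_module_def)
  interpret S: cring "PR I" by (rule PR_cring)
  interpret constS: ring_hom_cring R "PR I" indexed_const by (rule const_hom)
  define rel :: "('a multiset \<Rightarrow> 'a) set" where "rel = symmetric_relations R M"
  have rel: "rel = {indexed_var (x \<oplus> y) \<ominus>\<^bsub>PR I\<^esub> (indexed_var x \<oplus>\<^bsub>PR I\<^esub> indexed_var y) | x y. x \<in> I \<and> y \<in> I} \<union>
      {indexed_var (a \<otimes> x) \<ominus>\<^bsub>PR I\<^esub> (indexed_const a \<otimes>\<^bsub>PR I\<^esub> indexed_var x) | a x. a \<in> carrier R \<and> x \<in> I}"
    by (simp add: rel_def symmetric_relations_def M Let_def)
  have rel_closed: "rel \<subseteq> carrier (PR I)"
    unfolding rel using ideal_add[OF Iid] ideal_mult[OF Iid] by (auto simp: var_closed const_closed)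
  define N where "N = Idl\<^bsub>PR I\<^esub> rel"
  have Nid: "ideal N (PR I)" unfolding N_def by (rule S.genideal_ideal[OF rel_closed])
  have rel_N: "rel \<subseteq> N" unfolding N_def by (rule S.genideal_self[OF rel_closed])
  have sym: "symmetric_algebra R (ideal_module R (J (Suc d))) = PR I Quot N"
    unfolding symmetric_algebra_def N_def rel_def M_def[symmetric] I_def[symmetric] by (simp add: M Let_def)
  have N_add: "indexed_var (x \<oplus> y) \<ominus>\<^bsub>PR I\<^esub> (indexed_var x \<oplus>\<^bsub>PR I\<^esub> indexed_var y) \<in> N" if "x \<in> I" "y \<in> I" for x y
    using rel_N that unfolding rel by blast
  have N_scale: "indexed_var (a \<otimes> x) \<ominus>\<^bsub>PR I\<^esub> (indexed_const a \<otimes>\<^bsub>PR I\<^esub> indexed_var x) \<in> N"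
    if "a \<in> carrier R" "x \<in> I" for a x
    using rel_N that unfolding rel by blast
  have cI: "c i \<in> I" if "i \<le> d" for i unfolding I_def by (rule c_in_J) (use that in simp)

  interpret \<pi>: poly_eval R "PR I" indexed_const "\<lambda>i. indexed_var (c i)" "{..d}"
    by (intro poly_eval.intro poly_eval_axioms.intro is_cring PR_cring constS.homh) (auto intro: var_closed cI)
  define \<pi> :: "(nat multiset \<Rightarrow> 'a) \<Rightarrow> ('a multiset \<Rightarrow> 'a)" where "\<pi> = peval R (PR I) indexed_const (\<lambda>i. indexed_var (c i))"
  interpret pi: ring_hom_cring P "PR I" \<pi> unfolding \<pi>_def by (rule \<pi>.peval_hom)
  have pi_const: "\<pi> (\<kappa> r) = indexed_const r" if "r \<in> carrier R" for r unfolding \<pi>_def by (rule \<pi>.peval_const[OF that])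
  have pi_var: "\<pi> (T i) = indexed_var (c i)" if "i \<le> d" for i unfolding \<pi>_def by (rule \<pi>.peval_var) (use that in simp)

  define Q where "Q = P Quot L (Suc d)"
  have Lid: "ideal (L (Suc d)) P" by (rule L_ideal) simp
  interpret Q: cring Q unfolding Q_def by (rule ideal.quotient_is_cring[OF Lid P.is_cring])
  define q :: "(nat multiset \<Rightarrow> 'a) \<Rightarrow> (nat multiset \<Rightarrow> 'a) set" where "q = (+>\<^bsub>P\<^esub>) (L (Suc d))"
  interpret q: ring_hom_cring P Q q unfolding q_def Q_def by (rule ideal.rcos_ring_hom_cring[OF Lid P.is_cring])
  have q_zero: "q x = \<zero>\<^bsub>Q\<^esub> \<longleftrightarrow> x \<in> L (Suc d)" if "x \<in> carrier P" for x
    unfolding q_def Q_def by (rule P.coset_zero_iff[OF Lid that])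
  \<comment> \<open>An arbitrary choice of coefficients for x; by \<open>lin_diff_in_L\<close> every
    other choice gives the same class, which is why \<open>e\<close> respects sums and
    scalars.\<close>
  define sel where "sel x = (SOME s. (\<forall>i. s i \<in> carrier R) \<and> x = csum R s c (Suc d))" for x
  have sel: "(\<forall>i. sel x i \<in> carrier R) \<and> x = csum R (sel x) c (Suc d)" if x: "x \<in> I" for x
  proof -
    have "\<exists>s. (\<forall>i. s i \<in> carrier R) \<and> x = csum R s c (Suc d)" using x unfolding I_def J_mem .
    then show ?thesis unfolding sel_def by (rule someI_ex)
  qed
  define e where "e x = q (lin (sel x) (Suc d))" for x
  have e: "e x = q (lin s (Suc d))" if "x \<in> I" "\<forall>i. s i \<in> carrier R" "x = csum R s c (Suc d)" for x s
  proof -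
    have "lin (sel x) (Suc d) \<ominus>\<^bsub>P\<^esub> lin s (Suc d) \<in> L (Suc d)"
      using lin_diff_in_L[of "sel x" s "Suc d"] sel[OF that(1)] that by simp
    moreover have cl: "lin (sel x) (Suc d) \<in> carrier P" "lin s (Suc d) \<in> carrier P"
      using lin_closed that sel[OF that(1)] by auto
    ultimately have "q (lin (sel x) (Suc d)) \<ominus>\<^bsub>Q\<^esub> q (lin s (Suc d)) = \<zero>\<^bsub>Q\<^esub>"
      using q_zero[of "lin (sel x) (Suc d) \<ominus>\<^bsub>P\<^esub> lin s (Suc d)"] by (simp add: a_minus_def)
    then show ?thesis unfolding e_def using cl by simp
  qed
  have e_closed: "e x \<in> carrier Q" if "x \<in> I" for x
    unfolding e_def using lin_closed sel[OF that] by simp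
  have qk: "(\<lambda>r. q (\<kappa> r)) \<in> ring_hom R Q"
    by (rule ring_hom_memI) (simp_all add: const_closed)
  interpret \<rho>: poly_eval R Q "\<lambda>r. q (\<kappa> r)" e I
    by (intro poly_eval.intro poly_eval_axioms.intro is_cring Q.is_cring qk) (rule e_closed)
  define \<rho> where "\<rho> = peval R Q (\<lambda>r. q (\<kappa> r)) e"
  interpret rho: ring_hom_cring "PR I" Q \<rho> unfolding \<rho>_def by (rule \<rho>.peval_hom)
  have rho_const: "\<rho> (indexed_const r) = q (\<kappa> r)" if "r \<in> carrier R" for r unfolding \<rho>_def by (rule \<rho>.peval_const[OF that])
  have rho_var: "\<rho> (indexed_var x) = e x" if "x \<in> I" for x unfolding \<rho>_def by (rule \<rho>.peval_var[OF that])

  have rho_N: "\<rho> x = \<zero>\<^bsub>Q\<^esub>" if "x \<in> N" for x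
  proof -
    have "ideal {\<zero>\<^bsub>Q\<^esub>} Q" by (rule Q.zeroideal)
    then have "ideal {x \<in> carrier (PR I). \<rho> x \<in> {\<zero>\<^bsub>Q\<^esub>}} (PR I)"
      by (rule ring_hom_ring.ideal_vimage[OF ring_hom_ringI2[OF S.ring_axioms Q.ring_axioms rho.homh]])
    moreover have "rel \<subseteq> {x \<in> carrier (PR I). \<rho> x \<in> {\<zero>\<^bsub>Q\<^esub>}}"
    proof
      fix z assume z: "z \<in> rel"
      have "\<rho> z = \<zero>\<^bsub>Q\<^esub>"
      proof -
        consider x y where "x \<in> I" "y \<in> I" "z = indexed_var (x \<oplus> y) \<ominus>\<^bsub>PR I\<^esub> (indexed_var x \<oplus>\<^bsub>PR I\<^esub> indexed_var y)"
          | a x where "a \<in> carrier R" "x \<in> I" "z = indexed_var (a \<otimes> x) \<ominus>\<^bsub>PR I\<^esub> (indexed_const a \<otimes>\<^bsub>PR I\<^esub> indexed_var x)"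
          using z unfolding rel by blast
        then show ?thesis
        proof cases
          case (1 x y)
          note xy = ideal_add[OF Iid 1(1,2)]
          have s: "\<forall>i. sel x i \<in> carrier R" "\<forall>i. sel y i \<in> carrier R" "x = csum R (sel x) c (Suc d)" "y = csum R (sel y) c (Suc d)"
            using sel 1 by auto
          have "x \<oplus> y = csum R (\<lambda>i. sel x i \<oplus> sel y i) c (Suc d)"
            using csum_add[of "Suc d" "sel x" "sel y" c] s c_closed by (simp del: csum.simps)
          then have "e (x \<oplus> y) = q (lin (\<lambda>i. sel x i \<oplus> sel y i) (Suc d))" using e[OF xy] s(1,2) by (simp del: csum.simps)
          also have "\<dots> = e x \<oplus>\<^bsub>Q\<^esub> e y" unfolding e_def using lin_add[OF s(1,2)] lin_closed s(1,2) by simp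
          finally show ?thesis unfolding 1(3)
            using var_closed[OF 1(1)] var_closed[OF 1(2)] var_closed[OF xy] rho_var[OF 1(1)] rho_var[OF 1(2)] rho_var[OF xy]
              e_closed[OF 1(1)] e_closed[OF 1(2)] by (simp add: a_minus_def Q.r_neg)
        next
          case (2 a x)
          note ax = ideal_mult[OF Iid 2(2,1)]
          have s: "\<forall>i. sel x i \<in> carrier R" "x = csum R (sel x) c (Suc d)"
            using sel 2 by auto
          have "a \<otimes> x = csum R (\<lambda>i. a \<otimes> sel x i) c (Suc d)"
            using csum_scale[of a "Suc d" "sel x" c] s c_closed 2(1) by (simp del: csum.simps)
          then have "e (a \<otimes> x) = q (lin (\<lambda>i. a \<otimes> sel x i) (Suc d))" using e[OF ax] s(1) 2(1) by (simp del: csum.simps)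
          also have "\<dots> = q (\<kappa> a) \<otimes>\<^bsub>Q\<^esub> e x"
            unfolding e_def using lin_scale[OF s(1) 2(1)] lin_closed s(1) 2(1) const_closed by simp
          finally show ?thesis unfolding 2(3)
            using var_closed[OF 2(2)] var_closed[OF ax] rho_var[OF 2(2)] rho_var[OF ax] rho_const[OF 2(1)]
              const_closed[OF 2(1), of I] const_closed[OF 2(1), of "{..d}"] e_closed[OF 2(2)] by (simp add: a_minus_def Q.r_neg)
        qed
      qed
      then show "z \<in> {x \<in> carrier (PR I). \<rho> x \<in> {\<zero>\<^bsub>Q\<^esub>}}" using z rel_closed by blast
    qed
    ultimately have "N \<subseteq> {x \<in> carrier (PR I). \<rho> x \<in> {\<zero>\<^bsub>Q\<^esub>}}" unfolding N_def by (rule S.genideal_minimal)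
    then show ?thesis using that by blast
  qed

  have rho_pi: "\<rho> (\<pi> x) = q x" if x: "x \<in> carrier P" for x
  proof -
    have comp: "(\<lambda>x. \<rho> (\<pi> x)) \<in> ring_hom P Q" by (rule ring_hom_memI) simp_all
    have var: "\<rho> (\<pi> (T i)) = q (T i)" if i: "i \<in> {..d}" for i
    proof -
      have i': "i \<le> d" using i by simp
      let ?s = "\<lambda>k. if k = i then \<one> else \<zero>"
      have "csum R ?s c (Suc d) = c i" using csum_delta[of \<one> "Suc d" c i] c_closed i' by (simp del: csum.simps)
      then have "e (c i) = q (lin ?s (Suc d))" using e[OF cI[OF i'], of ?s] by (simp del: csum.simps)
      also have "lin ?s (Suc d) = T i" using lin_delta[of \<one> i "Suc d"] i' T_closed by simp
      finally show ?thesis using pi_var[OF i'] rho_var[OF cI[OF i']] by simp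
    qed
    show ?thesis
      by (rule PR_hom_eq[OF comp q.homh x]) (simp_all add: pi_const rho_const var)
  qed

  have pi_L: "\<pi> x \<in> N" if "x \<in> L (Suc d)" for x
  proof -
    have "L (Suc d) \<subseteq> {x \<in> carrier P. \<pi> x \<in> N}"
    proof (rule L_least)
      show "ideal {x \<in> carrier P. \<pi> x \<in> N} P"
        by (rule ring_hom_ring.ideal_vimage[OF ring_hom_ringI2[OF P.ring_axioms S.ring_axioms pi.homh] Nid])
      fix s assume s: "\<forall>i. s i \<in> carrier R" "csum R s c (Suc d) = \<zero>"
      \<comment> \<open>Partial sums are symbols of elements of \<open>I\<close>, so additivity and
        scaling apply term by term. The start needs the symbol of 0 to vanish, which is the scaling
        relation with factor 0.\<close>
      have step: "j \<le> Suc d \<Longrightarrow> indexed_var (csum R s c j) \<ominus>\<^bsub>PR I\<^esub> \<pi> (lin s j) \<in> N" for j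
      proof (induction j)
        case 0
        have z: "\<zero> \<in> I" by (rule ideal_zero[OF Iid])
        have "indexed_var (\<zero> \<otimes> \<zero>) \<ominus>\<^bsub>PR I\<^esub> (indexed_const \<zero> \<otimes>\<^bsub>PR I\<^esub> indexed_var \<zero>) \<in> N" by (rule N_scale[OF zero_closed z])
        then show ?case using var_closed[OF z] by (simp add: lin_def)
      next
        case (Suc j)
        have cl: "csum R s c j \<in> I" "s j \<in> carrier R" "c j \<in> I" "s j \<otimes> c j \<in> I"
        proof -
          show "csum R s c j \<in> I" using csum_in_J[OF s(1)] J_mono[of j "Suc d"] Suc.prems I_def by auto
          show "c j \<in> I" using cI Suc.prems by simp
          then show "s j \<otimes> c j \<in> I" using ideal_mult[OF Iid] s(1) by simp
        qed (use s in auto)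
        have cP: "lin s j \<in> carrier P" "T j \<in> carrier P" using lin_closed[OF s(1)] T_closed Suc.prems by auto
        define v1 v2 v3 v4 where "v1 = (indexed_var (csum R s c j \<oplus> s j \<otimes> c j) :: 'a multiset \<Rightarrow> 'a)"
          and "v2 = (indexed_var (csum R s c j) :: 'a multiset \<Rightarrow> 'a)" and "v3 = (indexed_var (s j \<otimes> c j) :: 'a multiset \<Rightarrow> 'a)"
          and "v4 = (indexed_const (s j) \<otimes>\<^bsub>PR I\<^esub> indexed_var (c j) :: 'a multiset \<Rightarrow> 'a)"
        have v: "v1 \<in> carrier (PR I)" "v2 \<in> carrier (PR I)" "v3 \<in> carrier (PR I)" "v4 \<in> carrier (PR I)"
          unfolding v1_def v2_def v3_def v4_def using cl ideal_add[OF Iid cl(1,4)] by (auto intro!: var_closed const_closed)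
        have pl: "\<pi> (lin s j) \<in> carrier (PR I)" using cP by simp
        have "\<pi> (lin s (Suc j)) = \<pi> (lin s j) \<oplus>\<^bsub>PR I\<^esub> v4"
          using cP cl(2) pi_const pi_var[of j] Suc.prems const_closed by (simp add: lin_Suc v4_def)
        then have "indexed_var (csum R s c (Suc j)) \<ominus>\<^bsub>PR I\<^esub> \<pi> (lin s (Suc j)) = v1 \<ominus>\<^bsub>PR I\<^esub> (\<pi> (lin s j) \<oplus>\<^bsub>PR I\<^esub> v4)"
          by (simp add: v1_def)
        also have "\<dots> = (v1 \<ominus>\<^bsub>PR I\<^esub> (v2 \<oplus>\<^bsub>PR I\<^esub> v3)) \<oplus>\<^bsub>PR I\<^esub> ((v3 \<ominus>\<^bsub>PR I\<^esub> v4) \<oplus>\<^bsub>PR I\<^esub> (v2 \<ominus>\<^bsub>PR I\<^esub> \<pi> (lin s j)))"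
          using v pl by algebra
        also have "\<dots> \<in> N"
          using N_add[OF cl(1,4)] N_scale[OF cl(2,3)] Suc v1_def v2_def v3_def v4_def
          by (intro S.ideal_add[OF Nid]) auto
        finally show ?case .
      qed
      have z: "\<zero> \<in> I" by (rule ideal_zero[OF Iid])
      have lc: "lin s (Suc d) \<in> carrier P" using lin_closed[OF s(1)] by simp
      have "indexed_var (\<zero> \<otimes> \<zero>) \<ominus>\<^bsub>PR I\<^esub> (indexed_const \<zero> \<otimes>\<^bsub>PR I\<^esub> indexed_var \<zero>) \<in> N" by (rule N_scale[OF zero_closed z])
      then have "indexed_var \<zero> \<in> N" using var_closed[OF z] by (simp add: a_minus_def)
      then have "\<pi> (lin s (Suc d)) \<in> N"
        using S.ideal_diff_cancel2[OF Nid step[OF order_refl]] s(2) lc by simp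
      then show "lin s (Suc d) \<in> {x \<in> carrier P. \<pi> x \<in> N}" using lc by simp
    qed
    then show ?thesis using that by blast
  qed

  interpret t: ring_hom_cring "PR I" "PR I Quot N" "(+>\<^bsub>PR I\<^esub>) N" by (rule ideal.rcos_ring_hom_cring[OF Nid S.is_cring])
  have pc: "\<pi> p \<in> carrier (PR I)" using p(1) by simp
  have "\<pi> p [^]\<^bsub>PR I\<^esub> n \<in> N" using pi_L[OF p(2)] pi.hom_pow[OF p(1)] by simp
  then have "(N +>\<^bsub>PR I\<^esub> \<pi> p) [^]\<^bsub>PR I Quot N\<^esub> n = \<zero>\<^bsub>PR I Quot N\<^esub>"
    using t.hom_pow[OF pc, of n] S.coset_zero_iff[OF Nid, of "\<pi> p [^]\<^bsub>PR I\<^esub> n"] pc by simp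
  then have "N +>\<^bsub>PR I\<^esub> \<pi> p = \<zero>\<^bsub>PR I Quot N\<^esub>"
    using red t.hom_closed[OF pc] unfolding sym reduced_ring_def by blast
  then have "\<pi> p \<in> N" using S.coset_zero_iff[OF Nid pc] by simp
  then have "q p = \<zero>\<^bsub>Q\<^esub>" using rho_N rho_pi[OF p(1)] by simp
  then show ?thesis using q_zero[OF p(1)] by simp
qed

end

context parameter_system
begin

section \<open>The Rees algebra\<close>

sublocale UP: UP_cring R "UP R"
  by (rule UP_cring.intro) (rule is_cring)

abbreviation coef :: "(nat \<Rightarrow> 'a) \<Rightarrow> nat \<Rightarrow> 'a" where "coef \<equiv> up_ring.coeff (UP R)"
abbreviation mn :: "'a \<Rightarrow> nat \<Rightarrow> nat \<Rightarrow> 'a" where "mn \<equiv> up_ring.monom (UP R)"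

text \<open>The map T_i -> c_i t into R[t]; \<open>rees_carrier\<close> identifies its image with
  the Rees algebra.\<close>

definition rees_map :: "(nat multiset \<Rightarrow> 'a) \<Rightarrow> nat \<Rightarrow> 'a" where
  "rees_map = peval R (UP R) (\<lambda>r. mn r 0) (\<lambda>i. mn (c i) 1)"

lemma mn_hom: "(\<lambda>r. mn r 0) \<in> ring_hom R (UP R)"
proof (rule ring_hom_memI)
  fix x y assume "x \<in> carrier R" "y \<in> carrier R"
  then show "mn (x \<otimes> y) 0 = mn x 0 \<otimes>\<^bsub>UP R\<^esub> mn y 0" using UP.monom_mult[of x y 0 0] by simp
qed simp_all

lemma rees_eval: "poly_eval R (UP R) (\<lambda>r. mn r 0) (\<lambda>i. mn (c i) 1) {..d}"
  by (intro poly_eval.intro poly_eval_axioms.intro is_cring UP.UP_cring mn_hom) (simp add: c_closed)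

sublocale rees: ring_hom_cring P "UP R" rees_map
  unfolding rees_map_def by (rule poly_eval.peval_hom[OF rees_eval])

lemma rees_const: "r \<in> carrier R \<Longrightarrow> rees_map (\<kappa> r) = mn r 0"
  unfolding rees_map_def by (rule poly_eval.peval_const[OF rees_eval])

lemma rees_var: "i \<le> d \<Longrightarrow> rees_map (T i) = mn (c i) 1"
  unfolding rees_map_def by (rule poly_eval.peval_var[OF rees_eval]) simp

lemma coef_mn_mult_Suc:
  "\<lbrakk>r \<in> carrier R; f \<in> carrier (UP R)\<rbrakk> \<Longrightarrow> coef (mn r 1 \<otimes>\<^bsub>UP R\<^esub> f) (Suc k) = r \<otimes> coef f k"
  using UP.coeff_monom_mult[of r f 1 k] by simp

lemma coef_mn_mult_0:
  "\<lbrakk>r \<in> carrier R; f \<in> carrier (UP R)\<rbrakk> \<Longrightarrow> coef (mn r 1 \<otimes>\<^bsub>UP R\<^esub> f) 0 = \<zero>"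
  by (simp del: One_nat_def)

lemma coef_const_mult:
  "\<lbrakk>r \<in> carrier R; f \<in> carrier (UP R)\<rbrakk> \<Longrightarrow> coef (mn r 0 \<otimes>\<^bsub>UP R\<^esub> f) k = r \<otimes> coef f k"
  using UP.coeff_monom_mult[of r f 0 k] by simp

lemma coef_var_mult:
  assumes "i \<le> d" "p \<in> carrier P"
  shows "coef (rees_map (T i \<otimes>\<^bsub>P\<^esub> p)) k = (case k of 0 \<Rightarrow> \<zero> | Suc l \<Rightarrow> c i \<otimes> coef (rees_map p) l)"
  using assms T_closed[of i] c_closed[of i]
  by (simp add: rees_var coef_mn_mult_Suc coef_mn_mult_0 del: One_nat_def UP.coeff_mult split: nat.split)

definition ker :: "(nat multiset \<Rightarrow> 'a) set" where
  "ker = {p \<in> carrier P. rees_map p = \<zero>\<^bsub>UP R\<^esub>}"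

lemma ker_ideal: "ideal ker P"
  by (rule P.ideal_intro) (auto simp: ker_def)

lemma rees_lin: "\<lbrakk>\<forall>i. s i \<in> carrier R; j \<le> Suc d\<rbrakk> \<Longrightarrow> rees_map (lin s j) = mn (csum R s c j) 1"
proof (induction j)
  case 0 then show ?case by (simp add: lin_def)
next
  case (Suc j)
  have cl: "csum R s c j \<in> carrier R" "lin s j \<in> carrier P" "T j \<in> carrier P" "\<kappa> (s j) \<in> carrier P"
    using Suc.prems c_closed lin_closed T_closed const_closed by (auto intro!: csum_closed)
  then show ?case using Suc c_closed[of j] UP.monom_mult[of "s j" "c j" 0 1]
    by (simp add: lin_Suc rees_const rees_var del: UP.monom_mult)
qed

lemma L_sub_ker: "L (Suc d) \<subseteq> ker"
  by (rule L_least[OF ker_ideal])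
    (use rees_lin[of _ "Suc d"] lin_closed[of _ "Suc d"] in \<open>auto simp: ker_def simp del: csum.simps\<close>)

text \<open>c_0 is regular on R, hence on R[t], into which P/ker embeds.\<close>

lemma ker_nzd: "P.nzd_on (\<kappa> (c 0)) (carrier P) ker"
  unfolding P.nzd_on_def
proof (intro ballI impI)
  fix p assume p: "p \<in> carrier P" "\<kappa> (c 0) \<otimes>\<^bsub>P\<^esub> p \<in> ker"
  note pU = rees.hom_closed[OF p(1)]
  have "mn (c 0) 0 \<otimes>\<^bsub>UP R\<^esub> rees_map p = \<zero>\<^bsub>UP R\<^esub>"
    using p c_closed[of 0] const_closed[OF c_closed[of 0], of "{..d}"] by (simp add: ker_def rees_const)
  then have "c 0 \<otimes> coef (rees_map p) k = \<zero>" for k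
    using coef_const_mult[OF c_closed pU, of 0 k] by simp
  then have "coef (rees_map p) k = \<zero>" for k
    using c_reg[OF d_pos, of "coef (rees_map p) k"] J_0 pU by simp
  then have "rees_map p = \<zero>\<^bsub>UP R\<^esub>" using pU by (intro UP.up_eqI) auto
  then show "p \<in> ker" using p by (simp add: ker_def)
qed

text \<open>Modulo the linear relations, a power of \<^term>\<open>c i\<close> moves every polynomial into the subring generated by \<^term>\<open>T i\<close>.\<close>

lemma ker_torsion:
  assumes "i \<le> d" "p \<in> ker"
  shows "\<exists>n::nat. \<kappa> (c i) [^]\<^bsub>P\<^esub> n \<otimes>\<^bsub>P\<^esub> p \<in> L (Suc d)"
proof -
  note Lid = L_ideal[OF order_refl]
  interpret th: UP_univ_prop R P \<kappa> "UP R" "T i" "UnivPoly.eval R P \<kappa> (T i)"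
    by (intro UP_univ_prop.intro UP_pre_univ_prop.intro UP_univ_prop_axioms.intro const.ring_hom_cring_axioms UP.UP_cring_axioms)
      (simp_all add: T_closed assms(1))
  \<comment> \<open>\<theta> sends t to \<open>T i\<close>, so its values are the polynomials in
    this single variable.\<close>
  define \<theta> where "\<theta> = UnivPoly.eval R P \<kappa> (T i)"
  interpret th: ring_hom_cring "UP R" P \<theta> unfolding \<theta>_def by (rule th.ring_hom_cring_axioms)
  have th_monom: "\<theta> (mn r n) = \<kappa> r \<otimes>\<^bsub>P\<^esub> T i [^]\<^bsub>P\<^esub> n" if "r \<in> carrier R" for r n
    unfolding \<theta>_def by (rule th.Eval_monom[OF that])
  note ci = c_closed[of i] const_closed[OF c_closed[of i], of "{..d}"]
  \<comment> \<open>The invariant: c_i^n p = f(T_i) modulo L, and the image of this under the Rees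
    map, f(c_i t) = c_i^n times the image of p, stated coefficient by coefficient.\<close>
  have key: "\<exists>(n::nat) f. f \<in> carrier (UP R) \<and> \<kappa> (c i) [^]\<^bsub>P\<^esub> n \<otimes>\<^bsub>P\<^esub> p \<ominus>\<^bsub>P\<^esub> \<theta> f \<in> L (Suc d) \<and>
      (\<forall>k. coef f k \<otimes> c i [^] k = c i [^] n \<otimes> coef (rees_map p) k)" if p: "p \<in> carrier P" for p
    using p
  proof (induction p rule: PR_induct_gen)
    case (const r)
    have rP: "\<kappa> r \<in> carrier P" by (rule const_closed[OF const])
    have "\<kappa> (c i) [^]\<^bsub>P\<^esub> (0::nat) \<otimes>\<^bsub>P\<^esub> \<kappa> r \<ominus>\<^bsub>P\<^esub> \<theta> (mn r 0) \<in> L (Suc d)"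
      using th_monom[OF const, of 0] rP P.ideal_zero[OF Lid] by (simp add: a_minus_def P.r_neg)
    moreover have "coef (mn r 0) k \<otimes> c i [^] k = c i [^] (0::nat) \<otimes> coef (rees_map (\<kappa> r)) k" for k
      using const ci by (simp add: rees_const)
    ultimately show ?case using UP.monom_closed[OF const, of 0] by blast
  next
    case (var l p)
    have l: "l \<le> d" using var by simp
    obtain n f where f: "f \<in> carrier (UP R)" "\<kappa> (c i) [^]\<^bsub>P\<^esub> (n::nat) \<otimes>\<^bsub>P\<^esub> p \<ominus>\<^bsub>P\<^esub> \<theta> f \<in> L (Suc d)"
      "\<And>k. coef f k \<otimes> c i [^] k = c i [^] n \<otimes> coef (rees_map p) k" using var.IH by blast
    note cl = T_closed[OF l] T_closed[OF assms(1)] const_closed[OF c_closed[of l], of "{..d}"] ci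
      var.hyps(2) th.hom_closed[OF f(1)] P.nat_pow_closed[OF ci(2), of n]
    \<comment> \<open>Multiplication by T_l becomes multiplication by c_l T_i once a further factor
      c_i is spent, by the Koszul relation.\<close>
    define g where "g = mn (c l) 1 \<otimes>\<^bsub>UP R\<^esub> f"
    have g: "g \<in> carrier (UP R)" using f(1) c_closed unfolding g_def by simp
    have tg: "\<theta> g = \<kappa> (c l) \<otimes>\<^bsub>P\<^esub> T i \<otimes>\<^bsub>P\<^esub> \<theta> f"
      using f(1) cl th_monom[OF c_closed[of l], of 1] c_closed[of l] unfolding g_def by simp
    have "\<kappa> (c i) [^]\<^bsub>P\<^esub> Suc n \<otimes>\<^bsub>P\<^esub> (T l \<otimes>\<^bsub>P\<^esub> p) \<ominus>\<^bsub>P\<^esub> \<theta> g =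
        \<kappa> (c i) [^]\<^bsub>P\<^esub> n \<otimes>\<^bsub>P\<^esub> \<kappa> (c i) \<otimes>\<^bsub>P\<^esub> (T l \<otimes>\<^bsub>P\<^esub> p) \<ominus>\<^bsub>P\<^esub> \<kappa> (c l) \<otimes>\<^bsub>P\<^esub> T i \<otimes>\<^bsub>P\<^esub> \<theta> f"
      unfolding tg by simp
    also have "\<dots> = \<kappa> (c i) [^]\<^bsub>P\<^esub> n \<otimes>\<^bsub>P\<^esub> p \<otimes>\<^bsub>P\<^esub> (\<kappa> (c i) \<otimes>\<^bsub>P\<^esub> T l \<ominus>\<^bsub>P\<^esub> \<kappa> (c l) \<otimes>\<^bsub>P\<^esub> T i) \<oplus>\<^bsub>P\<^esub>
        \<kappa> (c l) \<otimes>\<^bsub>P\<^esub> T i \<otimes>\<^bsub>P\<^esub> (\<kappa> (c i) [^]\<^bsub>P\<^esub> n \<otimes>\<^bsub>P\<^esub> p \<ominus>\<^bsub>P\<^esub> \<theta> f)"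
      using cl by algebra
    also have "\<dots> \<in> L (Suc d)"
      using l assms(1) cl f(2) by (intro P.ideal_add[OF Lid] P.ideal_mult[OF Lid] koszul_in_L) auto
    finally have 1: "\<kappa> (c i) [^]\<^bsub>P\<^esub> Suc n \<otimes>\<^bsub>P\<^esub> (T l \<otimes>\<^bsub>P\<^esub> p) \<ominus>\<^bsub>P\<^esub> \<theta> g \<in> L (Suc d)" .
    have 2: "coef g k \<otimes> c i [^] k = c i [^] Suc n \<otimes> coef (rees_map (T l \<otimes>\<^bsub>P\<^esub> p)) k" for k
    proof (cases k)
      case 0
      then show ?thesis using f(1) c_closed coef_var_mult[OF l var.hyps(2), of 0]
        by (simp add: g_def coef_mn_mult_0 del: One_nat_def UP.coeff_mult rees.hom_mult)
    next
      case (Suc k')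
      have cc: "coef f k' \<in> carrier R" "coef (rees_map p) k' \<in> carrier R" "c l \<in> carrier R" "c i \<in> carrier R"
        "c i [^] k' \<in> carrier R" "c i [^] n \<in> carrier R"
        using f(1) var.hyps(2) c_closed by auto
      have "coef g k \<otimes> c i [^] k = c l \<otimes> coef f k' \<otimes> (c i [^] k' \<otimes> c i)"
        using Suc f(1) c_closed by (simp add: g_def coef_mn_mult_Suc del: One_nat_def UP.coeff_mult)
      also have "\<dots> = c l \<otimes> c i \<otimes> (coef f k' \<otimes> c i [^] k')" using cc by algebra
      also have "\<dots> = c l \<otimes> c i \<otimes> (c i [^] n \<otimes> coef (rees_map p) k')" unfolding f(3) by simp
      also have "\<dots> = c i [^] n \<otimes> c i \<otimes> (c l \<otimes> coef (rees_map p) k')" using cc by algebra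
      also have "\<dots> = c i [^] Suc n \<otimes> coef (rees_map (T l \<otimes>\<^bsub>P\<^esub> p)) k"
        using Suc coef_var_mult[OF l var.hyps(2), of k] by simp
      finally show ?thesis .
    qed
    show ?case using g 1 2 by blast
  next
    case (add p q)
    obtain n f where f: "f \<in> carrier (UP R)" "\<kappa> (c i) [^]\<^bsub>P\<^esub> (n::nat) \<otimes>\<^bsub>P\<^esub> p \<ominus>\<^bsub>P\<^esub> \<theta> f \<in> L (Suc d)"
      "\<And>k. coef f k \<otimes> c i [^] k = c i [^] n \<otimes> coef (rees_map p) k" using add.IH(1) by blast
    obtain n' f' where f': "f' \<in> carrier (UP R)" "\<kappa> (c i) [^]\<^bsub>P\<^esub> (n'::nat) \<otimes>\<^bsub>P\<^esub> q \<ominus>\<^bsub>P\<^esub> \<theta> f' \<in> L (Suc d)"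
      "\<And>k. coef f' k \<otimes> c i [^] k = c i [^] n' \<otimes> coef (rees_map q) k" using add.IH(2) by blast
    have ca: "c i [^] n \<in> carrier R" "c i [^] n' \<in> carrier R" using ci by auto
    \<comment> \<open>Each of the two congruences is multiplied by the power of c_i from the other
      to reach the common exponent n + n'.\<close>
    define g where "g = mn (c i [^] n') 0 \<otimes>\<^bsub>UP R\<^esub> f \<oplus>\<^bsub>UP R\<^esub> mn (c i [^] n) 0 \<otimes>\<^bsub>UP R\<^esub> f'"
    have g: "g \<in> carrier (UP R)" using f(1) f'(1) ci unfolding g_def by simp
    have tg: "\<theta> g = \<kappa> (c i) [^]\<^bsub>P\<^esub> n' \<otimes>\<^bsub>P\<^esub> \<theta> f \<oplus>\<^bsub>P\<^esub> \<kappa> (c i) [^]\<^bsub>P\<^esub> n \<otimes>\<^bsub>P\<^esub> \<theta> f'"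
      using f(1) f'(1) ci th_monom[OF ca(1), of 0] th_monom[OF ca(2), of 0] unfolding g_def by simp
    note cl = ci add.hyps th.hom_closed[OF f(1)] th.hom_closed[OF f'(1)]
      P.nat_pow_closed[OF ci(2), of n] P.nat_pow_closed[OF ci(2), of n']
    have "\<kappa> (c i) [^]\<^bsub>P\<^esub> (n + n') \<otimes>\<^bsub>P\<^esub> (p \<oplus>\<^bsub>P\<^esub> q) \<ominus>\<^bsub>P\<^esub> \<theta> g =
        \<kappa> (c i) [^]\<^bsub>P\<^esub> n \<otimes>\<^bsub>P\<^esub> \<kappa> (c i) [^]\<^bsub>P\<^esub> n' \<otimes>\<^bsub>P\<^esub> (p \<oplus>\<^bsub>P\<^esub> q) \<ominus>\<^bsub>P\<^esub>
          (\<kappa> (c i) [^]\<^bsub>P\<^esub> n' \<otimes>\<^bsub>P\<^esub> \<theta> f \<oplus>\<^bsub>P\<^esub> \<kappa> (c i) [^]\<^bsub>P\<^esub> n \<otimes>\<^bsub>P\<^esub> \<theta> f')"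
      unfolding tg P.nat_pow_mult[OF ci(2), symmetric] by simp
    also have "\<dots> = \<kappa> (c i) [^]\<^bsub>P\<^esub> n' \<otimes>\<^bsub>P\<^esub> (\<kappa> (c i) [^]\<^bsub>P\<^esub> n \<otimes>\<^bsub>P\<^esub> p \<ominus>\<^bsub>P\<^esub> \<theta> f) \<oplus>\<^bsub>P\<^esub>
        \<kappa> (c i) [^]\<^bsub>P\<^esub> n \<otimes>\<^bsub>P\<^esub> (\<kappa> (c i) [^]\<^bsub>P\<^esub> n' \<otimes>\<^bsub>P\<^esub> q \<ominus>\<^bsub>P\<^esub> \<theta> f')"
      using cl by algebra
    also have "\<dots> \<in> L (Suc d)"
      using cl f(2) f'(2) by (intro P.ideal_add[OF Lid] P.ideal_mult[OF Lid]) auto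
    finally have 1: "\<kappa> (c i) [^]\<^bsub>P\<^esub> (n + n') \<otimes>\<^bsub>P\<^esub> (p \<oplus>\<^bsub>P\<^esub> q) \<ominus>\<^bsub>P\<^esub> \<theta> g \<in> L (Suc d)" .
    have 2: "coef g k \<otimes> c i [^] k = c i [^] (n + n') \<otimes> coef (rees_map (p \<oplus>\<^bsub>P\<^esub> q)) k" for k
    proof -
      have cc: "coef f k \<in> carrier R" "coef (rees_map p) k \<in> carrier R" "coef f' k \<in> carrier R" "coef (rees_map q) k \<in> carrier R"
        "c i [^] k \<in> carrier R" "c i [^] n \<in> carrier R" "c i [^] n' \<in> carrier R"
        using f(1) f'(1) add.hyps ci by auto
      have "coef g k \<otimes> c i [^] k = (c i [^] n' \<otimes> coef f k \<oplus> c i [^] n \<otimes> coef f' k) \<otimes> c i [^] k"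
        using f(1) f'(1) ca by (simp add: g_def coef_const_mult del: UP.coeff_mult)
      also have "\<dots> = c i [^] n' \<otimes> (coef f k \<otimes> c i [^] k) \<oplus> c i [^] n \<otimes> (coef f' k \<otimes> c i [^] k)"
        using cc by algebra
      also have "\<dots> = c i [^] n' \<otimes> (c i [^] n \<otimes> coef (rees_map p) k) \<oplus> c i [^] n \<otimes> (c i [^] n' \<otimes> coef (rees_map q) k)"
        unfolding f(3) f'(3) by simp
      also have "\<dots> = c i [^] n \<otimes> c i [^] n' \<otimes> (coef (rees_map p) k \<oplus> coef (rees_map q) k)"
        using cc by algebra
      also have "\<dots> = c i [^] (n + n') \<otimes> coef (rees_map (p \<oplus>\<^bsub>P\<^esub> q)) k"
        using add.hyps ci by (simp add: nat_pow_mult)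
      finally show ?thesis .
    qed
    show ?case using g 1 2 by blast
  qed
  have pc: "p \<in> carrier P" "rees_map p = \<zero>\<^bsub>UP R\<^esub>" using assms(2) by (auto simp: ker_def)
  obtain n f where f: "f \<in> carrier (UP R)" "\<kappa> (c i) [^]\<^bsub>P\<^esub> (n::nat) \<otimes>\<^bsub>P\<^esub> p \<ominus>\<^bsub>P\<^esub> \<theta> f \<in> L (Suc d)"
    "\<And>k. coef f k \<otimes> c i [^] k = c i [^] n \<otimes> coef (rees_map p) k" using key[OF pc(1)] by blast
  \<comment> \<open>For p in the kernel the coefficient of degree k of f is killed by c_i^k, so the
    power with the degree of f as exponent kills all coefficients.\<close>
  define N where "N = deg R f"
  have cN: "c i [^] N \<in> carrier R" using ci by simp
  have "mn (c i [^] N) 0 \<otimes>\<^bsub>UP R\<^esub> f = \<zero>\<^bsub>UP R\<^esub>"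
  proof (rule UP.up_eqI)
    fix k
    have fk: "coef f k \<in> carrier R" using f(1) by simp
    have "c i [^] N \<otimes> coef f k = \<zero>"
    proof (cases "k \<le> N")
      case True
      have "c i [^] N = c i [^] (N - k) \<otimes> c i [^] k" using True nat_pow_mult[OF ci(1), of "N - k" k] by simp
      then have "c i [^] N \<otimes> coef f k = c i [^] (N - k) \<otimes> (coef f k \<otimes> c i [^] k)"
        using fk nat_pow_closed[OF ci(1), of "N - k"] nat_pow_closed[OF ci(1), of k] by (simp add: m_assoc m_comm m_lcomm)
      also have "\<dots> = \<zero>" unfolding f(3) pc(2) using ci by simp
      finally show ?thesis .
    next
      case False
      then have "coef f k = \<zero>" using UP.deg_aboveD[of f k] f(1) N_def by simp
      then show ?thesis using cN by simp
    qed
    then show "coef (mn (c i [^] N) 0 \<otimes>\<^bsub>UP R\<^esub> f) k = coef \<zero>\<^bsub>UP R\<^esub> k"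
      using coef_const_mult[OF cN f(1)] by (simp del: UP.coeff_mult)
  qed (use f(1) cN in auto)
  then have "\<kappa> (c i) [^]\<^bsub>P\<^esub> N \<otimes>\<^bsub>P\<^esub> \<theta> f = \<zero>\<^bsub>P\<^esub>"
    using th.hom_mult[of "mn (c i [^] N) 0" f] f(1) cN th_monom[OF cN, of 0] ci by simp
  moreover have "\<kappa> (c i) [^]\<^bsub>P\<^esub> (N + n) \<otimes>\<^bsub>P\<^esub> p =
      \<kappa> (c i) [^]\<^bsub>P\<^esub> N \<otimes>\<^bsub>P\<^esub> (\<kappa> (c i) [^]\<^bsub>P\<^esub> n \<otimes>\<^bsub>P\<^esub> p \<ominus>\<^bsub>P\<^esub> \<theta> f) \<oplus>\<^bsub>P\<^esub> \<kappa> (c i) [^]\<^bsub>P\<^esub> N \<otimes>\<^bsub>P\<^esub> \<theta> f"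
    unfolding P.nat_pow_mult[OF ci(2), symmetric]
    using pc(1) th.hom_closed[OF f(1)] P.nat_pow_closed[OF ci(2), of n] P.nat_pow_closed[OF ci(2), of N] by algebra
  ultimately have "\<kappa> (c i) [^]\<^bsub>P\<^esub> (N + n) \<otimes>\<^bsub>P\<^esub> p =
      \<kappa> (c i) [^]\<^bsub>P\<^esub> N \<otimes>\<^bsub>P\<^esub> (\<kappa> (c i) [^]\<^bsub>P\<^esub> n \<otimes>\<^bsub>P\<^esub> p \<ominus>\<^bsub>P\<^esub> \<theta> f)"
    using P.ideal_carrier[OF Lid f(2)] ci by simp
  then show ?thesis using P.ideal_mult[OF Lid f(2)] ci by (intro exI[of _ "N + n"]) simp
qed

end

context cring
begin

section \<open>From grade on \<open>P\<close> to regular sequences in the Rees algebra\<close>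

lemma grade_ge_list:
  "grade_ge Q n U Y \<Longrightarrow>
    \<exists>ys. length ys = n \<and> set ys \<subseteq> Q \<and> (\<forall>i<n. nzd_on (ys ! i) U (foldl (extend U) Y (take i ys)))"
proof (induction n arbitrary: Y)
  case (Suc n)
  then obtain z where z: "z \<in> Q" "nzd_on z U Y" "grade_ge Q n U (extend U Y z)" by auto
  obtain ys where ys: "length ys = n" "set ys \<subseteq> Q"
    "\<forall>i<n. nzd_on (ys ! i) U (foldl (extend U) (extend U Y z) (take i ys))"
    using Suc.IH[OF z(3)] by blast
  have "\<forall>i<Suc n. nzd_on ((z # ys) ! i) U (foldl (extend U) Y (take i (z # ys)))"
    using z(2) ys(3) by (simp add: All_less_Suc2)
  then show ?case using ys(1,2) z(1) by (intro exI[of _ "z # ys"]) simp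
qed simp

lemma foldl_extend_ideal:
  "\<lbrakk>ideal Y R; set zs \<subseteq> carrier R\<rbrakk> \<Longrightarrow> ideal (foldl (extend (carrier R)) Y zs) R"
  by (induction zs arbitrary: Y) (auto intro: extend_ideal[OF oneideal])

lemma foldl_extend_upper:
  "\<lbrakk>ideal Y R; set zs \<subseteq> carrier R\<rbrakk> \<Longrightarrow> Y \<union> set zs \<subseteq> foldl (extend (carrier R)) Y zs"
proof (induction zs arbitrary: Y)
  case (Cons z zs)
  have z: "z \<in> carrier R" using Cons.prems by simp
  have "extend (carrier R) Y z \<union> set zs \<subseteq> foldl (extend (carrier R)) Y (z # zs)"
    using Cons.IH[OF extend_ideal[OF oneideal Cons.prems(1) z]] Cons.prems(2) by simp
  moreover have "Y \<subseteq> extend (carrier R) Y z" by (rule extend_upper1[OF oneideal Cons.prems(1) z])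
  moreover have "z \<in> extend (carrier R) Y z" using extend_upper2[OF oneideal Cons.prems(1) z one_closed] z by simp
  ultimately show ?case by auto
qed simp

lemma foldl_extend_least:
  "\<lbrakk>ideal I R; Y \<subseteq> I; set zs \<subseteq> I\<rbrakk> \<Longrightarrow> foldl (extend (carrier R)) Y zs \<subseteq> I"
proof (induction zs arbitrary: Y)
  case (Cons z zs)
  have "extend (carrier R) Y z \<subseteq> I"
    by (rule extend_least[OF Cons.prems(1,2)]) (use Cons.prems ideal_mult_right in auto)
  then show ?case using Cons by simp
qed simp

lemma ideals_set_pow_Suc: "I [^]\<^bsub>ideals_set R\<^esub> Suc j = ideal_prod R (I [^]\<^bsub>ideals_set R\<^esub> j) I"
  by (simp add: nat_pow_def ideals_set_def)

lemma ideals_set_pow_0: "I [^]\<^bsub>ideals_set R\<^esub> (0::nat) = carrier R"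
  by (simp add: nat_pow_def ideals_set_def)

lemma ideals_set_pow_ideal: "ideal I R \<Longrightarrow> ideal (I [^]\<^bsub>ideals_set R\<^esub> (j::nat)) R"
  by (induction j) (simp_all only: ideals_set_pow_0 ideals_set_pow_Suc oneideal ideal_prod_is_ideal)

end

context parameter_system
begin

lemma rees_image_coef: "p \<in> carrier P \<Longrightarrow> coef (rees_map p) j \<in> J (Suc d) [^]\<^bsub>ideals_set R\<^esub> j"
proof (induction p arbitrary: j rule: PR_induct_gen)
  case (const r)
  then show ?case
    using ideal_zero[OF ideals_set_pow_ideal[OF J_ideal]] ideals_set_pow_0 by (cases j) (simp_all only: rees_const UP.coeff_monom simp_thms if_True if_False nat.distinct)
next
  case (var i p)
  have i: "i \<le> d" using var by simp
  show ?case
  proof (cases j)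
    case 0
    then show ?thesis using coef_var_mult[OF i var.hyps(2), of 0] ideals_set_pow_0 by (simp del: nat_pow_0)
  next
    case (Suc k)
    have "coef (rees_map p) k \<otimes> c i \<in> J (Suc d) [^]\<^bsub>ideals_set R\<^esub> j"
      unfolding Suc ideals_set_pow_Suc by (rule ideal_prod.prod[OF var.IH c_in_J]) (use i in simp)
    then show ?thesis
      using coef_var_mult[OF i var.hyps(2), of j] Suc m_comm[OF c_closed[of i], of "coef (rees_map p) k"] var.hyps(2) by simp
  qed
next
  case (add p q)
  then show ?case using ideal_add[OF ideals_set_pow_ideal[OF J_ideal]] by simp
qed

text \<open>A power of I is spanned by products ab with a in the preceding power and b in I, and bt
  is the image of a linear form.\<close>

lemma monom_in_rees_image: "r \<in> J (Suc d) [^]\<^bsub>ideals_set R\<^esub> j \<Longrightarrow> mn r j \<in> rees_map ` carrier P"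
proof (induction j arbitrary: r)
  case 0
  then have r: "r \<in> carrier R" by (simp only: ideals_set_pow_0)
  show ?case using rees_const[OF r] const_closed[OF r, of "{..d}"] by (metis image_eqI)
next
  case (Suc j)
  let ?I = "J (Suc d)" and ?Ij = "J (Suc d) [^]\<^bsub>ideals_set R\<^esub> j"
  note id = ideals_set_pow_ideal[OF J_ideal[of "Suc d"], of j]
  have "r \<in> carrier R \<and> mn r (Suc j) \<in> rees_map ` carrier P" if "r \<in> ideal_prod R ?Ij ?I"
    using that
  proof (induction r rule: ideal_prod.induct)
    case (prod a b)
    have ac: "a \<in> carrier R" using ideal_carrier[OF id prod(1)] .
    obtain s where s: "\<forall>i. s i \<in> carrier R" "b = csum R s c (Suc d)" using prod(2) J_mem by blast
    have bc: "b \<in> carrier R" using ideal_carrier[OF J_ideal prod(2)] .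
    have b: "mn b 1 = rees_map (lin s (Suc d))" unfolding s(2) by (rule rees_lin[OF s(1) order_refl, symmetric])
    obtain p where p: "p \<in> carrier P" "mn a j = rees_map p" using Suc.IH[OF prod(1)] by blast
    have lc: "lin s (Suc d) \<in> carrier P" by (rule lin_closed[OF s(1) order_refl])
    have "mn (a \<otimes> b) (Suc j) = mn a j \<otimes>\<^bsub>UP R\<^esub> mn b 1" using UP.monom_mult[OF ac bc, of j 1] by simp
    also have "\<dots> = rees_map (p \<otimes>\<^bsub>P\<^esub> lin s (Suc d))" unfolding b p(2) using p(1) lc by simp
    finally show ?case using ac bc p(1) lc by blast
  next
    case (sum a b)
    then obtain p q where pq: "p \<in> carrier P" "q \<in> carrier P" "mn a (Suc j) = rees_map p" "mn b (Suc j) = rees_map q"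
      by blast
    have "mn (a \<oplus> b) (Suc j) = mn a (Suc j) \<oplus>\<^bsub>UP R\<^esub> mn b (Suc j)" using sum.IH by (intro UP.monom_add) auto
    also have "\<dots> = rees_map (p \<oplus>\<^bsub>P\<^esub> q)" unfolding pq(3,4) using pq(1,2) by simp
    finally show ?case using sum.IH pq(1,2) by blast
  qed
  then show ?case using Suc.prems unfolding ideals_set_pow_Suc by blast
qed

abbreviation "B \<equiv> rees_algebra R (J (Suc d))"

lemma rees_carrier: "carrier B = rees_map ` carrier P"
proof (intro equalityI subsetI)
  fix q assume "q \<in> carrier B"
  then have q: "q \<in> carrier (UP R)" "\<And>j. coef q j \<in> J (Suc d) [^]\<^bsub>ideals_set R\<^esub> j"
    by (auto simp: rees_algebra_def)
  have "\<forall>j. \<exists>p. p \<in> carrier P \<and> rees_map p = mn (coef q j) j"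
    using monom_in_rees_image[OF q(2)] by (metis imageE)
  then obtain h where h: "\<And>j. h j \<in> carrier P" "\<And>j. rees_map (h j) = mn (coef q j) j" by metis
  have "rees_map (finsum P h {..deg R q}) = finsum (UP R) (rees_map \<circ> h) {..deg R q}"
    using h(1) by (intro rees.hom_finsum) auto
  also have "\<dots> = q" using UP.up_repr[OF q(1)] by (simp add: h(2) comp_def)
  finally show "q \<in> rees_map ` carrier P" using h(1) by (intro image_eqI[of _ _ "finsum P h {..deg R q}"]) auto
next
  fix q assume "q \<in> rees_map ` carrier P"
  then show "q \<in> carrier B" using rees_image_coef by (auto simp: rees_algebra_def)
qed

lemma rees_algebra_image: "B = (UP R)\<lparr>carrier := rees_map ` carrier P\<rparr>"
  unfolding rees_carrier[symmetric] by (simp add: rees_algebra_def)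

sublocale B: cring B
  unfolding rees_algebra_image
  by (rule ring_hom_ring.img_is_cring[OF ring_hom_ringI2[OF P.ring_axioms UP.UP_ring rees.homh] UP.UP_cring])

sublocale rees_B: ring_hom_cring P B rees_map
proof (rule ring_hom_cringI[OF P.is_cring B.is_cring ring_hom_memI])
qed (auto simp: rees_carrier, auto simp: rees_algebra_def)

lemma rees_B_zero: "\<zero>\<^bsub>B\<^esub> = \<zero>\<^bsub>UP R\<^esub>"
  by (simp add: rees_algebra_def)

text \<open>The iterated ideal is the kernel plus the ideal generated by \<open>zs\<close>. As it
  contains the kernel, membership can be read off from the image, and regularity moves from P/ker to
  the Rees algebra.\<close>

lemma rees_foldl_extend:
  assumes zs: "set zs \<subseteq> carrier P" and p: "p \<in> carrier P"
  shows "p \<in> foldl (P.extend (carrier P)) ker zs \<longleftrightarrow> rees_map p \<in> Idl\<^bsub>B\<^esub> (rees_map ` set zs)"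
proof -
  let ?F = "foldl (P.extend (carrier P)) ker zs"
  have Fid: "ideal ?F P" by (rule P.foldl_extend_ideal[OF ker_ideal zs])
  have F: "ker \<subseteq> ?F" "set zs \<subseteq> ?F" using P.foldl_extend_upper[OF ker_ideal zs] by auto
  have gens: "rees_map ` set zs \<subseteq> carrier B" using zs rees_B.hom_closed by blast
  note Bid = B.genideal_ideal[OF gens]
  show ?thesis
  proof
    have "ideal {x \<in> carrier P. rees_map x \<in> Idl\<^bsub>B\<^esub> (rees_map ` set zs)} P"
      by (rule ring_hom_ring.ideal_vimage[OF ring_hom_ringI2[OF P.ring_axioms B.ring_axioms rees_B.homh] Bid])
    moreover have "ker \<subseteq> {x \<in> carrier P. rees_map x \<in> Idl\<^bsub>B\<^esub> (rees_map ` set zs)}"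
      using B.ideal_zero[OF Bid] by (auto simp: ker_def rees_B_zero)
    moreover have "set zs \<subseteq> {x \<in> carrier P. rees_map x \<in> Idl\<^bsub>B\<^esub> (rees_map ` set zs)}"
      using zs B.genideal_self[OF gens] by auto
    ultimately have "?F \<subseteq> {x \<in> carrier P. rees_map x \<in> Idl\<^bsub>B\<^esub> (rees_map ` set zs)}" by (rule P.foldl_extend_least)
    then show "rees_map p \<in> Idl\<^bsub>B\<^esub> (rees_map ` set zs)" if "p \<in> ?F" using that by blast
    have "ideal (rees_map ` ?F) B"
    proof (rule B.ideal_intro)
      show "rees_map ` ?F \<subseteq> carrier B" using P.ideal_carrier[OF Fid] rees_B.hom_closed by blast
      show "\<zero>\<^bsub>B\<^esub> \<in> rees_map ` ?F" using P.ideal_zero[OF Fid] rees_B.hom_zero by (metis image_eqI)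
    next
      fix a b assume "a \<in> rees_map ` ?F" "b \<in> rees_map ` ?F"
      then obtain x y where xy: "x \<in> ?F" "y \<in> ?F" "a = rees_map x" "b = rees_map y" by blast
      have "a \<oplus>\<^bsub>B\<^esub> b = rees_map (x \<oplus>\<^bsub>P\<^esub> y)"
        using rees_B.hom_add[OF P.ideal_carrier[OF Fid xy(1)] P.ideal_carrier[OF Fid xy(2)]] xy(3,4) by simp
      then show "a \<oplus>\<^bsub>B\<^esub> b \<in> rees_map ` ?F" using P.ideal_add[OF Fid xy(1,2)] by blast
    next
      fix a b assume "a \<in> rees_map ` ?F" "b \<in> carrier B"
      then obtain x y where xy: "x \<in> ?F" "y \<in> carrier P" "a = rees_map x" "b = rees_map y"
        unfolding rees_carrier by blast
      have "b \<otimes>\<^bsub>B\<^esub> a = rees_map (y \<otimes>\<^bsub>P\<^esub> x)"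
        using rees_B.hom_mult[OF xy(2) P.ideal_carrier[OF Fid xy(1)]] xy(3,4) by simp
      then show "b \<otimes>\<^bsub>B\<^esub> a \<in> rees_map ` ?F" using P.ideal_mult[OF Fid xy(1,2)] by blast
    qed
    then have sub: "Idl\<^bsub>B\<^esub> (rees_map ` set zs) \<subseteq> rees_map ` ?F"
      by (rule B.genideal_minimal) (use F(2) in blast)
    show "p \<in> ?F" if pI: "rees_map p \<in> Idl\<^bsub>B\<^esub> (rees_map ` set zs)"
    proof -
      obtain q where q: "q \<in> ?F" "rees_map p = rees_map q" using sub pI by blast
      have qc: "q \<in> carrier P" using P.ideal_carrier[OF Fid q(1)] .
      have "rees_map (p \<ominus>\<^bsub>P\<^esub> q) = \<zero>\<^bsub>UP R\<^esub>"
        using p qc q(2) rees.hom_closed[OF qc] by (simp add: a_minus_def UP.P.r_neg)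
      then have "p \<ominus>\<^bsub>P\<^esub> q \<in> ?F" using F(1) p qc by (auto simp: ker_def)
      then show ?thesis using P.ideal_diff_cancel[OF Fid _ q(1) p] by blast
    qed
  qed
qed

lemma one_notin_m: "\<one> \<notin> m"
  using maximalideal.I_notcarr[OF max] ideal.one_imp_carrier[OF m_ideal] by blast

text \<open>\<open>grade_ge\<close> admits a zero quotient, \<open>regular_sequence\<close> does
  not. Properness is seen in degree 0: the images of \<open>Qh\<close> and of the kernel have their
  constant coefficient in \<open>m\<close>.\<close>

lemma one_notin_foldl_extend:
  assumes "set zs \<subseteq> Qh"
  shows "\<one>\<^bsub>P\<^esub> \<notin> foldl (P.extend (carrier P)) ker zs"
proof -
  let ?M = "{p \<in> carrier P. coef (rees_map p) 0 \<in> m}"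
  have M: "ideal ?M P"
    by (rule P.ideal_intro)
      (use ideal_zero[OF m_ideal] ideal_add[OF m_ideal] ideal_mult[OF m_ideal] rees.hom_closed in
        \<open>auto simp del: One_nat_def\<close>)
  have "\<kappa> ` m \<union> T ` {..d} \<subseteq> ?M"
    using Qh_gens ideal_carrier[OF m_ideal] ideal_zero[OF m_ideal] c_closed
    by (auto simp: rees_const rees_var simp del: One_nat_def)
  then have "Qh \<subseteq> ?M" unfolding Qh_def by (rule P.genideal_minimal[OF M])
  moreover have "ker \<subseteq> ?M" using ideal_zero[OF m_ideal] by (auto simp: ker_def)
  ultimately have "foldl (P.extend (carrier P)) ker zs \<subseteq> ?M" using assms by (intro P.foldl_extend_least[OF M]) auto
  moreover have "\<one>\<^bsub>P\<^esub> \<notin> ?M" using one_notin_m by simp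
  ultimately show ?thesis by blast
qed

lemma rees_Qh: "p \<in> Qh \<Longrightarrow> rees_map p \<in> rees_homogeneous_ideal R m (J (Suc d))"
proof -
  let ?G = "(\<lambda>a. mn a 0) ` m \<union> (\<lambda>a. mn a 1) ` J (Suc d)"
  have mon: "mn r 0 \<in> carrier B" if "r \<in> m" for r
    using rees_B.hom_closed[OF const_closed] rees_const ideal_carrier[OF m_ideal that] by metis
  have "?G \<subseteq> carrier B"
  proof (intro Un_least subsetI)
    fix x assume "x \<in> (\<lambda>a. mn a 1) ` J (Suc d)"
    then obtain b where b: "x = mn b 1" "b \<in> J (Suc d)" by blast
    then obtain s where s: "\<forall>i. s i \<in> carrier R" "b = csum R s c (Suc d)" using J_mem by blast
    show "x \<in> carrier B"
      unfolding b(1) s(2) rees_lin[OF s(1) order_refl, symmetric] by (rule rees_B.hom_closed[OF lin_closed[OF s(1) order_refl]])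
  qed (use mon in blast)
  note Bid = B.genideal_ideal[OF this] and gen = B.genideal_self[OF this]
  have "ideal {x \<in> carrier P. rees_map x \<in> Idl\<^bsub>B\<^esub> ?G} P"
    by (rule ring_hom_ring.ideal_vimage[OF ring_hom_ringI2[OF P.ring_axioms B.ring_axioms rees_B.homh] Bid])
  moreover have "\<kappa> ` m \<union> T ` {..d} \<subseteq> {x \<in> carrier P. rees_map x \<in> Idl\<^bsub>B\<^esub> ?G}"
  proof (intro subsetI CollectI conjI)
    fix x assume x: "x \<in> \<kappa> ` m \<union> T ` {..d}"
    then show "x \<in> carrier P" using Qh_gens by blast
    have "rees_map x \<in> ?G"
      using x ideal_carrier[OF m_ideal] c_in_J[of _ "Suc d"] by (auto simp: rees_const rees_var simp del: One_nat_def)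
    then show "rees_map x \<in> Idl\<^bsub>B\<^esub> ?G" using gen by blast
  qed
  ultimately have "Qh \<subseteq> {x \<in> carrier P. rees_map x \<in> Idl\<^bsub>B\<^esub> ?G}" unfolding Qh_def by (rule P.genideal_minimal)
  then show "p \<in> Qh \<Longrightarrow> rees_map p \<in> rees_homogeneous_ideal R m (J (Suc d))"
    unfolding rees_homogeneous_ideal_def by blast
qed

theorem depth_rees_algebra:
  assumes "reduced_ring (symmetric_algebra R (ideal_module R (J (Suc d))))"
  shows "enat d \<le> depth B (rees_homogeneous_ideal R m (J (Suc d)))"
proof -
  have "P.grade_ge Qh d (carrier P) ker"
    using symmetric_algebra_reduced_imp[OF assms] ker_torsion
    by (intro grade_torsion_quotient[OF _ ker_ideal L_sub_ker _ ker_nzd]) auto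
  then obtain ys where ys: "length ys = d" "set ys \<subseteq> Qh"
    "\<forall>i<d. P.nzd_on (ys ! i) (carrier P) (foldl (P.extend (carrier P)) ker (take i ys))"
    using P.grade_ge_list by blast
  have ysP: "set ys \<subseteq> carrier P" using ys(2) P.ideal_carrier[OF Qh_ideal] by blast
  have tP: "set (take i ys) \<subseteq> carrier P" for i using ysP set_take_subset[of i ys] by blast
  have "regular_sequence B (map rees_map ys)"
    unfolding regular_sequence_def
  proof (intro conjI allI ballI impI)
    show "set (map rees_map ys) \<subseteq> carrier B" using ysP rees_B.hom_closed by auto
    have "\<one>\<^bsub>B\<^esub> \<notin> Idl\<^bsub>B\<^esub> (rees_map ` set ys)"
      using one_notin_foldl_extend[OF ys(2)] rees_foldl_extend[OF ysP P.one_closed] rees_B.hom_one by simp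
    then show "Idl\<^bsub>B\<^esub> (set (map rees_map ys)) \<noteq> carrier B" using B.one_closed by auto
    fix i y assume i: "i < length (map rees_map ys)" and y: "y \<in> carrier B"
      and yi: "map rees_map ys ! i \<otimes>\<^bsub>B\<^esub> y \<in> Idl\<^bsub>B\<^esub> (set (take i (map rees_map ys)))"
    obtain p where p: "p \<in> carrier P" "y = rees_map p" using y unfolding rees_carrier by blast
    have yc: "ys ! i \<in> carrier P" using i ysP by auto
    have "rees_map (ys ! i \<otimes>\<^bsub>P\<^esub> p) \<in> Idl\<^bsub>B\<^esub> (rees_map ` set (take i ys))"
      using yi i p rees_B.hom_mult[OF yc p(1)] by (simp add: take_map)
    then have "ys ! i \<otimes>\<^bsub>P\<^esub> p \<in> foldl (P.extend (carrier P)) ker (take i ys)"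
      using rees_foldl_extend[OF tP, of "ys ! i \<otimes>\<^bsub>P\<^esub> p" i] yc p(1) by simp
    then have "p \<in> foldl (P.extend (carrier P)) ker (take i ys)"
      using P.nzd_onD[OF ys(3)[rule_format] p(1)] ys(1) i by simp
    then show "y \<in> Idl\<^bsub>B\<^esub> (set (take i (map rees_map ys)))"
      using rees_foldl_extend[OF tP p(1)] p(2) by (simp add: take_map)
  qed
  moreover have "set (map rees_map ys) \<subseteq> rees_homogeneous_ideal R m (J (Suc d))" using ys(2) rees_Qh by auto
  ultimately have "enat (length (map rees_map ys)) \<le> depth B (rees_homogeneous_ideal R m (J (Suc d)))"
    unfolding depth_def by (intro SUP_upper) simp
  then show ?thesis using ys(1) by simp
qed

end

context cring
begin

section \<open>Krull dimension and regular sequences\<close>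

text \<open>An ideal maximal among those that contain \<open>I\<close> and miss the multiplicative
  set \<open>M\<close> is prime.\<close>

lemma exists_prime_avoiding:
  assumes noeth: "noetherian_ring R" and I: "ideal I R" "I \<inter> M = {}"
    and M: "\<one> \<in> M" "\<And>x y. \<lbrakk>x \<in> M; y \<in> M\<rbrakk> \<Longrightarrow> x \<otimes> y \<in> M"
  obtains \<pp> where "primeideal \<pp> R" "I \<subseteq> \<pp>" "\<pp> \<inter> M = {}"
proof -
  define SS where "SS = {N. ideal N R \<and> I \<subseteq> N \<and> N \<inter> M = {}}"
  have "SS \<noteq> {}" using I by (auto simp: SS_def)
  moreover have "\<And>N. N \<in> SS \<Longrightarrow> ideal N R" by (simp add: SS_def)
  ultimately obtain N where N: "N \<in> SS" "\<And>N'. \<lbrakk>N' \<in> SS; N \<subseteq> N'\<rbrakk> \<Longrightarrow> N' = N"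
    using noetherian_maximal[OF noeth] by metis
  have Nid: "ideal N R" and IN: "I \<subseteq> N" and NM: "N \<inter> M = {}" using N(1) by (auto simp: SS_def)
  have meet: "\<exists>y\<in>N. \<exists>x\<in>carrier R. y \<oplus> a \<otimes> x \<in> M" if a: "a \<in> carrier R" "a \<notin> N" for a
  proof (rule ccontr)
    assume no: "\<not> ?thesis"
    let ?N = "extend (carrier R) N a"
    have NN: "N \<subseteq> ?N" by (rule extend_upper1[OF oneideal Nid a(1)])
    have "?N \<inter> M = {}" using no by (auto simp: extend_def)
    then have "?N \<in> SS" using extend_ideal[OF oneideal Nid a(1)] IN NN by (auto simp: SS_def)
    then have "?N = N" by (rule N(2)[OF _ NN])
    moreover have "a \<in> ?N" using extend_upper2[OF oneideal Nid a(1) one_closed] a(1) by simp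
    ultimately show False using a(2) by blast
  qed
  have "primeideal N R"
  proof (rule primeidealI[OF Nid is_cring])
    have "\<one> \<notin> N" using NM M(1) by blast
    then show "carrier R \<noteq> N" using one_closed by blast
    fix a b assume ab: "a \<in> carrier R" "b \<in> carrier R" "a \<otimes> b \<in> N"
    show "a \<in> N \<or> b \<in> N"
    proof (rule ccontr)
      assume "\<not> ?thesis"
      then obtain y x y' x' where yx: "y \<in> N" "x \<in> carrier R" "y \<oplus> a \<otimes> x \<in> M"
        "y' \<in> N" "x' \<in> carrier R" "y' \<oplus> b \<otimes> x' \<in> M"
        using meet[OF ab(1)] meet[OF ab(2)] by blast
      note yc = ideal_carrier[OF Nid yx(1)] ideal_carrier[OF Nid yx(4)]
      have "(y \<oplus> a \<otimes> x) \<otimes> (y' \<oplus> b \<otimes> x') = (y' \<oplus> b \<otimes> x') \<otimes> y \<oplus> (a \<otimes> x \<otimes> y' \<oplus> x \<otimes> x' \<otimes> (a \<otimes> b))"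
        using ab(1,2) yx(2,5) yc by algebra
      also have "\<dots> \<in> N"
        using ideal_mult[OF Nid yx(1), of "y' \<oplus> b \<otimes> x'"] ideal_mult[OF Nid yx(4), of "a \<otimes> x"]
          ideal_mult[OF Nid ab(3), of "x \<otimes> x'"] ab(1,2) yx(2,5) yc by (simp add: ideal_add[OF Nid])
      finally show False using M(2)[OF yx(3,6)] NM by blast
    qed
  qed
  then show ?thesis using that IN NM by blast
qed

text \<open>A prime over the first i members has height at least i. The step finds a prime strictly
  below \<pp> that contains the members before c_i but not c_i: it misses all u c_i^k with u outside
  \<pp>, which amounts to localizing at \<pp> and inverting c_i.\<close>

lemma regular_sequence_prime_chain:
  assumes noeth: "noetherian_ring R" and c: "\<And>i. c i \<in> carrier R"
    and reg: "\<And>i r. \<lbrakk>i < n; r \<in> carrier R; c i \<otimes> r \<in> Idl (c ` {..<i})\<rbrakk> \<Longrightarrow> r \<in> Idl (c ` {..<i})"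
  shows "\<lbrakk>i \<le> n; primeideal \<pp> R; Idl (c ` {..<i}) \<subseteq> \<pp>\<rbrakk> \<Longrightarrow>
    \<exists>Q. (\<forall>k\<le>i. primeideal (Q k) R) \<and> (\<forall>k<i. Q k \<subset> Q (Suc k)) \<and> Q i = \<pp>"
proof (induction i arbitrary: \<pp>)
  case 0
  then show ?case by (intro exI[of _ "\<lambda>_. \<pp>"]) auto
next
  case (Suc i)
  note pp = primeideal.axioms(1)[OF Suc.prems(2)]
  have one: "\<one> \<notin> \<pp>" using primeideal.I_notcarr[OF Suc.prems(2)] ideal.one_imp_carrier[OF pp] by blast
  have id: "ideal (Idl (c ` {..<i})) R" using c by (intro genideal_ideal) auto
  have gens: "c ` {..<Suc i} \<subseteq> carrier R" using c by auto
  have ci: "c i \<in> \<pp>" using genideal_self[OF gens] Suc.prems(3) by blast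
  have sub: "Idl (c ` {..<i}) \<subseteq> \<pp>"
    using genideal_self[OF gens] Suc.prems(3) by (intro genideal_minimal[OF pp]) force
  define M where "M = {u \<otimes> c i [^] k | u (k::nat). u \<in> carrier R \<and> u \<notin> \<pp>}"
  \<comment> \<open>Powers of c_i cancel modulo the preceding members, so u c_i^k in their ideal
    would put u into \<pp>.\<close>
  have cancel: "u \<in> carrier R \<Longrightarrow> u \<otimes> c i [^] k \<in> Idl (c ` {..<i}) \<Longrightarrow> u \<in> Idl (c ` {..<i})" for u and k :: nat
  proof (induction k)
    case (Suc k)
    have "c i \<otimes> (u \<otimes> c i [^] k) \<in> Idl (c ` {..<i})"
      using Suc.prems c[of i] by (simp add: m_assoc m_comm m_lcomm)
    then show ?case using Suc reg[of i "u \<otimes> c i [^] k"] c[of i] \<open>Suc i \<le> n\<close> by simp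
  qed simp
  have disj: "Idl (c ` {..<i}) \<inter> M = {}" using cancel sub by (auto simp: M_def)
  have M1: "\<one> \<in> M"
    unfolding M_def using one one_closed by (intro CollectI exI[of _ \<one>] exI[of _ "0::nat"]) simp
  have Mmult: "x \<otimes> y \<in> M" if xy: "x \<in> M" "y \<in> M" for x y
  proof -
    obtain u v and k l :: nat where uv: "x = u \<otimes> c i [^] k" "y = v \<otimes> c i [^] l" "u \<in> carrier R" "v \<in> carrier R"
      "u \<notin> \<pp>" "v \<notin> \<pp>" using xy unfolding M_def by blast
    have "x \<otimes> y = (u \<otimes> v) \<otimes> (c i [^] k \<otimes> c i [^] l)"
      unfolding uv(1,2) using uv(3,4) c[of i] by (simp add: m_assoc m_comm m_lcomm)
    also have "\<dots> = (u \<otimes> v) \<otimes> c i [^] (k + l)" using nat_pow_mult[OF c[of i], of k l] by simp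
    finally have "x \<otimes> y = (u \<otimes> v) \<otimes> c i [^] (k + l)" .
    moreover have "u \<otimes> v \<notin> \<pp>" using primeideal.I_prime[OF Suc.prems(2)] uv by blast
    ultimately show ?thesis unfolding M_def using uv(3,4) by blast
  qed
  obtain \<qq> where q: "primeideal \<qq> R" "Idl (c ` {..<i}) \<subseteq> \<qq>" "\<qq> \<inter> M = {}"
    by (rule exists_prime_avoiding[OF noeth id disj M1 Mmult])
  have "x \<in> \<pp>" if x: "x \<in> \<qq>" for x
  proof (rule ccontr)
    assume nx: "x \<notin> \<pp>"
    have xc: "x \<in> carrier R" using ideal_carrier[OF primeideal.axioms(1)[OF q(1)] x] .
    have "x = x \<otimes> c i [^] (0::nat)" using xc by simp
    then have "x \<in> M" unfolding M_def using xc nx by blast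
    then show False using q(3) x by blast
  qed
  moreover have "c i \<notin> \<qq>"
  proof -
    have "c i = \<one> \<otimes> c i [^] (1::nat)" using c[of i] by simp
    then have "c i \<in> M" unfolding M_def using one one_closed by blast
    then show ?thesis using q(3) by blast
  qed
  ultimately have qp: "\<qq> \<subset> \<pp>" using ci by blast
  obtain Q where Q: "\<forall>k\<le>i. primeideal (Q k) R" "\<forall>k<i. Q k \<subset> Q (Suc k)" "Q i = \<qq>"
    using Suc.IH[OF _ q(1,2)] Suc.prems(1) by auto
  have "\<forall>k\<le>Suc i. primeideal ((Q(Suc i := \<pp>)) k) R" using Q(1) Suc.prems(2) by (simp add: le_Suc_eq)
  moreover have "\<forall>k<Suc i. (Q(Suc i := \<pp>)) k \<subset> (Q(Suc i := \<pp>)) (Suc k)"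
    using Q(2,3) qp by (simp add: less_Suc_eq)
  ultimately show ?case by (intro exI[of _ "Q(Suc i := \<pp>)"]) simp
qed

lemma proper_ideal_sub_maximal:
  assumes noeth: "noetherian_ring R" and I: "ideal I R" "I \<noteq> carrier R"
  obtains n where "maximalideal n R" "I \<subseteq> n"
proof -
  define SS where "SS = {N. ideal N R \<and> I \<subseteq> N \<and> N \<noteq> carrier R}"
  have "SS \<noteq> {}" using I by (auto simp: SS_def)
  moreover have "\<And>N. N \<in> SS \<Longrightarrow> ideal N R" by (simp add: SS_def)
  ultimately obtain N where N: "N \<in> SS" "\<And>N'. \<lbrakk>N' \<in> SS; N \<subseteq> N'\<rbrakk> \<Longrightarrow> N' = N"
    using noetherian_maximal[OF noeth] by metis
  have "maximalideal N R"
  proof (rule maximalidealI)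
    show "ideal N R" "carrier R \<noteq> N" using N(1) by (auto simp: SS_def)
    fix N' assume "ideal N' R" "N \<subseteq> N'" "N' \<subseteq> carrier R"
    then show "N' = N \<or> N' = carrier R" using N unfolding SS_def by blast
  qed
  then show ?thesis using that N(1) by (auto simp: SS_def)
qed

text \<open>A power of every element of \<^term>\<open>m\<close> lies in the ideal, as otherwise some non-maximal prime ideal would
  have height at least \<^term>\<open>d\<close>.\<close>

lemma system_of_parameters_radical:
  assumes noeth: "noetherian_ring R" and m: "maximalideal m R" "\<And>n. maximalideal n R \<Longrightarrow> n = m"
    and dim: "krull_dim R \<le> enat d" and c: "\<And>i. c i \<in> carrier R"
    and reg: "\<And>i r. \<lbrakk>i < d; r \<in> carrier R; c i \<otimes> r \<in> Idl (c ` {..<i})\<rbrakk> \<Longrightarrow> r \<in> Idl (c ` {..<i})"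
    and r: "r \<in> m"
  shows "\<exists>n::nat. r [^] n \<in> Idl (c ` {..<d})"
proof (rule ccontr)
  assume no: "\<not> ?thesis"
  have rc: "r \<in> carrier R" using ideal_carrier[OF maximalideal.axioms(1)[OF m(1)] r] .
  have id: "ideal (Idl (c ` {..<d})) R" using c by (intro genideal_ideal) auto
  define M where "M = {r [^] n | n::nat. True}"
  have disj: "Idl (c ` {..<d}) \<inter> M = {}" using no by (auto simp: M_def)
  have M1: "\<one> \<in> M" unfolding M_def by (intro CollectI exI[of _ "0::nat"]) simp
  have Mmult: "x \<otimes> y \<in> M" if "x \<in> M" "y \<in> M" for x y
    using that rc by (auto simp: M_def nat_pow_mult)
  obtain \<pp> where p: "primeideal \<pp> R" "Idl (c ` {..<d}) \<subseteq> \<pp>" "\<pp> \<inter> M = {}"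
    by (rule exists_prime_avoiding[OF noeth id disj M1 Mmult])
  obtain n where n: "maximalideal n R" "\<pp> \<subseteq> n"
    using proper_ideal_sub_maximal[OF noeth primeideal.axioms(1)[OF p(1)]] primeideal.I_notcarr[OF p(1)] by metis
  have "r = r [^] (1::nat)" using rc by simp
  then have "r \<in> M" unfolding M_def by blast
  then have pm: "\<pp> \<subset> m" using n(2) m(2)[OF n(1)] p(3) r by blast
  obtain Q where Q: "\<forall>k\<le>d. primeideal (Q k) R" "\<forall>k<d. Q k \<subset> Q (Suc k)" "Q d = \<pp>"
    using regular_sequence_prime_chain[OF noeth c reg order_refl p(1,2)] by blast
  \<comment> \<open>The d + 1 primes ending in \<pp> are prolonged by \<open>m\<close>; a chain of d
    + 2 primes exceeds the dimension.\<close>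
  have "\<forall>k\<le>Suc d. primeideal ((Q(Suc d := m)) k) R"
    using Q(1) maximalideal_prime[OF m(1)] by (simp add: le_Suc_eq)
  moreover have "\<forall>k<Suc d. (Q(Suc d := m)) k \<subset> (Q(Suc d := m)) (Suc k)"
    using Q(2,3) pm by (simp add: less_Suc_eq)
  ultimately have "enat (Suc d) \<le> krull_dim R"
    unfolding krull_dim_def by (intro SUP_upper) blast
  then have "enat (Suc d) \<le> enat d" using dim by (rule order_trans)
  then show False by simp
qed

end

theorem theorem2p10:
  fixes R :: "('a, 'b) ring_scheme" and m I :: "'a set" and d :: nat
  assumes "cohen_macaulay_local_ring R m"
    and "krull_dim R = enat d"
    and "primary_almost_complete_intersection R m d I"
    and "reduced_ring (symmetric_algebra R (ideal_module R I))"
  shows "enat d \<le> depth (rees_algebra R I) (rees_homogeneous_ideal R m I)"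
proof (cases "d = 0")
  \<comment> \<open>For d = 0 the claimed bound is zero. For positive d the element
    \<open>c 0\<close> is available as denominator.\<close>
  case False
  have R: "cring R" "noetherian_ring R" "maximalideal m R" "\<And>n. maximalideal n R \<Longrightarrow> n = m"
    using assms(1) by (auto simp: cohen_macaulay_local_ring_def noetherian_local_ring_def)
  interpret cring R by (rule R(1))
  obtain as b where as: "length as = d" "regular_sequence R as" "b \<in> carrier R"
    "I = Idl\<^bsub>R\<^esub> (insert b (set as))" and rad: "radical R I = m"
    using assms(3) unfolding primary_almost_complete_intersection_def by blast
  have asR: "set as \<subseteq> carrier R" using as(2) by (simp add: regular_sequence_def)
  \<comment> \<open>The value b from index d on makes c a total sequence whose member
    \<open>c d\<close> is the additional generator.\<close>
  define c where "c i = (if i < d then as ! i else b)" for i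
  have c_img: "c ` {..<i} = set (take i as)" if "i \<le> d" for i
  proof -
    have "c ` {..<i} = (!) as ` {0..<i}" using that by (auto simp: c_def)
    also have "\<dots> = set (take i as)" by (rule nth_image) (use that as(1) in simp)
    finally show ?thesis .
  qed
  have "c ` {..<Suc d} = insert b (set as)"
    using c_img[of d] as(1) unfolding lessThan_Suc image_insert by (simp add: c_def)
  then have I: "I = Idl\<^bsub>R\<^esub> (c ` {..<Suc d})" using as(4) by simp
  have cR: "c i \<in> carrier R" for i
    using asR as(1,3) by (auto simp: c_def)
  have reg: "r \<in> Idl\<^bsub>R\<^esub> (c ` {..<i})"
    if ir: "i < d" "r \<in> carrier R" "c i \<otimes>\<^bsub>R\<^esub> r \<in> Idl\<^bsub>R\<^esub> (c ` {..<i})" for i r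
    using as(2) ir c_img[of i] as(1) by (auto simp: regular_sequence_def c_def)
  have cm: "c i \<in> m" if "i < d" for i
  proof -
    have "c i \<in> I" unfolding I using genideal_self[of "c ` {..<Suc d}"] cR that by force
    moreover have "c i [^]\<^bsub>R\<^esub> (1::nat) = c i" using cR[of i] by simp
    ultimately have "c i \<in> radical R I" unfolding radical_def using cR[of i] by (metis (mono_tags, lifting) mem_Collect_eq)
    then show ?thesis using rad by simp
  qed
  have "parameter_system R m c d"
  proof (intro parameter_system.intro parameter_system_axioms.intro)
    show "\<exists>n::nat. r [^]\<^bsub>R\<^esub> n \<in> Idl\<^bsub>R\<^esub> (c ` {..<d})" if "r \<in> m" for r
      by (rule system_of_parameters_radical[OF R(2-4) _ cR reg that]) (simp_all add: assms(2))
  qed (fact R(1-3) cR cm reg | use False in simp)+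
  from parameter_system.depth_rees_algebra[OF this] assms(4) show ?thesis unfolding I by blast
qed (simp add: zero_enat_def[symmetric])

end
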